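(* Let $q$ be a prime power, $1 \leq j \leq n$, $A = \mathbb{F}_q^n$, $B = \mathbb{F}_q^j$, $G = \mathrm{GL}(A) \cong \mathrm{GL}_n(q)$, $S = \mathrm{GL}(B) \cong \mathrm{GL}_j(q)$, and $V = A \otimes_{\mathbb{F}_q} B$. Let $\tau$ be the character of $\mathrm{GL}(V)$ given by $\tau(x) = q^{\dim_{\mathbb{F}_q}\mathrm{Ker}(x-1_V)}$, viewed as a character of $G \times S$ via the natural action on $V$, and decompose $\tau|_{G\times S} = \sum_{\alpha \in \mathrm{Irr}(S)} D_\alpha \otimes \alpha$ where each $D_\alpha$ is $0$ or a character of $G$. Then: (i) If $\mathfrak{l}^*(\alpha) < 2j-n$ and $D_\alpha \neq 0$, then all irreducible constituents of $D_\alpha$ have true level smaller than $j$. (ii) If $\mathfrak{l}^*(\alpha) \geq 2j-n$, there is a unique $D^\circ_\alpha \in \mathrm{Irr}(G)$ of true level $j$ such that $D_\alpha - D^\circ_\alpha$ is either zero or a sum of irreducible characters of $G$ of true level less than $j$. (iii) The map $\alpha \mapsto D^\circ_\alpha$ is a bijection from $\{\alpha \in \mathrm{Irr}(\mathrm{GL}_j(q)) : \mathfrak{l}^*(\alpha) \geq 2j-n\}$ onto $\{\theta \in \mathrm{Irr}(\mathrm{GL}_n(q)) : \mathfrak{l}^*(\theta) = j\}$. (iv) If $\chi \in \mathrm{Irr}(G)$ has $\mathfrak{l}(\chi) \leq \sqrt{(8n-17)/12}-1/2$, then $|\chi(g)| < 1.76\,\chi(1)^{1-1/n}$ for all $g \in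 G \setminus \mathbf{Z}(G)$. If $\mathfrak{l}(\chi) \leq (\sqrt{12n-59}-1)/6$, then $|\chi(g)| < 1.76\,\chi(1)^{\max(1-1/(2\mathfrak{l}(\chi)),\, \delta(g)/n)}$ for all $g \in G$ (where for $\mathfrak{l}(\chi)=0$ the exponent is read as $\delta(g)/n$). (v) The statements in (iv) also hold with $G$ replaced by $\mathrm{SL}_n(q)$ (and $\mathbf{Z}(G)$ by $\mathbf{Z}(\mathrm{SL}_n(q))$).
   Context: For $\mathrm{GL}_m(q)$ with natural module $W=\mathbb{F}_q^m$, let $\tau_m(g) = q^{\dim \mathrm{Ker}(g-1_W)}$ (the permutation character on vectors of $W$). For $\chi \in \mathrm{Irr}(\mathrm{GL}_m(q))$, the true level $\mathfrak{l}^*(\chi)$ is the least $k\ge0$ with $\chi$ a constituent of $\tau_m^k$; the level $\mathfrak{l}(\chi)$ is the least $k$ with $\lambda\chi$ a constituent of $\tau_m^k$ for some linear character $\lambda$. For $\psi \in \mathrm{Irr}(\mathrm{SL}_m(q))$, $\mathfrak{l}(\psi)$ is $\mathfrak{l}(\chi)$ for any $\chi\in\mathrm{Irr}(\mathrm{GL}_m(q))$ lying over $\psi$. For $g \in \mathrm{GL}(A)$, $\delta(g)$ denotes the largest dimension of an eigenspace of $g$ acting on $A \otimes_{\mathbb{F}_q} \overline{\mathbb{F}}_q$. *)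

theory Defs
  imports "Jordan_Normal_Form.Matrix_Kernel" "HOL-Algebra.Algebraic_Closure_Type"
begin

text \<open>Matrix groups over a finite field 'a (so q = card (UNIV :: 'a set) is a prime power).
  Elements of GL_m(q) are m x m matrices; group law is matrix multiplication.\<close>

definition GLm :: "nat \<Rightarrow> 'a::field mat set" where
  "GLm m = {g \<in> carrier_mat m m. det g \<noteq> 0}"

definition SLm :: "nat \<Rightarrow> 'a::field mat set" where
  "SLm m = {g \<in> carrier_mat m m. det g = 1}"

definition grp_center :: "'a::field mat set \<Rightarrow> 'a mat set" where
  "grp_center G = {z \<in> G. \<forall>g\<in>G. z * g = g * z}"

definition mat_trace :: "complex mat \<Rightarrow> complex" where
  "mat_trace A = (\<Sum>i<dim_row A. A $$ (i, i))"

definition is_rep :: "nat \<Rightarrow> 'a::field mat set \<Rightarrow> nat \<Rightarrow> ('a mat \<Rightarrow> complex mat) \<Rightarrow> bool" where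
  "is_rep m G d \<rho> \<longleftrightarrow> 0 < d \<and> (\<forall>g\<in>G. \<rho> g \<in> carrier_mat d d) \<and>
     \<rho> (1\<^sub>m m) = 1\<^sub>m d \<and> (\<forall>g\<in>G. \<forall>h\<in>G. \<rho> (g * h) = \<rho> g * \<rho> h)"

definition is_char :: "nat \<Rightarrow> 'a::field mat set \<Rightarrow> ('a mat \<Rightarrow> complex) \<Rightarrow> bool" where
  "is_char m G \<chi> \<longleftrightarrow> (\<exists>d \<rho>. is_rep m G d \<rho> \<and>
      \<chi> = (\<lambda>g. if g \<in> G then mat_trace (\<rho> g) else 0))"

definition inner_G :: "'a::field mat set \<Rightarrow> ('a mat \<Rightarrow> complex) \<Rightarrow> ('a mat \<Rightarrow> complex) \<Rightarrow> complex" where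
  "inner_G G \<phi> \<psi> = (\<Sum>g\<in>G. \<phi> g * cnj (\<psi> g)) / of_nat (card G)"

definition Irr :: "nat \<Rightarrow> 'a::field mat set \<Rightarrow> ('a mat \<Rightarrow> complex) set" where
  "Irr m G = {\<chi>. is_char m G \<chi> \<and> inner_G G \<chi> \<chi> = 1}"

definition constituent :: "nat \<Rightarrow> 'a::field mat set \<Rightarrow> ('a mat \<Rightarrow> complex) \<Rightarrow> ('a mat \<Rightarrow> complex) \<Rightarrow> bool" where
  "constituent m G \<chi> \<phi> \<longleftrightarrow> \<chi> \<in> Irr m G \<and> inner_G G \<phi> \<chi> \<noteq> 0"

definition linear_char :: "nat \<Rightarrow> 'a::field mat set \<Rightarrow> ('a mat \<Rightarrow> complex) \<Rightarrow> bool" where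
  "linear_char m G lam \<longleftrightarrow> is_char m G lam \<and> lam (1\<^sub>m m) = 1"

definition tau_m :: "nat \<Rightarrow> 'a::{finite,field} mat \<Rightarrow> complex" where
  "tau_m m g = (if g \<in> GLm m then of_nat (card (UNIV :: 'a set) ^ kernel_dim (g - 1\<^sub>m m)) else 0)"

definition true_level :: "nat \<Rightarrow> ('a::{finite,field} mat \<Rightarrow> complex) \<Rightarrow> nat" where
  "true_level m \<chi> = (LEAST k. constituent m (GLm m) \<chi> (\<lambda>g. tau_m m g ^ k))"

definition level :: "nat \<Rightarrow> ('a::{finite,field} mat \<Rightarrow> complex) \<Rightarrow> nat" where
  "level m \<chi> = (LEAST k. \<exists>lam. linear_char m (GLm m) lam \<and>
       constituent m (GLm m) (\<lambda>g. lam g * \<chi> g) (\<lambda>g. tau_m m g ^ k))"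

definition level_SL :: "nat \<Rightarrow> ('a::{finite,field} mat \<Rightarrow> complex) \<Rightarrow> nat" where
  "level_SL m \<psi> = level m (SOME \<chi>. \<chi> \<in> Irr m (GLm m) \<and> inner_G (SLm m) \<chi> \<psi> \<noteq> 0)"

definition delta :: "nat \<Rightarrow> 'a::field mat \<Rightarrow> nat" where
  "delta m g = Max ((\<lambda>\<mu>. kernel_dim (map_mat to_ac g - \<mu> \<cdot>\<^sub>m 1\<^sub>m m)) ` UNIV)"

text \<open>Action of (g,s) in GL(A) x GL(B) on V = A \<otimes> B, in the basis e_i \<otimes> f_k
  indexed by i * dim B + k (Kronecker product).\<close>

definition tensor_mat :: "'a::field mat \<Rightarrow> 'a mat \<Rightarrow> 'a mat" where
  "tensor_mat g s = mat (dim_row g * dim_row s) (dim_col g * dim_col s)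
     (\<lambda>(r, c). g $$ (r div dim_row s, c div dim_col s) * s $$ (r mod dim_row s, c mod dim_col s))"

definition tau_V :: "nat \<Rightarrow> nat \<Rightarrow> 'a::{finite,field} mat \<Rightarrow> 'a mat \<Rightarrow> complex" where
  "tau_V n j g s = of_nat (card (UNIV :: 'a set) ^ kernel_dim (tensor_mat g s - 1\<^sub>m (n * j)))"

text \<open>D_alpha, the coefficient of alpha in tau restricted to G x S:
  D_alpha(g) = <tau(g, -), alpha>_S.\<close>

definition D_coef :: "nat \<Rightarrow> nat \<Rightarrow> ('a::{finite,field} mat \<Rightarrow> complex) \<Rightarrow> 'a mat \<Rightarrow> complex" where
  "D_coef n j \<alpha> = (\<lambda>g. if g \<in> GLm n then inner_G (GLm j) (\<lambda>s. tau_V n j g s) \<alpha> else 0)"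

definition D_circ_prop :: "nat \<Rightarrow> nat \<Rightarrow> ('a::{finite,field} mat \<Rightarrow> complex) \<Rightarrow> ('a mat \<Rightarrow> complex) \<Rightarrow> bool" where
  "D_circ_prop n j \<alpha> \<theta> \<longleftrightarrow> \<theta> \<in> Irr n (GLm n) \<and> true_level n \<theta> = j \<and>
     ((\<lambda>g. D_coef n j \<alpha> g - \<theta> g) = (\<lambda>g. 0) \<or>
      (is_char n (GLm n) (\<lambda>g. D_coef n j \<alpha> g - \<theta> g) \<and>
       (\<forall>\<psi>. constituent n (GLm n) \<psi> (\<lambda>g. D_coef n j \<alpha> g - \<theta> g) \<longrightarrow> true_level n \<psi> < j)))"

definition D_circ :: "nat \<Rightarrow> nat \<Rightarrow> ('a::{finite,field} mat \<Rightarrow> complex) \<Rightarrow> 'a mat \<Rightarrow> complex" where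
  "D_circ n j \<alpha> = (THE \<theta>. D_circ_prop n j \<alpha> \<theta>)"

end

theory Submission
  imports Defs "HOL-Library.Cardinality" "Jordan_Normal_Form.Spectral_Radius"
begin

text \<open>
  For a group acting on a finite set and an irreducible character chi, the function
  k(x, y) = sum of cnj (chi g) over all g with g y = x is, up to a scalar, the kernel of the projection to
  the chi-isotypic functions. Everything is phrased in terms of such kernels for G x S acting on n x j
  matrices by (g, s) N = g N s^T.

  A character th of G has true level at least j iff its kernels vanish on n x r matrices for r < j; its
  kernels on n x j matrices are then cuspidal: they vanish at matrices that are not injective, and summing
  them over a rank one direction gives 0. A cuspidal function invariant under the stabilizer of an
  injective M0 is determined by its values at the matrices M0 s. Hence each alpha meets at most one th of
  level j, each such th meets exactly one alpha, and with multiplicity 1. If the level of alpha is at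
  least 2j - n, an explicit cuspidal function attached to alpha (a combination, weighted by the dimension
  of the preimage of im M0, of translates of alpha) shows that th exists.

  For the bounds, the part of D_alpha of level below j has small degree because a function in it is
  determined by its values at the non-injective matrices and its sums over rank one directions. So th is
  close to D_alpha, whose values are dominated by the scalar matrices in S, that is, by eigenspace
  dimensions of g. Finally th stays irreducible on SL_n when 2j < n, because then any two n x j matrices
  are fixed by matrices of arbitrary determinant.
\<close>

text \<open>The threshold 2j - n arises in two independent ways. In one direction a j-dimensional
  image is recorded by n - j functionals, so together with i further vectors it needs n - j + i of
  them; for i < 2j - n this is less than j, too few for a character of level j. In the other
  direction the weights of the explicit cuspidal function obey a recursion whose denominator q^n -
  q^(j+d) vanishes at d = n - j. The term affected is a sum of conjugates of \<alpha> over those s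
  that are prescribed on a subspace of dimension 2j - n - 1, and the hypothesis on the level makes
  it 0. Uniqueness, disjointness and multiplicity one share one source: for fixed \<alpha> the
  invariant cuspidal kernels form a space of dimension at most one. Each conclusion then compares
  traces or convolutions of kernels. The constant 1.76 lies above (101/80 + 1/4) / (7/8) and (29/20
  + 1/4) / (63/64). In both, the first summand bounds the sum over eigenspaces, 1/4 pays for the
  error terms, and the divisor is the fraction of its main term that the degree is known to
  retain.\<close>

no_notation fps_nth (infixl "$" 75)
abbreviation Vec :: "nat => 'a vec set" where "Vec == carrier_vec"
abbreviation Mat :: "nat => nat => 'a mat set" where "Mat == carrier_mat"
abbreviation trm :: "'a mat => 'a mat" where "trm == transpose_mat"
notation mult_mat_vec (infixl "*v" 70)
notation smult_vec (infixl "*s" 70)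
notation scalar_prod (infix "*." 70)
abbreviation idm :: "nat => 'a::{zero,one} mat" where "idm == one_mat"
abbreviation zv :: "nat => 'a::zero vec" where "zv == zero_vec"
abbreviation biimplies (infixr "<->" 25) where "A <-> B == A = (B::bool)"
lemmas sumc = sum.cong[OF refl]

subsection \<open>Matrices indexed by finite sets\<close>

text \<open>Functions on arbitrary index types serve as matrices because later index sets consist of
  field matrices, of pairs, or are disjoint sums. Values off the index sets carry no meaning, so
  equality is always relative, as in \<open>eq_on\<close>.\<close>

definition mmul :: "'l set => ('i => 'l => 'f) => ('l => 'k => 'f) => 'i => 'k => 'f::field" where
 "mmul I A B = (%i k. SUM l:I. A i l * B l k)"

definition kdelta :: "'i => 'i => 'f::field" where
 "kdelta i k = (if i = k then 1 else 0)"

definition ktrace :: "'i set => ('i => 'i => 'f) => 'f::field" where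
 "ktrace I A = (SUM i:I. A i i)"

definition eq_on :: "'i set => 'k set => ('i => 'k => 'f) => ('i => 'k => 'f::field) => bool" where
 "eq_on I K A B <-> (ALL i:I. ALL k:K. A i k = B i k)"

lemma eq_onI: "(!!i k. i : I ==> k : K ==> A i k = B i k) ==> eq_on I K A B"
 by (simp add: eq_on_def)

lemma eq_onD: "eq_on I K A B ==> i : I ==> k : K ==> A i k = B i k"
 by (simp add: eq_on_def)

lemma eq_on_refl [simp]: "eq_on I K A A"
 by (simp add: eq_on_def)

lemma eq_on_sym: "eq_on I K A B ==> eq_on I K B A"
 by (simp add: eq_on_def)

lemma eq_on_trans [trans]: "eq_on I K A B ==> eq_on I K B C ==> eq_on I K A C"
 by (simp add: eq_on_def)

lemma mmul_assoc: "mmul J (mmul I A B) C = mmul I A (mmul J B C)"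
 unfolding mmul_def
 by (intro ext) (simp add: sum_distrib_left sum_distrib_right mult.assoc, rule sum.swap)

lemma mmul_cong:
 assumes "eq_on I L A A'" "eq_on L K B B'"
 shows "eq_on I K (mmul L A B) (mmul L A' B')"
 using assms by (auto simp: eq_on_def mmul_def intro!: sum.cong)

lemma mmul_kdelta_left: "finite I ==> eq_on I K (mmul I kdelta A) A"
 by (auto simp: eq_on_def mmul_def kdelta_def if_distrib[of "%x. x * _"] sum.delta cong: if_cong)

lemma mmul_kdelta_right: "finite K ==> eq_on I K (mmul K A kdelta) A"
 by (auto simp: eq_on_def mmul_def kdelta_def if_distrib[of "%x. _ * x"] sum.delta' cong: if_cong)

lemma ktrace_cong: "eq_on I I A B ==> ktrace I A = ktrace I B"
 by (auto simp: eq_on_def ktrace_def)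

lemma ktrace_mmul: "ktrace I (mmul J A B) = ktrace J (mmul I B A)"
 unfolding ktrace_def mmul_def by (subst sum.swap) (simp add: mult.commute)

lemma ktrace_kdelta [simp]: "ktrace I kdelta = of_nat (card I)"
 by (simp add: ktrace_def kdelta_def)

text \<open>Elimination by induction on the number of nonzero rows: subtracting the rank one matrix
  through a nonzero entry clears its row and its column. The one-sided inverses stand in for
  independence of the columns of A and of the rows of B.\<close>

lemma rank_factorization:
 fixes T :: "'i => 'k => 'f::field"
 assumes "finite I" "finite K"
 shows "\<exists>(r::nat) A B A' B'. r <= card I & eq_on I K T (mmul {..<r} A B) &
  eq_on {..<r} {..<r} (mmul I A' A) kdelta & eq_on {..<r} {..<r} (mmul K B B') kdelta"
proof -
 have "\<exists>(r::nat) A B A' B'. r <= card {i\<in>I. EX k:K. T i k ~= 0} & eq_on I K T (mmul {..<r} A B) &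
  eq_on {..<r} {..<r} (mmul I A' A) kdelta & eq_on {..<r} {..<r} (mmul K B B') kdelta"
 proof (induction "card {i\<in>I. EX k:K. T i k ~= 0}" arbitrary: T rule: less_induct)
  case less
  show ?case
  proof (cases "ALL i:I. ALL k:K. T i k = 0")
   case True
   have "(0::nat) <= card {i\<in>I. EX k:K. T i k ~= 0} & eq_on I K T (mmul {..<0} (%i l::nat. 0) (%l k. 0)) &
    eq_on {..<0} {..<0} (mmul I (%l i. 0) (%i l::nat. 0::'f)) kdelta & eq_on {..<0} {..<0} (mmul K (%l k. 0) (%k l::nat. 0::'f)) kdelta"
    using True by (simp add: eq_on_def mmul_def)
   then show ?thesis by blast
  next
   case False
   then obtain i0 k0 where i0: "i0 : I" and k0: "k0 : K" and p: "T i0 k0 ~= 0" by blast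
   define T2 where "T2 i k = T i k - T i k0 * T i0 k / T i0 k0" for i k
   have row0: "T2 i0 k = 0" for k using p by (simp add: T2_def)
   have col0: "T2 i k0 = 0" for i using p by (simp add: T2_def)
   have sub: "{i\<in>I. EX k:K. T2 i k ~= 0} \<subseteq> {i\<in>I. EX k:K. T i k ~= 0} - {i0}"
   proof
    fix i assume i: "i : {i\<in>I. EX k:K. T2 i k ~= 0}"
    then obtain k where k: "k : K" "T2 i k ~= 0" and iI: "i : I" by blast
    have "i ~= i0" using k row0 by auto
    moreover have "EX k:K. T i k ~= 0"
     using k k0 by (cases "T i k0 = 0") (auto simp: T2_def)
    ultimately show "i : {i\<in>I. EX k:K. T i k ~= 0} - {i0}" using iI by simp
   qed
   have mem: "i0 : {i\<in>I. EX k:K. T i k ~= 0}" using i0 k0 p by blast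
   have cd: "card {i\<in>I. EX k:K. T2 i k ~= 0} < card {i\<in>I. EX k:K. T i k ~= 0}"
    by (rule le_less_trans[OF card_mono[OF _ sub] card_Diff1_less]) (use assms(1) mem in auto)
   from less(1)[OF cd] obtain r A B A' B' where
    r: "r <= card {i\<in>I. EX k:K. T2 i k ~= 0}" and f: "eq_on I K T2 (mmul {..<(r::nat)} A B)"
    and a: "eq_on {..<r} {..<r} (mmul I A' A) kdelta" and b: "eq_on {..<r} {..<r} (mmul K B B') kdelta" by blast
   \<comment> \<open>A = A (B B') = T2 B', so A inherits the zero row of T2; \<open>B0\<close> is
     the dual statement for columns.\<close>
   have A0: "A i0 l = 0" if l: "l < r" for l
   proof -
    have "A i0 l = (\<Sum>l'<r. A i0 l' * mmul K B B' l' l)"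
     using b l by (simp add: eq_on_def kdelta_def if_distrib[of "%x. _ * x"] sum.delta' cong: if_cong)
    also have "... = mmul {..<r} A (mmul K B B') i0 l" by (simp add: mmul_def)
    also have "... = mmul K (mmul {..<r} A B) B' i0 l" by (simp add: mmul_assoc)
    also have "... = (SUM k:K. T2 i0 k * B' k l)"
     using f i0 by (auto simp: eq_on_def mmul_def intro!: sum.cong)
    also have "... = 0" by (simp add: row0)
    finally show ?thesis .
   qed
   have B0: "B l k0 = 0" if l: "l < r" for l
   proof -
    have "B l k0 = (\<Sum>l'<r. mmul I A' A l l' * B l' k0)"
     using a l by (simp add: eq_on_def kdelta_def if_distrib[of "%x. x * _"] sum.delta cong: if_cong)
    also have "... = mmul {..<r} (mmul I A' A) B l k0" by (simp add: mmul_def)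
    also have "... = mmul I A' (mmul {..<r} A B) l k0" by (simp add: mmul_assoc)
    also have "... = (SUM i:I. A' l i * T2 i k0)"
     using f k0 by (auto simp: eq_on_def mmul_def[of I] intro!: sum.cong)
    also have "... = 0" by (simp add: col0)
    finally show ?thesis .
   qed
   define A1 where "A1 i l = (if l = r then T i k0 / T i0 k0 else A i l)" for i l
   define B1 where "B1 l k = (if l = r then T i0 k else B l k)" for l k
   define u where "u l = (SUM i:I. A' l i * A1 i r)" for l
   define v where "v l = (SUM k:K. B1 r k * B' k l)" for l
   \<comment> \<open>The inverse is bordered by the coordinate functional at i0, which by
     \<open>A0\<close> sees only the new column; subtracting u l times it makes row l annihilate
     that column.\<close>
   define A1' where "A1' l i = (if l = r then kdelta i i0 else A' l i - u l * kdelta i i0)" for l i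
   define B1' where "B1' k l = (if l = r then kdelta k k0 / T i0 k0 else B' k l - v l / T i0 k0 * kdelta k k0)" for k l
   have s1: "(SUM i:I. kdelta i i0 * h i) = h i0" for h :: "'i => 'f"
    using i0 assms(1) by (simp add: kdelta_def if_distrib[of "%x. x * _"] sum.delta' cong: if_cong)
   have s2: "(SUM k:K. h k * kdelta k k0) = h k0" for h :: "'k => 'f"
    using k0 assms(2) by (simp add: kdelta_def if_distrib[of "%x. _ * x"] sum.delta' cong: if_cong)
   have c1: "Suc r <= card {i\<in>I. EX k:K. T i k ~= 0}" using r cd by simp
   have c2: "eq_on I K T (mmul {..<Suc r} A1 B1)"
   proof (rule eq_onI)
    fix i k assume ik: "i : I" "k : K"
    have "mmul {..<Suc r} A1 B1 i k = mmul {..<r} A B i k + T i k0 * T i0 k / T i0 k0"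
     by (simp add: mmul_def A1_def B1_def)
    also have "... = T i k" using eq_onD[OF f ik, symmetric] by (simp add: T2_def)
    finally show "T i k = mmul {..<Suc r} A1 B1 i k" by simp
   qed
   have A1i0: "A1 i0 l = (if l = r then 1 else 0)" if "l <= r" for l
    using that A0 p by (simp add: A1_def)
   have B1k0: "B1 l k0 = (if l = r then T i0 k0 else 0)" if "l <= r" for l
    using that B0 by (simp add: B1_def)
   have c3: "eq_on {..<Suc r} {..<Suc r} (mmul I A1' A1) kdelta"
   proof (rule eq_onI)
    fix l l' assume l: "l : {..<Suc r}" "l' : {..<Suc r}"
    show "mmul I A1' A1 l l' = kdelta l l'"
    proof (cases "l = r")
     case True
     then have "mmul I A1' A1 l l' = A1 i0 l'" by (simp add: mmul_def A1'_def s1)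
     then show ?thesis using A1i0 l True by (simp add: kdelta_def)
    next
     case False
     have "mmul I A1' A1 l l' = (SUM i:I. A' l i * A1 i l') - u l * (SUM i:I. kdelta i i0 * A1 i l')"
      using False by (simp add: mmul_def A1'_def left_diff_distrib sum_subtractf sum_distrib_left mult.assoc)
     also have "... = (SUM i:I. A' l i * A1 i l') - u l * A1 i0 l'" by (simp add: s1)
     also have "... = kdelta l l'"
     proof (cases "l' = r")
      case True then show ?thesis using False A1i0[of r] by (simp add: u_def kdelta_def)
     next
      case F2: False
      have "(SUM i:I. A' l i * A1 i l') = mmul I A' A l l'" using F2 by (simp add: mmul_def A1_def)
      also have "... = kdelta l l'" using a l False F2 by (simp add: eq_on_def)
      finally show ?thesis using A1i0[of l'] F2 l by simp
     qed
     finally show ?thesis .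
    qed
   qed
   have c4: "eq_on {..<Suc r} {..<Suc r} (mmul K B1 B1') kdelta"
   proof (rule eq_onI)
    fix l l' assume l: "l : {..<Suc r}" "l' : {..<Suc r}"
    show "mmul K B1 B1' l l' = kdelta l l'"
    proof (cases "l' = r")
     case True
     then have "mmul K B1 B1' l l' = (SUM k:K. B1 l k * kdelta k k0) / T i0 k0"
      by (simp add: mmul_def B1'_def sum_divide_distrib)
     then have "mmul K B1 B1' l l' = B1 l k0 / T i0 k0" by (simp only: s2)
     then show ?thesis using B1k0 l True p by (simp add: kdelta_def)
    next
     case False
     have "mmul K B1 B1' l l' = (SUM k:K. B1 l k * B' k l') - v l' / T i0 k0 * (SUM k:K. B1 l k * kdelta k k0)"
      using False by (simp add: mmul_def B1'_def right_diff_distrib sum_subtractf sum_distrib_left mult.left_commute)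
     also have "... = (SUM k:K. B1 l k * B' k l') - v l' / T i0 k0 * B1 l k0" by (simp add: s2)
     also have "... = kdelta l l'"
     proof (cases "l = r")
      case True then show ?thesis using False B1k0[of r] p by (simp add: v_def kdelta_def)
     next
      case F2: False
      have "(SUM k:K. B1 l k * B' k l') = mmul K B B' l l'" using F2 by (simp add: mmul_def B1_def)
      also have "... = kdelta l l'" using b l False F2 by (simp add: eq_on_def)
      finally show ?thesis using B1k0[of l] F2 l by simp
     qed
     finally show ?thesis .
    qed
   qed
   from c1 c2 c3 c4 show ?thesis by blast
  qed
 qed
 then obtain r A B A' B' where *: "r <= card {i\<in>I. EX k:K. T i k ~= 0}" "eq_on I K T (mmul {..<(r::nat)} A B)"
  "eq_on {..<r} {..<r} (mmul I A' A) kdelta" "eq_on {..<r} {..<r} (mmul K B B') kdelta" by blast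
 moreover have "card {i\<in>I. EX k:K. T i k ~= 0} <= card I" using assms by (intro card_mono) auto
 ultimately show ?thesis by (meson order_trans)
qed

text \<open>Write T = A B. Since A B B' B = A B, the columns of B' B - 1 are killed by T, so
  injectivity gives B' B = 1, and B' A' is a left inverse.\<close>

lemma left_inverse_if_injective:
 fixes T :: "'k => 'i => 'f::field"
 assumes fin: "finite I" "finite K"
  and inj: "!!v. (!!k. k : K ==> (SUM i:I. T k i * v i) = 0) ==> (!!i. i : I ==> v i = 0)"
 shows "EX C. eq_on I I (mmul K C T) kdelta"
proof -
 obtain r A B A' B' where f: "eq_on K I T (mmul {..<(r::nat)} A B)"
  and a: "eq_on {..<r} {..<r} (mmul K A' A) kdelta" and b: "eq_on {..<r} {..<r} (mmul I B B') kdelta"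
  using rank_factorization[of K I T] fin by blast
 have BB: "eq_on I I (mmul {..<r} B' B) kdelta"
 proof (rule eq_onI)
  fix i k assume ik: "i : I" "k : I"
  define v where "v i = mmul {..<r} B' B i k - kdelta i k" for i
  have "v i = 0"
  proof (rule inj)
   fix l assume l: "l : K"
   have 1: "(SUM i:I. T l i * v i) = mmul I T (mmul {..<r} B' B) l k - mmul I T kdelta l k"
    by (simp add: v_def mmul_def[of I] right_diff_distrib sum_subtractf)
   have "eq_on K I (mmul I T (mmul {..<r} B' B)) (mmul I (mmul {..<r} A B) (mmul {..<r} B' B))"
    by (rule mmul_cong[OF f]) simp
   also have "mmul I (mmul {..<r} A B) (mmul {..<r} B' B) = mmul {..<r} A (mmul {..<r} (mmul I B B') B)"
    by (simp add: mmul_assoc)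
   also have "eq_on K I ... (mmul {..<r} A (mmul {..<r} kdelta B))"
    by (intro mmul_cong b) simp_all
   also have "eq_on K I ... (mmul {..<r} A B)"
    by (intro mmul_cong mmul_kdelta_left) simp_all
   also have "eq_on K I ... T" by (rule eq_on_sym[OF f])
   finally have "mmul I T (mmul {..<r} B' B) l k = T l k" using l ik by (simp add: eq_on_def)
   moreover have "mmul I T kdelta l k = T l k"
    using eq_onD[OF mmul_kdelta_right[OF fin(1), of K T]] l ik by simp
   ultimately show "(SUM i:I. T l i * v i) = 0" using 1 by simp
  qed fact
  then show "mmul {..<r} B' B i k = kdelta i k" by (simp add: v_def)
 qed
 have "eq_on I I (mmul K (mmul {..<r} B' A') T) (mmul K (mmul {..<r} B' A') (mmul {..<r} A B))"
  by (intro mmul_cong f) simp_all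
 also have "... = mmul {..<r} B' (mmul {..<r} (mmul K A' A) B)" by (simp add: mmul_assoc)
 also have "eq_on I I ... (mmul {..<r} B' (mmul {..<r} kdelta B))" by (intro mmul_cong a) simp_all
 also have "eq_on I I ... (mmul {..<r} B' B)" by (intro mmul_cong mmul_kdelta_left) simp_all
 also have "eq_on I I ... kdelta" by (rule BB)
 finally show ?thesis by blast
qed

text \<open>Cancelling the outer factors of A B A B = A B by their one-sided inverses leaves B A =
  1. Cyclicity then identifies the trace with the inner dimension r, so traces of projections are
  natural numbers.\<close>

lemma idempotent_factorization:
 fixes P :: "'i => 'i => 'f::field"
 assumes fin: "finite I" and idem: "eq_on I I (mmul I P P) P"
 shows "\<exists>(r::nat) A B. eq_on I I P (mmul {..<r} A B) & eq_on {..<r} {..<r} (mmul I B A) kdelta & ktrace I P = of_nat r"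
proof -
 obtain r A B A' B' where f: "eq_on I I P (mmul {..<(r::nat)} A B)"
  and a: "eq_on {..<r} {..<r} (mmul I A' A) kdelta" and b: "eq_on {..<r} {..<r} (mmul I B B') kdelta"
  using rank_factorization[of I I P] fin by blast
 let ?r = "{..<r}"
 have "eq_on ?r ?r (mmul I B A) (mmul ?r (mmul I A' A) (mmul ?r (mmul I B A) (mmul I B B')))" (is "eq_on _ _ ?L ?R")
 proof -
  have "eq_on ?r ?r ?R (mmul ?r kdelta (mmul ?r (mmul I B A) kdelta))"
   by (intro mmul_cong a b) simp_all
  also have "eq_on ?r ?r ... (mmul ?r (mmul I B A) kdelta)" by (rule mmul_kdelta_left) simp
  also have "eq_on ?r ?r ... (mmul I B A)" by (rule mmul_kdelta_right) simp
  finally show ?thesis by (rule eq_on_sym)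
 qed
 also have "?R = mmul I A' (mmul I (mmul I (mmul ?r A B) (mmul ?r A B)) B')" by (simp add: mmul_assoc)
 also have "eq_on ?r ?r ... (mmul I A' (mmul I (mmul I P P) B'))"
  by (intro mmul_cong eq_on_sym[OF f]) simp_all
 also have "eq_on ?r ?r ... (mmul I A' (mmul I P B'))" by (intro mmul_cong idem) simp_all
 also have "eq_on ?r ?r ... (mmul I A' (mmul I (mmul ?r A B) B'))" by (intro mmul_cong f) simp_all
 also have "... = mmul ?r (mmul I A' A) (mmul I B B')" by (simp add: mmul_assoc)
 also have "eq_on ?r ?r ... (mmul ?r kdelta kdelta)" by (intro mmul_cong a b)
 also have "eq_on ?r ?r ... kdelta" by (rule mmul_kdelta_left) simp
 finally have BA: "eq_on ?r ?r (mmul I B A) kdelta" .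
 have "ktrace I P = ktrace I (mmul ?r A B)" by (rule ktrace_cong[OF f])
 also have "... = ktrace ?r (mmul I B A)" by (rule ktrace_mmul)
 also have "... = of_nat r" by (simp add: ktrace_cong[OF BA])
 finally show ?thesis using f BA by blast
qed

text \<open>The rows of C are functionals that separate the image of P, so its rank is at most their
  number. This device later bounds a sum of degrees by counting linear conditions.\<close>

lemma idempotent_trace_le_card:
 fixes P :: "'i => 'i => complex" and C :: "'z => 'i => complex"
 assumes fin: "finite I" "finite Z" and idem: "eq_on I I (mmul I P P) P"
  and inj: "!!f. (!!i. i : I ==> f i = (SUM k:I. P i k * f k)) ==> (!!z. z : Z ==> (SUM i:I. C z i * f i) = 0) ==> (!!i. i : I ==> f i = 0)"
 shows "EX r <= card Z. ktrace I P = of_nat r"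
proof -
 obtain r A B where f: "eq_on I I P (mmul {..<(r::nat)} A B)" and BA: "eq_on {..<r} {..<r} (mmul I B A) kdelta"
  and tr: "ktrace I P = of_nat r" using idempotent_factorization[OF fin(1) idem] by blast
 have inj2: "v l = 0" if v0: "!!z. z : Z ==> (\<Sum>l<r. mmul I C A z l * v l) = 0" and l: "l : {..<r}" for v l
 proof -
  define h where "h = (%i (_::unit). \<Sum>l<r. A i l * v l)"
  have h: "h = mmul {..<r} A (%l _. v l)" by (simp add: h_def mmul_def)
  have "eq_on I UNIV (mmul I P h) (mmul I (mmul {..<r} A B) h)" by (intro mmul_cong f) simp_all
  also have "... = mmul {..<r} A (mmul {..<r} (mmul I B A) (%l _. v l))" by (simp add: h mmul_assoc)
  also have "eq_on I UNIV ... (mmul {..<r} A (mmul {..<r} kdelta (%l _. v l)))" by (intro mmul_cong BA) simp_all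
  also have "eq_on I UNIV ... h" unfolding h by (intro mmul_cong mmul_kdelta_left) simp_all
  finally have Ph: "eq_on I UNIV (mmul I P h) h" .
  have Ch: "mmul I C h z () = 0" if "z : Z" for z
  proof -
   have "mmul I C h z () = mmul {..<r} (mmul I C A) (%l _. v l) z ()" by (simp add: h mmul_assoc)
   also have "... = 0" using v0[OF that] by (simp add: mmul_def[of "{..<r}"])
   finally show ?thesis .
  qed
  have h0: "h i () = 0" if i: "i : I" for i
  proof (rule inj[of "%i. h i ()"])
   show "h k () = (SUM l:I. P k l * h l ())" if "k : I" for k
    using eq_onD[OF Ph that, of "()"] by (simp add: mmul_def)
   show "(SUM k:I. C z k * h k ()) = 0" if "z : Z" for z
    using Ch[OF that] by (simp add: mmul_def)
  qed (rule i)
  have "v l = mmul {..<r} (mmul I B A) (%l _. v l) l ()"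
   using BA l by (simp add: mmul_def[of "{..<r}"] eq_on_def kdelta_def if_distrib[of "%x. x * _"] sum.delta cong: if_cong)
  also have "... = mmul I B h l ()" by (simp add: h mmul_assoc)
  also have "... = 0" using h0 by (simp add: mmul_def)
  finally show ?thesis .
 qed
 \<comment> \<open>C A is left invertible, hence its rank s, which is at most card Z, must equal
   r.\<close>
 obtain D where D: "eq_on {..<r} {..<r} (mmul Z D (mmul I C A)) kdelta"
  using left_inverse_if_injective[of "{..<r}" Z "mmul I C A"] inj2 fin by blast
 obtain s E F E' F' where s: "s <= card Z" and M: "eq_on Z {..<r} (mmul I C A) (mmul {..<(s::nat)} E F)"
  and E: "eq_on {..<s} {..<s} (mmul Z E' E) kdelta" and F: "eq_on {..<s} {..<s} (mmul {..<r} F F') kdelta"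
  using rank_factorization[of Z "{..<r}" "mmul I C A"] fin by blast
 have 1: "eq_on {..<r} {..<r} (mmul {..<s} (mmul Z D E) F) kdelta"
 proof -
  have "eq_on {..<r} {..<r} (mmul {..<s} (mmul Z D E) F) (mmul Z D (mmul {..<s} E F))" by (simp add: mmul_assoc)
  also have "eq_on {..<r} {..<r} ... (mmul Z D (mmul I C A))" by (intro mmul_cong eq_on_sym[OF M]) simp_all
  also have "eq_on {..<r} {..<r} ... kdelta" by (rule D)
  finally show ?thesis .
 qed
 \<comment> \<open>a two-sided inverse pair between index sets of sizes r and s: compare traces\<close>
 have "eq_on {..<s} {..<s} (mmul {..<r} F (mmul Z D E)) (mmul {..<r} F (mmul {..<s} (mmul Z D E) (mmul {..<r} F F')))"
  by (intro mmul_cong eq_on_sym[OF eq_on_trans[OF mmul_cong[OF eq_on_refl F] mmul_kdelta_right]]) simp_all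
 also have "... = mmul {..<r} F (mmul {..<r} (mmul {..<s} (mmul Z D E) F) F')" by (simp add: mmul_assoc)
 also have "eq_on {..<s} {..<s} ... (mmul {..<r} F (mmul {..<r} kdelta F'))" by (intro mmul_cong 1) simp_all
 also have "eq_on {..<s} {..<s} ... (mmul {..<r} F F')" by (intro mmul_cong mmul_kdelta_left) simp_all
 also have "eq_on {..<s} {..<s} ... kdelta" by (rule F)
 finally have 2: "eq_on {..<s} {..<s} (mmul {..<r} F (mmul Z D E)) kdelta" .
 have "(of_nat r :: complex) = ktrace {..<r} (mmul {..<s} (mmul Z D E) F)" by (simp add: ktrace_cong[OF 1])
 also have "... = ktrace {..<s} (mmul {..<r} F (mmul Z D E))" by (rule ktrace_mmul)
 also have "... = of_nat s" by (simp add: ktrace_cong[OF 2])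
 finally have "r = s" by simp
 then show ?thesis using s tr by blast
qed



subsection \<open>Complex representations of finite groups\<close>

locale finite_group_on =
 fixes G :: "'g set" and mul :: "'g => 'g => 'g" (infixl "**" 70) and e :: 'g and iv :: "'g => 'g"
 assumes fin [simp]: "finite G"
  and closed [simp]: "!!g h. g : G ==> h : G ==> g ** h : G"
  and assoc: "!!g h k. g : G ==> h : G ==> k : G ==> g ** h ** k = g ** (h ** k)"
  and e_in [simp]: "e : G"
  and e_left [simp]: "!!g. g : G ==> e ** g = g"
  and e_right [simp]: "!!g. g : G ==> g ** e = g"
  and iv_in [simp]: "!!g. g : G ==> iv g : G"
  and iv_left [simp]: "!!g. g : G ==> iv g ** g = e"
  and iv_right [simp]: "!!g. g : G ==> g ** iv g = e"
begin

lemma iv_cancel [simp]: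
 assumes "g : G" "h : G"
 shows "iv g ** (g ** h) = h" "g ** (iv g ** h) = h" "h ** g ** iv g = h" "h ** iv g ** g = h"
 using assms by (simp_all add: assoc) (simp_all flip: assoc)

lemma iv_unique: "g : G ==> h : G ==> g ** h = e ==> iv g = h"
 using iv_cancel(1)[of g h] by simp

lemma iv_iv [simp]: "g : G ==> iv (iv g) = g"
 by (rule iv_unique) simp_all

lemma iv_e [simp]: "iv e = e"
 by (rule iv_unique) simp_all

lemma iv_mul: "g : G ==> h : G ==> iv (g ** h) = iv h ** iv g"
 by (rule iv_unique) (simp_all add: assoc)

lemma sum_left: "a : G ==> (SUM g:G. f (a ** g)) = (SUM g:G. f g)"
 by (rule sum.reindex_bij_witness[of _ "%g. iv a ** g" "%g. a ** g"]) auto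

lemma sum_right: "a : G ==> (SUM g:G. f (g ** a)) = (SUM g:G. f g)"
 by (rule sum.reindex_bij_witness[of _ "%g. g ** iv a" "%g. g ** a"]) auto

lemma sum_iv: "(SUM g:G. f (iv g)) = (SUM g:G. f g)"
 by (rule sum.reindex_bij_witness[of _ iv iv]) auto

lemma card_pos: "card G > 0"
 using e_in fin by (metis card_gt_0_iff empty_iff)

definition rep :: "'i set => ('g => 'i => 'i => complex) => bool" where
 "rep I R <-> finite I & (ALL g:G. ALL h:G. eq_on I I (mmul I (R g) (R h)) (R (g ** h))) & eq_on I I (R e) kdelta"

definition commutes :: "'i set => ('g => 'i => 'i => complex) => ('i => 'i => complex) => bool" where
 "commutes I R T <-> (ALL g:G. eq_on I I (mmul I T (R g)) (mmul I (R g) T))"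

text \<open>Schur's lemma taken as the definition. For complex representations of finite groups this
  is irreducibility, and its failure directly supplies the matrix along which R is split.\<close>

definition simple :: "'i set => ('g => 'i => 'i => complex) => bool" where
 "simple I R <-> rep I R & I ~= {} & (ALL T. commutes I R T --> (EX c. eq_on I I T (%i k. c * kdelta i k)))"

definition irr :: "('g => complex) set" where
 "irr = {ch. \<exists>(d::nat) R. simple {..<d} R & ch = (%g. if g : G then ktrace {..<d} (R g) else 0)}"

lemma repD:
 assumes "rep I R"
 shows "finite I" "!!g h. g : G ==> h : G ==> eq_on I I (mmul I (R g) (R h)) (R (g ** h))" "eq_on I I (R e) kdelta"
 using assms by (auto simp: rep_def)

lemma rep_mul:
 assumes "rep I R" "g : G" "h : G" "i : I" "k : I"
 shows "(SUM l:I. R g i l * R h l k) = R (g ** h) i k"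
 using repD(2)[OF assms(1-3)] assms by (simp add: eq_on_def mmul_def)

lemma rep_e: "rep I R ==> i : I ==> k : I ==> R e i k = kdelta i k"
 by (simp add: rep_def eq_on_def)

lemma trace_e: "rep I R ==> ktrace I (R e) = of_nat (card I)"
 using ktrace_cong[OF repD(3)] by fastforce

lemma trace_mul_comm:
 assumes "rep I R" "g : G" "h : G"
 shows "ktrace I (R (g ** h)) = ktrace I (R (h ** g))"
 using ktrace_cong[OF repD(2)[OF assms]] ktrace_cong[OF repD(2)[OF assms(1,3,2)]] ktrace_mmul[of I I "R g" "R h"] by simp

lemma trace_conj:
 assumes "rep I R" "g : G" "h : G"
 shows "ktrace I (R (h ** g ** iv h)) = ktrace I (R g)"
 using trace_mul_comm[OF assms(1), of "h ** g" "iv h"] assms by simp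

text \<open>Averaging gives an invariant Hermitian form H, and then (adjoint of R h) H = H R(h^-1).
  As H is invertible, R(h^-1) is conjugate to the adjoint of R h.\<close>

lemma trace_iv:
 assumes R: "rep I R" and h: "h : G"
 shows "ktrace I (R (iv h)) = cnj (ktrace I (R h))"
proof -
 have finI: "finite I" by (rule repD(1)[OF R])
 \<comment> \<open>the matrix of an invariant inner product\<close>
 define H where "H i k = (SUM g:G. SUM a:I. cnj (R g a i) * R g a k)" for i k
 define S where "S h i b = cnj (R h b i)" for h i b
 have Herm: "H i k = cnj (H k i)" for i k by (simp add: H_def mult.commute)
 have inv: "mmul I (S h) (mmul I H (R h)) i k = H i k" if "i : I" "k : I" for i k
 proof -
  have "mmul I (S h) (mmul I H (R h)) i k = (SUM g:G. SUM b:I. SUM c:I. SUM a:I. S h i b * (cnj (R g a b) * R g a c * R h c k))"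
   unfolding mmul_def H_def by (simp add: sum_distrib_left sum_distrib_right mult.assoc) (subst sum.swap, subst (2) sum.swap, rule refl)
  also have "... = (SUM g:G. SUM a:I. cnj (SUM b:I. R g a b * R h b i) * (SUM c:I. R g a c * R h c k))"
  proof (rule sumc)
   fix g assume "g : G"
   have "(SUM b:I. SUM c:I. SUM a:I. S h i b * (cnj (R g a b) * R g a c * R h c k))
    = (SUM b:I. SUM a:I. SUM c:I. S h i b * (cnj (R g a b) * R g a c * R h c k))"
    by (intro sum.cong refl sum.swap)
   also have "... = (SUM a:I. SUM b:I. SUM c:I. S h i b * (cnj (R g a b) * R g a c * R h c k))" by (rule sum.swap)
   also have "... = (SUM a:I. cnj (SUM b:I. R g a b * R h b i) * (SUM c:I. R g a c * R h c k))"
    by (simp only: cnj_sum sum_product complex_cnj_mult S_def) (simp add: mult_ac)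
   finally show "(SUM b:I. SUM c:I. SUM a:I. S h i b * (cnj (R g a b) * R g a c * R h c k)) = ..." .
  qed
  also have "... = (SUM g:G. SUM a:I. cnj (R (g ** h) a i) * R (g ** h) a k)"
   using that h by (intro sum.cong refl) (simp add: rep_mul[OF R])
  also have "... = H i k" unfolding H_def by (rule sum_right[OF h, of "%g. SUM a:I. cnj (R g a i) * R g a k"])
  finally show ?thesis .
 qed
 have SH: "eq_on I I (mmul I (S h) H) (mmul I H (R (iv h)))"
 proof -
  have "eq_on I I (mmul I (S h) H) (mmul I (S h) (mmul I H (mmul I (R h) (R (iv h)))))"
  proof -
   have "eq_on I I (mmul I H (mmul I (R h) (R (iv h)))) (mmul I H (R e))"
    using repD(2)[OF R h, of "iv h"] h by (intro mmul_cong) simp_all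
   also have "eq_on I I ... (mmul I H kdelta)" by (intro mmul_cong repD(3)[OF R]) simp
   also have "eq_on I I ... H" by (rule mmul_kdelta_right[OF finI])
   finally show ?thesis by (intro mmul_cong) (simp_all add: eq_on_sym)
  qed
  also have "mmul I (S h) (mmul I H (mmul I (R h) (R (iv h)))) = mmul I (mmul I (S h) (mmul I H (R h))) (R (iv h))"
   by (simp add: mmul_assoc)
  also have "eq_on I I ... (mmul I H (R (iv h)))" using inv by (intro mmul_cong) (simp_all add: eq_on_def)
  finally show ?thesis .
 qed
 have "EX C. eq_on I I (mmul I C H) kdelta"
 proof (rule left_inverse_if_injective[OF finI finI])
  fix v i assume v: "!!k. k : I ==> (SUM i:I. H k i * v i) = 0" and i: "i : I"
  \<comment> \<open>N is the value at v of the form given by H. It is a sum of squares whose part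
    for g = e is the norm of v, so H has no kernel.\<close>
  define N where "N = (SUM g:G. SUM a:I. (cmod (SUM k:I. R g a k * v k))\<^sup>2)"
  have "complex_of_real N = (SUM g:G. SUM a:I. cnj (SUM b:I. R g a b * v b) * (SUM k:I. R g a k * v k))"
   unfolding N_def of_real_sum complex_norm_square by (simp add: mult.commute)
  also have "... = (SUM g:G. SUM a:I. SUM b:I. SUM k:I. cnj (v b) * (cnj (R g a b) * R g a k * v k))"
   by (simp only: cnj_sum sum_product complex_cnj_mult) (simp add: mult_ac)
  also have "... = (SUM g:G. SUM b:I. SUM k:I. SUM a:I. cnj (v b) * (cnj (R g a b) * R g a k * v k))"
   by (rule sumc, subst sum.swap, rule sumc, rule sum.swap)
  also have "... = (SUM b:I. SUM k:I. SUM g:G. SUM a:I. cnj (v b) * (cnj (R g a b) * R g a k * v k))"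
   by (subst sum.swap, rule sumc, rule sum.swap)
  also have "... = (SUM b:I. cnj (v b) * (SUM k:I. H b k * v k))"
   by (intro sum.cong refl) (simp add: H_def sum_distrib_left sum_distrib_right mult.assoc)
  also have "... = 0" using v by simp
  finally have N0: "N = 0" by simp
  have "(SUM a:I. (cmod (SUM k:I. R e a k * v k))\<^sup>2) = 0"
   using N0 unfolding N_def by (subst (asm) sum_nonneg_eq_0_iff) (auto intro!: sum_nonneg)
  then have "(cmod (SUM k:I. R e i k * v k))\<^sup>2 = 0"
   using i finI by (subst (asm) sum_nonneg_eq_0_iff) auto
  then have "(SUM k:I. R e i k * v k) = 0" by simp
  moreover have "(SUM k:I. R e i k * v k) = (SUM k:I. if k = i then v k else 0)"
   using i by (intro sum.cong refl) (simp add: rep_e[OF R] kdelta_def)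
  ultimately show "v i = 0" using i finI by simp
 qed
 then obtain C where C: "eq_on I I (mmul I C H) kdelta" by blast
 \<comment> \<open>H is Hermitian, so the conjugate transpose of its left inverse C is a right
   inverse, and the two coincide.\<close>
 define D where "D k j = cnj (C j k)" for k j
 have HD: "eq_on I I (mmul I H D) kdelta"
 proof (rule eq_onI)
  fix i j assume ij: "i : I" "j : I"
  have "mmul I H D i j = cnj (mmul I C H j i)"
   by (simp add: mmul_def D_def mult.commute Herm[of i])
  then show "mmul I H D i j = kdelta i j" using eq_onD[OF C ij(2,1)] by (simp add: kdelta_def)
 qed
 have CD: "eq_on I I C D"
 proof -
  have "eq_on I I C (mmul I C kdelta)" by (rule eq_on_sym[OF mmul_kdelta_right[OF finI]])
  also have "eq_on I I ... (mmul I C (mmul I H D))" by (intro mmul_cong eq_on_sym[OF HD]) simp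
  also have "... = mmul I (mmul I C H) D" by (simp add: mmul_assoc)
  also have "eq_on I I ... (mmul I kdelta D)" by (intro mmul_cong C) simp
  also have "eq_on I I ... D" by (rule mmul_kdelta_left[OF finI])
  finally show ?thesis .
 qed
 have "eq_on I I (R (iv h)) (mmul I kdelta (R (iv h)))" by (rule eq_on_sym[OF mmul_kdelta_left[OF finI]])
 also have "eq_on I I ... (mmul I (mmul I C H) (R (iv h)))" by (intro mmul_cong eq_on_sym[OF C]) simp
 also have "... = mmul I C (mmul I H (R (iv h)))" by (simp add: mmul_assoc)
 also have "eq_on I I ... (mmul I C (mmul I (S h) H))" by (intro mmul_cong eq_on_sym[OF SH]) simp
 finally have "ktrace I (R (iv h)) = ktrace I (mmul I C (mmul I (S h) H))" by (rule ktrace_cong)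
 also have "... = ktrace I (mmul I (S h) (mmul I H C))" by (simp add: ktrace_mmul[of I I C] mmul_assoc)
 also have "eq_on I I (mmul I (S h) (mmul I H C)) (mmul I (S h) (mmul I H D))" by (intro mmul_cong CD) simp_all
 then have "ktrace I (mmul I (S h) (mmul I H C)) = ktrace I (mmul I (S h) (mmul I H D))" by (rule ktrace_cong)
 also have "eq_on I I (mmul I (S h) (mmul I H D)) (mmul I (S h) kdelta)" by (intro mmul_cong HD) simp_all
 then have "ktrace I (mmul I (S h) (mmul I H D)) = ktrace I (mmul I (S h) kdelta)" by (rule ktrace_cong)
 also have "... = ktrace I (S h)" by (rule ktrace_cong[OF mmul_kdelta_right[OF finI]])
 also have "... = cnj (ktrace I (R h))" by (simp add: ktrace_def S_def)
 finally show ?thesis .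
qed

text \<open>The average of the conjugates of R x commutes with R, hence is a scalar that its trace
  determines; multiplying by R y and taking traces gives the equation.\<close>

lemma simple_functional_equation:
 assumes s: "simple I R" and x: "x : G" and y: "y : G"
 shows "(SUM h:G. ktrace I (R (h ** x ** iv h ** y))) * of_nat (card I) = of_nat (card G) * ktrace I (R x) * ktrace I (R y)"
proof -
 have R: "rep I R" using s by (simp add: simple_def)
 have finI: "finite I" by (rule repD(1)[OF R])
 define T where "T i k = (SUM h:G. R (h ** x ** iv h) i k)" for i k
 have TR: "mmul I T (R g) i k = (SUM h:G. R (h ** x ** iv h ** g) i k)" if "g : G" "i : I" "k : I" for g i k
 proof -
  have "mmul I T (R g) i k = (SUM h:G. SUM l:I. R (h ** x ** iv h) i l * R g l k)"
   unfolding mmul_def T_def by (simp add: sum_distrib_right) (rule sum.swap)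
  then show ?thesis using that x by (simp add: rep_mul[OF R])
 qed
 have RT: "mmul I (R g) T i k = (SUM h:G. R (g ** (h ** x ** iv h)) i k)" if "g : G" "i : I" "k : I" for g i k
 proof -
  have "mmul I (R g) T i k = (SUM h:G. SUM l:I. R g i l * R (h ** x ** iv h) l k)"
   unfolding mmul_def T_def by (simp add: sum_distrib_left) (rule sum.swap)
  then show ?thesis using that x by (simp add: rep_mul[OF R])
 qed
 have "commutes I R T"
  unfolding commutes_def
 proof (intro ballI eq_onI)
  fix g i k assume g: "g : G" "i : I" "k : I"
  have "(SUM h:G. R (h ** x ** iv h ** g) i k) = (SUM h:G. R ((g ** h) ** x ** iv (g ** h) ** g) i k)"
   using sum_left[OF g(1), of "%h. R (h ** x ** iv h ** g) i k"] by simp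
  also have "... = (SUM h:G. R (g ** (h ** x ** iv h)) i k)"
   using g x by (intro sum.cong refl) (simp add: iv_mul assoc)
  finally show "mmul I T (R g) i k = mmul I (R g) T i k" using TR[OF g] RT[OF g] by simp
 qed
 then obtain c where c: "eq_on I I T (%i k. c * kdelta i k)" using s unfolding simple_def by blast
 have "ktrace I T = (SUM h:G. ktrace I (R (h ** x ** iv h)))"
  unfolding ktrace_def T_def by (rule sum.swap)
 also have "... = of_nat (card G) * ktrace I (R x)" using trace_conj[OF R x] by simp
 finally have 1: "of_nat (card G) * ktrace I (R x) = c * of_nat (card I)"
  using c by (simp add: ktrace_def eq_on_def kdelta_def mult.commute)
 have "(SUM h:G. ktrace I (R (h ** x ** iv h ** y))) = (SUM i:I. mmul I T (R y) i i)"
  unfolding ktrace_def by (subst sum.swap) (simp add: TR y)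
 also have "... = (SUM i:I. c * R y i i)"
 proof (rule sumc)
  fix i assume i: "i : I"
  have "mmul I T (R y) i i = (SUM l:I. if l = i then c * R y l i else 0)"
   unfolding mmul_def using i c by (intro sum.cong refl) (auto simp: eq_on_def kdelta_def)
  then show "mmul I T (R y) i i = c * R y i i" using i finI by simp
 qed
 also have "... = c * ktrace I (R y)" by (simp add: ktrace_def sum_distrib_left)
 finally show ?thesis using 1 by simp
qed

text \<open>T is the sum over g of R g E R'(g^-1), with E the matrix unit at (j, k), written
  entrywise; substituting h g for g moves h across.\<close>

lemma intertwiner:
 assumes R: "rep I R" and R': "rep K R'" and h: "h : G" and i: "i : I" and l: "l : K" and j: "j : I" and k: "k : K"
 defines "T \<equiv> (%i l. SUM g:G. R g i j * R' (iv g) k l)"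
 shows "mmul I (R h) T i l = mmul K T (R' h) i l"
proof -
 have "mmul I (R h) T i l = (SUM g:G. (SUM a:I. R h i a * R g a j) * R' (iv g) k l)"
  unfolding mmul_def T_def by (simp add: sum_distrib_left sum_distrib_right mult.assoc) (rule sum.swap)
 also have "... = (SUM g:G. R (h ** g) i j * R' (iv (h ** g) ** h) k l)"
  using h i j by (intro sum.cong refl) (simp add: rep_mul[OF R] iv_mul)
 also have "... = (SUM g:G. R g i j * R' (iv g ** h) k l)"
  by (rule sum_left[OF h, of "%g. R g i j * R' (iv g ** h) k l"])
 also have "... = (SUM g:G. R g i j * (SUM b:K. R' (iv g) k b * R' h b l))"
  using h k l by (intro sum.cong refl) (simp add: rep_mul[OF R'])
 also have "... = mmul K T (R' h) i l"
  unfolding mmul_def T_def by (simp add: sum_distrib_left sum_distrib_right mult.assoc) (rule sum.swap)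
 finally show ?thesis .
qed

text \<open>Schur orthogonality for diagonal coefficients: the averaged matrix unit is a scalar
  matrix, with trace |G| or 0.\<close>

lemma simple_norm:
 assumes s: "simple I R"
 shows "(SUM g:G. ktrace I (R g) * ktrace I (R (iv g))) = of_nat (card G)"
proof -
 have R: "rep I R" using s by (simp add: simple_def)
 have finI: "finite I" by (rule repD(1)[OF R])
 have I0: "card I ~= 0" using s finI by (simp add: simple_def)
 have *: "(SUM g:G. R g i i * R (iv g) k k) = of_nat (card G) / of_nat (card I) * kdelta k i" if i: "i : I" and k: "k : I" for i k
 proof -
  define T where "T = (%a l. SUM g:G. R g a i * R (iv g) k l)"
  have "commutes I R T" unfolding commutes_def
   using intertwiner[OF R R _ _ _ i k] by (intro ballI eq_onI) (simp add: T_def)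
  then obtain c where c: "eq_on I I T (%i k. c * kdelta i k)" using s unfolding simple_def by blast
  have "ktrace I T = (SUM g:G. SUM a:I. R (iv g) k a * R g a i)"
   unfolding ktrace_def T_def by (subst sum.swap) (simp add: mult.commute)
  also have "... = (SUM g:G. kdelta k i)" using i k by (intro sum.cong refl) (simp add: rep_mul[OF R] rep_e[OF R])
  finally have "of_nat (card I) * c = of_nat (card G) * kdelta k i"
   using c by (simp add: ktrace_def eq_on_def kdelta_def[of x x for x])
  then have "c = of_nat (card G) / of_nat (card I) * kdelta k i" using I0 by (simp add: field_simps)
  moreover have "T i k = c * kdelta i k" using c i k by (simp add: eq_on_def)
  ultimately show ?thesis by (simp add: T_def kdelta_def)
 qed
 have "(SUM g:G. ktrace I (R g) * ktrace I (R (iv g))) = (SUM g:G. SUM i:I. SUM k:I. R g i i * R (iv g) k k)"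
  by (simp add: ktrace_def sum_product)
 also have "... = (SUM i:I. SUM k:I. SUM g:G. R g i i * R (iv g) k k)"
  by (subst sum.swap) (intro sum.cong refl sum.swap)
 also have "... = (SUM i:I. SUM k:I. of_nat (card G) / of_nat (card I) * kdelta k i)"
  by (intro sum.cong refl *)
 also have "... = (SUM i:I. of_nat (card G) / of_nat (card I))"
  using finI by (intro sum.cong refl) (simp add: kdelta_def if_distrib[of "%x. _ * x"] sum.delta cong: if_cong)
 also have "... = of_nat (card G)" using I0 by simp
 finally show ?thesis .
qed

text \<open>A nonzero sum of coefficients would make the averaged matrix unit T a nonzero
  intertwiner. Up to a scalar it is invertible, with an inverse averaged in the opposite direction,
  so it conjugates one representation into the other and the characters agree.\<close>

lemma simple_orthogonal:
 assumes s: "simple I R" and s': "simple K R'" and ne: "EX g:G. ktrace I (R g) ~= ktrace K (R' g)"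
 shows "(SUM g:G. ktrace I (R g) * ktrace K (R' (iv g))) = 0"
proof -
 have R: "rep I R" and R': "rep K R'" using s s' by (simp_all add: simple_def)
 have finI: "finite I" and finK: "finite K" using repD(1)[OF R] repD(1)[OF R'] by auto
 have *: "(SUM g:G. R g i j * R' (iv g) k l) = 0" if i: "i : I" and j: "j : I" and k: "k : K" and l: "l : K" for i j k l
 proof (rule ccontr)
  assume nz: "(SUM g:G. R g i j * R' (iv g) k l) ~= 0"
  define T where "T = (%i l. SUM g:G. R g i j * R' (iv g) k l)"
  \<comment> \<open>The matrix unit behind T2 is chosen so that the trace of T T2 is |G| times the
    nonzero entry \<open>T i l\<close>; hence the scalar c below is nonzero.\<close>
  define T2 where "T2 = (%x y. SUM g:G. R' g x l * R (iv g) i y)"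
  have RT: "eq_on I K (mmul I (R h) T) (mmul K T (R' h))" if "h : G" for h
   using intertwiner[OF R R' that _ _ j k] by (intro eq_onI) (simp add: T_def)
  have RT2: "eq_on K I (mmul K (R' h) T2) (mmul I T2 (R h))" if "h : G" for h
   using intertwiner[OF R' R that _ _ l i] by (intro eq_onI) (simp add: T2_def)
  have "commutes I R (mmul K T T2)" unfolding commutes_def
  proof
   fix g assume g: "g : G"
   have "eq_on I I (mmul I (mmul K T T2) (R g)) (mmul K T (mmul I T2 (R g)))" by (simp add: mmul_assoc)
   also have "eq_on I I ... (mmul K T (mmul K (R' g) T2))" by (intro mmul_cong eq_on_sym[OF RT2[OF g]]) simp
   also have "... = mmul K (mmul K T (R' g)) T2" by (simp add: mmul_assoc)
   also have "eq_on I I ... (mmul K (mmul I (R g) T) T2)" by (intro mmul_cong eq_on_sym[OF RT[OF g]]) simp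
   also have "... = mmul I (R g) (mmul K T T2)" by (simp add: mmul_assoc)
   finally show "eq_on I I (mmul I (mmul K T T2) (R g)) (mmul I (R g) (mmul K T T2))" .
  qed
  then obtain c where c: "eq_on I I (mmul K T T2) (%i k. c * kdelta i k)" using s unfolding simple_def by blast
  have "commutes K R' (mmul I T2 T)" unfolding commutes_def
  proof
   fix g assume g: "g : G"
   have "eq_on K K (mmul K (mmul I T2 T) (R' g)) (mmul I T2 (mmul K T (R' g)))" by (simp add: mmul_assoc)
   also have "eq_on K K ... (mmul I T2 (mmul I (R g) T))" by (intro mmul_cong eq_on_sym[OF RT[OF g]]) simp
   also have "... = mmul I (mmul I T2 (R g)) T" by (simp add: mmul_assoc)
   also have "eq_on K K ... (mmul I (mmul K (R' g) T2) T)" by (intro mmul_cong eq_on_sym[OF RT2[OF g]]) simp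
   also have "... = mmul K (R' g) (mmul I T2 T)" by (simp add: mmul_assoc)
   finally show "eq_on K K (mmul K (mmul I T2 T) (R' g)) (mmul K (R' g) (mmul I T2 T))" .
  qed
  then obtain c' where c': "eq_on K K (mmul I T2 T) (%i k. c' * kdelta i k)" using s' unfolding simple_def by blast
  have scal: "mmul I A (%i k. d * kdelta i k) i k = d * A i k" "mmul I (%i k. d * kdelta i k) A i k = d * A i k"
   if "finite I" "i : I" "k : I" for I :: "'z set" and A :: "'z => 'z => complex" and d i k
   using that by (simp_all add: mmul_def kdelta_def if_distrib[of "%x. _ * x"] if_distrib[of "%x. x * _"] sum.delta sum.delta' mult.commute cong: if_cong)
  have "ktrace I (mmul K T T2) = (SUM g:G. SUM a:I. R (iv g) i a * (SUM x:K. T a x * R' g x l))"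
   unfolding ktrace_def mmul_def T2_def
   by (simp add: sum_distrib_left sum.swap[of _ G] mult_ac)
  also have "... = (SUM g:G. T i l)"
  proof (rule sumc)
   fix g assume g: "g : G"
   have "(SUM a:I. R (iv g) i a * (SUM x:K. T a x * R' g x l)) = mmul I (R (iv g)) (mmul K T (R' g)) i l"
    by (simp add: mmul_def)
   also have "... = mmul I (R (iv g)) (mmul I (R g) T) i l"
    by (rule eq_onD[OF mmul_cong[OF eq_on_refl eq_on_sym[OF RT[OF g]]] i l])
   also have "... = mmul I (mmul I (R (iv g)) (R g)) T i l" by (simp add: mmul_assoc)
   also have "... = mmul I kdelta T i l"
    by (rule eq_onD[OF mmul_cong[OF eq_on_trans[OF repD(2)[OF R iv_in[OF g] g]] eq_on_refl] i l]) (simp add: g repD(3)[OF R])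
   also have "... = T i l" by (rule eq_onD[OF mmul_kdelta_left[OF finI] i l])
   finally show "(SUM a:I. R (iv g) i a * (SUM x:K. T a x * R' g x l)) = T i l" .
  qed
  also have "... ~= 0" using nz e_in by (auto simp: T_def)
  finally have c0: "c ~= 0" using c by (auto simp: ktrace_def eq_on_def)
  have "c * T i l = mmul I (mmul K T T2) T i l"
  proof -
   have "mmul I (mmul K T T2) T i l = mmul I (%i k. c * kdelta i k) T i l" by (rule eq_onD[OF mmul_cong[OF c eq_on_refl] i l])
   also have "... = c * T i l" using i finI by (simp add: mmul_def kdelta_def if_distrib[of "%x. _ * x"] if_distrib[of "%x. x * _"] sum.delta cong: if_cong)
   finally show ?thesis by simp
  qed
  also have "... = mmul K T (mmul I T2 T) i l" by (simp add: mmul_assoc)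
  also have "... = mmul K T (%i k. c' * kdelta i k) i l" by (rule eq_onD[OF mmul_cong[OF eq_on_refl c'] i l])
  also have "... = c' * T i l"
   using l finK by (simp add: mmul_def kdelta_def if_distrib[of "%x. _ * x"] sum.delta sum.delta' mult.commute cong: if_cong)
  finally have cc: "c = c'" using nz by (simp add: T_def)
  have "ktrace I (R g) = ktrace K (R' g)" if g: "g : G" for g
  proof -
   have "c * ktrace I (R g) = (SUM a:I. mmul I (R g) (%i k. c * kdelta i k) a a)"
    unfolding ktrace_def sum_distrib_left by (intro sum.cong refl) (simp add: scal(1)[OF finI])
   also have "... = ktrace I (mmul I (R g) (mmul K T T2))"
    unfolding ktrace_def by (intro sum.cong refl) (rule eq_onD[OF mmul_cong[OF eq_on_refl eq_on_sym[OF c]]])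
   also have "... = ktrace I (mmul K (mmul I (R g) T) T2)" by (simp add: mmul_assoc)
   also have "... = ktrace I (mmul K (mmul K T (R' g)) T2)" by (rule ktrace_cong[OF mmul_cong[OF RT[OF g] eq_on_refl]])
   also have "... = ktrace K (mmul K (R' g) (mmul I T2 T))"
    by (simp add: mmul_assoc ktrace_mmul[of I K T])
   also have "... = (SUM a:K. mmul K (R' g) (%i k. c' * kdelta i k) a a)"
    unfolding ktrace_def by (intro sum.cong refl) (rule eq_onD[OF mmul_cong[OF eq_on_refl c']])
   also have "... = c' * ktrace K (R' g)"
    unfolding ktrace_def sum_distrib_left by (intro sum.cong refl) (simp add: scal(1)[OF finK])
   finally show ?thesis using c0 cc by simp
  qed
  with ne show False by blast
 qed
 have "(SUM g:G. ktrace I (R g) * ktrace K (R' (iv g))) = (SUM g:G. SUM i:I. SUM k:K. R g i i * R' (iv g) k k)"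
  by (simp add: ktrace_def sum_product)
 also have "... = (SUM i:I. SUM k:K. SUM g:G. R g i i * R' (iv g) k k)"
  by (subst sum.swap) (intro sum.cong refl sum.swap)
 also have "... = 0" by (simp add: *)
 finally show ?thesis .
qed

end

section \<open>Decomposition into irreducible characters\<close>

lemma exists_eigenvector:
 fixes T :: "'i => 'i => complex"
 assumes "finite I" "I ~= {}"
 shows "EX \<mu> v. (EX i:I. v i ~= 0) & (ALL i:I. (SUM k:I. T i k * v k) = \<mu> * v i)"
proof -
 define d where "d = card I"
 have d: "d > 0" using assms by (simp add: d_def card_gt_0_iff)
 obtain f where f: "bij_betw f {0..<d} I" using ex_bij_betw_nat_finite[OF assms(1)] by (auto simp: d_def)
 define A where "A = mat d d (%(a,b). T (f a) (f b))"
 have A: "A : Mat d d" by (simp add: A_def)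
 from spectrum_non_empty[OF A d] obtain \<mu> w where ev: "eigenvector A w \<mu>"
  by (auto simp: spectrum_def eigenvalue_def)
 then have w: "w : Vec d" "w ~= zv d" "A *v w = \<mu> *s w" using A by (auto simp: eigenvector_def)
 define g where "g = the_inv_into {0..<d} f"
 have gf: "g (f a) = a" if "a < d" for a
  using f that by (simp add: g_def bij_betw_def the_inv_into_f_f)
 have fg: "i : I ==> f (g i) = i & g i < d" for i
  using f by (metis atLeastLessThan_iff bij_betw_def f_the_inv_into_f g_def the_inv_into_into subset_refl)
 define v where "v i = w $ (g i)" for i
 obtain a where a: "a < d" "w $ a ~= 0" using w(1,2) by (metis carrier_vecD eq_vecI index_zero_vec(1) index_zero_vec(2))
 have "f a : I" using f a by (auto simp: bij_betw_def)
 then have 1: "EX i:I. v i ~= 0" using a gf by (intro bexI[of _ "f a"]) (simp_all add: v_def)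
 have "(SUM k:I. T i k * v k) = \<mu> * v i" if i: "i : I" for i
 proof -
  have "(SUM k:I. T i k * v k) = (SUM b:{0..<d}. T i (f b) * v (f b))"
   by (rule sum.reindex_bij_betw[OF f, symmetric])
  also have "... = (SUM b:{0..<d}. A $$ (g i, b) * w $ b)"
   using fg[OF i] gf by (intro sum.cong refl) (simp add: A_def v_def)
  also have "... = (A *v w) $ (g i)" using fg[OF i] A w(1) by (simp add: scalar_prod_def A_def)
  also have "... = \<mu> * v i" using fg[OF i] w by (simp add: v_def)
  finally show ?thesis .
 qed
 with 1 show ?thesis by blast
qed

context finite_group_on
begin

text \<open>\<open>irr\<close> admits only the index sets {..<d}, so that all irreducible characters
  live over one type; other index sets are brought there.\<close>

lemma rep_transport:
 assumes R: "rep I R"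
 shows "EX R1. rep {..<card I} R1 & (ALL g. ktrace {..<card I} (R1 g) = ktrace I (R g))"
proof -
 have finI: "finite I" by (rule repD(1)[OF R])
 obtain f where f: "bij_betw f {..<card I} I"
  using ex_bij_betw_nat_finite[OF finI] by (auto simp: atLeast0LessThan)
 define R1 where "R1 g a b = R g (f a) (f b)" for g a b
 have fI: "a < card I ==> f a : I" for a using f by (auto simp: bij_betw_def)
 have inj: "a < card I ==> b < card I ==> f a = f b <-> a = b" for a b
  using f by (auto simp: bij_betw_def inj_on_def)
 have "rep {..<card I} R1" unfolding rep_def
 proof (intro conjI ballI eq_onI)
  fix g h a b assume *: "g : G" "h : G" "a : {..<card I}" "b : {..<card I}"
  have "mmul {..<card I} (R1 g) (R1 h) a b = (SUM l:I. R g (f a) l * R h l (f b))"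
   unfolding mmul_def R1_def by (rule sum.reindex_bij_betw[OF f])
  then show "mmul {..<card I} (R1 g) (R1 h) a b = R1 (g ** h) a b" using * fI by (simp add: rep_mul[OF R] R1_def)
 next
  fix a b assume "a : {..<card I}" "b : {..<card I}"
  then show "R1 e a b = kdelta a b" using fI inj by (simp add: R1_def rep_e[OF R] kdelta_def)
 qed simp
 moreover have "ktrace {..<card I} (R1 g) = ktrace I (R g)" for g
  unfolding ktrace_def R1_def by (rule sum.reindex_bij_betw[OF f])
 ultimately show ?thesis by blast
qed

text \<open>The image of an equivariant projection P = A B, in the basis formed by the columns of A,
  is again a representation.\<close>

lemma compress:
 assumes R: "rep I R" and P: "eq_on I I (mmul I P P) P" and c: "commutes I R P"
 shows "\<exists>(r::nat) R1. rep {..<r} R1 & (ALL g:G. ktrace {..<r} (R1 g) = ktrace I (mmul I (R g) P)) & ktrace I P = of_nat r"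
proof -
 have finI: "finite I" by (rule repD(1)[OF R])
 obtain r A B where f: "eq_on I I P (mmul {..<(r::nat)} A B)" and BA: "eq_on {..<r} {..<r} (mmul I B A) kdelta"
  and tr: "ktrace I P = of_nat r" using idempotent_factorization[OF finI P] by blast
 let ?r = "{..<r}"
 define R1 where "R1 g = mmul I B (mmul I (R g) A)" for g
 have "rep ?r R1" unfolding rep_def
 proof (intro conjI ballI)
  show "finite ?r" by simp
  fix g h assume g: "g : G" and h: "h : G"
  have "eq_on ?r ?r (mmul ?r (R1 g) (R1 h)) (mmul I B (mmul I (mmul I (R g) (mmul ?r A B)) (mmul I (R h) A)))"
   by (simp add: R1_def mmul_assoc)
  also have "eq_on ?r ?r ... (mmul I B (mmul I (mmul I (R g) P) (mmul I (R h) A)))"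
   by (intro mmul_cong eq_on_sym[OF f]) simp_all
  also have "eq_on ?r ?r ... (mmul I B (mmul I (mmul I P (R g)) (mmul I (R h) A)))"
   using c g by (intro mmul_cong[OF eq_on_refl mmul_cong[OF eq_on_sym eq_on_refl]]) (simp add: commutes_def)
  also have "eq_on ?r ?r ... (mmul I B (mmul I (mmul I (mmul ?r A B) (R g)) (mmul I (R h) A)))"
   by (intro mmul_cong f) simp_all
  also have "... = mmul ?r (mmul I B A) (mmul I B (mmul I (mmul I (R g) (R h)) A))" by (simp add: mmul_assoc)
  also have "eq_on ?r ?r ... (mmul ?r kdelta (mmul I B (mmul I (R (g ** h)) A)))"
   by (intro mmul_cong BA repD(2)[OF R g h]) simp_all
  also have "eq_on ?r ?r ... (R1 (g ** h))" unfolding R1_def by (rule mmul_kdelta_left) simp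
  finally show "eq_on ?r ?r (mmul ?r (R1 g) (R1 h)) (R1 (g ** h))" .
 next
  have "eq_on ?r ?r (R1 e) (mmul I B (mmul I kdelta A))"
   unfolding R1_def by (intro mmul_cong repD(3)[OF R]) simp_all
  also have "eq_on ?r ?r ... (mmul I B A)" by (intro mmul_cong mmul_kdelta_left finI) simp
  also have "eq_on ?r ?r ... kdelta" by (rule BA)
  finally show "eq_on ?r ?r (R1 e) kdelta" .
 qed
 moreover have "ktrace ?r (R1 g) = ktrace I (mmul I (R g) P)" for g
 proof -
  have "ktrace ?r (R1 g) = ktrace I (mmul I (R g) (mmul ?r A B))"
   unfolding R1_def by (simp add: ktrace_mmul[of ?r I B] mmul_assoc)
  also have "... = ktrace I (mmul I (R g) P)"
   by (intro ktrace_cong mmul_cong eq_on_sym[OF f]) simp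
  finally show ?thesis .
 qed
 ultimately show ?thesis using tr by blast
qed

text \<open>S is equivariant, nonzero and singular. Its image is invariant, with matrices W g, and Y
  g are the matrices on the quotient by the image. Since only traces are compared, an invariant
  complement is not constructed.\<close>

lemma split_rep:
 fixes I :: "'i set"
 assumes R: "rep I R" and c: "commutes I R S" and nz: "i0 : I" "k0 : I" "S i0 k0 ~= 0"
  and v: "j0 : I" "v j0 ~= 0" "!!i. i : I ==> (SUM k:I. S i k * v k) = 0"
 shows "\<exists>(r::nat) (s::nat) R1 Y. rep {..<r} R1 & rep {..<s} Y & r + s = card I & r > 0 & s > 0 &
  (ALL g:G. ktrace I (R g) = ktrace {..<r} (R1 g) + ktrace {..<s} (Y g))"
proof -
 have finI: "finite I" by (rule repD(1)[OF R])
 obtain r A B A' B' where f: "eq_on I I S (mmul {..<(r::nat)} A B)"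
  and a: "eq_on {..<r} {..<r} (mmul I A' A) kdelta" and b: "eq_on {..<r} {..<r} (mmul I B B') kdelta"
  using rank_factorization[OF finI finI, of S] by blast
 let ?r = "{..<r}"
 define W where "W g = mmul I B (mmul I (R g) B')" for g
 have RA: "eq_on I ?r (mmul I (R g) A) (mmul ?r A (W g))" if g: "g : G" for g
 proof -
  have "eq_on I ?r (mmul I (R g) A) (mmul ?r (mmul I (R g) A) kdelta)" by (rule eq_on_sym[OF mmul_kdelta_right]) simp
  also have "eq_on I ?r ... (mmul ?r (mmul I (R g) A) (mmul I B B'))" by (intro mmul_cong eq_on_sym[OF b]) simp_all
  also have "... = mmul I (mmul I (R g) (mmul ?r A B)) B'" by (simp add: mmul_assoc)
  also have "eq_on I ?r ... (mmul I (mmul I (R g) S) B')" by (intro mmul_cong eq_on_sym[OF f]) simp_all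
  also have "eq_on I ?r ... (mmul I (mmul I S (R g)) B')" using c g by (intro mmul_cong[OF eq_on_sym eq_on_refl]) (simp add: commutes_def)
  also have "eq_on I ?r ... (mmul I (mmul I (mmul ?r A B) (R g)) B')" by (intro mmul_cong f) simp_all
  also have "... = mmul ?r A (W g)" by (simp add: W_def mmul_assoc)
  finally show ?thesis .
 qed
 have AW: "eq_on ?r ?r (mmul I A' (mmul I (R g) A)) (W g)" if g: "g : G" for g
 proof -
  have "eq_on ?r ?r (mmul I A' (mmul I (R g) A)) (mmul I A' (mmul ?r A (W g)))" by (intro mmul_cong RA[OF g]) simp
  also have "... = mmul ?r (mmul I A' A) (W g)" by (simp add: mmul_assoc)
  also have "eq_on ?r ?r ... (mmul ?r kdelta (W g))" by (intro mmul_cong a) simp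
  also have "eq_on ?r ?r ... (W g)" by (rule mmul_kdelta_left) simp
  finally show ?thesis .
 qed
 have W: "rep ?r W" unfolding rep_def
 proof (intro conjI ballI)
  show "finite ?r" by simp
  fix g h assume g: "g : G" and h: "h : G"
  have "eq_on ?r ?r (mmul ?r (W g) (W h)) (mmul ?r (mmul I A' (mmul I (R g) A)) (W h))"
   by (intro mmul_cong eq_on_sym[OF AW[OF g]]) simp
  also have "... = mmul I A' (mmul I (R g) (mmul ?r A (W h)))" by (simp add: mmul_assoc)
  also have "eq_on ?r ?r ... (mmul I A' (mmul I (R g) (mmul I (R h) A)))" by (intro mmul_cong eq_on_sym[OF RA[OF h]]) simp_all
  also have "... = mmul I A' (mmul I (mmul I (R g) (R h)) A)" by (simp add: mmul_assoc)
  also have "eq_on ?r ?r ... (mmul I A' (mmul I (R (g ** h)) A))" by (intro mmul_cong repD(2)[OF R g h]) simp_all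
  also have "eq_on ?r ?r ... (W (g ** h))" by (rule AW) (simp add: g h)
  finally show "eq_on ?r ?r (mmul ?r (W g) (W h)) (W (g ** h))" .
 next
  have "eq_on ?r ?r (W e) (mmul I B (mmul I kdelta B'))"
   unfolding W_def by (intro mmul_cong repD(3)[OF R]) simp_all
  also have "eq_on ?r ?r ... (mmul I B B')" by (intro mmul_cong mmul_kdelta_left finI) simp
  also have "eq_on ?r ?r ... kdelta" by (rule b)
  finally show "eq_on ?r ?r (W e) kdelta" .
 qed
 \<comment> \<open>Q projects along the image of S, which the columns of A span. It need not commute
   with R; only Q R Q = Q R is available.\<close>
 define Q where "Q i k = kdelta i k - mmul ?r A A' i k" for i k
 have subl: "mmul I Q C i k = C i k - mmul ?r A (mmul I A' C) i k" if "i : I" for C :: "'i => nat => complex" and i k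
 proof -
  have "mmul I Q C i k = mmul I kdelta C i k - mmul I (mmul ?r A A') C i k"
   by (simp add: mmul_def[of I] Q_def left_diff_distrib sum_subtractf)
  then show ?thesis using eq_onD[OF mmul_kdelta_left[OF finI] that, of k UNIV C] by (simp add: mmul_assoc)
 qed
 have subr: "mmul I C Q i k = C i k - mmul ?r (mmul I C A) A' i k" if "k : I" for C :: "'i => 'i => complex" and i k
 proof -
  have "mmul I C Q i k = mmul I C kdelta i k - mmul I C (mmul ?r A A') i k"
   by (simp add: mmul_def[of I] Q_def right_diff_distrib sum_subtractf)
  then show ?thesis using eq_onD[OF mmul_kdelta_right[OF finI] _ that, of i UNIV C] by (simp add: mmul_assoc)
 qed
 have QA: "eq_on I ?r (mmul I Q A) (%i k. 0)"
 proof (rule eq_onI)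
  fix i k assume ik: "i : I" "k : ?r"
  have "mmul ?r A (mmul I A' A) i k = mmul ?r A kdelta i k" by (rule eq_onD[OF mmul_cong[OF eq_on_refl a] ik])
  also have "... = A i k" by (rule eq_onD[OF mmul_kdelta_right ik]) simp
  finally show "mmul I Q A i k = 0" using subl[OF ik(1)] by simp
 qed
 have QQ: "eq_on I I (mmul I Q Q) Q"
 proof (rule eq_onI)
  fix i k assume ik: "i : I" "k : I"
  have "mmul ?r (mmul I Q A) A' i k = mmul ?r (%i k. 0) A' i k" by (rule eq_onD[OF mmul_cong[OF QA eq_on_refl] ik])
  also have "... = 0" by (simp add: mmul_def)
  finally show "mmul I Q Q i k = Q i k" using subr[OF ik(2), of Q i] by simp
 qed
 have QRQ: "eq_on I I (mmul I (mmul I Q (R g)) Q) (mmul I Q (R g))" if g: "g : G" for g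
 proof (rule eq_onI)
  fix i k assume ik: "i : I" "k : I"
  have "eq_on I I (mmul ?r (mmul I (mmul I Q (R g)) A) A') (mmul ?r (mmul I Q (mmul I (R g) A)) A')" by (simp add: mmul_assoc)
  also have "eq_on I I ... (mmul ?r (mmul I Q (mmul ?r A (W g))) A')" by (intro mmul_cong RA[OF g]) simp_all
  also have "... = mmul ?r (mmul ?r (mmul I Q A) (W g)) A'" by (simp add: mmul_assoc)
  also have "eq_on I I ... (mmul ?r (mmul ?r (%i k. 0) (W g)) A')" by (intro mmul_cong QA) simp_all
  finally have "mmul ?r (mmul I (mmul I Q (R g)) A) A' i k = 0" using ik by (simp add: eq_on_def mmul_def[of ?r])
  then show "mmul I (mmul I Q (R g)) Q i k = mmul I Q (R g) i k" using subr[OF ik(2), of "mmul I Q (R g)" i] by simp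
 qed
 obtain s A2 B2 where f2: "eq_on I I Q (mmul {..<(s::nat)} A2 B2)" and BA: "eq_on {..<s} {..<s} (mmul I B2 A2) kdelta"
  and tr: "ktrace I Q = of_nat s" using idempotent_factorization[OF finI QQ] by blast
 let ?s = "{..<s}"
 have B2Q: "eq_on ?s I B2 (mmul I B2 Q)"
 proof -
  have "eq_on ?s I (mmul I B2 Q) (mmul I B2 (mmul ?s A2 B2))" by (intro mmul_cong f2) simp
  also have "... = mmul ?s (mmul I B2 A2) B2" by (simp add: mmul_assoc)
  also have "eq_on ?s I ... (mmul ?s kdelta B2)" by (intro mmul_cong BA) simp
  also have "eq_on ?s I ... B2" by (rule mmul_kdelta_left) simp
  finally show ?thesis by (rule eq_on_sym)
 qed
 define Y where "Y g = mmul I B2 (mmul I (R g) A2)" for g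
 have Y: "rep ?s Y" unfolding rep_def
 proof (intro conjI ballI)
  show "finite ?s" by simp
  fix g h assume g: "g : G" and h: "h : G"
  have "eq_on ?s ?s (mmul ?s (Y g) (Y h)) (mmul I B2 (mmul I (R g) (mmul I (mmul ?s A2 B2) (mmul I (R h) A2))))"
   by (simp add: Y_def mmul_assoc)
  also have "eq_on ?s ?s ... (mmul I (mmul I B2 Q) (mmul I (R g) (mmul I Q (mmul I (R h) A2))))"
   by (intro mmul_cong eq_on_sym[OF f2] B2Q) simp_all
  also have "... = mmul I B2 (mmul I (mmul I (mmul I Q (R g)) Q) (mmul I (R h) A2))" by (simp add: mmul_assoc)
  also have "eq_on ?s ?s ... (mmul I B2 (mmul I (mmul I Q (R g)) (mmul I (R h) A2)))" by (intro mmul_cong QRQ[OF g]) simp_all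
  also have "... = mmul I (mmul I B2 Q) (mmul I (mmul I (R g) (R h)) A2)" by (simp add: mmul_assoc)
  also have "eq_on ?s ?s ... (mmul I B2 (mmul I (R (g ** h)) A2))" by (intro mmul_cong eq_on_sym[OF B2Q] repD(2)[OF R g h]) simp_all
  finally show "eq_on ?s ?s (mmul ?s (Y g) (Y h)) (Y (g ** h))" unfolding Y_def .
 next
  have "eq_on ?s ?s (Y e) (mmul I B2 (mmul I kdelta A2))"
   unfolding Y_def by (intro mmul_cong repD(3)[OF R]) simp_all
  also have "eq_on ?s ?s ... (mmul I B2 A2)" by (intro mmul_cong mmul_kdelta_left finI) simp
  also have "eq_on ?s ?s ... kdelta" by (rule BA)
  finally show "eq_on ?s ?s (Y e) kdelta" .
 qed
 have trW: "ktrace ?r (W g) = ktrace I (mmul ?r (mmul I (R g) A) A')" if g: "g : G" for g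
 proof -
  have "ktrace ?r (W g) = ktrace ?r (mmul I A' (mmul I (R g) A))" by (rule ktrace_cong[OF eq_on_sym[OF AW[OF g]]])
  then show ?thesis by (simp add: ktrace_mmul[of ?r I])
 qed
 have tot: "ktrace I (R g) = ktrace ?r (W g) + ktrace ?s (Y g)" if g: "g : G" for g
 proof -
  have "ktrace ?s (Y g) = ktrace I (mmul I (R g) (mmul ?s A2 B2))"
   unfolding Y_def by (simp add: ktrace_mmul[of ?s I B2] mmul_assoc)
  also have "... = ktrace I (mmul I (R g) Q)" by (intro ktrace_cong mmul_cong eq_on_sym[OF f2]) simp
  also have "... = ktrace I (R g) - ktrace I (mmul ?r (mmul I (R g) A) A')"
   unfolding ktrace_def by (simp add: subr sum_subtractf)
  finally show ?thesis using trW[OF g] by simp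
 qed
 have "of_nat (card I) = (of_nat (r + s) :: complex)"
  using tot[OF e_in] trace_e[OF R] trace_e[OF W] trace_e[OF Y] by simp
 then have rs: "r + s = card I" using of_nat_eq_iff by metis
 have r0: "r > 0"
 proof (rule ccontr)
  assume "\<not> r > 0"
  then have "S i0 k0 = 0" using f nz by (simp add: eq_on_def mmul_def)
  with nz show False by simp
 qed
 \<comment> \<open>With a trivial quotient r would be card I, so 1 - B' B would be an idempotent of
   trace 0, hence 0. Then B, and with it S, would be injective.\<close>
 have s0: "s > 0"
 proof (rule ccontr)
  assume "\<not> s > 0"
  then have r: "r = card I" using rs by simp
  define P where "P i k = kdelta i k - mmul ?r B' B i k" for i k
  have subP: "mmul I P C i k = C i k - mmul ?r B' (mmul I B C) i k" if "i : I" for C :: "'i => 'i => complex" and i k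
  proof -
   have "mmul I P C i k = mmul I kdelta C i k - mmul I (mmul ?r B' B) C i k"
    by (simp add: mmul_def[of I] P_def left_diff_distrib sum_subtractf)
   then show ?thesis using eq_onD[OF mmul_kdelta_left[OF finI] that, of k UNIV C] by (simp add: mmul_assoc)
  qed
  have BP: "eq_on ?r I (mmul I B P) (%i k. 0)"
  proof (rule eq_onI)
   fix l k assume lk: "l : ?r" "k : I"
   have "mmul I B P l k = mmul I B kdelta l k - mmul I B (mmul ?r B' B) l k"
    by (simp add: mmul_def[of I] P_def right_diff_distrib sum_subtractf)
   moreover have "mmul I B kdelta l k = B l k" by (rule eq_onD[OF mmul_kdelta_right[OF finI] lk])
   moreover have "mmul ?r (mmul I B B') B l k = mmul ?r kdelta B l k" by (rule eq_onD[OF mmul_cong[OF b eq_on_refl] lk])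
   moreover have "mmul ?r kdelta B l k = B l k" by (rule eq_onD[OF mmul_kdelta_left lk]) simp
   ultimately show "mmul I B P l k = 0" by (simp add: mmul_assoc)
  qed
  have PP: "eq_on I I (mmul I P P) P"
  proof (rule eq_onI)
   fix i k assume ik: "i : I" "k : I"
   have "mmul ?r B' (mmul I B P) i k = mmul ?r B' (%i k. 0) i k" by (rule eq_onD[OF mmul_cong[OF eq_on_refl BP] ik])
   also have "... = 0" by (simp add: mmul_def)
   finally show "mmul I P P i k = P i k" using subP[OF ik(1), of P k] by simp
  qed
  obtain t C D where f3: "eq_on I I P (mmul {..<(t::nat)} C D)" and tr3: "ktrace I P = of_nat t"
   using idempotent_factorization[OF finI PP] by blast
  have "ktrace I P = of_nat (card I) - ktrace I (mmul ?r B' B)"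
   by (simp add: ktrace_def P_def sum_subtractf kdelta_def)
  also have "ktrace I (mmul ?r B' B) = of_nat r" by (simp add: ktrace_mmul[of I] ktrace_cong[OF b])
  finally have "t = 0" using tr3 r by simp
  then have P0: "P j0 k = 0" if "k : I" for k using f3 v(1) that by (simp add: eq_on_def mmul_def)
  have Bv: "mmul I B (%k (_::'i). v k) l j0 = 0" if l: "l : ?r" for l
  proof -
   have "mmul I B (%k (_::'i). v k) l j0 = mmul ?r kdelta (mmul I B (%k (_::'i). v k)) l j0"
    by (rule eq_onD[OF mmul_kdelta_left l UNIV_I, symmetric]) simp
   also have "... = mmul ?r (mmul I A' A) (mmul I B (%k (_::'i). v k)) l j0"
    by (rule eq_onD[OF mmul_cong[OF eq_on_sym[OF a] eq_on_refl] l UNIV_I])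
   also have "... = mmul I A' (mmul I (mmul ?r A B) (%k (_::'i). v k)) l j0" by (simp add: mmul_assoc)
   also have "... = mmul I A' (mmul I S (%k (_::'i). v k)) l j0"
    by (rule eq_onD[OF mmul_cong[OF eq_on_refl mmul_cong[OF eq_on_sym[OF f] eq_on_refl]] l UNIV_I])
   also have "... = 0" using v(3) by (simp add: mmul_def)
   finally show ?thesis .
  qed
  have "mmul I P (%k (_::'i). v k) j0 j0 = v j0 - mmul ?r B' (mmul I B (%k (_::'i). v k)) j0 j0"
   using subP[OF v(1), of "%k (_::'i). v k" j0] by simp
  moreover have "mmul ?r B' (mmul I B (%k (_::'i). v k)) j0 j0 = 0"
   unfolding mmul_def[of ?r] using Bv by simp
  moreover have "mmul I P (%k (_::'i). v k) j0 j0 = 0" unfolding mmul_def by (simp add: P0)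
  ultimately show False using v(2) by simp
 qed
 show ?thesis using W Y rs r0 s0 tot by blast
qed

text \<open>Sums of irreducible characters, with multiplicities, as lists. The empty list gives 0,
  in accordance with coefficients that are allowed to be 0.\<close>

definition vchar :: "('g => complex) set" where
 "vchar = {f. EX cs. set cs \<subseteq> irr & f = (%g. \<Sum>c\<leftarrow>cs. c g)}"

lemma irr_out: "ch : irr ==> g \<notin> G ==> ch g = 0"
 by (auto simp: irr_def)

lemma vchar_add: "f : vchar ==> f' : vchar ==> (%g. f g + f' g) : vchar"
proof -
 assume "f : vchar" "f' : vchar"
 then obtain cs cs' where "set cs \<subseteq> irr" "f = (%g. \<Sum>c\<leftarrow>cs. c g)" "set cs' \<subseteq> irr" "f' = (%g. \<Sum>c\<leftarrow>cs'. c g)"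
  by (auto simp: vchar_def)
 then show ?thesis unfolding vchar_def by (intro CollectI exI[of _ "cs @ cs'"]) auto
qed

lemma decompose_nat:
 assumes "rep {..<(d::nat)} R"
 shows "(%g. if g : G then ktrace {..<d} (R g) else 0) : vchar"
 using assms
proof (induction d arbitrary: R rule: less_induct)
 case (less d)
 note R = less.prems
 show ?case
 proof (cases "d = 0 \<or> simple {..<d} R")
  case True
  then show ?thesis
  proof
   assume "d = 0"
   then show ?thesis unfolding vchar_def by (intro CollectI exI[of _ "[]"]) (auto simp: ktrace_def)
  next
   assume "simple {..<d} R"
   then show ?thesis unfolding vchar_def irr_def
    by (intro CollectI exI[of _ "[%g. if g : G then ktrace {..<d} (R g) else 0]"]) auto
  qed
 next
  case False
  then have d: "{..<d} ~= {}" by auto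
  from False R d obtain T where T: "commutes {..<d} R T" and nT: "!!c. \<not> eq_on {..<d} {..<d} T (%i k. c * kdelta i k)"
   unfolding simple_def by blast
  obtain \<mu> v j0 where j0: "j0 : {..<d}" "v j0 ~= 0" and ev: "!!i. i : {..<d} ==> (\<Sum>k<d. T i k * v k) = \<mu> * v i"
   using exists_eigenvector[OF _ d, of T] by blast
  \<comment> \<open>Subtracting an eigenvalue makes T singular, and the result is nonzero because T
    is not scalar.\<close>
  define S where "S i k = T i k - \<mu> * kdelta i k" for i k
  obtain i0 k0 where ik: "i0 : {..<d}" "k0 : {..<d}" "S i0 k0 ~= 0"
   using nT[of \<mu>] by (auto simp: eq_on_def S_def)
  have kd: "(\<Sum>k<d. kdelta i k * h k) = h i" "(\<Sum>k<d. h k * kdelta k i) = h i" if "i < d" for i and h :: "nat => complex"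
   using that by (simp_all add: kdelta_def if_distrib[of "%x. _ * x"] if_distrib[of "%x. x * _"] sum.delta sum.delta' cong: if_cong)
  have cS: "commutes {..<d} R S" unfolding commutes_def
  proof (intro ballI eq_onI)
   fix g i k assume g: "g : G" "i : {..<d}" "k : {..<d}"
   have "mmul {..<d} S (R g) i k = mmul {..<d} T (R g) i k - \<mu> * (\<Sum>l<d. kdelta i l * R g l k)"
    by (simp add: mmul_def S_def left_diff_distrib sum_subtractf sum_distrib_left mult.assoc)
   moreover have "mmul {..<d} (R g) S i k = mmul {..<d} (R g) T i k - \<mu> * (\<Sum>l<d. R g i l * kdelta l k)"
    by (simp add: mmul_def S_def right_diff_distrib sum_subtractf sum_distrib_left mult.left_commute)
   ultimately show "mmul {..<d} S (R g) i k = mmul {..<d} (R g) S i k"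
    using T g kd by (simp add: commutes_def eq_on_def)
  qed
  have Sv: "(\<Sum>k<d. S i k * v k) = 0" if "i : {..<d}" for i
  proof -
   have "(\<Sum>k<d. S i k * v k) = (\<Sum>k<d. T i k * v k) - \<mu> * (\<Sum>k<d. kdelta i k * v k)"
    by (simp add: S_def left_diff_distrib sum_subtractf sum_distrib_left mult.assoc)
   then show ?thesis using ev that kd by simp
  qed
  from split_rep[where v=v, OF R cS ik j0 Sv] obtain r s R1 Y where
   *: "rep {..<(r::nat)} R1" "rep {..<(s::nat)} Y" "r + s = d" "r > 0" "s > 0"
    "!!g. g : G ==> ktrace {..<d} (R g) = ktrace {..<r} (R1 g) + ktrace {..<s} (Y g)" by auto
  have "(%g. if g : G then ktrace {..<d} (R g) else 0)
   = (%g. (if g : G then ktrace {..<r} (R1 g) else 0) + (if g : G then ktrace {..<s} (Y g) else 0))"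
   by (auto simp: *(6))
  moreover have "... : vchar" using less.IH[OF _ *(1)] less.IH[OF _ *(2)] *(3-5) by (intro vchar_add) auto
  ultimately show ?thesis by simp
 qed
qed

lemma decompose: "rep I R ==> (%g. if g : G then ktrace I (R g) else 0) : vchar"
proof -
 assume "rep I R"
 then obtain R1 where R1: "rep {..<card I} R1" "!!g. ktrace {..<card I} (R1 g) = ktrace I (R g)"
  using rep_transport by blast
 show ?thesis by (rule decompose_nat[OF R1(1), unfolded R1(2)])
qed

lemma compress_vchar:
 assumes "rep I R" "eq_on I I (mmul I P P) P" "commutes I R P"
 shows "(%g. if g : G then ktrace I (mmul I (R g) P) else 0) : vchar"
proof -
 obtain r R1 where R1: "rep {..<(r::nat)} R1" "ALL g:G. ktrace {..<r} (R1 g) = ktrace I (mmul I (R g) P)"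
  using compress[OF assms] by blast
 have "(%g. if g : G then ktrace I (mmul I (R g) P) else 0) = (%g. if g : G then ktrace {..<r} (R1 g) else 0)"
  using R1(2) by auto
 then show ?thesis using decompose[OF R1(1)] by simp
qed

text \<open>Block sums, indexed by a disjoint sum. Nonempty lists keep the degree positive, which
  \<open>is_rep\<close> demands.\<close>

lemma vchar_rep:
 assumes "set cs \<subseteq> irr" "cs ~= []"
 shows "\<exists>(d::nat) R. d > 0 & rep {..<d} R & (ALL g:G. (\<Sum>c\<leftarrow>cs. c g) = ktrace {..<d} (R g))"
 using assms(2,1)
proof (induction cs rule: list_nonempty_induct)
 case (single c)
 then obtain d R where "simple {..<(d::nat)} R" "c = (%g. if g : G then ktrace {..<d} (R g) else 0)"
  by (auto simp: irr_def)
 then show ?case by (intro exI[of _ d] exI[of _ R]) (auto simp: simple_def)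
next
 case (cons c cs)
 obtain d R where R: "rep {..<(d::nat)} R" "d > 0" "!!g. g : G ==> c g = ktrace {..<d} (R g)"
 proof -
  have "c : irr" using cons.prems by simp
  then obtain d R where "simple {..<(d::nat)} R" "c = (%g. if g : G then ktrace {..<d} (R g) else 0)"
   unfolding irr_def by blast
  then show ?thesis using that[of d R] by (auto simp: simple_def)
 qed
 obtain d' R' where R': "rep {..<(d'::nat)} R'" "!!g. g : G ==> (\<Sum>c\<leftarrow>cs. c g) = ktrace {..<d'} (R' g)"
  using cons.IH cons.prems by auto
 define Q where "Q g x y = (case (x, y) of (Inl i, Inl k) => R g i k | (Inr i, Inr k) => R' g i k | _ => 0)" for g x y
 have Q: "rep ({..<d} <+> {..<d'}) Q" unfolding rep_def
 proof (intro conjI ballI eq_onI)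
  fix g h x y assume *: "g : G" "h : G" "x : {..<d} <+> {..<d'}" "y : {..<d} <+> {..<d'}"
  then show "mmul ({..<d} <+> {..<d'}) (Q g) (Q h) x y = Q (g ** h) x y"
   unfolding mmul_def by (subst sum.Plus) (auto simp: Q_def rep_mul[OF R(1)] rep_mul[OF R'(1)])
 next
  fix x y assume "x : {..<d} <+> {..<d'}" "y : {..<d} <+> {..<d'}"
  then show "Q e x y = kdelta x y" by (auto simp: Q_def rep_e[OF R(1)] rep_e[OF R'(1)] kdelta_def split: if_splits)
 qed simp
 have tr: "ktrace ({..<d} <+> {..<d'}) (Q g) = ktrace {..<d} (R g) + ktrace {..<d'} (R' g)" for g
  unfolding ktrace_def by (subst sum.Plus) (auto simp: Q_def)
 obtain R1 where R1: "rep {..<card ({..<d} <+> {..<d'})} R1"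
  "!!g. ktrace {..<card ({..<d} <+> {..<d'})} (R1 g) = ktrace ({..<d} <+> {..<d'}) (Q g)"
  using rep_transport[OF Q] by blast
 show ?case using R1 R R' tr by (intro exI[of _ "card ({..<d} <+> {..<d'})"] exI[of _ R1]) (simp add: card_Plus)
qed

end

section \<open>Orthogonality and convolution of characters\<close>

context finite_group_on
begin

lemma nonempty [simp]: "G ~= {}"
 using e_in by blast

definition ip :: "('g => complex) => ('g => complex) => complex" where
 "ip ph psi = (SUM g:G. ph g * cnj (psi g)) / of_nat (card G)"

text \<open>The functional equation characterizes the irreducible characters. Since it passes to products,
 it allows to treat characters of a direct product without constructing tensor products.\<close>

definition spherical :: "('g => complex) => bool" where
 "spherical ch <-> (\<exists>d::nat. d > 0 & ch e = of_nat d) & (ALL g:G. ch (iv g) = cnj (ch g)) &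
  (ALL x:G. ALL y:G. (SUM h:G. ch (h ** x ** iv h ** y)) * ch e = of_nat (card G) * ch x * ch y) &
  (SUM g:G. ch g * cnj (ch g)) = of_nat (card G) & (ALL g:G. ALL h:G. ch (h ** g ** iv h) = ch g)"

lemma sphericalD:
 assumes "spherical ch"
 shows "ch e ~= 0" "!!g. g : G ==> ch (iv g) = cnj (ch g)" "(SUM g:G. ch g * cnj (ch g)) = of_nat (card G)"
  "!!g h. g : G ==> h : G ==> ch (h ** g ** iv h) = ch g"
  "!!x y. x : G ==> y : G ==> (SUM h:G. ch (h ** x ** iv h ** y)) * ch e = of_nat (card G) * ch x * ch y"
 using assms by (auto simp: spherical_def)

lemma irr_spherical:
 assumes "ch : irr"
 shows "spherical ch"
proof -
 obtain d R where s: "simple {..<(d::nat)} R" and ch: "ch = (%g. if g : G then ktrace {..<d} (R g) else 0)"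
  using assms unfolding irr_def by blast
 have R: "rep {..<d} R" and d: "d > 0" using s by (auto simp: simple_def)
 show ?thesis unfolding spherical_def
 proof (intro conjI ballI)
  show "\<exists>d>0. ch e = of_nat d" using d trace_e[OF R] by (auto simp: ch)
  show "ch (iv g) = cnj (ch g)" if "g : G" for g using that by (simp add: ch trace_iv[OF R])
  show "(SUM h:G. ch (h ** x ** iv h ** y)) * ch e = of_nat (card G) * ch x * ch y" if "x : G" "y : G" for x y
   using simple_functional_equation[OF s that] that trace_e[OF R] by (simp add: ch)
  have "(SUM g:G. ch g * cnj (ch g)) = (SUM g:G. ktrace {..<d} (R g) * ktrace {..<d} (R (iv g)))"
   by (intro sum.cong refl) (simp add: ch trace_iv[OF R])
  then show "(SUM g:G. ch g * cnj (ch g)) = of_nat (card G)" using simple_norm[OF s] by simp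
  show "ch (h ** g ** iv h) = ch g" if "g : G" "h : G" for g h
   using that by (simp add: ch trace_conj[OF R])
 qed
qed

lemma irr_degree: "ch : irr ==> \<exists>d::nat. d > 0 & ch e = of_nat d"
 using irr_spherical by (auto simp: spherical_def)

lemma irr_orthogonal:
 assumes "ch : irr" "psi : irr"
 shows "ip ch psi = (if ch = psi then 1 else 0)"
proof (cases "ch = psi")
 case True
 then show ?thesis using sphericalD(3)[OF irr_spherical[OF assms(1)]] card_pos by (simp add: ip_def)
next
 case False
 obtain d R where s: "simple {..<(d::nat)} R" and ch: "ch = (%g. if g : G then ktrace {..<d} (R g) else 0)"
  using assms unfolding irr_def by blast
 obtain d' R' where s': "simple {..<(d'::nat)} R'" and psi: "psi = (%g. if g : G then ktrace {..<d'} (R' g) else 0)"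
  using assms unfolding irr_def by blast
 have R': "rep {..<d'} R'" using s' by (auto simp: simple_def)
 have "EX g:G. ktrace {..<d} (R g) ~= ktrace {..<d'} (R' g)"
 proof (rule ccontr)
  assume "\<not> ?thesis"
  then have "ch = psi" unfolding ch psi by auto
  with False show False by simp
 qed
 from simple_orthogonal[OF s s' this] have "(SUM g:G. ch g * cnj (psi g)) = 0"
  by (simp add: ch psi trace_iv[OF R'])
 then show ?thesis using False by (simp add: ip_def)
qed

lemma ip_cnj: "ip psi ph = cnj (ip ph psi)"
 by (simp add: ip_def mult.commute)

lemma ip_sum_list: "ip (%g. \<Sum>c\<leftarrow>cs. c g) psi = (\<Sum>c\<leftarrow>cs. ip c psi)"
 by (induction cs) (simp_all add: ip_def distrib_right sum.distrib add_divide_distrib)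

lemma ip_count:
 assumes "set cs \<subseteq> irr" "th : irr"
 shows "ip (%g. \<Sum>c\<leftarrow>cs. c g) th = of_nat (count_list cs th)"
 unfolding ip_sum_list using assms(1) by (induction cs) (auto simp: irr_orthogonal[OF _ assms(2)])

lemma ip_vchar_nat: "f : vchar ==> th : irr ==> \<exists>m::nat. ip f th = of_nat m"
 unfolding vchar_def using ip_count by blast

lemma irr_vchar: "th : irr ==> th : vchar"
 unfolding vchar_def by (intro CollectI exI[of _ "[th]"]) auto

lemma vchar_remove:
 assumes "f : vchar" "th : irr" "ip f th ~= 0"
 shows "(%g. f g - th g) : vchar"
proof -
 obtain cs where cs: "set cs \<subseteq> irr" "f = (%g. \<Sum>c\<leftarrow>cs. c g)" using assms(1) by (auto simp: vchar_def)
 have "th : set cs" using assms(3) ip_count[OF cs(1) assms(2)] cs(2) by (metis count_notin of_nat_0)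
 then have "(\<Sum>c\<leftarrow>cs. c g) = th g + (\<Sum>c\<leftarrow>remove1 th cs. c g)" for g
  by (rule sum_list_map_remove1)
 then show ?thesis unfolding vchar_def cs(2)
  using cs(1) set_remove1_subset[of th cs] by (intro CollectI exI[of _ "remove1 th cs"]) auto
qed

text \<open>The norm is the sum over the list of the multiplicity of each entry, hence at least the
  length of the list.\<close>

lemma vchar_norm_one:
 assumes "f : vchar" "ip f f = 1"
 shows "f : irr"
proof -
 obtain cs where cs: "set cs \<subseteq> irr" "f = (%g. \<Sum>c\<leftarrow>cs. c g)" using assms(1) by (auto simp: vchar_def)
 have "ip f f = (\<Sum>c\<leftarrow>cs. ip c f)" by (subst cs(2)) (rule ip_sum_list)
 also have "... = (\<Sum>c\<leftarrow>cs. of_nat (count_list cs c))"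
  using cs ip_count[OF cs(1)] by (intro arg_cong[of _ _ sum_list] map_cong refl) (subst ip_cnj, auto)
 also have "... = of_nat (\<Sum>c\<leftarrow>cs. count_list cs c)"
 proof -
  have "(\<Sum>c\<leftarrow>xs. (of_nat (h c) :: complex)) = of_nat (\<Sum>c\<leftarrow>xs. h c)" for xs :: "('g => complex) list" and h
   by (induction xs) simp_all
  then show ?thesis .
 qed
 finally have one: "(\<Sum>c\<leftarrow>cs. count_list cs c) = 1" using assms(2) by (metis of_nat_1 of_nat_eq_iff)
 have "length cs <= (\<Sum>c\<leftarrow>cs. count_list cs c)"
 proof -
  have "(\<Sum>c\<leftarrow>cs. 1) <= (\<Sum>c\<leftarrow>cs. count_list cs c)"
  proof (rule sum_list_mono)
   fix c assume "c : set cs"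
   then show "1 <= count_list cs c" by (metis count_list_0_iff less_one not_le)
  qed
  then show ?thesis by (simp add: sum_list_triv)
 qed
 then have "length cs <= 1" unfolding one .
 moreover have "cs ~= []" using one by auto
 ultimately have "length cs = 1" by (cases cs) auto
 then obtain c where "cs = [c]" by (metis One_nat_def length_0_conv length_Suc_conv)
 then show ?thesis using cs by simp
qed

text \<open>Replacing g by its conjugates and averaging over h puts the left side of the functional
  equation under the sum. A class function therefore acts on ch by a scalar under
  convolution.\<close>

lemma class_convolution:
 assumes s: "spherical ch" and f: "!!g h. g : G ==> h : G ==> f (h ** g ** iv h) = f g" and k: "k : G"
 shows "(SUM g:G. f g * ch (iv g ** k)) * ch e = (SUM g:G. f g * ch (iv g)) * ch k"
proof -
 have 1: "(SUM g:G. f g * ch (iv g ** k)) = (SUM g:G. f g * ch (h ** iv g ** iv h ** k))" if h: "h : G" for h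
 proof -
  have "(SUM g:G. f g * ch (iv g ** k)) = (SUM g:G. f (h ** g) * ch (iv (h ** g) ** k))"
   by (rule sum_left[OF h, of "%g. f g * ch (iv g ** k)", symmetric])
  also have "... = (SUM g:G. f (h ** (g ** iv h)) * ch (iv (h ** (g ** iv h)) ** k))"
   by (rule sum_right[OF iv_in[OF h], of "%g. f (h ** g) * ch (iv (h ** g) ** k)", symmetric])
  also have "... = (SUM g:G. f g * ch (h ** iv g ** iv h ** k))"
   using h f k by (intro sum.cong refl) (simp add: iv_mul flip: assoc)
  finally show ?thesis .
 qed
 have "of_nat (card G) * ((SUM g:G. f g * ch (iv g ** k)) * ch e) = (SUM h:G. (SUM g:G. f g * ch (iv g ** k)) * ch e)"
  by simp
 also have "... = (SUM h:G. (SUM g:G. f g * ch (h ** iv g ** iv h ** k)) * ch e)"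
  by (rule sumc, rule arg_cong[of _ _ "%x. x * ch e"], rule 1)
 also have "... = (SUM g:G. f g * ((SUM h:G. ch (h ** iv g ** iv h ** k)) * ch e))"
  by (simp add: sum_distrib_left sum_distrib_right mult.assoc) (rule sum.swap)
 also have "... = (SUM g:G. f g * (of_nat (card G) * ch (iv g) * ch k))"
  using k by (intro sum.cong refl) (simp add: sphericalD(5)[OF s])
 also have "... = of_nat (card G) * ((SUM g:G. f g * ch (iv g)) * ch k)"
  by (simp add: sum_distrib_left sum_distrib_right mult_ac)
 finally show ?thesis using card_pos by simp
qed

lemma spherical_convolution:
 assumes s: "spherical ch" and k: "k : G"
 shows "(SUM g:G. ch g * ch (iv g ** k)) = of_nat (card G) / ch e * ch k"
proof -
 have "(SUM g:G. ch g * ch (iv g)) = of_nat (card G)"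
  using sphericalD(2,3)[OF s] by (simp cong: sum.cong)
 then show ?thesis
  using class_convolution[OF s sphericalD(4)[OF s] k] sphericalD(1)[OF s] by (simp add: field_simps)
qed

lemma irr_convolution_0:
 assumes "ch : irr" "psi : irr" "ch ~= psi" and k: "k : G"
 shows "(SUM g:G. ch g * psi (iv g ** k)) = 0"
proof -
 note s = irr_spherical[OF assms(1)] irr_spherical[OF assms(2)]
 have "(SUM g:G. ch g * psi (iv g)) = 0"
  using irr_orthogonal[OF assms(1,2)] assms(3) card_pos sphericalD(2)[OF s(2)] by (simp add: ip_def cong: sum.cong)
 then show ?thesis
  using class_convolution[OF s(2) sphericalD(4)[OF s(1)] k] sphericalD(1)[OF s(2)] by simp
qed

end

section \<open>Isotypic kernels of a finite group action\<close>

locale group_action_on = finite_group_on G mul e iv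
 for G :: "'g set" and mul :: "'g => 'g => 'g" (infixl "**" 70) and e iv +
 fixes Om :: "'x set" and act :: "'g => 'x => 'x"
 assumes finOm [simp]: "finite Om"
  and act_in [simp]: "!!g x. g : G ==> x : Om ==> act g x : Om"
  and act_e [simp]: "!!x. x : Om ==> act e x = x"
  and act_mul: "!!g h x. g : G ==> h : G ==> x : Om ==> act (g ** h) x = act g (act h x)"
begin

lemma act_iv [simp]: "g : G ==> x : Om ==> act (iv g) (act g x) = x" "g : G ==> x : Om ==> act g (act (iv g) x) = x"
 by (simp_all flip: act_mul)

lemma act_eq_iff: "g : G ==> x : Om ==> y : Om ==> act g y = x <-> y = act (iv g) x"
 by (metis act_iv)

lemma sum_act: "g : G ==> (SUM x:Om. f (act g x)) = (SUM x:Om. f x)"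
 by (rule sum.reindex_bij_witness[of _ "act (iv g)" "act g"]) auto

definition fixc :: "'g => complex" where
 "fixc g = of_nat (card {x\<in>Om. act g x = x})"

lemma fixc_sum: "fixc g = (SUM x:Om. if act g x = x then 1 else 0)"
 by (simp add: fixc_def sum.If_cases Int_def)

lemma perm_vchar: "(%g. if g : G then fixc g else 0) : vchar"
proof -
 define R :: "'g => 'x => 'x => complex" where "R g x y = (if act g y = x then 1 else 0)" for g x y
 have "rep Om R" unfolding rep_def
 proof (intro conjI ballI eq_onI)
  fix g h x y assume *: "g : G" "h : G" "x : Om" "y : Om"
  have "mmul Om (R g) (R h) x y = (SUM l:Om. if l = act h y then R g x l else 0)"
   unfolding mmul_def by (intro sum.cong refl) (simp add: R_def)
  then show "mmul Om (R g) (R h) x y = R (g ** h) x y" using * by (simp add: R_def act_mul)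
 next
  fix x y assume "x : Om" "y : Om"
  then show "R e x y = kdelta x y" by (auto simp: R_def kdelta_def)
 qed simp
 note V = decompose[OF this]
 have "ktrace Om (R g) = fixc g" for g by (simp add: ktrace_def R_def fixc_sum)
 then show ?thesis using V by (simp only:)
qed

lemma fixc_conj:
 assumes "g : G" "h : G"
 shows "fixc (h ** g ** iv h) = fixc g"
proof -
 have *: "act (h ** g ** iv h) y = y <-> act g (act (iv h) y) = act (iv h) y" if y: "y : Om" for y
 proof -
  have "act (h ** g ** iv h) y = act h (act g (act (iv h) y))" using assms y by (simp add: act_mul)
  then show ?thesis using act_eq_iff[of h y "act g (act (iv h) y)"] assms y by simp
 qed
 have "fixc (h ** g ** iv h) = (SUM y:Om. if act g (act (iv h) y) = act (iv h) y then 1 else 0)"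
  unfolding fixc_sum by (rule sumc) (simp add: *)
 also have "... = fixc g"
  unfolding fixc_sum by (rule sum_act[OF iv_in[OF assms(2)], of "%y. if act g y = y then 1 else 0"])
 finally show ?thesis .
qed

lemma fixc_iv: "g : G ==> fixc (iv g) = fixc g"
 unfolding fixc_sum by (rule sumc) (metis act_iv)

definition kr :: "('g => complex) => 'x => 'x => complex" where
 "kr ch x y = (SUM g:G. if act g y = x then cnj (ch g) else 0)"

lemma kr_left:
 assumes "h : G" "x : Om" "y : Om"
 shows "kr ch (act h x) y = (SUM g:G. if act g y = x then cnj (ch (h ** g)) else 0)"
proof -
 have "kr ch (act h x) y = (SUM g:G. if act (h ** g) y = act h x then cnj (ch (h ** g)) else 0)"
  unfolding kr_def by (rule sum_left[OF assms(1), of "%g. if act g y = act h x then cnj (ch g) else 0", symmetric])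
 also have "... = (SUM g:G. if act g y = x then cnj (ch (h ** g)) else 0)"
  using assms by (intro sum.cong refl if_cong) (auto simp: act_mul, metis act_iv(1) act_in)
 finally show ?thesis .
qed

lemma kr_invariant:
 assumes s: "spherical ch" and "h : G" "x : Om" "y : Om"
 shows "kr ch (act h x) (act h y) = kr ch x y"
proof -
 have "kr ch (act h x) (act h y) = (SUM g:G. if act g (act h y) = x then cnj (ch (h ** g)) else 0)"
  using assms by (intro kr_left) auto
 also have "... = (SUM g:G. if act (g ** iv h) (act h y) = x then cnj (ch (h ** (g ** iv h))) else 0)"
  by (rule sum_right[OF iv_in[OF assms(2)], of "%g. if act g (act h y) = x then cnj (ch (h ** g)) else 0", symmetric])
 also have "... = kr ch x y" unfolding kr_def
  using assms sphericalD(4)[OF s] by (intro sum.cong refl if_cong) (auto simp: act_mul simp flip: assoc)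
 finally show ?thesis .
qed

lemma kr_hermitian:
 assumes s: "spherical ch" and "x : Om" "y : Om"
 shows "kr ch y x = cnj (kr ch x y)"
proof -
 have "kr ch y x = (SUM g:G. if act (iv g) x = y then cnj (ch (iv g)) else 0)"
  unfolding kr_def by (rule sum_iv[of "%g. if act g x = y then cnj (ch g) else 0", symmetric])
 also have "... = (SUM g:G. if act g y = x then ch g else 0)"
  using assms by (intro sum.cong refl if_cong) (auto simp: sphericalD(2)[OF s] act_eq_iff)
 finally show ?thesis by (simp add: kr_def if_distrib[of cnj] cong: if_cong)
qed

lemma kr_convolution:
 assumes "x : Om" "z : Om"
 shows "(SUM y:Om. kr ch x y * kr psi y z) = (SUM k:G. if act k z = x then cnj (SUM g:G. ch g * psi (iv g ** k)) else 0)"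
proof -
 have "(SUM y:Om. kr ch x y * kr psi y z)
  = (SUM y:Om. SUM g:G. SUM h:G. (if act g y = x then cnj (ch g) else 0) * (if act h z = y then cnj (psi h) else 0))"
  by (simp add: kr_def sum_product)
 also have "... = (SUM g:G. SUM h:G. SUM y:Om. (if act g y = x then cnj (ch g) else 0) * (if act h z = y then cnj (psi h) else 0))"
  by (subst sum.swap) (intro sum.cong refl sum.swap)
 also have "... = (SUM g:G. SUM h:G. if act (g ** h) z = x then cnj (ch g * psi h) else 0)"
 proof (intro sum.cong refl)
  fix g h assume *: "g : G" "h : G"
  have "(SUM y:Om. (if act g y = x then cnj (ch g) else 0) * (if act h z = y then cnj (psi h) else 0))
   = (SUM y:Om. if y = act h z then (if act g y = x then cnj (ch g) else 0) * cnj (psi h) else 0)"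
   by (intro sum.cong refl) auto
  also have "... = (if act (g ** h) z = x then cnj (ch g * psi h) else 0)"
   using * assms by (simp add: act_mul)
  finally show "(SUM y:Om. (if act g y = x then cnj (ch g) else 0) * (if act h z = y then cnj (psi h) else 0)) = ..." .
 qed
 also have "... = (SUM g:G. SUM k:G. if act k z = x then cnj (ch g * psi (iv g ** k)) else 0)"
 proof (rule sumc)
  fix g assume g: "g : G"
  have "(SUM h:G. if act (g ** h) z = x then cnj (ch g * psi h) else 0)
   = (SUM h:G. if act (g ** (iv g ** h)) z = x then cnj (ch g * psi (iv g ** h)) else 0)"
   by (rule sum_left[OF iv_in[OF g], of "%h. if act (g ** h) z = x then cnj (ch g * psi h) else 0", symmetric])
  then show "(SUM h:G. if act (g ** h) z = x then cnj (ch g * psi h) else 0)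
   = (SUM k:G. if act k z = x then cnj (ch g * psi (iv g ** k)) else 0)" using g by (simp cong: sum.cong)
 qed
 also have "... = (SUM k:G. if act k z = x then cnj (SUM g:G. ch g * psi (iv g ** k)) else 0)"
  by (subst sum.swap) (intro sum.cong refl, simp)
 finally show ?thesis .
qed

lemma kr_idempotent:
 assumes s: "spherical ch" and "x : Om" "z : Om"
 shows "(SUM y:Om. kr ch x y * kr ch y z) = of_nat (card G) / ch e * kr ch x z"
proof -
 have "cnj (ch e) = ch e" using sphericalD(2)[OF s e_in] by simp
 then show ?thesis
  by (subst kr_convolution[OF assms(2,3)], unfold kr_def sum_distrib_left, intro sum.cong refl)
   (simp add: spherical_convolution[OF s] del: cnj_sum)
qed

lemma kr_convolution_0:
 assumes "ch : irr" "psi : irr" "ch ~= psi" "x : Om" "z : Om"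
 shows "(SUM y:Om. kr ch x y * kr psi y z) = 0"
 unfolding kr_convolution[OF assms(4,5)] by (intro sum.neutral ballI) (simp add: irr_convolution_0[OF assms(1-3)] del: cnj_sum)

text \<open>The kernel commutes with the action, so its trace twisted by h is the multiplicity of ch
  times ch h, up to the factor |G| / ch e. Multiplicities and character values are later read off
  from kernels in this way.\<close>

lemma kr_trace:
 assumes s: "spherical ch" and h: "h : G"
 shows "(SUM x:Om. kr ch x (act h x)) = (SUM g:G. fixc g * cnj (ch g)) * ch h / ch e"
proof -
 have "(SUM x:Om. kr ch x (act h x)) = (SUM g:G. SUM x:Om. if act (g ** h) x = x then cnj (ch g) else 0)"
  unfolding kr_def using h by (subst sum.swap) (intro sum.cong refl, simp add: act_mul)
 also have "... = (SUM g:G. fixc (g ** h) * cnj (ch g))"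
  by (simp add: fixc_sum sum_distrib_right if_distrib[of "%x. x * _"] cong: if_cong)
 also have "... = (SUM g:G. fixc (g ** iv h ** h) * cnj (ch (g ** iv h)))"
  by (rule sum_right[OF iv_in[OF h], of "%g. fixc (g ** h) * cnj (ch g)", symmetric])
 also have "... = (SUM g:G. fixc (iv g) * cnj (ch (iv g ** iv h)))"
  using h by (simp add: sum_iv[of "%g. fixc g * cnj (ch (g ** iv h))"] cong: sum.cong)
 also have "... = cnj (SUM g:G. fixc g * ch (iv g ** iv h))"
  by (simp add: fixc_iv cong: sum.cong) (simp add: fixc_def)
 also have "(SUM g:G. fixc g * ch (iv g ** iv h)) = (SUM g:G. fixc g * ch (iv g)) * ch (iv h) / ch e"
  using class_convolution[where f=fixc, OF s fixc_conj iv_in[OF h]] sphericalD(1)[OF s] by (simp add: field_simps)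
 also have "(SUM g:G. fixc g * ch (iv g)) = (SUM g:G. fixc g * ch g)"
  using sum_iv[of "%g. fixc g * ch g"] by (simp add: fixc_iv cong: sum.cong)
 also have "cnj ((SUM g:G. fixc g * ch g) * ch (iv h) / ch e) = (SUM g:G. fixc g * cnj (ch g)) * ch h / ch e"
  using sphericalD(2)[OF s h] sphericalD(2)[OF s e_in] by (simp add: fixc_def)
 finally show ?thesis .
qed

text \<open>The kernel is Hermitian and idempotent up to a scalar, so the sum of its squared
  absolute values is a multiple of its trace, and thus of the multiplicity.\<close>

lemma kr_eq_0:
 assumes s: "spherical ch" and 0: "(SUM g:G. fixc g * cnj (ch g)) = 0" and "x : Om" "y : Om"
 shows "kr ch x y = 0"
proof -
 define N where "N = (SUM x:Om. SUM y:Om. (cmod (kr ch x y))\<^sup>2)"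
 have "complex_of_real N = (SUM x:Om. SUM y:Om. kr ch x y * kr ch y x)"
  unfolding N_def of_real_sum complex_norm_square
 proof (intro sum.cong refl)
  fix x y assume "x : Om" "y : Om"
  then show "kr ch x y * cnj (kr ch x y) = kr ch x y * kr ch y x" by (simp only: kr_hermitian[OF s, of x y])
 qed
 also have "... = (SUM x:Om. of_nat (card G) / ch e * kr ch x (act e x))"
  by (intro sum.cong refl) (simp add: kr_idempotent[OF s])
 also have "... = of_nat (card G) / ch e * (SUM x:Om. kr ch x (act e x))"
  by (simp add: sum_distrib_left)
 also have "... = 0" by (simp only: kr_trace[OF s e_in] 0) simp
 finally have "N = 0" by simp
 then have "(SUM y:Om. (cmod (kr ch x y))\<^sup>2) = 0"
  unfolding N_def using assms(3) by (subst (asm) sum_nonneg_eq_0_iff) (auto intro!: sum_nonneg)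
 then show ?thesis using assms(4) by (subst (asm) sum_nonneg_eq_0_iff) auto
qed

end

section \<open>The regular character and completeness\<close>

context finite_group_on
begin

lemma regular_character: "(%g. if g = e then of_nat (card G) else 0) : vchar"
proof -
 interpret A: group_action_on G mul e iv G mul
  by unfold_locales (auto simp: assoc)
 have "{x\<in>G. g ** x = x} = (if g = e then G else {})" if "g : G" for g
 proof -
  have "g = e" if "x : G" "g ** x = x" for x
   using iv_cancel(3)[of x g] that \<open>g : G\<close> by simp
  then have "g ~= e ==> {x\<in>G. g ** x = x} = {}" by blast
  moreover have "{x\<in>G. e ** x = x} = G" using e_left by blast
  ultimately show ?thesis by (cases "g = e") simp_all
 qed
 then have "(if g : G then A.fixc g else 0) = (if g = e then of_nat (card G) else 0)" for g
  by (auto simp: A.fixc_def)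
 then show ?thesis using A.perm_vchar by simp
qed

lemma ip_regular: "th : irr ==> ip (%g. if g = e then of_nat (card G) else 0) th = th e"
 using irr_degree[of th] card_pos by (auto simp: ip_def if_distrib[of "%x. x * _"] sum.delta cong: if_cong)

text \<open>Every irreducible character occurs in the regular one, with multiplicity its degree,
  hence in one fixed list.\<close>

lemma finite_irr [simp]: "finite irr"
proof -
 obtain cs where cs: "set cs \<subseteq> irr" "(%g. if g = e then of_nat (card G) else 0) = (%g. \<Sum>c\<leftarrow>cs. c g)"
  using regular_character by (auto simp: vchar_def)
 have "irr \<subseteq> set cs"
 proof
  fix th assume th: "th : irr"
  have "of_nat (count_list cs th) = th e" using ip_regular[OF th] ip_count[OF cs(1) th] cs(2) by simp
  then have "count_list cs th ~= 0" using irr_degree[OF th] by auto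
  then show "th : set cs" by (meson count_notin)
 qed
 then show ?thesis using finite_subset by blast
qed

lemma vchar_expand:
 assumes "f : vchar"
 shows "f g = (SUM th:irr. ip f th * th g)"
proof -
 obtain cs where cs: "set cs \<subseteq> irr" "f = (%g. \<Sum>c\<leftarrow>cs. c g)" using assms by (auto simp: vchar_def)
 have "(\<Sum>c\<leftarrow>cs. c g) = (SUM th:irr. of_nat (count_list cs th) * th g)" using cs(1)
 proof (induction cs)
  case (Cons c cs)
  have "(SUM th:irr. of_nat (count_list (c # cs) th) * th g)
   = (SUM th:irr. of_nat (count_list cs th) * th g + (if th = c then th g else 0))"
   by (intro sum.cong refl) (auto simp: distrib_right)
  also have "... = (SUM th:irr. of_nat (count_list cs th) * th g) + c g"
   using Cons.prems by (simp add: sum.distrib)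
  finally show ?case using Cons by simp
 qed simp
 then show ?thesis using ip_count[OF cs(1)] cs(2) by simp
qed

lemma irr_completeness: "(SUM th:irr. th e * th g) = (if g = e then of_nat (card G) else 0)"
 using vchar_expand[OF regular_character, of g] by (simp add: ip_regular)

end

subsection \<open>Linear algebra over a finite field\<close>

abbreviation q_of :: "'a itself => nat" where
 "q_of _ \<equiv> CARD('a)"

lemma card_UNIV_field: "card (UNIV :: 'a::{finite,field} set) >= 2"
proof -
 have "card {0::'a, 1} <= CARD('a)" by (intro card_mono) auto
 then show ?thesis by simp
qed

lemma card_columns_in:
 assumes "W \<subseteq> Vec n" "finite (W :: 'a vec set)"
 shows "finite {M : Mat n k. \<forall>i<k. col M i : W}"
  and "card {M : Mat n k. \<forall>i<k. col M i : W} = card W ^ k"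
proof -
 have b: "bij_betw (%f. mat n k (%(a,b). f b $ a)) (PiE {..<k} (%_. W)) {M : Mat n k. \<forall>i<k. col M i : W}"
 proof (rule bij_betw_byWitness[where f' = "%M. restrict (col M) {..<k}"])
  have c: "col (mat n k (%(a,b). f b $ a)) i = f i" if "f : PiE {..<k} (%_. W)" "i < k" for f i
   using that assms(1) by (intro eq_vecI) (auto simp: PiE_iff)
  show "ALL f:PiE {..<k} (%_. W). restrict (col (mat n k (%(a,b). f b $ a))) {..<k} = f"
  proof (intro ballI ext)
   fix f i assume f: "f : PiE {..<k} (%_. W)"
   show "restrict (col (mat n k (%(a,b). f b $ a))) {..<k} i = f i"
    using c[OF f] f by (cases "i < k") (auto simp: PiE_iff extensional_def)
  qed
  show "ALL M:{M : Mat n k. \<forall>i<k. col M i : W}. mat n k (%(a,b). restrict (col M) {..<k} b $ a) = M"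
   by (auto intro!: eq_matI)
  show "(%f. mat n k (%(a,b). f b $ a)) ` PiE {..<k} (%_. W) \<subseteq> {M : Mat n k. \<forall>i<k. col M i : W}"
   using c by (auto simp: PiE_iff)
  show "(%M. restrict (col M) {..<k}) ` {M : Mat n k. \<forall>i<k. col M i : W} \<subseteq> PiE {..<k} (%_. W)"
   by auto
 qed
 show "finite {M : Mat n k. \<forall>i<k. col M i : W}"
  using bij_betw_finite[OF b] assms(2) by (simp add: finite_PiE)
 show "card {M : Mat n k. \<forall>i<k. col M i : W} = card W ^ k"
  using bij_betw_same_card[OF b] by (simp add: card_PiE)
qed

lemma finite_carrier_vec' [simp]: "finite (Vec n :: 'a::finite vec set)"
 and card_carrier_vec': "card (Vec n :: 'a::finite vec set) = CARD('a) ^ n"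
proof -
 have b: "bij_betw (%f. vec n f) (PiE {..<n} (%_. UNIV :: 'a set)) (Vec n)"
 proof (rule bij_betw_byWitness[where f' = "%v. restrict (%i. v $ i) {..<n}"])
  show "ALL f:PiE {..<n} (%_. UNIV :: 'a set). restrict (%i. vec n f $ i) {..<n} = f"
  proof (intro ballI ext)
   fix f :: "nat => 'a" and i assume f: "f : PiE {..<n} (%_. UNIV :: 'a set)"
   show "restrict (%i. vec n f $ i) {..<n} i = f i"
    by (cases "i < n") (use f PiE_arb[OF f, of i] in auto)
  qed
  show "ALL v:Vec n. vec n (restrict (%i. (v :: 'a vec) $ i) {..<n}) = v"
   by (auto intro!: eq_vecI)
 qed (simp_all add: image_subset_iff PiE_iff)
 show "finite (Vec n :: 'a::finite vec set)"
  using bij_betw_finite[OF b] by (simp add: finite_PiE)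
 show "card (Vec n :: 'a::finite vec set) = CARD('a) ^ n"
  using bij_betw_same_card[OF b] by (simp add: card_PiE)
qed

lemma finite_carrier_mat [simp]: "finite (Mat n k :: 'a::finite mat set)"
 and card_carrier_mat: "card (Mat n k :: 'a::finite mat set) = CARD('a) ^ (n * k)"
proof -
 have "{M : Mat n k. \<forall>i<k. col M i : Vec n} = (Mat n k :: 'a mat set)" by auto
 then show "finite (Mat n k :: 'a::finite mat set)" "card (Mat n k :: 'a::finite mat set) = CARD('a) ^ (n * k)"
  using card_columns_in[of "Vec n :: 'a vec set" n k] by (simp_all add: card_carrier_vec' power_mult)
qed

definition subsp :: "nat => 'a::field vec set => bool" where
 "subsp n W <-> W \<subseteq> Vec n & zv n : W & (ALL x:W. ALL y:W. x + y : W) & (ALL c. ALL x:W. c *s x : W)"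

lemma mult_mat_vec_index: "A : Mat m n ==> v : Vec n ==> i < m ==> (A *v v) $ i = (\<Sum>k<n. A $$ (i,k) * v $ k)"
 by (auto simp: scalar_prod_def atLeast0LessThan intro!: sum.cong)

lemma mult_mat_index: "A : Mat m n ==> B : Mat n k ==> i < m ==> l < k ==> (A * B) $$ (i,l) = (\<Sum>x<n. A $$ (i,x) * B $$ (x,l))"
 by (auto simp: scalar_prod_def atLeast0LessThan intro!: sum.cong)

lemma mat_vec_cancel:
 fixes L :: "'a::field mat"
 assumes "L : Mat r m" "A : Mat m r" "L * A = idm r" "x : Vec r"
 shows "L *v (A *v x) = x"
 using assoc_mult_mat_vec[OF assms(1,2,4)] one_mult_mat_vec[OF assms(4)] assms(3) by simp

lemma vec_eq_if_diff_0:
 fixes x :: "'a::field vec"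
 assumes "x : Vec n" "y : Vec n" "x - y = zv n"
 shows "x = y"
proof (rule eq_vecI)
 fix i assume i: "i < dim_vec y"
 have "x $ i - y $ i = (x - y) $ i" using i by simp
 also have "... = 0" using i assms(2) unfolding assms(3) by simp
 finally show "x $ i = y $ i" by simp
qed (use assms in simp)

lemma subsp_sum:
 fixes W :: "'a::field vec set"
 assumes "subsp n W" "finite V" "V \<subseteq> W"
 shows "vec n (%k. SUM w:V. c w * w $ k) : W"
 using assms(2,3)
proof (induction V)
 case empty
 have "vec n (%k. 0) = (zv n :: 'a vec)" by (intro eq_vecI) auto
 then show ?case using assms(1) by (simp add: subsp_def)
next
 case (insert v V)
 have v: "v : Vec n" using insert assms(1) by (auto simp: subsp_def)
 have "vec n (%k. SUM w:insert v V. c w * w $ k) = c v *s v + vec n (%k. SUM w:V. c w * w $ k)"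
  using insert v by (intro eq_vecI) auto
 then show ?case using insert assms(1) by (simp add: subsp_def)
qed

lemma mat_rank_factorization:
 fixes A :: "'a::field mat"
 assumes A: "A : Mat m n"
 shows "EX r A1 A2 L R. r <= m & A1 : Mat m r & A2 : Mat r n & A = A1 * A2 &
  L : Mat r m & L * A1 = idm r & R : Mat n r & A2 * R = idm r"
proof -
 obtain r P Q P' Q' where r: "r <= card {..<m}" and f: "eq_on {..<m} {..<n} (%i k. A $$ (i,k)) (mmul {..<(r::nat)} P Q)"
  and a: "eq_on {..<r} {..<r} (mmul {..<m} P' P) kdelta" and b: "eq_on {..<r} {..<r} (mmul {..<n} Q Q') kdelta"
  using rank_factorization[of "{..<m}" "{..<n}" "%i k. A $$ (i,k)"] by blast
 define A1 where "A1 = mat m r (%(i,k). P i k)"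
 define A2 where "A2 = mat r n (%(i,k). Q i k)"
 define L where "L = mat r m (%(i,k). P' i k)"
 define R where "R = mat n r (%(i,k). Q' i k)"
 have c: "A1 : Mat m r" "A2 : Mat r n" "L : Mat r m" "R : Mat n r"
  by (auto simp: A1_def A2_def L_def R_def)
 have "A = A1 * A2"
 proof (rule eq_matI)
  fix i j assume "i < dim_row (A1 * A2)" "j < dim_col (A1 * A2)"
  then have ij: "i < m" "j < n" using c by auto
  have "(A1 * A2) $$ (i,j) = (\<Sum>x<r. P i x * Q x j)" unfolding mult_mat_index[OF c(1,2) ij] using ij
   by (intro sum.cong refl) (simp add: A1_def A2_def)
  then show "A $$ (i,j) = (A1 * A2) $$ (i,j)" using f ij by (simp add: eq_on_def mmul_def)
 qed (use A c in auto)
 moreover have "L * A1 = idm r"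
 proof (rule eq_matI)
  fix i j assume "i < dim_row (idm r)" "j < dim_col (idm r :: 'a mat)"
  then have ij: "i < r" "j < r" by auto
  have "(L * A1) $$ (i,j) = (\<Sum>x<m. P' i x * P x j)" unfolding mult_mat_index[OF c(3,1) ij] using ij
   by (intro sum.cong refl) (simp add: A1_def L_def)
  then show "(L * A1) $$ (i,j) = idm r $$ (i,j)" using a ij by (simp add: eq_on_def mmul_def kdelta_def)
 qed (use c in auto)
 moreover have "A2 * R = idm r"
 proof (rule eq_matI)
  fix i j assume "i < dim_row (idm r)" "j < dim_col (idm r :: 'a mat)"
  then have ij: "i < r" "j < r" by auto
  have "(A2 * R) $$ (i,j) = (\<Sum>x<n. Q i x * Q' x j)" unfolding mult_mat_index[OF c(2,4) ij] using ij
   by (intro sum.cong refl) (simp add: A2_def R_def)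
  then show "(A2 * R) $$ (i,j) = idm r $$ (i,j)" using b ij by (simp add: eq_on_def mmul_def kdelta_def)
 qed (use c in auto)
 ultimately show ?thesis using c r
  by (intro exI[of _ r] exI[of _ A1] exI[of _ A2] exI[of _ L] exI[of _ R]) simp
qed

text \<open>Factor the matrix whose rows are all vectors of W. The rows of B are independent by B',
  and they lie in W because A' expresses them through vectors of W.\<close>

lemma subsp_basis:
 fixes W :: "'a::{finite,field} vec set"
 assumes W: "subsp n W"
 shows "EX r C C'. C : Mat n r & C' : Mat r n & C' * C = idm r & W = {C *v c | c. c : Vec r} & card W = CARD('a) ^ r"
proof -
 have Wc: "W \<subseteq> Vec n" using W by (simp add: subsp_def)
 have fW: "finite W" by (rule finite_subset[OF Wc]) simp
 obtain r A B A' B' where f: "eq_on W {..<n} (%w k. w $ k) (mmul {..<(r::nat)} A B)"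
  and a: "eq_on {..<r} {..<r} (mmul W A' A) kdelta" and b: "eq_on {..<r} {..<r} (mmul {..<n} B B') kdelta"
  using rank_factorization[OF fW, of "{..<n}" "%w k. w $ k"] by blast
 define C where "C = mat n r (%(k,l). B l k)"
 define C' where "C' = mat r n (%(l,k). B' k l)"
 have c: "C : Mat n r" "C' : Mat r n" by (auto simp: C_def C'_def)
 have CC: "C' * C = idm r"
 proof (rule eq_matI)
  fix i j assume "i < dim_row (idm r)" "j < dim_col (idm r :: 'a mat)"
  then have ij: "i < r" "j < r" by auto
  have "(C' * C) $$ (i,j) = (\<Sum>x<n. B j x * B' x i)" unfolding mult_mat_index[OF c(2,1) ij] using ij
   by (intro sum.cong refl) (simp add: C_def C'_def mult.commute)
  then show "(C' * C) $$ (i,j) = idm r $$ (i,j)" using b ij by (auto simp: eq_on_def mmul_def kdelta_def)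
 qed (use c in auto)
 have sub1: "w : {C *v c | c. c : Vec r}" if w: "w : W" for w
 proof -
  have "w = C *v vec r (A w)"
  proof (rule eq_vecI)
   fix k assume "k < dim_vec (C *v vec r (A w))"
   then have k: "k < n" using c by simp
   have "(C *v vec r (A w)) $ k = (\<Sum>l<r. A w l * B l k)" unfolding mult_mat_vec_index[OF c(1) vec_carrier k]
    using k by (intro sum.cong refl) (simp add: C_def mult.commute)
   then show "w $ k = (C *v vec r (A w)) $ k" using f w k by (simp add: eq_on_def mmul_def)
  qed (use w Wc c in auto)
  then show ?thesis by auto
 qed
 have sub2: "C *v x : W" if x: "x : Vec r" for x
 proof -
  have Bl: "B l k = (SUM w:W. A' l w * w $ k)" if lk: "l < r" "k < n" for l k
  proof -
   have "B l k = mmul {..<r} kdelta B l k" by (rule eq_onD[OF mmul_kdelta_left, symmetric]) (use lk in auto)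
   also have "... = mmul {..<r} (mmul W A' A) B l k"
    by (rule eq_onD[OF mmul_cong[OF eq_on_sym[OF a] eq_on_refl], where K = UNIV]) (use lk in auto)
   also have "... = mmul W A' (mmul {..<r} A B) l k" by (simp add: mmul_assoc)
   also have "... = mmul W A' (%w k. w $ k) l k"
    by (rule eq_onD[OF mmul_cong[OF eq_on_refl eq_on_sym[OF f]], where I = UNIV]) (use lk in auto)
   finally show ?thesis by (simp add: mmul_def)
  qed
  have "C *v x = vec n (%k. SUM w:W. (\<Sum>l<r. x $ l * A' l w) * w $ k)"
  proof (rule eq_vecI)
   fix k assume "k < dim_vec (vec n (%k. SUM w:W. (\<Sum>l<r. x $ l * A' l w) * w $ k))"
   then have k: "k < n" by simp
   have "(C *v x) $ k = (\<Sum>l<r. x $ l * (SUM w:W. A' l w * w $ k))" unfolding mult_mat_vec_index[OF c(1) x k]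
    using k by (intro sum.cong refl) (simp add: C_def Bl)
   also have "... = (SUM w:W. (\<Sum>l<r. x $ l * A' l w) * w $ k)"
    by (simp add: sum_distrib_left sum_distrib_right mult.assoc) (rule sum.swap)
   finally show "(C *v x) $ k = vec n (%k. SUM w:W. (\<Sum>l<r. x $ l * A' l w) * w $ k) $ k" using k by simp
  qed (use c in auto)
  then show ?thesis using subsp_sum[OF W fW order_refl] by simp
 qed
 have We: "W = {C *v c | c. c : Vec r}" using sub1 sub2 by auto
 have inj: "inj_on (%x. C *v x) (Vec r)"
 proof (rule inj_onI)
  fix x y assume xy: "x : Vec r" "y : Vec r" "C *v x = C *v y"
  then have "C' *v (C *v x) = C' *v (C *v y)" by simp
  then show "x = y" using xy mat_vec_cancel[OF c(2,1) CC] by metis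
 qed
 have "W = (%x. C *v x) ` Vec r" using We by auto
 then have "card W = card (Vec r :: 'a vec set)" using card_image[OF inj] by simp
 then show ?thesis using c CC We card_carrier_vec' by (metis (no_types, lifting))
qed

text \<open>1 - C C' is a projection with kernel W, so one of its rows is nonzero at a.\<close>

lemma separating_functional:
 fixes W :: "'a::{finite,field} vec set"
 assumes W: "subsp n W" and a: "a : Vec n" "a \<notin> W"
 shows "EX l:Vec n. (ALL w:W. l *. w = 0) & l *. a ~= 0"
proof -
 obtain r C C' where c: "C : Mat n r" "C' : Mat r n" "C' * C = idm r"
  and We: "W = {C *v c | c. c : Vec r}" using subsp_basis[OF W] by blast
 define Q where "Q = idm n - C * C'"
 have Qc: "Q : Mat n n" using c by (simp add: Q_def minus_carrier_mat)
 have Qx: "Q *v x = x - C *v (C' *v x)" if "x : Vec n" for x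
  using that c by (simp add: Q_def minus_mult_distrib_mat_vec[of _ n n])
 have QW: "Q *v w = zv n" if w: "w : W" for w
 proof -
  obtain x where x: "x : Vec r" "w = C *v x" using w We by auto
  have "C' *v w = x" using x mat_vec_cancel[OF c(2,1,3)] by simp
  moreover have "w : Vec n" using x c by auto
  ultimately show ?thesis using Qx x by simp
 qed
 have "Q *v a ~= zv n"
 proof
  assume 0: "Q *v a = zv n"
  have CCa: "C *v (C' *v a) : Vec n" using c a by auto
  have "a = C *v (C' *v a)"
   by (rule vec_eq_if_diff_0[OF a(1) CCa]) (use 0 Qx[OF a(1)] in simp)
  moreover have "C' *v a : Vec r" using c a by auto
  ultimately have "a : W" using We by blast
  with a show False by simp
 qed
 then obtain i where i: "i < n" "(Q *v a) $ i ~= 0" using Qc a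
 proof -
  have "\<not> (\<forall>i<n. (Q *v a) $ i = 0)"
  proof
   assume "\<forall>i<n. (Q *v a) $ i = 0"
   then have "Q *v a = zv n" using Qc by (intro eq_vecI) auto
   with \<open>Q *v a ~= zv n\<close> show False by simp
  qed
  then show ?thesis using that by blast
 qed
 have r: "row Q i *. w = (Q *v w) $ i" for w using i Qc by simp
 have "ALL w:W. row Q i *. w = 0" using r QW i(1) by simp
 moreover have "row Q i *. a ~= 0" using r i(2) by simp
 moreover have "row Q i : Vec n" using Qc by (simp add: row_def carrier_matD)
 ultimately show ?thesis by blast
qed

lemma card_fibers:
 assumes "finite A" "!!b. b : f ` A ==> card {a\<in>A. f a = b} = c"
 shows "card A = c * card (f ` A)"
proof -
 have "card A = (SUM b:f ` A. card {a\<in>A. f a = b})"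
  using sum.image_gen[OF assms(1), of "%_. 1::nat" f] by simp
 then show ?thesis using assms(2) by simp
qed

lemma subsp_kernel: "A : Mat m n ==> subsp n {x : Vec n. A *v x = zv m}"
 by (auto simp: subsp_def mult_add_distrib_mat_vec mult_mat_vec[where nr=m and nc=n])

lemma card_fiber_mat:
 fixes A :: "'a::{finite,field} mat"
 assumes A: "A : Mat m n" and V: "subsp n V" and b: "b : (%x. A *v x) ` V"
 shows "card {x\<in>V. A *v x = b} = card {x\<in>V. A *v x = zv m}"
proof -
 have Vc: "V \<subseteq> Vec n" using V by (simp add: subsp_def)
 obtain x0 where x0: "x0 : V" "b = A *v x0" using b by auto
 have x0c: "x0 : Vec n" using x0 Vc by auto
 have neg: "- x : V" if "x : V" for x
 proof -
  have "- x = (-1) *s x" by (intro eq_vecI) auto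
  then show ?thesis using V that by (simp add: subsp_def)
 qed
 have "bij_betw (%x. x + x0) {x\<in>V. A *v x = zv m} {x\<in>V. A *v x = b}"
 proof (rule bij_betw_byWitness[where f' = "%x. x + (- x0)"])
  show "ALL x:{x\<in>V. A *v x = zv m}. x + x0 + - x0 = x" using Vc x0c by (auto intro!: eq_vecI)
  show "ALL x:{x\<in>V. A *v x = b}. x + - x0 + x0 = x" using Vc x0c by (auto intro!: eq_vecI)
  show "(%x. x + x0) ` {x\<in>V. A *v x = zv m} \<subseteq> {x\<in>V. A *v x = b}"
  proof
   fix y assume "y : (%x. x + x0) ` {x\<in>V. A *v x = zv m}"
   then obtain x where x: "x : V" "A *v x = zv m" "y = x + x0" by auto
   have "A *v y = zv m + A *v x0" using x x0c Vc mult_add_distrib_mat_vec[OF A _ x0c, of x] by auto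
   then show "y : {x\<in>V. A *v x = b}" using x x0 V A by (auto simp: subsp_def)
  qed
  show "(%x. x + - x0) ` {x\<in>V. A *v x = b} \<subseteq> {x\<in>V. A *v x = zv m}"
  proof
   fix y assume "y : (%x. x + - x0) ` {x\<in>V. A *v x = b}"
   then obtain x where x: "x : V" "A *v x = b" "y = x + - x0" by auto
   have "y = x - x0" using x Vc x0c by (auto intro!: eq_vecI)
   then have "A *v y = A *v x - A *v x0" using x x0c Vc mult_minus_distrib_mat_vec[OF A _ x0c, of x] by auto
   then have "A *v y = zv m" using x x0 A by auto
   then show "y : {x\<in>V. A *v x = zv m}" using x x0 V neg by (auto simp: subsp_def)
  qed
 qed
 from bij_betw_same_card[OF this] show ?thesis by simp
qed

lemma card_image_kernel:
 fixes A :: "'a::{finite,field} mat"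
 assumes A: "A : Mat m n" and V: "subsp n V"
 shows "card V = card {x\<in>V. A *v x = zv m} * card ((%x. A *v x) ` V)"
proof (rule card_fibers)
 show "finite V" by (rule finite_subset[of _ "Vec n"]) (use V in \<open>auto simp: subsp_def\<close>)
qed (rule card_fiber_mat[OF A V])

lemma subsp_carrier: "subsp n (Vec n)"
 by (auto simp: subsp_def)

lemma card_kernel_surj:
 fixes A :: "'a::{finite,field} mat"
 assumes A: "A : Mat r n" and R: "R : Mat n r" "A * R = idm r"
 shows "CARD('a) ^ n = card {x\<in>Vec n. A *v x = zv r} * CARD('a) ^ r"
proof -
 have "(%x. A *v x) ` Vec n = Vec r"
 proof
  show "Vec r \<subseteq> (%x. A *v x) ` Vec n"
  proof
   fix y :: "'a vec" assume y: "y : Vec r"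
   have "A *v (R *v y) = y" by (rule mat_vec_cancel[OF A R y])
   moreover have "R *v y : Vec n" using R y by auto
   ultimately show "y : (%x. A *v x) ` Vec n" by (metis imageI)
  qed
 qed (use A in auto)
 then show ?thesis using card_image_kernel[OF A subsp_carrier] by (simp add: card_carrier_vec')
qed

lemma kernel_left_cancel:
 fixes A1 :: "'a::field mat"
 assumes "A1 : Mat m r" "A2 : Mat r n" "L : Mat r m" "L * A1 = idm r"
 shows "{x\<in>Vec n. A1 * A2 *v x = zv m} = {x\<in>Vec n. A2 *v x = zv r}"
proof -
 have "A2 *v x = zv r" if x: "x : Vec n" "A1 * A2 *v x = zv m" for x
 proof -
  have "A2 *v x = L *v (A1 *v (A2 *v x))" by (rule mat_vec_cancel[OF assms(3,1,4), symmetric]) (use assms x in auto)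
  also have "A1 *v (A2 *v x) = zv m" using assoc_mult_mat_vec[OF assms(1,2) x(1)] x by simp
  also have "L *v zv m = zv r" using assms(3) by (intro eq_vecI) auto
  finally show ?thesis .
 qed
 moreover have "A1 * A2 *v x = zv m" if x: "x : Vec n" "A2 *v x = zv r" for x
 proof -
  have "A1 * A2 *v x = A1 *v zv r" using assms x by simp
  also have "... = zv m" using assms(1) by (intro eq_vecI) auto
  finally show ?thesis .
 qed
 ultimately show ?thesis by auto
qed

text \<open>With A = A1 A2 of rank r, the kernel of A is that of A2, and the kernel of the transpose
  is that of the transpose of A1. Both are kernels of surjections onto dimension r.\<close>

lemma card_kernel_transpose:
 fixes A :: "'a::{finite,field} mat"
 assumes A: "A : Mat n n"
 shows "card {x\<in>Vec n. trm A *v x = zv n} = card {x\<in>Vec n. A *v x = zv n}"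
proof -
 obtain r A1 A2 L R where f: "A1 : Mat n r" "A2 : Mat r n" "A = A1 * A2"
  "L : Mat r n" "L * A1 = idm r" "R : Mat n r" "A2 * R = idm r"
  using mat_rank_factorization[OF A] by blast
 have At: "trm A = trm A2 * trm A1" using f by (simp add: transpose_mult)
 have L1: "trm A1 * trm L = idm r" using transpose_mult[OF f(4,1)] f(5) by simp
 have R1: "trm R * trm A2 = idm r" using transpose_mult[OF f(2,6)] f(7) by simp
 have "card {x\<in>Vec n. trm A1 *v x = zv r} * CARD('a) ^ r
  = card {x\<in>Vec n. A2 *v x = zv r} * CARD('a) ^ r"
  using card_kernel_surj[OF f(2,6,7)] card_kernel_surj[of "trm A1" r n "trm L"] f L1 by simp
 then have "card {x\<in>Vec n. trm A1 *v x = zv r} = card {x\<in>Vec n. A2 *v x = zv r}"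
  using card_UNIV_field[where 'a='a] by simp
 then show ?thesis unfolding At
  using kernel_left_cancel[of "trm A2" n r "trm A1" n "trm R"] kernel_left_cancel[OF f(1,2,4,5)] f R1
  by simp
qed

text \<open>Turns \<open>kernel_dim\<close> into a number of vectors; from here on fixed points are
  counted.\<close>

lemma card_mat_kernel:
 fixes A :: "'a::{finite,field} mat"
 assumes A: "A : Mat m n"
 shows "card {x\<in>Vec n. A *v x = zv m} = CARD('a) ^ kernel_dim A"
proof -
 interpret K: kernel m n A by (unfold_locales) (rule A)
 obtain B where B: "finite B" "K.basis B" using kernel_basis_exists[OF A] by blast
 have d: "kernel_dim A = card B" using K.Ker.dim_basis[OF B] by simp
 have BK: "B \<subseteq> mat_kernel A" using B(2) by (simp add: K.Ker.basis_def)
 have bc: "!!v. v : mat_kernel A ==> \<exists>!a. a : B \<rightarrow>\<^sub>E UNIV & K.lincomb a B = v"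
  using K.Ker.basis_criterion[OF B(1) BK] B(2) by simp
 have cl: "K.lincomb a B : mat_kernel A" for a
  using K.Ker.lincomb_closed[OF BK, of a] by simp
 have "bij_betw (%a. K.lincomb a B) (B \<rightarrow>\<^sub>E UNIV) (mat_kernel A)"
  unfolding bij_betw_def
 proof
  show "inj_on (%a. K.lincomb a B) (B \<rightarrow>\<^sub>E UNIV)"
   by (rule inj_onI) (use bc cl in blast)
  show "(%a. K.lincomb a B) ` (B \<rightarrow>\<^sub>E UNIV) = mat_kernel A"
   using bc cl by blast
 qed
 from bij_betw_same_card[OF this] have "card (mat_kernel A) = card (B \<rightarrow>\<^sub>E (UNIV :: 'a set))" by simp
 then show ?thesis using B(1) d by (simp add: mat_kernel[OF A] card_PiE)
qed

lemma mat_eq_by_vec: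
 fixes A :: "'a::field mat"
 assumes A: "A : Mat n k" and B: "B : Mat n k" and eq: "!!x. x : Vec k ==> A *v x = B *v x"
 shows "A = B"
proof (rule eq_matI)
 fix i j assume "i < dim_row B" "j < dim_col B"
 then have ij: "i < n" "j < k" using B by auto
 have r: "(C *v unit_vec k j) $ i = C $$ (i,j)" if C: "C : Mat n k" for C :: "'a mat"
 proof -
  have "(C *v unit_vec k j) $ i = row C i *. unit_vec k j" using C ij by simp
  also have "... = row C i $ j" using C ij by (intro scalar_prod_right_unit) auto
  finally show ?thesis using C ij by simp
 qed
 show "A $$ (i,j) = B $$ (i,j)" using r[OF A] r[OF B] eq[of "unit_vec k j"] by simp
qed (use A B in auto)

section \<open>General linear groups and their action on vectors\<close>

lemma GLm_carrier: "g : GLm n ==> g : Mat n n"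
 by (simp add: GLm_def)

lemma SLm_carrier: "g : SLm n ==> g : Mat n n"
 by (simp add: SLm_def)

lemma SLm_GLm: "SLm n \<subseteq> GLm n"
 by (auto simp: SLm_def GLm_def)

lemma GLm_inverse:
 fixes g :: "'a::field mat"
 assumes g: "g : GLm n"
 shows "EX h:GLm n. h * g = idm n & g * h = idm n"
proof -
 have gc: "g : Mat n n" and d: "det g ~= 0" using g by (auto simp: GLm_def)
 from det_non_zero_imp_unit[OF gc d, of "()"] obtain h where
  h: "h : Mat n n" "h * g = idm n" "g * h = idm n"
  by (auto simp: Units_def ring_mat_def)
 have "det h * det g = 1" using det_mult[OF h(1) gc] h(2) by simp
 then have "h : GLm n" using h by (auto simp: GLm_def)
 then show ?thesis using h by blast
qed

lemma GLm_if_injective: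
 fixes g :: "'a::field mat"
 assumes g: "g : Mat n n" and inj: "!!v. v : Vec n ==> g *v v = zv n ==> v = zv n"
 shows "g : GLm n"
 using det_0_iff_vec_prod_zero[OF g] g inj by (auto simp: GLm_def)

definition minv :: "nat => 'a::field mat => 'a mat" where
 "minv n g = (SOME h. h : GLm n & h * g = idm n & g * h = idm n)"

lemma minv:
 assumes "g : GLm n"
 shows "minv n g : GLm n" "minv n g * g = idm n" "g * minv n g = idm n"
proof -
 have "EX h. h : GLm n & h * g = idm n & g * h = idm n" using GLm_inverse[OF assms] by blast
 from someI_ex[OF this] show "minv n g : GLm n" "minv n g * g = idm n" "g * minv n g = idm n"
  by (auto simp: minv_def)
qed

lemma minv_carrier: "g : GLm n ==> minv n g : Mat n n"
 using minv(1) GLm_carrier by blast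

lemma GLm_mult: "g : GLm n ==> h : GLm n ==> g * h : GLm n"
 by (auto simp: GLm_def det_mult)

lemma one_GLm: "idm n : GLm n"
 by (simp add: GLm_def)

lemma GLm_cancel_vec:
 assumes "g : GLm n" "x : Vec n"
 shows "minv n g *v (g *v x) = x" "g *v (minv n g *v x) = x"
 using mat_vec_cancel[OF minv_carrier[OF assms(1)] GLm_carrier[OF assms(1)] minv(2)[OF assms(1)] assms(2)]
  mat_vec_cancel[OF GLm_carrier[OF assms(1)] minv_carrier[OF assms(1)] minv(3)[OF assms(1)] assms(2)] by simp_all

lemma GLm_cancel_mat:
 assumes "g : GLm n" "M : Mat n k"
 shows "minv n g * (g * M) = M" "g * (minv n g * M) = M"
 using assms minv[OF assms(1)] GLm_carrier[OF assms(1)] minv_carrier[OF assms(1)]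
 by (simp_all flip: assoc_mult_mat[of _ n n _ n _ k])

lemma finite_GLm [simp]: "finite (GLm n :: 'a::{finite,field} mat set)"
 by (rule finite_subset[of _ "Mat n n"]) (auto simp: GLm_def)

lemma GL_group: "finite_group_on (GLm n :: 'a::{finite,field} mat set) (*) (idm n) (minv n)"
proof unfold_locales
 fix g h k :: "'a mat" assume "g : GLm n" "h : GLm n" "k : GLm n"
 then show "g * h * k = g * (h * k)" by (intro assoc_mult_mat) (auto dest: GLm_carrier)
qed (auto simp: GLm_mult one_GLm minv dest: GLm_carrier)

lemma minv_SLm: "g : SLm n ==> minv n g : SLm n"
proof -
 assume g: "g : SLm n"
 then have g': "g : GLm n" using SLm_GLm by blast
 have "det (minv n g) * det g = 1"
  using det_mult[OF minv_carrier[OF g'] GLm_carrier[OF g']] minv(2)[OF g'] by simp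
 then show ?thesis using g minv_carrier[OF g'] by (simp add: SLm_def)
qed

lemma SL_group: "finite_group_on (SLm n :: 'a::{finite,field} mat set) (*) (idm n) (minv n)"
proof unfold_locales
 show "finite (SLm n :: 'a mat set)" by (rule finite_subset[OF SLm_GLm]) simp
 fix g h k :: "'a mat" assume gh: "g : SLm n" "h : SLm n"
 show "g * h : SLm n" using gh by (auto simp: SLm_def det_mult)
 assume "k : SLm n"
 then show "g * h * k = g * (h * k)" using gh by (intro assoc_mult_mat) (auto dest: SLm_carrier)
next
 show "idm n : (SLm n :: 'a mat set)" by (simp add: SLm_def)
 fix g :: "'a mat" assume g: "g : SLm n"
 then have "g : GLm n" using SLm_GLm by blast
 then show "minv n g : SLm n" "minv n g * g = idm n" "g * minv n g = idm n" by (simp_all add: minv minv_SLm g)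
 show "idm n * g = g" "g * idm n = g" using SLm_carrier[OF g] by simp_all
qed

lemma vec_add_cancel:
 fixes a :: "'a::field vec"
 assumes "a : Vec n" "b : Vec n" "u : Vec n" "m : Vec n" "a + u = m + b"
 shows "a - b + u = m"
proof (rule eq_vecI)
 fix i assume "i < dim_vec m"
 then have i: "i < n" using assms by simp
 have "a $ i + u $ i = (a + u) $ i" using i assms(3) by simp
 also have "... = m $ i + b $ i" unfolding assms(5) using i assms(2) by simp
 finally show "(a - b + u) $ i = m $ i" using i assms by (simp add: algebra_simps)
qed (use assms in simp)

lemma vec_smult_add_assoc:
 fixes a :: "'a::field vec"
 assumes "a : Vec n" "p : Vec n" "u : Vec n"
 shows "p + c *s (a + u) = p + c *s a + c *s u"
 using assms by (intro eq_vecI) (auto simp: algebra_simps)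

lemma vec_add_smult_0:
 fixes a :: "'a::field vec"
 assumes "a : Vec n" "u : Vec n"
 shows "a + 0 *s u = a"
 using assms by (intro eq_vecI) auto

text \<open>For a functional l that kills W but neither a nor b, take g v = v + l(v) / l(a) (b - a).
  Then l(g v) = l(v) l(b) / l(a), which makes g injective.\<close>

lemma mover:
 fixes W :: "'a::{finite,field} vec set"
 assumes W: "subsp n W" and a: "a : Vec n" "a \<notin> W" and b: "b : Vec n" "b \<notin> W"
 shows "EX g:GLm n. (ALL w:W. g *v w = w) & g *v a = b"
proof -
 have Wc: "W \<subseteq> Vec n" using W by (simp add: subsp_def)
 obtain l1 where l1: "l1 : Vec n" "ALL w:W. l1 *. w = 0" "l1 *. a ~= 0"
  using separating_functional[OF W a] by blast
 obtain l2 where l2: "l2 : Vec n" "ALL w:W. l2 *. w = 0" "l2 *. b ~= 0"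
  using separating_functional[OF W b] by blast
 have "EX l:Vec n. (ALL w:W. l *. w = 0) & l *. a ~= 0 & l *. b ~= 0"
 \<comment> \<open>Either one of l1 and l2 is already nonzero at both points, or each vanishes at
   the other point and their sum works.\<close>
 proof (cases "l1 *. b = 0 & l2 *. a = 0")
  case True
  have "(l1 + l2) *. x = l1 *. x + l2 *. x" if "x : Vec n" for x
   using add_scalar_prod_distrib[OF l1(1) l2(1) that] .
  then show ?thesis using l1 l2 True a b Wc by (intro bexI[of _ "l1 + l2"]) (auto simp: subset_iff)
 next
  case False
  then show ?thesis using l1 l2 by blast
 qed
 then obtain l where l: "l : Vec n" "ALL w:W. l *. w = 0" "l *. a ~= 0" "l *. b ~= 0" by blast
 define T where "T = mat n n (%(i,k). (b $ i - a $ i) * l $ k / (l *. a))"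
 define g where "g = idm n + T"
 have Tc: "T : Mat n n" by (simp add: T_def)
 have gc: "g : Mat n n" using Tc by (simp add: g_def)
 have Tx: "T *v x = (l *. x / (l *. a)) *s (b - a)" if x: "x : Vec n" for x
 proof (rule eq_vecI)
  fix i assume "i < dim_vec ((l *. x / (l *. a)) *s (b - a))"
  then have i: "i < n" using a by simp
  have "(T *v x) $ i = (\<Sum>k<n. (b $ i - a $ i) * l $ k / (l *. a) * x $ k)"
   unfolding mult_mat_vec_index[OF Tc x i] using i by (intro sum.cong refl) (simp add: T_def)
  also have "... = (b $ i - a $ i) / (l *. a) * (\<Sum>k<n. l $ k * x $ k)"
   unfolding sum_distrib_left by (intro sum.cong refl) simp
  also have "(\<Sum>k<n. l $ k * x $ k) = l *. x" using x by (simp add: scalar_prod_def atLeast0LessThan)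
  finally show "(T *v x) $ i = ((l *. x / (l *. a)) *s (b - a)) $ i" using i a b by simp
 qed (use Tc a in auto)
 have gx: "g *v x = x + (l *. x / (l *. a)) *s (b - a)" if x: "x : Vec n" for x
  using add_mult_distrib_mat_vec[OF one_carrier_mat Tc x] Tx[OF x] x by (simp add: g_def)
 have "g *v a = b" using gx[OF a(1)] l a b by (intro eq_vecI) auto
 moreover have "g *v w = w" if "w : W" for w
 proof -
  have "w : Vec n" using that Wc by auto
  then show ?thesis using gx[of w] l(2) that a b by (intro eq_vecI) auto
 qed
 moreover have "g : GLm n"
 proof (rule GLm_if_injective[OF gc])
  fix v :: "'a vec" assume v: "v : Vec n" "g *v v = zv n"
  have "l *. (g *v v) = l *. v + l *. v / (l *. a) * (l *. b - l *. a)"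
   using v(1) l(1) a b by (simp add: gx scalar_prod_add_distrib[of _ n] scalar_prod_minus_distrib[of _ n])
  also have "... = l *. v * (l *. b) / (l *. a)" using l(3) by (simp add: field_simps)
  finally have "l *. v = 0" using v l by simp
  then have "g *v v = v" using gx[OF v(1)] v(1) a b by (intro eq_vecI) auto
  then show "v = zv n" using v by simp
 qed
 ultimately show ?thesis by blast
qed

section \<open>Injective matrices and cuspidal functions\<close>

definition injm :: "nat => 'a::field mat => bool" where
 "injm j M <-> (ALL v:Vec j. M *v v = zv (dim_row M) --> v = zv j)"

lemma injmD:
 assumes "injm j M" "M : Mat n j" "x : Vec j" "y : Vec j" "M *v x = M *v y"
 shows "x = y"
proof (rule vec_eq_if_diff_0[OF assms(3,4)])
 have "M *v (x - y) = M *v x - M *v y" by (rule mult_minus_distrib_mat_vec[OF assms(2-4)])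
 also have "... = zv n" using assms by simp
 finally show "x - y = zv j" using assms by (auto simp: injm_def)
qed

lemma injm_mult_left:
 assumes "g : GLm n" "M : Mat n j"
 shows "injm j (g * M) <-> injm j M"
proof -
 have gc: "g : Mat n n" by (rule GLm_carrier[OF assms(1)])
 have "(g * M) *v v = zv n <-> M *v v = zv n" if v: "v : Vec j" for v
 proof -
  have Mv: "M *v v : Vec n" using assms v by auto
  have 1: "(g * M) *v v = g *v (M *v v)" by (rule assoc_mult_mat_vec[OF gc assms(2) v])
  have z: "h *v zv n = zv n" if "h : Mat n n" for h :: "'a mat" using that by (intro eq_vecI) auto
  have "M *v v = minv n g *v (g *v (M *v v))" using GLm_cancel_vec[OF assms(1) Mv] by simp
  then show ?thesis using 1 z[OF gc] z[OF minv_carrier[OF assms(1)]] by auto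
 qed
 then show ?thesis using assms gc by (auto simp: injm_def)
qed

text \<open>One unit vector at a time: once g is correct on \<open>supp k\<close>, the span of the
  first k unit vectors, \<open>mover\<close> corrects the image of the next one and fixes the image
  of that span.\<close>

lemma GL_transitive:
 fixes M N :: "'a::{finite,field} mat"
 assumes M: "M : Mat n j" "injm j M" and N: "N : Mat n j" "injm j N"
 shows "EX g:GLm n. g * M = N"
proof -
 define supp where "supp k = {x :: 'a vec. x : Vec j & (ALL i. k <= i --> i < j --> x $ i = 0)}" for k
 have scD: "x : Vec j" if "x : supp k" for x k using that by (simp add: supp_def)
 then have sc: "supp k \<subseteq> Vec j" for k by blast
 have Mx: "A *v x : Vec n" if "x : Vec j" "A : Mat n j" for x and A :: "'a mat" using that by auto
 have "k <= j ==> EX g:GLm n. ALL x:supp k. g *v (M *v x) = N *v x" for k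
 proof (induction k)
  case 0
  have "x = zv j" if "x : supp 0" for x using that by (intro eq_vecI) (auto simp: supp_def)
  moreover have "A *v zv j = zv n" if "A : Mat n j" for A :: "'a mat" using that by (intro eq_vecI) auto
  ultimately show ?case using M N by (intro bexI[of _ "idm n"]) (auto simp: one_GLm)
 next
  case (Suc k)
  then obtain g where g: "g : GLm n" "ALL x:supp k. g *v (M *v x) = N *v x" by auto
  have gc: "g : Mat n n" by (rule GLm_carrier[OF g(1)])
  define e where "e = (unit_vec j k :: 'a vec)"
  have e: "e : Vec j" by (simp add: e_def)
  have ns: "e \<notin> supp k" using Suc.prems by (auto simp: e_def supp_def)
  define W where "W = (%x. N *v x) ` supp k"
  have W: "subsp n W"
   unfolding subsp_def
  proof (intro conjI ballI allI)
   show "W \<subseteq> Vec n" using Mx[OF _ N(1)] sc by (auto simp: W_def)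
   have "N *v zv j = zv n" using N(1) by (intro eq_vecI) auto
   moreover have "zv j : supp k" by (auto simp: supp_def)
   ultimately show "zv n : W" unfolding W_def by (metis imageI)
   fix x assume "x : W"
   then obtain x' where x': "x' : supp k" "x = N *v x'" by (auto simp: W_def)
   show "c *s x : W" for c
   proof -
    have "c *s x' : supp k" using x' by (auto simp: supp_def)
    moreover have "c *s x = N *v (c *s x')" using x' mult_mat_vec[OF N(1) scD[OF x'(1)], of c] by simp
    ultimately show ?thesis by (auto simp: W_def)
   qed
   fix y assume "y : W"
   then obtain y' where y': "y' : supp k" "y = N *v y'" by (auto simp: W_def)
   have "x' + y' : supp k" using x' y' by (auto simp: supp_def)
   moreover have "x + y = N *v (x' + y')" using x' y' mult_add_distrib_mat_vec[OF N(1) scD[OF x'(1)] scD[OF y'(1)]] by simp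
   ultimately show "x + y : W" by (auto simp: W_def)
  qed
  have Me: "M *v e : Vec n" and Ne: "N *v e : Vec n" using Mx e M N by auto
  have a: "g *v (M *v e) : Vec n" using gc Me by auto
  have aW: "g *v (M *v e) \<notin> W"
  proof
   assume "g *v (M *v e) : W"
   then obtain x where x: "x : supp k" "g *v (M *v e) = N *v x" by (auto simp: W_def)
   then have "g *v (M *v e) = g *v (M *v x)" using g(2) by simp
   then have "M *v e = M *v x" using GLm_cancel_vec(1)[OF g(1) Me] GLm_cancel_vec(1)[OF g(1) Mx[OF _ M(1)], of x] x sc by auto
   then have "e = x" using injmD[OF M(2,1) e] x sc by blast
   then show False using ns x by simp
  qed
  have bW: "N *v e \<notin> W"
  proof
   assume "N *v e : W"
   then obtain x where x: "x : supp k" "N *v e = N *v x" by (auto simp: W_def)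
   then have "e = x" using injmD[OF N(2,1) e] sc by blast
   then show False using ns x by simp
  qed
  obtain h where h: "h : GLm n" "ALL w:W. h *v w = w" "h *v (g *v (M *v e)) = N *v e"
   using mover[OF W a aW Ne bW] by blast
  have hc: "h : Mat n n" by (rule GLm_carrier[OF h(1)])
  have "(h * g) *v (M *v x) = N *v x" if x: "x : supp (Suc k)" for x
  proof -
   have xc: "x : Vec j" using x sc by auto
   define x' where "x' = x - x $ k *s e"
   have x'c: "x' : Vec j" using xc e by (simp add: x'_def)
   have x's: "x' : supp k"
   proof -
    have "x' $ i = 0" if i: "k <= i" "i < j" for i
     using x i Suc.prems by (cases "i = k") (auto simp: x'_def e_def supp_def)
    then show ?thesis using x'c by (simp add: supp_def)
   qed
   have xe: "x = x' + x $ k *s e" using xc e by (intro eq_vecI) (auto simp: x'_def)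
   have lin: "A *v x = A *v x' + x $ k *s (A *v e)" if A: "A : Mat n j" for A :: "'a mat"
   proof -
    have "A *v x = A *v x' + A *v (x $ k *s e)"
     by (subst xe) (rule mult_add_distrib_mat_vec[OF A x'c], use e in simp)
    then show ?thesis using mult_mat_vec[OF A e] by simp
   qed
   have "(h * g) *v (M *v x) = (h * (g * M)) *v x"
    using assoc_mult_mat_vec[of "h * g" n n M j x] hc gc M xc by (simp add: assoc_mult_mat[of _ n n _ n _ j])
   also have "... = (h * (g * M)) *v x' + x $ k *s ((h * (g * M)) *v e)" by (rule lin) (use hc gc M in simp)
   also have "(h * (g * M)) *v y = h *v (g *v (M *v y))" if y: "y : Vec j" for y
    using assoc_mult_mat_vec[of h n n "g * M" j y] assoc_mult_mat_vec[of g n n M j y] hc gc M y by simp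
   then have "(h * (g * M)) *v x' + x $ k *s ((h * (g * M)) *v e) = N *v x' + x $ k *s (N *v e)"
    using x'c e g(2) x's h by (simp add: W_def)
   also have "... = N *v x" using lin[OF N(1)] by simp
   finally show ?thesis .
  qed
  then show ?case using GLm_mult[OF h(1) g(1)] by blast
 qed
 then obtain g where g: "g : GLm n" "ALL x:supp j. g *v (M *v x) = N *v x" by blast
 have "g * M = N"
 proof (rule mat_eq_by_vec[of _ n j])
  fix x :: "'a vec" assume x: "x : Vec j"
  then have "x : supp j" by (auto simp: supp_def)
  then show "(g * M) *v x = N *v x" using g(2) assoc_mult_mat_vec[OF GLm_carrier[OF g(1)] M(1) x] by simp
 qed (use GLm_carrier[OF g(1)] M N in auto)
 then show ?thesis using g by blast
qed

definition std_inj :: "nat => nat => 'a::field mat" where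
 "std_inj n j = mat n j (%(a,b). if a = b then 1 else 0)"

lemma std_inj:
 assumes "j <= n"
 shows "std_inj n j : Mat n j" "injm j (std_inj n j :: 'a::field mat)"
proof -
 show c: "std_inj n j : Mat n j" for n j by (simp add: std_inj_def)
 have "v = zv j" if v: "v : Vec j" "std_inj n j *v v = zv n" for v :: "'a vec"
 proof (rule eq_vecI)
  fix i assume "i < dim_vec (zv j :: 'a vec)"
  then have i: "i < j" "i < n" using assms by auto
  have "(std_inj n j *v v) $ i = (\<Sum>k<j. if k = i then v $ k else 0)"
   unfolding mult_mat_vec_index[OF c v(1) i(2)] using i by (intro sum.cong refl) (simp add: std_inj_def)
  then show "v $ i = zv j $ i" using i v(2) by simp
 qed (use v in simp)
 then show "injm j (std_inj n j :: 'a::field mat)" by (simp add: injm_def carrier_matD(1)[OF c])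
qed

definition outer :: "nat => nat => 'a::field vec => 'a vec => 'a mat" where
 "outer n j u et = mat n j (%(a,b). u $ a * et $ b)"

text \<open>Both conditions are of the same kind: the second says that the Fourier transform of ph
  vanishes at matrices that are not injective.\<close>

definition cuspidal :: "nat => nat => ('a::{finite,field} mat => complex) => bool" where
 "cuspidal n j ph <-> (ALL M:Mat n j. \<not> injm j M --> ph M = 0) &
  (ALL M:Mat n j. ALL et:Vec j. et ~= zv j --> (SUM u:Vec n. ph (M + outer n j u et)) = 0)"

lemma outer_carrier [simp]: "outer n j u et : Mat n j"
 by (simp add: outer_def)

lemma outer_mult_vec:
 assumes "u : Vec n" "y : Vec j"
 shows "outer n j u et *v y = (et *. y) *s u"
proof (rule eq_vecI)
 fix i assume "i < dim_vec ((et *. y) *s u)"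
 then have i: "i < n" using assms by simp
 have "(outer n j u et *v y) $ i = (\<Sum>k<j. u $ i * (et $ k * y $ k))"
  unfolding mult_mat_vec_index[OF outer_carrier assms(2) i] using i by (intro sum.cong refl) (simp add: outer_def)
 then show "(outer n j u et *v y) $ i = ((et *. y) *s u) $ i"
  using i assms by (simp add: scalar_prod_def atLeast0LessThan sum_distrib_left mult.commute)
qed (use assms in \<open>simp add: outer_def\<close>)

lemma add_outer_mult_vec:
 assumes "N : Mat n j" "u : Vec n" "y : Vec j"
 shows "(N + outer n j u et) *v y = N *v y + (et *. y) *s u"
 using add_mult_distrib_mat_vec[OF assms(1) outer_carrier assms(3)] outer_mult_vec[OF assms(2,3)] by simp

text \<open>The subspace H of the stabilizer argument. It is everything precisely when the image of
  N lies in that of M.\<close>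

definition preim :: "nat => nat => 'a::field mat => 'a mat => 'a vec set" where
 "preim j r M N = {y : Vec j. N *v y : (%x. M *v x) ` Vec r}"

lemma subsp_image: "M : Mat n r ==> subsp n ((%x. (M :: 'a::field mat) *v x) ` Vec r)"
 unfolding subsp_def
proof (intro conjI ballI allI)
 assume M: "M : Mat n r"
 show "(%x. M *v x) ` Vec r \<subseteq> Vec n" using M by auto
 have "M *v zv r = zv n" using M by (intro eq_vecI) auto
 then show "zv n : (%x. M *v x) ` Vec r" by (metis imageI zero_carrier_vec)
 fix x assume "x : (%x. M *v x) ` Vec r"
 then obtain x' where x: "x' : Vec r" "x = M *v x'" by auto
 show "c *s x : (%x. M *v x) ` Vec r" for c
  using x mult_mat_vec[OF M x(1), of c] by (intro image_eqI[of _ _ "c *s x'"]) auto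
 fix y assume "y : (%x. M *v x) ` Vec r"
 then obtain y' where y: "y' : Vec r" "y = M *v y'" by auto
 show "x + y : (%x. M *v x) ` Vec r"
  using x y mult_add_distrib_mat_vec[OF M x(1) y(1)] by (intro image_eqI[of _ _ "x' + y'"]) auto
qed

lemma subsp_preim:
 assumes "N : Mat n j" "subsp n V"
 shows "subsp j {y : Vec j. N *v y : V}"
proof -
 have "N *v zv j = zv n" using assms(1) by (intro eq_vecI) auto
 then show ?thesis using assms(2) mult_add_distrib_mat_vec[OF assms(1)] mult_mat_vec[OF assms(1)] by (auto simp: subsp_def)
qed

lemma subsp_preim': "N : Mat n j ==> M : Mat n r ==> subsp j (preim j r M N)"
 unfolding preim_def by (rule subsp_preim[OF _ subsp_image])

text \<open>If H is proper, a row direction orthogonal to H gives a family N + u eta in which every member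
 either has a larger set H or is a translate of N under the stabilizer of M'.\<close>

lemma cuspidal_stabilizer_eq_0:
 fixes M :: "'a::{finite,field} mat"
 assumes M: "M : Mat n r" and cusp: "cuspidal n j ph"
  and inv: "!!g N. g : GLm n ==> g * M = M ==> N : Mat n j ==> ph (g * N) = ph N"
  and full: "!!N. N : Mat n j ==> preim j r M N = Vec j ==> ph N = 0"
  and N: "N : Mat n j"
 shows "ph N = 0"
 using N
proof (induction "card (Vec j :: 'a vec set) - card (preim j r M N)" arbitrary: N rule: less_induct)
 case less
 note N = less.prems
 let ?H = "preim j r M N"
 have Hc: "preim j r M K \<subseteq> Vec j" for K by (auto simp: preim_def)
 have H: "subsp j ?H" by (rule subsp_preim'[OF N M])
 show ?case
 proof (cases "?H = Vec j")
  case True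
  then show ?thesis using full N by blast
 next
  case False
  then obtain a where a: "a : Vec j" "a \<notin> ?H" using Hc by blast
  obtain et where et: "et : Vec j" "ALL w:?H. et *. w = 0" "et *. a ~= 0"
   using separating_functional[OF H a] by blast
  have et0: "et ~= zv j" using et(3) a by auto
  define y1 where "y1 = (1 / (et *. a)) *s a"
  have y1: "y1 : Vec j" "et *. y1 = 1" using a et by (auto simp: y1_def scalar_prod_smult_distrib)
  \<comment> \<open>W is spanned by the image of M and by the image under N of the hyperplane
    orthogonal to eta. An element that fixes W pointwise fixes M and can change N only at
    y1.\<close>
  define W where "W = {M *v x + N *v p | x p. x : Vec r & p : Vec j & et *. p = 0}"
  have Mx: "M *v x : Vec n" if "x : Vec r" for x using that M by auto
  have Nx: "N *v x : Vec n" if "x : Vec j" for x using that N by auto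
  have z: "A *v zv k = zv n" if "A : Mat n k" for A :: "'a mat" and k using that by (intro eq_vecI) auto
  have W: "subsp n W" unfolding subsp_def
  proof (intro conjI ballI allI)
   show "W \<subseteq> Vec n" using Mx Nx by (auto simp: W_def)
   show "zv n : W" unfolding W_def using z[OF M] z[OF N] et(1)
    by (intro CollectI exI[of _ "zv r"] exI[of _ "zv j"]) auto
   fix x assume "x : W"
   then obtain x1 p1 where x: "x = M *v x1 + N *v p1" "x1 : Vec r" "p1 : Vec j" "et *. p1 = 0" by (auto simp: W_def)
   show "c *s x : W" for c unfolding W_def
    using x et(1) Mx[OF x(2)] Nx[OF x(3)] mult_mat_vec[OF M x(2), of c] mult_mat_vec[OF N x(3), of c]
    by (intro CollectI exI[of _ "c *s x1"] exI[of _ "c *s p1"]) (simp add: smult_add_distrib_vec scalar_prod_smult_distrib[of _ j])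
   fix y assume "y : W"
   then obtain x2 p2 where y: "y = M *v x2 + N *v p2" "x2 : Vec r" "p2 : Vec j" "et *. p2 = 0" by (auto simp: W_def)
   have "x + y = M *v (x1 + x2) + N *v (p1 + p2)"
    unfolding x(1) y(1) mult_add_distrib_mat_vec[OF M x(2) y(2)] mult_add_distrib_mat_vec[OF N x(3) y(3)]
    using Mx[OF x(2)] Nx[OF x(3)] Mx[OF y(2)] Nx[OF y(3)] by (intro eq_vecI) auto
   then show "x + y : W" unfolding W_def using x y et(1)
    by (intro CollectI exI[of _ "x1 + x2"] exI[of _ "p1 + p2"]) (simp add: scalar_prod_add_distrib[of _ j])
  qed
  have MW: "M *v x : W" if "x : Vec r" for x unfolding W_def
   using that Mx[OF that] z[OF N] et(1) by (intro CollectI exI[of _ x] exI[of _ "zv j"]) auto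
  have NW: "N *v p : W" if "p : Vec j" "et *. p = 0" for p unfolding W_def
   using that Nx[OF that(1)] z[OF M] by (intro CollectI exI[of _ "zv r"] exI[of _ p]) auto
  let ?Nu = "%u. N + outer n j u et"
  have Nuc: "?Nu u : Mat n j" for u using N by simp
  have key: "y1 - p : preim j r M (?Nu u)"
   if "u : Vec n" "x : Vec r" "p : Vec j" "et *. p = 0" "N *v y1 + u = M *v x + N *v p" for u x p
  proof -
   have d: "y1 - p : Vec j" using that y1 by simp
   have "et *. (y1 - p) = 1" using scalar_prod_minus_distrib[OF et(1) y1(1) that(3)] y1 that by simp
   then have "?Nu u *v (y1 - p) = N *v y1 - N *v p + u"
    using add_outer_mult_vec[OF N that(1) d, of et] mult_minus_distrib_mat_vec[OF N y1(1) that(3)] by simp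
   also have "... = M *v x"
    by (rule vec_add_cancel[OF Nx[OF y1(1)] Nx[OF that(3)] that(1) Mx[OF that(2)] that(5)])
   finally show ?thesis using d that(2) by (auto simp: preim_def)
  qed
  have notin: "N *v y1 \<notin> W"
  proof
   assume "N *v y1 : W"
   then obtain x p where xp: "N *v y1 = M *v x + N *v p" "x : Vec r" "p : Vec j" "et *. p = 0" by (auto simp: W_def)
   have "?Nu (zv n) = N" using N by (intro eq_matI) (auto simp: outer_def)
   moreover have "N *v y1 + zv n = M *v x + N *v p" using xp Nx[OF y1(1)] by simp
   ultimately have "y1 - p : ?H" using key[OF _ xp(2-4), of "zv n"] by simp
   then have "et *. (y1 - p) = 0" using et(2) by blast
   then show False using scalar_prod_minus_distrib[OF et(1) y1(1) xp(3)] y1 xp by simp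
  qed
  \<comment> \<open>If N y1 + u falls into W, then y1 - p enters H while all of H survives, so the
    induction hypothesis applies.\<close>
  have inside: "ph (?Nu u) = 0" if u: "u : Vec n" and uW: "N *v y1 + u : W" for u
  proof -
   obtain x p where xp: "N *v y1 + u = M *v x + N *v p" "x : Vec r" "p : Vec j" "et *. p = 0"
    using uW by (auto simp: W_def)
   have sub: "?H \<subseteq> preim j r M (?Nu u)"
   proof
    fix h assume h: "h : ?H"
    have hc: "h : Vec j" using h Hc by blast
    have "?Nu u *v h = N *v h" using add_outer_mult_vec[OF N u hc, of et] et(2) h vec_add_smult_0[OF Nx[OF hc] u] by simp
    then show "h : preim j r M (?Nu u)" using h by (simp add: preim_def)
   qed
   have "y1 - p \<notin> ?H"
   proof
    assume "y1 - p : ?H"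
    then have "et *. (y1 - p) = 0" using et(2) by blast
    then show False using scalar_prod_minus_distrib[OF et(1) y1(1) xp(3)] y1 xp by simp
   qed
   then have "?H \<subset> preim j r M (?Nu u)" using sub key[OF u xp(2-4,1)] by blast
   moreover have fin: "finite (preim j r M (?Nu u))" by (rule finite_subset[OF Hc]) simp
   ultimately have "card ?H < card (preim j r M (?Nu u))" by (metis psubset_card_mono)
   moreover have "card (preim j r M (?Nu u)) <= card (Vec j :: 'a vec set)" by (intro card_mono Hc) simp
   ultimately show ?thesis using less.hyps[OF _ Nuc] by simp
  qed
  have outside: "ph (?Nu u) = ph N" if u: "u : Vec n" and uW: "N *v y1 + u \<notin> W" for u
  proof -
   obtain g where g: "g : GLm n" "ALL w:W. g *v w = w" "g *v (N *v y1) = N *v y1 + u"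
    using mover[OF W Nx[OF y1(1)] notin _ uW] u Nx[OF y1(1)] by auto
   have gc: "g : Mat n n" by (rule GLm_carrier[OF g(1)])
   have "g * M = M"
    using gc M by (intro mat_eq_by_vec[of _ n r]) (auto simp: assoc_mult_mat_vec[OF gc M] g(2) MW)
   moreover have "g * N = ?Nu u"
   proof (rule mat_eq_by_vec[of _ n j])
    fix y :: "'a vec" assume y: "y : Vec j"
    define p where "p = y - (et *. y) *s y1"
    have p: "p : Vec j" using y y1 by (simp add: p_def)
    have "et *. p = 0" using y y1 et(1) by (simp add: p_def scalar_prod_minus_distrib[of _ j] scalar_prod_smult_distrib[of _ j])
    then have gp: "g *v (N *v p) = N *v p" using g(2) NW p by blast
    have ye: "y = p + (et *. y) *s y1" using y y1 by (intro eq_vecI) (auto simp: p_def)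
    have Ny: "N *v y = N *v p + (et *. y) *s (N *v y1)"
    proof -
     have "N *v y = N *v p + N *v ((et *. y) *s y1)"
      by (subst ye) (rule mult_add_distrib_mat_vec[OF N p], use y1 in simp)
     then show ?thesis using mult_mat_vec[OF N y1(1)] by simp
    qed
    have "g *v (N *v y) = g *v (N *v p) + (et *. y) *s (g *v (N *v y1))"
     unfolding Ny using mult_add_distrib_mat_vec[OF gc Nx[OF p], of "(et *. y) *s (N *v y1)"] mult_mat_vec[OF gc Nx[OF y1(1)]] Nx[OF y1(1)] by simp
    also have "... = N *v y + (et *. y) *s u"
     unfolding gp g(3) Ny by (rule vec_smult_add_assoc[OF Nx[OF y1(1)] Nx[OF p] u])
    finally show "(g * N) *v y = ?Nu u *v y"
     using assoc_mult_mat_vec[OF gc N y] add_outer_mult_vec[OF N u y, of et] by simp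
   qed (use gc N in auto)
   ultimately show ?thesis using inv[OF g(1) _ N] by metis
  qed
  \<comment> \<open>Inside terms vanish and outside terms all equal \<open>ph N\<close>. Since u = 0
    is outside, a positive multiple of \<open>ph N\<close> is 0.\<close>
  have "0 = (SUM u:Vec n. ph (?Nu u))" using cusp N et(1) et0 by (simp add: cuspidal_def)
  also have "... = (SUM u:Vec n. if N *v y1 + u \<notin> W then ph N else 0)"
   using inside outside by (intro sum.cong refl) auto
  also have "... = of_nat (card {u\<in>Vec n. N *v y1 + u \<notin> W}) * ph N"
   by (simp add: sum.If_cases Int_def)
  finally have p0: "of_nat (card {u\<in>Vec n. N *v y1 + u \<notin> W}) * ph N = 0" by simp
  have "zv n : {u\<in>Vec n. N *v y1 + u \<notin> W}" using notin Nx[OF y1(1)] by simp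
  moreover have "finite {u\<in>Vec n. N *v y1 + u \<notin> W}" by (rule finite_subset[of _ "Vec n"]) auto
  ultimately have "card {u\<in>Vec n. N *v y1 + u \<notin> W} ~= 0" by (metis card_0_eq empty_iff)
  then show ?thesis using p0 by (metis mult_eq_0_iff of_nat_eq_0_iff)
 qed
qed

subsection \<open>Fixed points and the permutation characters\<close>

lemma fixed_columns:
 fixes g :: "'a::{finite,field} mat"
 assumes g: "g : Mat n n"
 shows "card {N : Mat n k. g * N = N} = card {x\<in>Vec n. (g - idm n) *v x = zv n} ^ k"
proof -
 let ?W = "{x\<in>Vec n. (g - idm n) *v x = zv n}"
 have W: "x : ?W <-> g *v x = x" if x: "x : Vec n" for x
 proof -
  have gx: "g *v x : Vec n" using g x by auto
  have "(g - idm n) *v x = g *v x - x" using minus_mult_distrib_mat_vec[OF g one_carrier_mat x] x by simp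
  then show ?thesis using vec_eq_if_diff_0[OF gx x] x by auto
 qed
 have "{N : Mat n k. g * N = N} = {N : Mat n k. \<forall>i<k. col N i : ?W}"
 proof (intro Collect_cong conj_cong refl)
  fix N :: "'a mat" assume N: "N : Mat n k"
  have c: "col (g * N) i = g *v col N i" if "i < k" for i using col_mult2[OF g N that] .
  have cc: "col N i : Vec n" for i using N by auto
  show "g * N = N <-> (\<forall>i<k. col N i : ?W)"
  proof
   assume "g * N = N" then show "\<forall>i<k. col N i : ?W" using c W[OF cc] by metis
  next
   assume "\<forall>i<k. col N i : ?W"
   then have "col (g * N) i = col N i" if "i < k" for i using c[OF that] W[OF cc] that by auto
   then show "g * N = N" by (intro mat_col_eqI) (use N g in auto)
  qed
 qed
 then show ?thesis using card_columns_in(2)[of ?W n k] by (simp add: finite_subset[of ?W "Vec n"])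
qed

text \<open>Levels become statements about actions: constituents of the k-th power are the
  constituents of the functions on n x k matrices.\<close>

lemma tau_pow:
 fixes g :: "'a::{finite,field} mat"
 assumes g: "g : GLm n"
 shows "of_nat (card {N : Mat n k. g * N = N}) = tau_m n g ^ k"
proof -
 have gc: "g - idm n : Mat n n" by (intro minus_carrier_mat) simp
 show ?thesis using g fixed_columns[OF GLm_carrier[OF g], of k] card_mat_kernel[OF gc] by (simp add: tau_m_def)
qed

text \<open>Lets functionals count toward the level just like vectors.\<close>

lemma fixed_rows:
 fixes g :: "'a::{finite,field} mat"
 assumes g: "g : Mat n n"
 shows "card {L : Mat k n. L * g = L} = card {N : Mat n k. g * N = N}"
proof -
 have gt: "trm g : Mat n n" using g by simp
 have "bij_betw trm {L : Mat k n. L * g = L} {N : Mat n k. trm g * N = N}"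
 proof (rule bij_betw_byWitness[where f' = trm])
  show "trm ` {L : Mat k n. L * g = L} \<subseteq> {N : Mat n k. trm g * N = N}"
   using transpose_mult[OF _ g, symmetric] by auto
  show "trm ` {N : Mat n k. trm g * N = N} \<subseteq> {L : Mat k n. L * g = L}"
  proof
   fix L assume "L : trm ` {N : Mat n k. trm g * N = N}"
   then obtain N where N: "N : Mat n k" "trm g * N = N" "L = trm N" by auto
   have "trm (trm g * N) = trm N * g" using transpose_mult[OF gt N(1)] by simp
   then show "L : {L : Mat k n. L * g = L}" using N by simp
  qed
 qed auto
 from bij_betw_same_card[OF this] have 1: "card {L : Mat k n. L * g = L} = card {N : Mat n k. trm g * N = N}" .
 have "trm g - idm n = trm (g - idm n)" using g by (intro eq_matI) auto
 moreover have "g - idm n : Mat n n" by (intro minus_carrier_mat) simp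
 ultimately show ?thesis
  using 1 fixed_columns[OF g, of k] fixed_columns[OF gt, of k] card_kernel_transpose[of "g - idm n" n] by simp
qed

lemma sum_div_mod:
 assumes "j > 0"
 shows "(\<Sum>c<n * j. f (c div j) (c mod j)) = (\<Sum>a<n. \<Sum>b<j. f a (b::nat))"
proof -
 have "(\<Sum>a<n. \<Sum>b<j. f a b) = (\<Sum>(a,b)\<in>{..<n} \<times> {..<j}. f a b)" by (rule sum.cartesian_product)
 also have "... = (\<Sum>c<n * j. f (c div j) (c mod j))"
 proof (rule sum.reindex_bij_witness[of _ "%c. (c div j, c mod j)" "%(a,b). a * j + b"])
  fix p assume "p : {..<n} \<times> {..<j}"
  then obtain a b where p: "p = (a,b)" "a < n" "b < j" by auto
  have "a * j + b < (a + 1) * j" using p by simp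
  also have "... <= n * j" using p by (intro mult_right_mono) auto
  finally show "(case p of (a,b) => a * j + b) : {..<n * j}" using p by simp
 qed (use assms in \<open>auto simp: less_mult_imp_div_less\<close>)
 finally show ?thesis by simp
qed

text \<open>In the Kronecker basis the coordinate c belongs to the matrix entry (c div j, c mod j),
  and g tensor s becomes N -> g N s^T.\<close>

lemma tau_V_card:
 fixes g s :: "'a::{finite,field} mat"
 assumes g: "g : Mat n n" and s: "s : Mat j j" and j: "j > 0"
 shows "tau_V n j g s = of_nat (card {N : Mat n j. g * N * trm s = N})"
proof -
 let ?T = "tensor_mat g s"
 have T: "?T : Mat (n * j) (n * j)" using g s by (simp add: tensor_mat_def)
 have Tm: "?T - idm (n * j) : Mat (n * j) (n * j)" by (intro minus_carrier_mat) simp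
 let ?K = "{x\<in>Vec (n * j). (?T - idm (n * j)) *v x = zv (n * j)}"
 have K: "x : ?K <-> ?T *v x = x" if x: "x : Vec (n * j)" for x
 proof -
  have gx: "?T *v x : Vec (n * j)" using T x by auto
  have "(?T - idm (n * j)) *v x = ?T *v x - x" using minus_mult_distrib_mat_vec[OF T one_carrier_mat x] x by simp
  then show ?thesis using vec_eq_if_diff_0[OF gx x] x by auto
 qed
 define F where "F N = vec (n * j) (%c. N $$ (c div j, c mod j))" for N :: "'a mat"
 define F' where "F' x = mat n j (%(a,b). x $ (a * j + b))" for x :: "'a vec"
 have lt: "a * j + b < n * j" if "a < n" "b < j" for a b
 proof -
  have "a * j + b < (a + 1) * j" using that by simp
  also have "... <= n * j" using that by (intro mult_right_mono) auto
  finally show ?thesis .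
 qed
 have TF: "?T *v F N = F (g * N * trm s)" if N: "N : Mat n j" for N
 proof (rule eq_vecI)
  fix c assume "c < dim_vec (F (g * N * trm s))"
  then have c: "c < n * j" by (simp add: F_def)
  have cd: "c div j < n" "c mod j < j" using c j by (simp_all add: less_mult_imp_div_less)
  have "(?T *v F N) $ c = (\<Sum>d<n * j. g $$ (c div j, d div j) * s $$ (c mod j, d mod j) * N $$ (d div j, d mod j))"
   unfolding mult_mat_vec_index[OF T _ c, of "F N", unfolded F_def, OF vec_carrier, folded F_def]
   using c g s by (intro sum.cong refl) (simp add: tensor_mat_def F_def)
  also have "... = (\<Sum>a<n. \<Sum>b<j. g $$ (c div j, a) * s $$ (c mod j, b) * N $$ (a, b))"
   by (rule sum_div_mod[OF j, of "%a b. g $$ (c div j, a) * s $$ (c mod j, b) * N $$ (a, b)"])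
  also have "... = (\<Sum>b<j. (g * N) $$ (c div j, b) * trm s $$ (b, c mod j))"
   using g s N cd by (subst sum.swap, intro sum.cong refl, subst mult_mat_index[of _ n n])
    (auto simp: sum_distrib_left sum_distrib_right mult_ac intro!: sum.cong)
  also have "... = (g * N * trm s) $$ (c div j, c mod j)"
   using g s N cd by (subst mult_mat_index[of "g * N" n j]) auto
  finally show "(?T *v F N) $ c = F (g * N * trm s) $ c" using c by (simp add: F_def)
 qed (use T in \<open>simp add: F_def\<close>)
 have FF: "F' (F N) = N" if "N : Mat n j" for N
  using that lt by (intro eq_matI) (auto simp: F_def F'_def)
 have FF': "F (F' x) = x" if "x : Vec (n * j)" for x
  using that j by (intro eq_vecI) (auto simp: F_def F'_def less_mult_imp_div_less)
 have Fc: "F N : Vec (n * j)" "F' x : Mat n j" for N x by (simp_all add: F_def F'_def)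
 have gc: "g * N * trm s : Mat n j" if "N : Mat n j" for N using that g s by auto
 have "bij_betw F {N : Mat n j. g * N * trm s = N} ?K"
 proof (rule bij_betw_byWitness[where f' = F'])
  show "F ` {N : Mat n j. g * N * trm s = N} \<subseteq> ?K"
  proof
   fix x assume "x : F ` {N : Mat n j. g * N * trm s = N}"
   then obtain N where N: "N : Mat n j" "g * N * trm s = N" "x = F N" by blast
   then have "?T *v F N = F N" using TF[OF N(1)] by simp
   then show "x : ?K" using K[OF Fc(1)[of N]] N(3) by blast
  qed
  show "F' ` ?K \<subseteq> {N : Mat n j. g * N * trm s = N}"
  proof
   fix N assume "N : F' ` ?K"
   then obtain x where x: "x : ?K" "N = F' x" by blast
   have xc: "x : Vec (n * j)" using x by simp
   have "F (g * N * trm s) = F N" using TF[OF Fc(2), of x] FF'[OF xc] K[OF xc] x by simp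
   then have "F' (F (g * N * trm s)) = F' (F N)" by simp
   then show "N : {N : Mat n j. g * N * trm s = N}"
    using FF[OF gc[OF Fc(2)], of x] FF[OF Fc(2), of x] x Fc by simp
  qed
 qed (use FF FF' in auto)
 from bij_betw_same_card[OF this] show ?thesis using card_mat_kernel[OF Tm] by (simp add: tau_V_def)
qed

lemma GL_action: "group_action_on (GLm n :: 'a::{finite,field} mat set) (*) (idm n) (minv n) (Mat n k) (*)"
proof -
 interpret finite_group_on "GLm n :: 'a mat set" "(*)" "idm n" "minv n" by (rule GL_group)
 show ?thesis
 proof unfold_locales
  fix g h N :: "'a mat" assume "g : GLm n" "h : GLm n" "N : Mat n k"
  then show "g * h * N = g * (h * N)" by (intro assoc_mult_mat) (auto dest: GLm_carrier)
 qed (auto dest: GLm_carrier)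
qed

section \<open>Characters of true level at least j\<close>

abbreviation Gkr :: "nat => ('a::{finite,field} mat => complex) => 'a mat => 'a mat => complex" where
 "Gkr n th M N \<equiv> (SUM g:GLm n. if g * N = M then cnj (th g) else 0)"

abbreviation gl_irr :: "nat => ('a::{finite,field} mat => complex) set" where
 "gl_irr n \<equiv> finite_group_on.irr (GLm n) (*) (idm n)"

text \<open>True level at least j, phrased through vanishing multiplicities; the equivalence is part
  of \<open>true_level\<close>.\<close>

definition new_char :: "nat => nat => ('a::{finite,field} mat => complex) => bool" where
 "new_char n j th <-> th : gl_irr n & (\<forall>r<j. (SUM g:GLm n. tau_m n g ^ r * cnj (th g)) = 0)"

lemma kernel_vanishes:
 fixes M N :: "'a::{finite,field} mat"
 assumes th: "th : gl_irr n" and 0: "(SUM g:GLm n. tau_m n g ^ r * cnj (th g)) = 0"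
  and MN: "M : Mat n r" "N : Mat n r"
 shows "Gkr n th M N = 0"
proof -
 interpret A: group_action_on "GLm n :: 'a mat set" "(*)" "idm n" "minv n" "Mat n r" "(*)" by (rule GL_action)
 have "(SUM g:GLm n. A.fixc g * cnj (th g)) = 0"
  using 0 by (simp add: A.fixc_def tau_pow cong: sum.cong)
 from A.kr_eq_0[OF A.irr_spherical[OF th] this MN] show ?thesis by (simp add: A.kr_def)
qed

lemma hyperplane_basis:
 fixes et :: "'a::{finite,field} vec"
 assumes et: "et : Vec j" "et ~= zv j"
 shows "EX r C C'. r < j & C : Mat j r & C' : Mat r j & C' * C = idm r & {p\<in>Vec j. et *. p = 0} = {C *v c | c. c : Vec r}"
proof -
 let ?W = "{p\<in>Vec j. et *. p = 0}"
 have "subsp j ?W" using et(1) by (auto simp: subsp_def scalar_prod_add_distrib[of _ j] scalar_prod_smult_distrib[of _ j])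
 from subsp_basis[OF this] obtain r C C' where C: "C : Mat j r" "C' : Mat r j" "C' * C = idm r"
  "?W = {C *v c | c. c : Vec r}" "card ?W = CARD('a) ^ r" by blast
 obtain i where i: "i < j" "et $ i ~= 0"
 proof -
  have "\<not> (\<forall>i<j. et $ i = 0)"
  proof
   assume "\<forall>i<j. et $ i = 0"
   then have "et = zv j" using et(1) by (intro eq_vecI) auto
   with et(2) show False by simp
  qed
  then show ?thesis using that by blast
 qed
 then have "unit_vec j i : Vec j - ?W" using et(1) by simp
 then have ps: "?W \<subset> Vec j" by blast
 have "card ?W < card (Vec j :: 'a vec set)" by (rule psubset_card_mono[OF finite_carrier_vec' ps])
 then have "CARD('a) ^ r < CARD('a) ^ j" using C(5) by (simp add: card_carrier_vec')
 then have "r < j" using card_UNIV_field[where 'a='a] power_strict_increasing_iff[of "CARD('a)" r j] by simp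
 then show ?thesis using C by blast
qed

lemma exists_dual_vec:
 fixes et :: "'a::{finite,field} vec"
 assumes et: "et : Vec j" "et ~= zv j"
 shows "EX y:Vec j. et *. y = 1"
proof -
 have "\<exists>i<j. et $ i ~= 0"
 proof (rule ccontr)
  assume "\<not> (\<exists>i<j. et $ i ~= 0)"
  then have "et = zv j" using et(1) by (intro eq_vecI) auto
  with et(2) show False by simp
 qed
 then obtain i where i: "i < j" "et $ i ~= 0" by blast
 then show ?thesis using et(1) by (intro bexI[of _ "(1 / et $ i) *s unit_vec j i"]) auto
qed

lemma outer_unique:
 fixes D :: "'a::{finite,field} mat"
 assumes D: "D : Mat n j" and et: "et : Vec j" and y1: "y1 : Vec j" "et *. y1 = 1"
  and ker: "!!p. p : Vec j ==> et *. p = 0 ==> D *v p = zv n" and u: "u : Vec n"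
 shows "D = outer n j u et <-> u = D *v y1"
proof
 assume "D = outer n j u et"
 then have "D *v y1 = outer n j u et *v y1" by simp
 then show "u = D *v y1" using outer_mult_vec[OF u y1(1), of et] y1 u by simp
next
 assume ue: "u = D *v y1"
 show "D = outer n j u et"
 proof (rule mat_eq_by_vec[OF D])
  fix y :: "'a vec" assume y: "y : Vec j"
  define p where "p = y - (et *. y) *s y1"
  have p: "p : Vec j" using y y1 by (simp add: p_def)
  have "et *. p = 0" using y y1 et by (simp add: p_def scalar_prod_minus_distrib[of _ j])
  then have Dp: "D *v p = zv n" using ker p by blast
  have ye: "y = p + (et *. y) *s y1" using y y1 by (intro eq_vecI) (auto simp: p_def)
  have "D *v y = D *v p + D *v ((et *. y) *s y1)"
   by (subst ye) (rule mult_add_distrib_mat_vec[OF D p], use y1 in simp)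
  then show "D *v y = outer n j u et *v y"
   using mult_mat_vec[OF D y1(1)] Dp ue outer_mult_vec[OF u y, of et] u by simp
 qed simp
qed

text \<open>The rows of M are orthogonal to v, and C C' is the identity on the hyperplane orthogonal
  to v.\<close>

lemma factor_through_hyperplane:
 fixes M :: "'a::{finite,field} mat"
 assumes M: "M : Mat n j" and v: "v : Vec j" and Mv: "M *v v = zv n"
  and C: "C : Mat j r" "C' : Mat r j" "C' * C = idm r" "{p\<in>Vec j. v *. p = 0} = {C *v c | c. c : Vec r}"
 shows "M * trm C' * trm C = M"
proof -
 have Mt: "trm M : Mat j n" using M by simp
 have "C * (C' * trm M) = trm M"
 proof (rule mat_eq_by_vec[of _ j n])
  fix y :: "'a vec" assume y: "y : Vec n"
  have ty: "trm M *v y : Vec j" using Mt y by auto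
  have "v *. (trm M *v y) = (trm M *v y) *. v" by (rule comm_scalar_prod[OF v ty])
  also have "... = y *. (M *v v)" using transpose_vec_mult_scalar[OF M v y] .
  also have "... = 0" using y Mv by simp
  finally have "trm M *v y : {C *v c | c. c : Vec r}" using C(4) ty by blast
  then obtain c where c: "c : Vec r" "trm M *v y = C *v c" by blast
  have "(C * (C' * trm M)) *v y = C *v (C' *v (trm M *v y))"
   using assoc_mult_mat_vec[OF C(1) mult_carrier_mat[OF C(2) Mt] y] assoc_mult_mat_vec[OF C(2) Mt y] by simp
  also have "... = trm M *v y" unfolding c(2) using mat_vec_cancel[OF C(2,1,3) c(1)] by simp
  finally show "(C * (C' * trm M)) *v y = trm M *v y" .
 qed (use C Mt in auto)
 then have "trm (C * (C' * trm M)) = M" by simp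
 moreover have "trm (C * (C' * trm M)) = M * trm C' * trm C"
  using transpose_mult[OF C(1) mult_carrier_mat[OF C(2) Mt]] transpose_mult[OF C(2) Mt] by simp
 ultimately show ?thesis by simp
qed

lemma mat_eq_add_iff:
 fixes A B C :: "'a::field mat"
 assumes "A : Mat n j" "B : Mat n j" "C : Mat n j"
 shows "A = B + C <-> A - B = C"
proof
 assume "A = B + C" then show "A - B = C" using assms by (intro eq_matI) auto
next
 assume a: "A - B = C"
 have "A = B + (A - B)" using assms(1,2) by (intro eq_matI) auto
 then show "A = B + C" using a by simp
qed

text \<open>Both conditions reduce to kernels on matrices with r < j columns, which vanish. If M v =
  0, then g N = M forces N v = 0 and can be tested after dividing out v. And g N = M + u eta^T for
  some u means that g N and M agree on the hyperplane orthogonal to eta.\<close>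

lemma new_cuspidal:
 fixes N :: "'a::{finite,field} mat"
 assumes new: "new_char n j th" and N: "N : Mat n j"
 shows "cuspidal n j (%M. Gkr n th M N)"
 unfolding cuspidal_def
proof (intro conjI ballI impI)
 have th: "th : gl_irr n" and k0: "!!r. r < j ==> (SUM g:GLm n. tau_m n g ^ r * cnj (th g)) = 0"
  using new by (auto simp: new_char_def)
 fix M :: "'a mat" assume M: "M : Mat n j"
 {
  assume "\<not> injm j M"
  then obtain v where v: "v : Vec j" "M *v v = zv n" "v ~= zv j" using M by (auto simp: injm_def)
  obtain r C C' where C: "r < j" "C : Mat j r" "C' : Mat r j" "C' * C = idm r" "{p\<in>Vec j. v *. p = 0} = {C *v c | c. c : Vec r}"
   using hyperplane_basis[OF v(1,3)] by blast
  have Ct: "trm C : Mat r j" "trm C' : Mat j r" using C by auto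
  show "Gkr n th M N = 0"
  proof (cases "N *v v = zv n")
   case True
   have "g * N = M <-> g * (N * trm C') = M * trm C'" if g: "g : GLm n" for g
   proof
    assume "g * N = M"
    then show "g * (N * trm C') = M * trm C'"
     using assoc_mult_mat[OF GLm_carrier[OF g] N Ct(2)] by simp
   next
    assume a: "g * (N * trm C') = M * trm C'"
    have "g * N = g * (N * trm C' * trm C)"
     using factor_through_hyperplane[OF N v(1) True C(2-5)] by simp
    also have "... = g * (N * trm C') * trm C"
     using assoc_mult_mat[OF GLm_carrier[OF g] mult_carrier_mat[OF N Ct(2)] Ct(1)] by simp
    also have "... = M" using a factor_through_hyperplane[OF M v(1,2) C(2-5)] by simp
    finally show "g * N = M" .
   qed
   then have "Gkr n th M N = Gkr n th (M * trm C') (N * trm C')" by (intro sum.cong refl) auto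
   also have "... = 0" by (rule kernel_vanishes[OF th k0[OF C(1)]]) (use M N Ct in auto)
   finally show ?thesis .
  next
   case False
   have "g * N ~= M" if g: "g : GLm n" for g
   proof
    assume "g * N = M"
    then have "g *v (N *v v) = zv n" using assoc_mult_mat_vec[OF GLm_carrier[OF g] N v(1)] v(2) by simp
    then have "minv n g *v (g *v (N *v v)) = minv n g *v zv n" by simp
    moreover have "minv n g *v zv n = zv n" using minv_carrier[OF g] by (intro eq_vecI) auto
    moreover have "N *v v : Vec n" using N v by auto
    ultimately show False using False GLm_cancel_vec(1)[OF g] by auto
   qed
   then show ?thesis by (intro sum.neutral) auto
  qed
 next
  fix et :: "'a vec" assume et: "et : Vec j" "et ~= zv j"
  obtain r C C' where C: "r < j" "C : Mat j r" "C' : Mat r j" "C' * C = idm r" "{p\<in>Vec j. et *. p = 0} = {C *v c | c. c : Vec r}"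
   using hyperplane_basis[OF et] by blast
  obtain y1 where y1: "y1 : Vec j" "et *. y1 = 1" using exists_dual_vec[OF et] by blast
  \<comment> \<open>For given g at most one u is possible, so the sum over u merely records
    agreement on the hyperplane.\<close>
  have one: "(SUM u:Vec n. if g * N = M + outer n j u et then c else 0) = (if g * (N * C) = M * C then c else 0)"
   if g: "g : GLm n" for g and c :: complex
  proof -
   have gc: "g : Mat n n" by (rule GLm_carrier[OF g])
   have gN: "g * N : Mat n j" using gc N by simp
   have eqv: "g * N = M + outer n j u et <-> g * N - M = outer n j u et" for u
    by (rule mat_eq_add_iff[OF gN M outer_carrier])
   have D: "g * N - M : Mat n j" using M by (intro minus_carrier_mat)
   have Dp: "(g * N - M) *v p = (g * N) *v p - M *v p" if "p : Vec j" for p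
    by (rule minus_mult_distrib_mat_vec[OF gN M that])
   show ?thesis
   proof (cases "g * (N * C) = M * C")
    case True
    have "(g * N - M) *v p = zv n" if p: "p : Vec j" "et *. p = 0" for p
    proof -
     obtain c where c: "c : Vec r" "p = C *v c" using C(5) p by blast
     have "(g * N) *v p = (g * (N * C)) *v c"
      unfolding c(2) using assoc_mult_mat[OF gc N C(2)] assoc_mult_mat_vec[OF gN C(2) c(1)] by simp
     also have "... = M *v p" unfolding True c(2) by (rule assoc_mult_mat_vec[OF M C(2) c(1)])
     finally show ?thesis using Dp[OF p(1)] M p by simp
    qed
    then have "(SUM u:Vec n. if g * N = M + outer n j u et then c else 0)
     = (SUM u:Vec n. if u = (g * N - M) *v y1 then c else 0)"
     unfolding eqv by (intro sum.cong refl if_cong outer_unique[OF D et(1) y1]) auto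
    also have "... = c" using D y1 by simp
    finally show ?thesis using True by simp
   next
    case False
    have "g * N ~= M + outer n j u et" if u: "u : Vec n" for u
    proof
     assume a: "g * N = M + outer n j u et"
     have "g * N * C = M * C"
     proof (rule mat_eq_by_vec[of _ n r])
      fix c :: "'a vec" assume c: "c : Vec r"
      have Cc: "C *v c : Vec j" using C(2) c by auto
      have "C *v c : {p\<in>Vec j. et *. p = 0}" unfolding C(5) using c by blast
      then have e0: "et *. (C *v c) = 0" by simp
      have "(g * N) *v (C *v c) = M *v (C *v c)"
       unfolding a using add_outer_mult_vec[OF M u Cc, of et] e0 vec_add_smult_0[OF mult_mat_vec_carrier[OF M Cc] u] by simp
      then show "(g * N * C) *v c = (M * C) *v c"
       using assoc_mult_mat_vec[OF gN C(2) c] assoc_mult_mat_vec[OF M C(2) c] by simp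
     qed (use gN M C in auto)
     then show False using False assoc_mult_mat[OF gc N C(2)] by simp
    qed
    then show ?thesis using False by (simp add: sum.neutral)
   qed
  qed
  have "(SUM u:Vec n. Gkr n th (M + outer n j u et) N) = (SUM g:GLm n. SUM u:Vec n. if g * N = M + outer n j u et then cnj (th g) else 0)"
   by (rule sum.swap)
  also have "... = Gkr n th (M * C) (N * C)" by (intro sum.cong refl one)
  also have "... = 0" by (rule kernel_vanishes[OF th k0[OF C(1)]]) (use M N C in auto)
  finally show "(SUM u:Vec n. Gkr n th (M + outer n j u et) N) = 0" .
 }
qed

lemma cuspidal_sum:
 fixes ph :: "'i => 'a::{finite,field} mat => complex"
 assumes "!!i. i : I ==> cuspidal n j (ph i)"
 shows "cuspidal n j (%M. SUM i:I. c i * ph i M)"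
 unfolding cuspidal_def
proof (intro conjI ballI impI)
 fix M :: "'a mat" assume M: "M : Mat n j"
 show "(SUM i:I. c i * ph i M) = 0" if "\<not> injm j M"
  using assms M that by (intro sum.neutral ballI) (auto simp: cuspidal_def)
 fix et :: "'a vec" assume et: "et : Vec j" "et ~= zv j"
 have "(SUM u:Vec n. SUM i:I. c i * ph i (M + outer n j u et)) = (SUM i:I. c i * (SUM u:Vec n. ph i (M + outer n j u et)))"
  unfolding sum_distrib_left by (rule sum.swap)
 also have "... = 0" using assms M et by (intro sum.neutral ballI) (auto simp: cuspidal_def)
 finally show "(SUM u:Vec n. SUM i:I. c i * ph i (M + outer n j u et)) = 0" .
qed

lemma cuspidal_cnj: "cuspidal n j ph ==> cuspidal n j (%M. cnj (ph M))"
 unfolding cuspidal_def by (simp flip: cnj_sum)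

lemma cuspidal_left:
 fixes g :: "'a::{finite,field} mat"
 assumes "cuspidal n j ph" and g: "g : GLm n"
 shows "cuspidal n j (%M. ph (g * M))"
 unfolding cuspidal_def
proof (intro conjI ballI impI)
 have gc: "g : Mat n n" by (rule GLm_carrier[OF g])
 fix M :: "'a mat" assume M: "M : Mat n j"
 have gM: "g * M : Mat n j" using gc M by simp
 show "ph (g * M) = 0" if "\<not> injm j M" using assms(1) that injm_mult_left[OF g M] gM by (auto simp: cuspidal_def)
 fix et :: "'a vec" assume et: "et : Vec j" "et ~= zv j"
 have o: "g * (M + outer n j u et) = g * M + outer n j (g *v u) et" if u: "u : Vec n" for u
 proof -
  have "g * outer n j u et = outer n j (g *v u) et"
  proof (rule mat_eq_by_vec[of _ n j])
   fix y :: "'a vec" assume y: "y : Vec j"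
   have gu: "g *v u : Vec n" using gc u by auto
   show "(g * outer n j u et) *v y = outer n j (g *v u) et *v y"
    using assoc_mult_mat_vec[OF gc outer_carrier y] outer_mult_vec[OF u y, of et] outer_mult_vec[OF gu y, of et] mult_mat_vec[OF gc u] by simp
  qed (use gc in auto)
  then show ?thesis using mult_add_distrib_mat[OF gc M outer_carrier] by simp
 qed
 have "(SUM u:Vec n. ph (g * (M + outer n j u et))) = (SUM u:Vec n. ph (g * M + outer n j (g *v u) et))"
  by (intro sum.cong refl) (simp add: o)
 also have "... = (SUM u:Vec n. ph (g * M + outer n j u et))"
  by (rule sum.reindex_bij_witness[of _ "%u. minv n g *v u" "%u. g *v u"])
   (use GLm_cancel_vec[OF g] gc minv_carrier[OF g] in auto)
 also have "... = 0" using assms(1) gM et by (simp add: cuspidal_def)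
 finally show "(SUM u:Vec n. ph (g * (M + outer n j u et))) = 0" .
qed

text \<open>By the stabilizer argument only N = x D matters. For singular D cuspidality gives 0, and
  an invertible D is the case of the last hypothesis.\<close>

lemma cuspidal_determined:
 fixes x :: "'a::{finite,field} mat"
 assumes x: "x : Mat n j" "injm j x" and cusp: "cuspidal n j ph"
  and inv: "!!g N. g : GLm n ==> g * x = x ==> N : Mat n j ==> ph (g * N) = ph N"
  and 0: "!!s. s : GLm j ==> ph (x * trm s) = 0"
  and N: "N : Mat n j"
 shows "ph N = 0"
proof (rule cuspidal_stabilizer_eq_0[OF x(1) cusp inv _ N])
 fix N :: "'a mat" assume N: "N : Mat n j" and full: "preim j j x N = Vec j"
 have "ALL i. EX d. i < j --> d : Vec j & N *v unit_vec j i = x *v d"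
 proof
  fix i
  have "unit_vec j i : preim j j x N" unfolding full by simp
  then show "EX d. i < j --> d : Vec j & N *v unit_vec j i = x *v d" by (auto simp: preim_def)
 qed
 then obtain d where d: "!!i. i < j ==> d i : Vec j" "!!i. i < j ==> N *v unit_vec j i = x *v d i" by metis
 define D where "D = mat j j (%(a,b). d b $ a)"
 have D: "D : Mat j j" by (simp add: D_def)
 have ND: "N = x * D"
 proof (rule mat_col_eqI)
  fix i assume "i < dim_col (x * D)"
  then have i: "i < j" by (simp add: D_def)
  have "col D i = d i" using i d(1)[OF i] by (intro eq_vecI) (auto simp: D_def)
  then have "col (x * D) i = N *v unit_vec j i" using col_mult2[OF x(1) D i] d(2)[OF i] by simp
  also have "... = col N i" using N i by (intro eq_vecI) auto
  finally show "col N i = col (x * D) i" by simp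
 qed (use N x D in auto)
 show "ph N = 0"
 proof (cases "D : GLm j")
  case True
  then have "trm D : GLm j" using D by (simp add: GLm_def det_transpose)
  from 0[OF this] show ?thesis using ND by simp
 next
  case False
  then obtain v where v: "v : Vec j" "v ~= zv j" "D *v v = zv j"
   using det_0_iff_vec_prod_zero[OF D] D by (auto simp: GLm_def)
  have "N *v v = x *v zv j" unfolding ND using assoc_mult_mat_vec[OF x(1) D v(1)] v(3) by simp
  also have "... = zv n" using x by (intro eq_vecI) auto
  finally have "\<not> injm j N" using v N by (auto simp: injm_def)
  then show ?thesis using cusp N by (simp add: cuspidal_def)
 qed
qed

text \<open>Up to a scalar, psi is the th-part of ph. It is again cuspidal, and so are its averages
  over stabilizers of n x r matrices, which therefore vanish for r < j. Summed over all n x r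
  matrices these averages amount to convolution with the r-th power of tau, which multiplies psi by
  a scalar; for some r < j the scalar is nonzero.\<close>

lemma old_annihilates_cuspidal:
 fixes ph :: "'a::{finite,field} mat => complex"
 assumes th: "th : gl_irr n" and old: "\<not> new_char n j th" and cusp: "cuspidal n j ph" and x: "x : Mat n j"
 shows "(SUM g:GLm n. cnj (th g) * ph (minv n g * x)) = 0"
proof -
 interpret G: finite_group_on "GLm n :: 'a mat set" "(*)" "idm n" "minv n" by (rule GL_group)
 obtain r where r: "r < j" "(SUM g:GLm n. tau_m n g ^ r * cnj (th g)) ~= 0" using old th by (auto simp: new_char_def)
 interpret A: group_action_on "GLm n :: 'a mat set" "(*)" "idm n" "minv n" "Mat n r" "(*)" by (rule GL_action)
 have tau: "tau_m n g ^ r = A.fixc g" if "g : GLm n" for g using tau_pow[OF that, of r] by (simp add: A.fixc_def)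
 note s = G.irr_spherical[OF th]
 have as: "g * h * y = g * (h * y)" if "g : GLm n" "h : GLm n" "y : Mat n j" for g h y :: "'a mat"
  using that by (intro assoc_mult_mat) (auto dest: GLm_carrier)
 have yc: "g * y : Mat n j" if "g : GLm n" "y : Mat n j" for g y :: "'a mat" using that by (auto dest: GLm_carrier)
 define psi where "psi y = (SUM g:GLm n. cnj (th g) * ph (minv n g * y))" for y
 have psi: "cuspidal n j psi" unfolding psi_def by (intro cuspidal_sum cuspidal_left[OF cusp] minv)
 have av: "(SUM h:GLm n. if h * M = M then psi (minv n h * x) else 0) = 0" if M: "M : Mat n r" for M
 proof -
  define \<Psi> where "\<Psi> y = (SUM h:GLm n. (if h * M = M then 1 else 0) * psi (minv n h * y))" for y
  have "\<Psi> x = 0"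
  proof (rule cuspidal_stabilizer_eq_0[OF M, of j \<Psi>])
   show "cuspidal n j \<Psi>" unfolding \<Psi>_def by (intro cuspidal_sum cuspidal_left[OF psi] minv)
  next
   fix g N :: "'a mat" assume g: "g : GLm n" "g * M = M" and N: "N : Mat n j"
   have "\<Psi> (g * N) = (SUM h:GLm n. (if (g * h) * M = M then 1 else 0) * psi (minv n (g * h) * (g * N)))"
    unfolding \<Psi>_def by (rule G.sum_left[OF g(1), of "%h. (if h * M = M then 1 else 0) * psi (minv n h * (g * N))", symmetric])
   also have "... = \<Psi> N" unfolding \<Psi>_def
   proof (rule sumc)
    fix h :: "'a mat" assume h: "h : GLm n"
    have "minv n (g * h) * (g * N) = minv n h * N"
     using G.iv_mul[OF g(1) h] as[of "minv n h" "minv n g" "g * N"] GLm_cancel_mat(1)[OF g(1) N] g h N yc by simp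
    moreover have "(g * h) * M = M <-> h * M = M"
    proof -
     have "(g * h) * M = g * (h * M)" using A.act_mul[OF g(1) h M] .
     moreover have "g * (h * M) = M <-> h * M = minv n g * M" using A.act_eq_iff[OF g(1) M, of "h * M"] h M by simp
     moreover have "minv n g * M = M" using A.act_eq_iff[OF g(1) M M] g(2) by simp
     ultimately show ?thesis by simp
    qed
    ultimately show "(if (g * h) * M = M then 1 else 0) * psi (minv n (g * h) * (g * N)) = (if h * M = M then 1 else 0) * psi (minv n h * N)" by simp
   qed
   finally show "\<Psi> (g * N) = \<Psi> N" .
  next
   \<comment> \<open>The image of N lies in that of M, of dimension at most r < j, so N cannot be
     injective.\<close>
   fix N :: "'a mat" assume N: "N : Mat n j" and full: "preim j r M N = Vec j"
   have "\<not> injm j N"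
   proof
    assume inj: "injm j N"
    have "card (Vec j :: 'a vec set) = card ((%y. N *v y) ` Vec j)"
     using injmD[OF inj N] by (intro card_image[symmetric] inj_onI) auto
    also have "... <= card ((%y. M *v y) ` Vec r)" using full by (intro card_mono) (auto simp: preim_def)
    also have "... <= card (Vec r :: 'a vec set)" by (intro card_image_le) simp
    finally have "CARD('a) ^ j <= CARD('a) ^ r" by (simp add: card_carrier_vec')
    then show False using r(1) card_UNIV_field[where 'a='a] power_increasing_iff[of "CARD('a)" j r] by simp
   qed
   then have "psi (minv n h * N) = 0" if "h : GLm n" for h
    using psi that N injm_mult_left[OF minv(1)[OF that] N] yc[OF minv(1)[OF that] N] by (simp add: cuspidal_def)
   then show "\<Psi> N = 0" unfolding \<Psi>_def by (intro sum.neutral ballI) simp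
  qed (rule x)
  then show ?thesis unfolding \<Psi>_def by (simp add: if_distrib[of "%z. z * _"] cong: if_cong)
 qed
 \<comment> \<open>Exchanging the sums turns the stabilizer averages into convolution with the class
   function \<open>A.fixc\<close>.\<close>
 have "0 = (SUM M:Mat n r. SUM h:GLm n. if h * M = M then psi (minv n h * x) else 0)" using av by simp
 also have "... = (SUM h:GLm n. A.fixc h * psi (minv n h * x))"
  by (subst sum.swap) (simp add: A.fixc_sum sum_distrib_right if_distrib[of "%z. z * _"] cong: if_cong)
 also have "... = (SUM h:GLm n. SUM g:GLm n. A.fixc h * (cnj (th g) * ph (minv n (h * g) * x)))"
  unfolding psi_def sum_distrib_left using x
  by (intro sum.cong refl) (simp add: G.iv_mul as minv)
 also have "... = (SUM h:GLm n. SUM g:GLm n. A.fixc h * (cnj (th (minv n h * g)) * ph (minv n g * x)))"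
 proof (rule sumc)
  fix h :: "'a mat" assume h: "h : GLm n"
  have "(SUM g:GLm n. A.fixc h * (cnj (th g) * ph (minv n (h * g) * x)))
   = (SUM g:GLm n. A.fixc h * (cnj (th (minv n h * g)) * ph (minv n (h * (minv n h * g)) * x)))"
   by (rule G.sum_left[OF G.iv_in[OF h], of "%g. A.fixc h * (cnj (th g) * ph (minv n (h * g) * x))", symmetric])
  then show "(SUM g:GLm n. A.fixc h * (cnj (th g) * ph (minv n (h * g) * x)))
   = (SUM g:GLm n. A.fixc h * (cnj (th (minv n h * g)) * ph (minv n g * x)))" using h by (simp cong: sum.cong)
 qed
 also have "... = (SUM g:GLm n. cnj (SUM h:GLm n. A.fixc h * th (minv n h * g)) * ph (minv n g * x))"
  by (subst sum.swap) (simp add: sum_distrib_right mult.assoc A.fixc_def)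
 also have "... = (SUM g:GLm n. cnj ((SUM h:GLm n. A.fixc h * th (minv n h)) / th (idm n)) * (cnj (th g) * ph (minv n g * x)))"
 proof (rule sumc)
  fix g :: "'a mat" assume g: "g : GLm n"
  have "(SUM h:GLm n. A.fixc h * th (minv n h * g)) = (SUM h:GLm n. A.fixc h * th (minv n h)) / th (idm n) * th g"
   using G.class_convolution[where f=A.fixc, OF s A.fixc_conj g] G.sphericalD(1)[OF s] by (simp add: field_simps)
  then show "cnj (SUM h:GLm n. A.fixc h * th (minv n h * g)) * ph (minv n g * x)
   = cnj ((SUM h:GLm n. A.fixc h * th (minv n h)) / th (idm n)) * (cnj (th g) * ph (minv n g * x))" by (simp only: complex_cnj_mult mult.assoc)
 qed
 also have "... = cnj ((SUM h:GLm n. A.fixc h * th (minv n h)) / th (idm n)) * psi x" by (simp only: psi_def sum_distrib_left)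
 finally have z: "cnj ((SUM h:GLm n. A.fixc h * th (minv n h)) / th (idm n)) * psi x = 0" by simp
 have "(SUM h:GLm n. A.fixc h * th (minv n h)) = (SUM h:GLm n. tau_m n h ^ r * cnj (th h))"
  by (intro sum.cong refl) (simp add: tau G.sphericalD(2)[OF s])
 then have nz: "cnj ((SUM h:GLm n. A.fixc h * th (minv n h)) / th (idm n)) ~= 0"
  using r(2) G.sphericalD(1)[OF s] by (simp del: cnj_sum complex_cnj_divide)
 have "psi x = 0" using z nz by (simp only: mult_eq_0_iff simp_thms)
 then show ?thesis by (simp only: psi_def)
qed

subsection \<open>The pair of general linear groups acting on matrices\<close>

lemma sum_prod_split: "(SUM p:A \<times> B. f (fst p) * h (snd p)) = (SUM a:A. f a) * (SUM b:B. h b :: complex)"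
 by (simp add: sum_product sum.cartesian_product split_def)

lemma mult_transpose_carrier:
 fixes N :: "'a::field mat"
 assumes "N : Mat n j" "s : GLm j"
 shows "N * trm s : Mat n j"
 using assms by (auto simp: GLm_def)

lemma mult_transpose_assoc:
 fixes N :: "'a::field mat"
 assumes "N : Mat n j" "s : GLm j" "t : GLm j"
 shows "N * trm s * trm t = N * trm (t * s)"
proof -
 have st: "s : Mat j j" "t : Mat j j" using assms by (auto simp: GLm_def)
 show ?thesis unfolding transpose_mult[OF st(2,1)] by (rule assoc_mult_mat[OF assms(1)]) (use st in auto)
qed

lemma mult_transpose_assoc_left:
 fixes N :: "'a::field mat"
 assumes "N : Mat n j" "s : GLm j" "g : GLm n"
 shows "g * N * trm s = g * (N * trm s)"
 by (rule assoc_mult_mat[OF GLm_carrier[OF assms(3)] assms(1)]) (use assms in \<open>auto simp: GLm_def\<close>)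

lemma transpose_GLm: "s : GLm j ==> trm s : GLm j"
 by (auto simp: GLm_def det_transpose)

lemma injm_mult_transpose:
 fixes N :: "'a::{finite,field} mat"
 assumes N: "N : Mat n j" and inj: "injm j N" and s: "s : GLm j"
 shows "injm j (N * trm s)"
 unfolding injm_def
proof (intro ballI impI)
 fix v :: "'a vec" assume v: "v : Vec j" and 0: "(N * trm s) *v v = zv (dim_row (N * trm s))"
 have st: "trm s : GLm j" by (rule transpose_GLm[OF s])
 have sv: "trm s *v v : Vec j" using GLm_carrier[OF st] v by auto
 have "N *v (trm s *v v) = zv n" using assoc_mult_mat_vec[OF N GLm_carrier[OF st] v] 0 N by simp
 then have "trm s *v v = zv j" using inj sv N by (simp add: injm_def)
 then have "minv j (trm s) *v (trm s *v v) = minv j (trm s) *v zv j" by simp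
 moreover have "minv j (trm s) *v zv j = zv j" using minv_carrier[OF st] by (intro eq_vecI) auto
 ultimately show "v = zv j" using GLm_cancel_vec(1)[OF st v] by simp
qed

lemma cuspidal_cong:
 assumes "!!M. M : Mat n j ==> ph M = psi M"
 shows "cuspidal n j ph <-> cuspidal n j psi"
 using assms by (simp add: cuspidal_def cong: sum.cong)

lemma (in finite_group_on) spherical_comm:
 assumes s: "spherical ch" and g: "g : G" and h: "h : G"
 shows "ch (g ** h) = ch (h ** g)"
 using sphericalD(4)[OF s, of "h ** g" g] g h by (simp add: assoc)

text \<open>The row version of \<open>kernel_vanishes\<close>; s acts through its inverse so that a
  left action results.\<close>

lemma kernel_vanishes_right:
 fixes L L' :: "'a::{finite,field} mat"
 assumes al: "al : gl_irr j" and 0: "(SUM s:GLm j. tau_m j s ^ k * cnj (al s)) = 0"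
  and L: "L : Mat k j" "L' : Mat k j"
 shows "(SUM s:GLm j. if L * s = L' then cnj (al s) else 0) = 0"
proof -
 interpret G: finite_group_on "GLm j :: 'a mat set" "(*)" "idm j" "minv j" by (rule GL_group)
 interpret A: group_action_on "GLm j :: 'a mat set" "(*)" "idm j" "minv j" "Mat k j" "%s L. L * minv j s"
 proof unfold_locales
  fix g h N :: "'a mat" assume *: "g : GLm j" "h : GLm j" "N : Mat k j"
  have "N * (minv j h * minv j g) = N * minv j h * minv j g"
   by (rule assoc_mult_mat[symmetric]) (use * minv_carrier in auto)
  then show "N * minv j (g * h) = N * minv j h * minv j g" using G.iv_mul[OF *(1,2)] by simp
  show "N * minv j g : Mat k j" by (rule mult_carrier_mat[OF *(3) minv_carrier[OF *(1)]])
 qed auto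
 have eqv: "N * minv j s = N' <-> N' * s = N" if "s : GLm j" "N : Mat k j" "N' : Mat k j" for s N N' :: "'a mat"
  using A.act_eq_iff[OF that(1,3,2)] G.iv_iv[OF that(1)] by auto
 have "A.fixc s = tau_m j s ^ k" if s: "s : GLm j" for s
 proof -
  have "{N : Mat k j. N * minv j s = N} = {N : Mat k j. N * s = N}" using eqv[OF s] by blast
  then show ?thesis using fixed_rows[OF GLm_carrier[OF s], of k] tau_pow[OF s, of k] by (simp add: A.fixc_def)
 qed
 then have "(SUM s:GLm j. A.fixc s * cnj (al s)) = 0" using 0 by (simp cong: sum.cong)
 from A.kr_eq_0[OF G.irr_spherical[OF al] this L] have "A.kr al L L' = 0" .
 moreover have "A.kr al L L' = (SUM s:GLm j. if L * s = L' then cnj (al s) else 0)"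
  unfolding A.kr_def by (intro sum.cong refl) (simp add: eqv[OF _ L(2,1)])
 ultimately show ?thesis by simp
qed

lemma factor_through:
 fixes x N :: "'a::{finite,field} mat"
 assumes x: "x : Mat n j" and N: "N : Mat n k"
  and im: "!!y. y : Vec k ==> N *v y : (%z. x *v z) ` Vec j"
 shows "EX D:Mat j k. N = x * D"
proof -
 have "ALL i. EX d. d : Vec j & N *v unit_vec k i = x *v d"
  using im[OF unit_vec_carrier] by (auto simp: image_iff)
 then obtain d where d: "!!i. d i : Vec j" "!!i. N *v unit_vec k i = x *v d i" by metis
 define D where "D = mat j k (%(a,b). d b $ a)"
 have D: "D : Mat j k" by (simp add: D_def)
 have "N = x * D"
 proof (rule mat_col_eqI)
  fix i assume "i < dim_col (x * D)"
  then have i: "i < k" by (simp add: D_def)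
  have "col D i = d i" using i d(1)[of i] by (intro eq_vecI) (auto simp: D_def)
  then have "col (x * D) i = N *v unit_vec k i" using col_mult2[OF x D i] d(2)[of i] by simp
  also have "... = col N i" using N i by (intro eq_vecI) auto
  finally show "col N i = col (x * D) i" by simp
 qed (use N x D in auto)
 then show ?thesis using D by blast
qed

lemma injm_cancel_mat:
 fixes x :: "'a::{finite,field} mat"
 assumes x: "x : Mat n j" "injm j x" and D: "D : Mat j k" "D' : Mat j k" and eq: "x * D = x * D'"
 shows "D = D'"
proof (rule mat_eq_by_vec[OF D])
 fix y :: "'a vec" assume y: "y : Vec k"
 have "x *v (D *v y) = x *v (D' *v y)"
  using assoc_mult_mat_vec[OF x(1) D(1) y] assoc_mult_mat_vec[OF x(1) D(2) y] eq by simp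
 then show "D *v y = D' *v y" using injmD[OF x(2,1)] D y by (metis mult_mat_vec_carrier)
qed

text \<open>The type argument pins down the field, which n and j do not mention.\<close>

locale gl_pair =
 fixes n j :: nat and ty :: "'a::{finite,field} itself"
 assumes j1: "1 <= j" and jn: "j <= n"
begin

abbreviation GG :: "'a mat set" where "GG \<equiv> GLm n"
abbreviation SS :: "'a mat set" where "SS \<equiv> GLm j"
abbreviation XX :: "'a mat set" where "XX \<equiv> Mat n j"
abbreviation M0 :: "'a mat" where "M0 \<equiv> std_inj n j"
abbreviation rm :: "'a mat => 'a mat => 'a mat" (infixl "*t" 70) where "N *t s \<equiv> N * trm s"

definition act :: "'a mat \<times> 'a mat => 'a mat => 'a mat" where
 "act p N = fst p * N * trm (snd p)"

definition pmul :: "'a mat \<times> 'a mat => 'a mat \<times> 'a mat => 'a mat \<times> 'a mat" where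
 "pmul p p' = (fst p * fst p', snd p * snd p')"

definition piv :: "'a mat \<times> 'a mat => 'a mat \<times> 'a mat" where
 "piv p = (minv n (fst p), minv j (snd p))"

sublocale G: finite_group_on GG "(*)" "idm n" "minv n" by (rule GL_group)
sublocale S: finite_group_on SS "(*)" "idm j" "minv j" by (rule GL_group)

lemma gc: "g : GG ==> M : XX ==> g * M : XX" by (auto dest: GLm_carrier)
lemma ga: "g : GG ==> h : GG ==> M : XX ==> g * h * M = g * (h * M)"
 by (intro assoc_mult_mat) (auto dest: GLm_carrier)
lemmas rc = mult_transpose_carrier[of _ n j]
lemmas ra = mult_transpose_assoc[of _ n j]
lemmas la = mult_transpose_assoc_left[of _ n j]
lemma r1: "M : XX ==> M *t idm j = M" by simp
lemma M0: "M0 : XX" "injm j M0" using std_inj[OF jn] by auto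

sublocale P: group_action_on "GG \<times> SS" pmul "(idm n, idm j)" piv XX act
proof unfold_locales
 fix p q :: "'a mat \<times> 'a mat" and x assume p: "p : GG \<times> SS" and q: "q : GG \<times> SS"
 show "pmul p q : GG \<times> SS" using p q by (auto simp: pmul_def GLm_mult)
 assume x: "x : XX"
 show "act (pmul p q) x = act p (act q x)"
 proof -
  obtain g s where p': "p = (g,s)" "g : GG" "s : SS" using p by auto
  obtain h t where q': "q = (h,t)" "h : GG" "t : SS" using q by auto
  have "g * h * x *t (s * t) = g * (h * x) *t t *t s"
   using p' q' x ra[OF gc[OF _ gc[OF _ x]], of g h t s] ga[of g h x] by simp
  also have "g * (h * x) *t t = g * (h * x *t t)" using la[OF gc[OF q'(2) x] q'(3) p'(2)] .
  finally show ?thesis using p' q' by (simp add: act_def pmul_def)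
 qed
 show "act p x : XX" unfolding act_def using p x by (intro rc gc) auto
qed (auto simp: pmul_def piv_def act_def S.assoc G.assoc minv GLm_mult one_GLm dest: GLm_carrier intro!: rc gc)

definition tp :: "('a mat => complex) => ('a mat => complex) => 'a mat \<times> 'a mat => complex" where
 "tp th al p = th (fst p) * al (snd p)"

lemma tp_spherical:
 assumes "th : G.irr" "al : S.irr"
 shows "P.spherical (tp th al)"
proof -
 note s1 = G.irr_spherical[OF assms(1)] and s2 = S.irr_spherical[OF assms(2)]
 show ?thesis unfolding P.spherical_def
 proof (intro conjI ballI)
  obtain d d' :: nat where "d > 0" "d' > 0" "th (idm n) = of_nat d" "al (idm j) = of_nat d'"
   using s1 s2 by (auto simp: G.spherical_def S.spherical_def)
  then show "\<exists>d>0. tp th al (idm n, idm j) = of_nat d" by (intro exI[of _ "d * d'"]) (simp add: tp_def)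
  show "tp th al (piv p) = cnj (tp th al p)" if "p : GG \<times> SS" for p
   using that G.sphericalD(2)[OF s1] S.sphericalD(2)[OF s2] by (auto simp: tp_def piv_def)
  show "(SUM h:GG \<times> SS. tp th al (pmul (pmul (pmul h x) (piv h)) y)) * tp th al (idm n, idm j)
   = of_nat (card (GG \<times> SS)) * tp th al x * tp th al y" if x: "x : GG \<times> SS" and y: "y : GG \<times> SS" for x y
  proof -
   have "(SUM h:GG \<times> SS. tp th al (pmul (pmul (pmul h x) (piv h)) y))
    = (SUM h:GG. th (h * fst x * minv n h * fst y)) * (SUM h:SS. al (h * snd x * minv j h * snd y))"
    unfolding sum_prod_split[symmetric] by (simp add: tp_def pmul_def piv_def)
   then have "(SUM h:GG \<times> SS. tp th al (pmul (pmul (pmul h x) (piv h)) y)) * tp th al (idm n, idm j)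
    = ((SUM h:GG. th (h * fst x * minv n h * fst y)) * th (idm n)) * ((SUM h:SS. al (h * snd x * minv j h * snd y)) * al (idm j))"
    by (simp only: tp_def fst_conv snd_conv mult_ac)
   also have "... = (of_nat (card GG) * th (fst x) * th (fst y)) * (of_nat (card SS) * al (snd x) * al (snd y))"
    using x y by (simp only: G.sphericalD(5)[OF s1] S.sphericalD(5)[OF s2] mem_Times_iff)
   also have "... = of_nat (card (GG \<times> SS)) * tp th al x * tp th al y"
    by (simp only: tp_def card_cartesian_product of_nat_mult mult_ac)
   finally show ?thesis .
  qed
  have "(SUM g:GG \<times> SS. tp th al g * cnj (tp th al g)) = (SUM g:GG. th g * cnj (th g)) * (SUM g:SS. al g * cnj (al g))"
   unfolding sum_prod_split[symmetric] by (simp add: tp_def mult_ac)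
  then show "(SUM g:GG \<times> SS. tp th al g * cnj (tp th al g)) = of_nat (card (GG \<times> SS))"
   using G.sphericalD(3)[OF s1] S.sphericalD(3)[OF s2] by (simp add: card_cartesian_product)
  show "tp th al (pmul (pmul h g) (piv h)) = tp th al g" if "g : GG \<times> SS" "h : GG \<times> SS" for g h
   using that G.sphericalD(4)[OF s1] S.sphericalD(4)[OF s2] by (auto simp: tp_def pmul_def piv_def)
 qed
qed

section \<open>Invariant kernels attached to pairs of characters\<close>

abbreviation KK :: "('a mat => complex) => ('a mat => complex) => 'a mat => 'a mat => complex" where
 "KK th al \<equiv> P.kr (tp th al)"

text \<open>The multiplicity of the pair in the permutation character on n x j matrices, times the
  order of G x S.\<close>

definition mm :: "('a mat => complex) => ('a mat => complex) => complex" where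
 "mm th al = (SUM p:GG \<times> SS. P.fixc p * cnj (tp th al p))"

text \<open>Writes the kernel of a pair through kernels of th alone, so that cuspidality carries
  over from \<open>new_cuspidal\<close>.\<close>

lemma KK_expand:
 assumes "N : XX"
 shows "KK th al M N = (SUM s:SS. cnj (al s) * Gkr n th M (N *t s))"
proof -
 have "KK th al M N = (SUM g:GG. SUM s:SS. if g * N *t s = M then cnj (th g) * cnj (al s) else 0)"
  unfolding P.kr_def tp_def act_def by (simp add: sum.cartesian_product split_def cong: if_cong)
 also have "... = (SUM s:SS. SUM g:GG. if g * N *t s = M then cnj (th g) * cnj (al s) else 0)" by (rule sum.swap)
 also have "... = (SUM s:SS. cnj (al s) * Gkr n th M (N *t s))"
  unfolding sum_distrib_left using assms by (intro sum.cong refl) (auto simp: la)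
 finally show ?thesis .
qed

lemma KK_cuspidal_left:
 assumes "new_char n j th" "N : XX"
 shows "cuspidal n j (%M. KK th al M N)"
proof -
 have "cuspidal n j (%M. SUM s:SS. cnj (al s) * Gkr n th M (N *t s))"
  by (intro cuspidal_sum new_cuspidal[OF assms(1)] rc[OF assms(2)])
 then show ?thesis by (simp add: KK_expand[OF assms(2)])
qed

lemma new_irr: "new_char n j th ==> th : G.irr" by (simp add: new_char_def)

lemma KK_cuspidal_right:
 assumes "new_char n j th" "al : S.irr" "M : XX"
 shows "cuspidal n j (%N. KK th al M N)"
proof -
 have "cuspidal n j (%N. cnj (KK th al N M))" by (intro cuspidal_cnj KK_cuspidal_left assms)
 moreover have "KK th al M N = cnj (KK th al N M)" if "N : XX" for N
  by (rule P.kr_hermitian[OF tp_spherical[OF new_irr[OF assms(1)] assms(2)] that assms(3)])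
 ultimately show ?thesis by (subst cuspidal_cong)
qed

lemma KK_0: "new_char n j th ==> M : XX ==> N : XX ==> \<not> injm j M ==> KK th al M N = 0"
 using KK_cuspidal_left[of th N al] by (simp add: cuspidal_def)

lemma KK_invariant_right:
 assumes "th : G.irr" "al : S.irr" "t : SS" "M : XX" "N : XX"
 shows "KK th al (M *t t) (N *t t) = KK th al M N"
 using P.kr_invariant[OF tp_spherical[OF assms(1,2)], of "(idm n, t)" M N] assms by (simp add: act_def one_GLm)

lemma KK_invariant_left:
 assumes "th : G.irr" "al : S.irr" "g : GG" "M : XX" "N : XX"
 shows "KK th al (g * M) (g * N) = KK th al M N"
 using P.kr_invariant[OF tp_spherical[OF assms(1,2)], of "(g, idm j)" M N] assms gc[of g M] gc[of g N] by (simp add: act_def one_GLm)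

lemma cnj_convolution:
 assumes al: "al : S.irr" and s: "s : SS"
 shows "(SUM t:SS. al t * cnj (al (s * t))) = of_nat (card SS) / al (idm j) * cnj (al s)"
proof -
 note sp = S.irr_spherical[OF al]
 have "(SUM t:SS. al t * cnj (al (s * t))) = (SUM t:SS. al (minv j t) * cnj (al (s * minv j t)))"
  by (rule S.sum_iv[of "%t. al t * cnj (al (s * t))", symmetric])
 also have "... = cnj (SUM t:SS. al t * al (minv j t * s))"
  using s S.sphericalD(2)[OF sp] S.spherical_comm[OF sp s] by (simp add: minv)
 also have "... = cnj (of_nat (card SS) / al (idm j) * al s)" by (simp only: S.spherical_convolution[OF sp s])
 finally show ?thesis using S.sphericalD(2)[OF sp S.e_in] by simp
qed

lemma KK_right:
 assumes al: "al : S.irr" and N: "N : XX"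
 shows "(SUM t:SS. al t * KK th al M (N *t minv j t)) = of_nat (card SS) / al (idm j) * KK th al M N"
proof -
 define F where "F s = Gkr n th M (N *t s)" for s
 have "KK th al M (N *t minv j t) = (SUM s:SS. cnj (al (s * t)) * F s)" if t: "t : SS" for t
 proof -
  have "KK th al M (N *t minv j t) = (SUM s:SS. cnj (al s) * F (s * minv j t))"
   unfolding KK_expand[OF rc[OF N S.iv_in[OF t]]] F_def using N t by (intro sum.cong refl) (simp add: ra minv)
  also have "... = (SUM s:SS. cnj (al (s * t)) * F (s * t * minv j t))"
   by (rule S.sum_right[OF t, of "%s. cnj (al s) * F (s * minv j t)", symmetric])
  finally show ?thesis using t by (simp cong: sum.cong)
 qed
 then have "(SUM t:SS. al t * KK th al M (N *t minv j t)) = (SUM t:SS. SUM s:SS. al t * cnj (al (s * t)) * F s)"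
  by (simp add: sum_distrib_left mult.assoc)
 also have "... = (SUM s:SS. (SUM t:SS. al t * cnj (al (s * t))) * F s)"
  by (subst sum.swap) (simp add: sum_distrib_right)
 also have "... = of_nat (card SS) / al (idm j) * KK th al M N"
  by (simp add: cnj_convolution[OF al] KK_expand[OF N] F_def sum_distrib_left mult.assoc)
 finally show ?thesis .
qed

lemma KK_left:
 assumes th: "th : G.irr" and al: "al : S.irr" and M: "M : XX" and N: "N : XX"
 shows "(SUM t:SS. al t * KK th al (M *t t) N) = of_nat (card SS) / al (idm j) * KK th al M N"
proof -
 have "KK th al (M *t t) N = KK th al M (N *t minv j t)" if t: "t : SS" for t
  using KK_invariant_right[OF th al t M rc[OF N S.iv_in[OF t]]] N t by (simp add: ra minv)
 then show ?thesis using KK_right[OF al N, of th M] by simp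
qed

text \<open>At the base point the right action of S can be imitated from the left by G. With joint
  invariance this makes s -> f M0 (M0 s^T) a class function.\<close>

lemma conj_by_GG:
 assumes "t : SS"
 shows "EX h:GG. h * M0 = M0 *t t"
 using GL_transitive[OF M0 rc[OF M0(1) assms] injm_mult_transpose[OF M0 assms]] .

lemma kernel_determined:
 assumes f1: "!!g x y. g : GG ==> x : XX ==> y : XX ==> f (g * x) (g * y) = f x y"
  and f2: "!!x. x : XX ==> cuspidal n j (f x)" and f3: "!!x y. x : XX ==> y : XX ==> \<not> injm j x ==> f x y = 0"
  and 0: "!!s. s : SS ==> f M0 (M0 *t s) = 0"
  and x: "x : XX" and y: "y : XX"
 shows "f x y = 0"
proof (cases "injm j x")
 case True
 have z: "f M0 N = 0" if N: "N : XX" for N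
 proof (rule cuspidal_determined[OF M0 f2[OF M0(1)] _ 0 N])
  fix g N assume "g : GG" "g * M0 = M0" "N : XX"
  then show "f M0 (g * N) = f M0 N" using f1[of g M0 N] M0 by simp
 qed
 obtain g where g: "g : GG" "g * M0 = x" using GL_transitive[OF M0 x True] by blast
 have "f x y = f (g * M0) (g * (minv n g * y))" using g GLm_cancel_mat(2)[OF g(1) y] by simp
 also have "... = 0" using f1[OF g(1) M0(1) gc[OF G.iv_in[OF g(1)] y]] z[OF gc[OF G.iv_in[OF g(1)] y]] by simp
 finally show ?thesis .
qed (use f3 x y in simp)

text \<open>The kernel is determined by the function kp on S. Invariance makes kp a class function,
  and f4 makes it an eigenfunction of convolution with al, hence a multiple of al. The multiple is
  its value at 1, up to a nonzero factor.\<close>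

lemma kernel_unique:
 assumes al: "al : S.irr"
  and f1: "!!g x y. g : GG ==> x : XX ==> y : XX ==> f (g * x) (g * y) = f x y"
  and f2: "!!x. x : XX ==> cuspidal n j (f x)" and f3: "!!x y. x : XX ==> y : XX ==> \<not> injm j x ==> f x y = 0"
  and f4: "!!x y. x : XX ==> y : XX ==> (SUM t:SS. al t * f x (y *t minv j t)) = of_nat (card SS) / al (idm j) * f x y"
  and f5: "!!t x y. t : SS ==> x : XX ==> y : XX ==> f (x *t t) (y *t t) = f x y"
  and 0: "f M0 M0 = 0" and x: "x : XX" and y: "y : XX"
 shows "f x y = 0"
proof (rule kernel_determined[where f = f, OF f1 f2 f3 _ x y])
 fix s assume s: "s : SS"
 note sp = S.irr_spherical[OF al]
 define kp where "kp s = f M0 (M0 *t s)" for s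
 have cl: "kp (t * s * minv j t) = kp s" if s: "s : SS" and t: "t : SS" for s t
 proof -
  let ?t = "minv j t"
  have t': "?t : SS" using t by simp
  obtain h where h: "h : GG" "h * M0 = M0 *t ?t" using conj_by_GG[OF t'] by blast
  have e: "M0 *t (t * s * ?t) *t ?t = M0 *t ?t *t s"
  proof -
   have "?t * (t * s * ?t) = s * ?t" using s t by (simp add: S.assoc)
   then show ?thesis using ra[OF M0(1), of "t * s * ?t" ?t] ra[OF M0(1) t' s] s t by simp
  qed
  have "kp (t * s * ?t) = f (M0 *t ?t) (M0 *t (t * s * ?t) *t ?t)"
   unfolding kp_def using f5[OF t' M0(1) rc[OF M0(1), of "t * s * ?t"]] s t by simp
  also have "... = f (h * M0) (h * (M0 *t s))" unfolding e using h la[OF M0(1) s h(1)] by simp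
  also have "... = kp s" using f1[OF h(1) M0(1) rc[OF M0(1) s]] by (simp add: kp_def)
  finally show ?thesis .
 qed
 have conv: "of_nat (card SS) / al (idm j) * kp s = (SUM r:SS. kp r * al (minv j r * s))" if s: "s : SS" for s
 proof -
  have "of_nat (card SS) / al (idm j) * kp s = (SUM t:SS. al t * kp (minv j t * s))"
   using f4[OF M0(1) rc[OF M0(1) s]] M0 s by (simp add: kp_def ra cong: sum.cong)
  also have "... = (SUM t:SS. al (s * t) * kp (minv j (s * t) * s))"
   by (rule S.sum_left[OF s, of "%t. al t * kp (minv j t * s)", symmetric])
  also have "... = (SUM t:SS. al (s * t) * kp (minv j t))"
   using s by (intro sum.cong refl) (simp add: S.iv_mul)
  also have "... = (SUM r:SS. al (s * minv j r) * kp (minv j (minv j r)))"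
   by (rule S.sum_iv[of "%t. al (s * t) * kp (minv j t)", symmetric])
  also have "... = (SUM r:SS. kp r * al (minv j r * s))"
   using s S.spherical_comm[OF sp s] by (intro sum.cong refl) simp
  finally show ?thesis .
 qed
 have k: "of_nat (card SS) * kp s = (SUM r:SS. kp r * al (minv j r)) * al s" if s: "s : SS" for s
  using S.class_convolution[where f = kp, OF sp cl s] conv[OF s] S.sphericalD(1)[OF sp] by (simp add: field_simps)
 have "kp (idm j) = 0" using 0 M0 by (simp add: kp_def)
 then have "(SUM r:SS. kp r * al (minv j r)) = 0" using k[OF S.e_in] S.sphericalD(1)[OF sp] by simp
 then have "kp s = 0" using k[OF s] by simp
 then show "f M0 (M0 *t s) = 0" by (simp add: kp_def)
qed

text \<open>Convolution with al and convolution with be both act on kp by nonzero scalars, yet their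
  composite is convolution with al convolved with be, which is 0.\<close>

lemma kernel_disjoint:
 assumes al: "al : S.irr" and be: "be : S.irr" and ne: "al ~= be"
  and f1: "!!g x y. g : GG ==> x : XX ==> y : XX ==> f (g * x) (g * y) = f x y"
  and f2: "!!x. x : XX ==> cuspidal n j (f x)" and f3: "!!x y. x : XX ==> y : XX ==> \<not> injm j x ==> f x y = 0"
  and f4: "!!x y. x : XX ==> y : XX ==> (SUM t:SS. be t * f x (y *t minv j t)) = of_nat (card SS) / be (idm j) * f x y"
  and f5: "!!x y. x : XX ==> y : XX ==> (SUM t:SS. al t * f (x *t t) y) = of_nat (card SS) / al (idm j) * f x y"
  and x: "x : XX" and y: "y : XX"
 shows "f x y = 0"
proof (rule kernel_determined[where f = f, OF f1 f2 f3 _ x y])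
 fix s0 assume s0: "s0 : SS"
 note spa = S.irr_spherical[OF al] and spb = S.irr_spherical[OF be]
 define kp where "kp s = f M0 (M0 *t s)" for s
 have kb: "of_nat (card SS) / be (idm j) * kp s = (SUM t:SS. be t * kp (minv j t * s))" if s: "s : SS" for s
  using f4[OF M0(1) rc[OF M0(1) s]] M0 s by (simp add: kp_def ra cong: sum.cong)
 \<comment> \<open>Translating M0 by t is imitated in G and moved to the other argument, so the
   condition on the first argument becomes a convolution of kp as well.\<close>
 have ka: "of_nat (card SS) / al (idm j) * kp s = (SUM t:SS. al t * kp (minv j t * s))" if s: "s : SS" for s
 proof -
  have sh: "f (M0 *t t) (M0 *t s) = kp (s * minv j t)" if t: "t : SS" for t
  proof -
   obtain h where h: "h : GG" "h * M0 = M0 *t t" using conj_by_GG[OF t] by blast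
   have st: "s * minv j t : SS" using s t by simp
   have "h * (M0 *t (s * minv j t)) = M0 *t t *t (s * minv j t)" using la[OF M0(1) st h(1)] h by simp
   also have "... = M0 *t s" using ra[OF M0(1) t st] s t by simp
   finally show ?thesis using f1[OF h(1) M0(1) rc[OF M0(1) st]] h by (simp add: kp_def)
  qed
  have "of_nat (card SS) / al (idm j) * kp s = (SUM t:SS. al t * kp (s * minv j t))"
   using f5[OF M0(1) rc[OF M0(1) s]] sh by (simp add: kp_def cong: sum.cong)
  also have "... = (SUM t:SS. al (minv j s * t) * kp (s * minv j (minv j s * t)))"
   by (rule S.sum_left[OF S.iv_in[OF s], of "%t. al t * kp (s * minv j t)", symmetric])
  also have "... = (SUM t:SS. al (minv j s * (t * s)) * kp (s * minv j (minv j s * (t * s))))"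
   by (rule S.sum_right[OF s, of "%t. al (minv j s * t) * kp (s * minv j (minv j s * t))", symmetric])
  also have "... = (SUM t:SS. al t * kp (minv j t * s))"
  proof (rule sumc)
   fix t assume t: "t : SS"
   have "al (minv j s * (t * s)) = al t" using S.spherical_comm[OF spa, of "minv j s" "t * s"] s t by (simp add: S.assoc)
   moreover have "s * minv j (minv j s * (t * s)) = minv j t * s" using s t by (simp add: S.iv_mul flip: S.assoc)
   ultimately show "al (minv j s * (t * s)) * kp (s * minv j (minv j s * (t * s))) = al t * kp (minv j t * s)" by simp
  qed
  finally show ?thesis .
 qed
 have "of_nat (card SS) / al (idm j) * (of_nat (card SS) / be (idm j) * kp s0)
  = of_nat (card SS) / be (idm j) * (SUM t:SS. al t * kp (minv j t * s0))"
  using ka[OF s0] by (simp add: mult.left_commute)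
 also have "... = (SUM t:SS. al t * (of_nat (card SS) / be (idm j) * kp (minv j t * s0)))"
  by (simp add: sum_distrib_left mult.left_commute)
 also have "... = (SUM t:SS. al t * (SUM r:SS. be r * kp (minv j (t * r) * s0)))"
 proof (rule sumc)
  fix t assume t: "t : SS"
  have "minv j t * s0 : SS" using t s0 by simp
  note kb[OF this]
  also have "(SUM r:SS. be r * kp (minv j r * (minv j t * s0))) = (SUM r:SS. be r * kp (minv j (t * r) * s0))"
   using t s0 by (intro sum.cong refl) (simp add: S.iv_mul S.assoc)
  finally show "al t * (of_nat (card SS) / be (idm j) * kp (minv j t * s0)) = al t * (SUM r:SS. be r * kp (minv j (t * r) * s0))"
   by (simp only:)
 qed
 also have "... = (SUM t:SS. al t * (SUM u:SS. be (minv j t * u) * kp (minv j u * s0)))"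
 proof (rule sumc)
  fix t assume t: "t : SS"
  have "(SUM r:SS. be r * kp (minv j (t * r) * s0)) = (SUM u:SS. be (minv j t * u) * kp (minv j (t * (minv j t * u)) * s0))"
   by (rule S.sum_left[OF S.iv_in[OF t], of "%r. be r * kp (minv j (t * r) * s0)", symmetric])
  then show "al t * (SUM r:SS. be r * kp (minv j (t * r) * s0)) = al t * (SUM u:SS. be (minv j t * u) * kp (minv j u * s0))"
   using t by (simp cong: sum.cong)
 qed
 also have "... = (SUM u:SS. (SUM t:SS. al t * be (minv j t * u)) * kp (minv j u * s0))"
  by (simp add: sum_distrib_left sum_distrib_right mult.assoc) (rule sum.swap)
 also have "... = 0" by (simp add: S.irr_convolution_0[OF al be ne])
 finally show "f M0 (M0 *t s0) = 0" using S.sphericalD(1)[OF spa] S.sphericalD(1)[OF spb] by (simp add: kp_def)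
qed

section \<open>Traces of kernels, unique partners and multiplicity one\<close>

lemma KK_trace:
 assumes "th : G.irr" "al : S.irr" "p : GG \<times> SS"
 shows "(SUM x:XX. KK th al x (act p x)) = mm th al * tp th al p / tp th al (idm n, idm j)"
 using P.kr_trace[OF tp_spherical[OF assms(1,2)] assms(3)] by (simp add: mm_def)

lemma KK_trace_1:
 assumes "th : G.irr" "al : S.irr"
 shows "(SUM x:XX. KK th al x x) = mm th al"
 using KK_trace[OF assms P.e_in] P.sphericalD(1)[OF tp_spherical[OF assms]] by (simp add: act_def)

lemma KK_eq_0:
 assumes "th : G.irr" "al : S.irr" "mm th al = 0" "x : XX" "y : XX"
 shows "KK th al x y = 0"
 using P.kr_eq_0[OF tp_spherical[OF assms(1,2)] _ assms(4,5)] assms(3) by (simp add: mm_def)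

lemma KK_M0:
 assumes new: "new_char n j th" and al: "al : S.irr" and mm: "mm th al ~= 0"
 shows "KK th al M0 M0 ~= 0"
proof
 note th = new_irr[OF new]
 assume 0: "KK th al M0 M0 = 0"
 have "KK th al x y = 0" if "x : XX" "y : XX" for x y
  by (rule kernel_unique[where f="KK th al", OF al KK_invariant_left[OF th al] KK_cuspidal_right[OF new al] KK_0[OF new] KK_right[OF al] KK_invariant_right[OF th al] 0 that])
 then have "mm th al = 0" using KK_trace_1[OF th al] by simp
 with mm show False by simp
qed

text \<open>For fixed al the admissible kernels form a space of dimension at most one: the
  cross-multiplied difference vanishes at the base point, so \<open>kernel_unique\<close> applies to
  it.\<close>

lemma KK_proportional:
 assumes new: "new_char n j th" and al: "al : S.irr"
  and f1: "!!g x y. g : GG ==> x : XX ==> y : XX ==> f (g * x) (g * y) = f x y"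
  and f2: "!!x. x : XX ==> cuspidal n j (f x)" and f3: "!!x y. x : XX ==> y : XX ==> \<not> injm j x ==> f x y = 0"
  and f4: "!!x y. x : XX ==> y : XX ==> (SUM t:SS. al t * f x (y *t minv j t)) = of_nat (card SS) / al (idm j) * f x y"
  and f5: "!!t x y. t : SS ==> x : XX ==> y : XX ==> f (x *t t) (y *t t) = f x y"
  and x: "x : XX" and y: "y : XX"
 shows "KK th al M0 M0 * f x y = f M0 M0 * KK th al x y"
proof -
 note th = new_irr[OF new]
 define h where "h x y = KK th al M0 M0 * f x y - f M0 M0 * KK th al x y" for x y
 have "h x y = 0"
 proof (rule kernel_unique[where f = h, OF al _ _ _ _ _ _ x y])
  show "h (g * x) (g * y) = h x y" if "g : GG" "x : XX" "y : XX" for g x y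
   using f1[OF that] KK_invariant_left[OF th al that] by (simp add: h_def)
  show "cuspidal n j (h x)" if "x : XX" for x
  proof -
   \<comment> \<open>The difference is written as a sum over the booleans so that
     \<open>cuspidal_sum\<close> applies.\<close>
   have "cuspidal n j (%y. SUM b:UNIV. (if b then KK th al M0 M0 else - f M0 M0) * (if b then f x y else KK th al x y))"
    using f2[OF that] KK_cuspidal_right[OF new al that] by (intro cuspidal_sum) (rename_tac b, case_tac b, simp_all)
   then show ?thesis by (simp add: UNIV_bool h_def[abs_def])
  qed
  show "h x y = 0" if "x : XX" "y : XX" "\<not> injm j x" for x y
   using f3[OF that] KK_0[OF new that] by (simp add: h_def)
  show "(SUM t:SS. al t * h x (y *t minv j t)) = of_nat (card SS) / al (idm j) * h x y" if "x : XX" "y : XX" for x y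
  proof -
   have "(SUM t:SS. al t * h x (y *t minv j t)) = KK th al M0 M0 * (SUM t:SS. al t * f x (y *t minv j t)) - f M0 M0 * (SUM t:SS. al t * KK th al x (y *t minv j t))"
    by (simp add: h_def right_diff_distrib sum_subtractf sum_distrib_left mult.left_commute)
   then show ?thesis unfolding f4[OF that] KK_right[OF al that(2)] by (simp add: h_def right_diff_distrib mult.left_commute)
  qed
  show "h (x *t t) (y *t t) = h x y" if "t : SS" "x : XX" "y : XX" for t x y
   using f5[OF that] KK_invariant_right[OF th al that] by (simp add: h_def)
  show "h M0 M0 = 0" by (simp add: h_def)
 qed
 then show ?thesis by (simp add: h_def)
qed

text \<open>The kernels of th and th' with the same al are proportional and nonzero at the base
  point, whereas the convolution of kernels for different characters of G vanishes.\<close>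

lemma new_unique:
 assumes new: "new_char n j th" and new': "new_char n j th'" and al: "al : S.irr"
  and mm: "mm th al ~= 0" and mm': "mm th' al ~= 0"
 shows "th = th'"
proof (rule ccontr)
 assume ne: "th ~= th'"
 note th = new_irr[OF new] and th' = new_irr[OF new']
 let ?a = "KK th al M0 M0" and ?b = "KK th' al M0 M0"
 have prp: "?a * KK th' al x y = ?b * KK th al x y" if "x : XX" "y : XX" for x y
  by (rule KK_proportional[where f = "KK th' al", OF new al KK_invariant_left[OF th' al] KK_cuspidal_right[OF new' al] KK_0[OF new'] KK_right[OF al] KK_invariant_right[OF th' al] that])
 have orth: "(SUM y:XX. KK th al M0 y * KK th' al y M0) = 0"
  unfolding P.kr_convolution[OF M0(1) M0(1)]
 proof (intro sum.neutral ballI)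
  fix k assume k: "k : GG \<times> SS"
  have "(SUM g:GG \<times> SS. tp th al g * tp th' al (pmul (piv g) k)) = (SUM g:GG. th g * th' (minv n g * fst k)) * (SUM s:SS. al s * al (minv j s * snd k))"
   unfolding sum_prod_split[symmetric] by (simp add: tp_def pmul_def piv_def mult_ac)
  also have "... = 0" using G.irr_convolution_0[OF th th' ne, of "fst k"] k by auto
  finally show "(if act k M0 = M0 then cnj (SUM g:GG \<times> SS. tp th al g * tp th' al (pmul (piv g) k)) else 0) = 0" by (simp del: cnj_sum)
 qed
 have "0 = ?a * (SUM y:XX. KK th al M0 y * KK th' al y M0)" using orth by simp
 also have "... = (SUM y:XX. KK th al M0 y * (?a * KK th' al y M0))" by (simp add: sum_distrib_left mult.left_commute)
 also have "... = (SUM y:XX. KK th al M0 y * (?b * KK th al y M0))" by (intro sum.cong refl) (simp only: prp M0(1))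
 also have "... = ?b * (SUM y:XX. KK th al M0 y * KK th al y M0)" by (simp add: sum_distrib_left mult.left_commute)
 also have "... = ?b * (of_nat (card (GG \<times> SS)) / tp th al (idm n, idm j) * ?a)"
  by (simp only: P.kr_idempotent[OF tp_spherical[OF th al] M0(1) M0(1)])
 finally show False
  using KK_M0[OF new al mm] KK_M0[OF new' al mm'] P.sphericalD(1)[OF tp_spherical[OF th al]] P.card_pos by auto
qed

lemma KK_trace_swap:
 assumes "th : G.irr" "al : S.irr" "p : GG \<times> SS"
 shows "(SUM x:XX. KK th al (act p x) x) = cnj (mm th al * tp th al p / tp th al (idm n, idm j))"
proof -
 have "(SUM x:XX. KK th al (act p x) x) = (SUM x:XX. cnj (KK th al x (act p x)))"
  using assms(3) by (intro sum.cong refl P.kr_hermitian[OF tp_spherical[OF assms(1,2)]]) auto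
 then show ?thesis using KK_trace[OF assms] by (simp flip: cnj_sum)
qed

text \<open>The product of the two kernels, averaged over G, has type al in its first argument and
  be in its second, so it vanishes by \<open>kernel_disjoint\<close>. Its trace over M and N is the
  norm of th times the two multiplicities, up to nonzero factors.\<close>

lemma new_one_alpha:
 assumes new: "new_char n j th" and al: "al : S.irr" and be: "be : S.irr"
  and mma: "mm th al ~= 0" and mmb: "mm th be ~= 0"
 shows "al = be"
proof (rule ccontr)
 assume ne: "al ~= be"
 note th = new_irr[OF new]
 have L0: "(SUM g:GG. KK th al x (g * M) * KK th be (g * N) y) = 0" if M: "M : XX" and N: "N : XX" and x: "x : XX" and y: "y : XX" for M N x y
 proof -
  define f where "f x y = (SUM g:GG. KK th al x (g * M) * KK th be (g * N) y)" for x y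
  have "f x y = 0"
  proof (rule kernel_disjoint[where f = f, OF al be ne _ _ _ _ _ x y])
   fix h x y assume h: "h : GG" and x: "x : XX" and y: "y : XX"
   have "f (h * x) (h * y) = (SUM g:GG. KK th al (h * x) (h * g * M) * KK th be (h * g * N) (h * y))"
    unfolding f_def by (rule G.sum_left[OF h, of "%g. KK th al (h * x) (g * M) * KK th be (g * N) (h * y)", symmetric])
   also have "... = f x y" unfolding f_def
    by (intro sum.cong refl) (simp add: ga h M N x y gc KK_invariant_left[OF th al] KK_invariant_left[OF th be])
   finally show "f (h * x) (h * y) = f x y" .
  next
   fix x assume "x : XX"
   show "cuspidal n j (f x)" unfolding f_def[abs_def] by (intro cuspidal_sum KK_cuspidal_right[OF new be] gc N)
   fix y assume "y : XX"
   then show "\<not> injm j x ==> f x y = 0" using \<open>x : XX\<close> by (simp add: f_def KK_0[OF new] gc M)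
   have "(SUM t:SS. be t * f x (y *t minv j t)) = (SUM g:GG. KK th al x (g * M) * (SUM t:SS. be t * KK th be (g * N) (y *t minv j t)))"
    unfolding f_def sum_distrib_left by (subst sum.swap) (simp add: mult.left_commute)
   then show "(SUM t:SS. be t * f x (y *t minv j t)) = of_nat (card SS) / be (idm j) * f x y"
    unfolding KK_right[OF be \<open>y : XX\<close>] by (simp add: f_def sum_distrib_left mult.left_commute)
   have "(SUM t:SS. al t * f (x *t t) y) = (SUM g:GG. (SUM t:SS. al t * KK th al (x *t t) (g * M)) * KK th be (g * N) y)"
    unfolding f_def sum_distrib_left sum_distrib_right by (subst sum.swap) (simp add: mult.assoc)
   also have "... = (SUM g:GG. of_nat (card SS) / al (idm j) * KK th al x (g * M) * KK th be (g * N) y)"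
    by (intro sum.cong refl) (simp add: KK_left[OF th al \<open>x : XX\<close> gc[OF _ M]])
   finally show "(SUM t:SS. al t * f (x *t t) y) = of_nat (card SS) / al (idm j) * f x y"
    by (simp add: f_def sum_distrib_left mult.assoc)
  qed
  then show ?thesis by (simp add: f_def)
 qed
 let ?ca = "mm th al / tp th al (idm n, idm j) * al (idm j)" and ?cb = "cnj (mm th be / tp th be (idm n, idm j) * be (idm j))"
 have ta: "(SUM M:XX. KK th al M (g * M)) = ?ca * th g" if g: "g : GG" for g
  using KK_trace[OF th al, of "(g, idm j)"] g gc[OF g] by (simp add: act_def one_GLm tp_def cong: sum.cong)
 have tb: "(SUM M:XX. KK th be (g * M) M) = ?cb * cnj (th g)" if g: "g : GG" for g
  using KK_trace_swap[OF th be, of "(g, idm j)"] g gc[OF g] by (simp add: act_def one_GLm tp_def cong: sum.cong)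
 have "0 = (SUM M:XX. SUM N:XX. SUM g:GG. KK th al M (g * M) * KK th be (g * N) N)" using L0 by simp
 also have "... = (SUM g:GG. SUM M:XX. SUM N:XX. KK th al M (g * M) * KK th be (g * N) N)"
  by (simp add: sum.swap[of _ XX GG])
 also have "... = (SUM g:GG. (?ca * th g) * (?cb * cnj (th g)))"
  by (intro sum.cong refl) (simp only: sum_product[symmetric] ta tb)
 also have "... = ?ca * ?cb * (SUM g:GG. th g * cnj (th g))"
  unfolding sum_distrib_left by (rule sumc) (simp only: mult_ac)
 also have "... = ?ca * ?cb * of_nat (card GG)" by (simp only: G.sphericalD(3)[OF G.irr_spherical[OF th]])
 finally show False
  using mma mmb G.card_pos P.sphericalD(1)[OF tp_spherical[OF th al]] P.sphericalD(1)[OF tp_spherical[OF th be]] by (auto simp: tp_def)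
qed

text \<open>Each averaged product f M N of two kernels is a multiple of the kernel itself, and
  taking its trace over x = y determines the multiple. The sum of f M N M N over all M and N is then
  evaluated twice, through these multiples and through characters; the comparison makes the squared
  multiplicity 1.\<close>

lemma new_multiplicity:
 assumes new: "new_char n j th" and al: "al : S.irr" and mm: "mm th al ~= 0"
 shows "mm th al * cnj (mm th al) = (of_nat (card (GG \<times> SS)))\<^sup>2"
proof -
 note th = new_irr[OF new]
 note sp = tp_spherical[OF th al]
 let ?K = "KK th al" and ?\<Gamma> = "GG \<times> SS" and ?d = "tp th al (idm n, idm j)" and ?m = "mm th al"
 let ?k = "?K M0 M0"
 have d0: "?d ~= 0" and cd: "cnj ?d = ?d" using P.sphericalD(1)[OF sp] P.sphericalD(2)[OF sp P.e_in] by (simp_all add: piv_def)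
 have k0: "?k ~= 0" by (rule KK_M0[OF new al mm])
 define C where "C = of_nat (card ?\<Gamma>) / ?d"
 define f where "f M N x y = (SUM p:?\<Gamma>. ?K x (act p M) * ?K (act p N) y)" for M N x y
 have inv: "?K (act p x) (act p y) = ?K x y" if "p : ?\<Gamma>" "x : XX" "y : XX" for p x y by (rule P.kr_invariant[OF sp that])
 have fi: "f M N (act q x) (act q y) = f M N x y" if "q : ?\<Gamma>" "M : XX" "N : XX" "x : XX" "y : XX" for q M N x y
 proof -
  have "f M N (act q x) (act q y) = (SUM p:?\<Gamma>. ?K (act q x) (act (pmul q p) M) * ?K (act (pmul q p) N) (act q y))"
   unfolding f_def by (rule P.sum_left[OF that(1), of "%p. ?K (act q x) (act p M) * ?K (act p N) (act q y)", symmetric])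
  also have "... = f M N x y" unfolding f_def using that
   by (intro sum.cong refl) (simp only: P.act_mul inv P.act_in)
  finally show ?thesis .
 qed
 have prp: "?k * f M N x y = f M N M0 M0 * ?K x y" if M: "M : XX" and N: "N : XX" and x: "x : XX" and y: "y : XX" for M N x y
 proof (rule KK_proportional[where f = "f M N", OF new al _ _ _ _ _ x y])
  show "f M N (g * x) (g * y) = f M N x y" if "g : GG" "x : XX" "y : XX" for g x y
   using fi[of "(g, idm j)" M N x y] that M N gc by (simp add: act_def one_GLm)
  show "f M N (x *t t) (y *t t) = f M N x y" if "t : SS" "x : XX" "y : XX" for t x y
   using fi[of "(idm n, t)" M N x y] that M N by (simp add: act_def one_GLm)
  show "cuspidal n j (f M N x)" if "x : XX" for x
   unfolding f_def[abs_def] by (intro cuspidal_sum KK_cuspidal_right[OF new al] P.act_in N)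
  show "f M N x y = 0" if "x : XX" "y : XX" "\<not> injm j x" for x y
   unfolding f_def by (intro sum.neutral ballI) (simp add: KK_0[OF new that(1) P.act_in[OF _ M] that(3)])
  show "(SUM t:SS. al t * f M N x (y *t minv j t)) = of_nat (card SS) / al (idm j) * f M N x y" if "x : XX" "y : XX" for x y
  proof -
   have "(SUM t:SS. al t * f M N x (y *t minv j t)) = (SUM p:?\<Gamma>. ?K x (act p M) * (SUM t:SS. al t * ?K (act p N) (y *t minv j t)))"
    unfolding f_def sum_distrib_left by (subst sum.swap) (simp add: mult.left_commute)
   then show ?thesis unfolding KK_right[OF al that(2)] by (simp add: f_def sum_distrib_left mult.left_commute)
  qed
 qed
 have tr: "(SUM x:XX. f M N x x) = of_nat (card ?\<Gamma>) * C * ?K N M" if M: "M : XX" and N: "N : XX" for M N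
 proof -
  have "(SUM x:XX. f M N x x) = (SUM p:?\<Gamma>. SUM x:XX. ?K (act p N) x * ?K x (act p M))"
   unfolding f_def by (subst sum.swap) (simp add: mult.commute)
  also have "... = (SUM p:?\<Gamma>. C * ?K N M)"
   using M N by (intro sum.cong refl) (simp only: P.kr_idempotent[OF sp] P.act_in inv C_def)
  finally show ?thesis by simp
 qed
 have e1: "?k * (of_nat (card ?\<Gamma>) * C * ?K N M) = f M N M0 M0 * ?m" if M: "M : XX" and N: "N : XX" for M N
 proof -
  have "?k * (SUM x:XX. f M N x x) = (SUM x:XX. f M N M0 M0 * ?K x x)"
   unfolding sum_distrib_left by (intro sum.cong refl prp[OF M N])
  then show ?thesis using tr[OF M N] KK_trace_1[OF th al] by (simp add: sum_distrib_left[symmetric])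
 qed
 have "(SUM M:XX. SUM N:XX. f M N M N) = (SUM p:?\<Gamma>. (SUM M:XX. ?K M (act p M)) * (SUM N:XX. ?K (act p N) N))"
  unfolding f_def by (simp add: sum.swap[of _ XX ?\<Gamma>] sum_product)
 also have "... = (SUM p:?\<Gamma>. (?m * cnj ?m / (?d * ?d)) * (tp th al p * cnj (tp th al p)))"
  using cd by (intro sum.cong refl) (simp add: KK_trace[OF th al] KK_trace_swap[OF th al])
 also have "... = ?m * cnj ?m / (?d * ?d) * of_nat (card ?\<Gamma>)"
  using P.sphericalD(3)[OF sp] by (simp only: sum_distrib_left[symmetric])
 finally have A: "(SUM M:XX. SUM N:XX. f M N M N) = ?m * cnj ?m / (?d * ?d) * of_nat (card ?\<Gamma>)" .
 have "?k * ?m * (SUM M:XX. SUM N:XX. f M N M N) = (SUM M:XX. SUM N:XX. ?m * (?k * f M N M N))"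
  unfolding sum_distrib_left by (intro sum.cong refl) (simp only: mult_ac)
 also have "... = (SUM M:XX. SUM N:XX. f M N M0 M0 * ?m * ?K M N)"
 proof (intro sum.cong refl)
  fix M N assume "M : XX" "N : XX"
  note prp[OF this this]
  then show "?m * (?k * f M N M N) = f M N M0 M0 * ?m * ?K M N" by (simp only: mult_ac)
 qed
 also have "... = (SUM M:XX. SUM N:XX. ?k * (of_nat (card ?\<Gamma>) * C * ?K N M) * ?K M N)"
  by (intro sum.cong refl) (simp only: e1)
 also have "... = ?k * of_nat (card ?\<Gamma>) * C * (SUM M:XX. SUM N:XX. ?K M N * ?K N M)"
  by (simp add: sum_distrib_left mult_ac)
 also have "(SUM M:XX. SUM N:XX. ?K M N * ?K N M) = (SUM M:XX. C * ?K M M)"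
  by (intro sum.cong refl) (simp only: P.kr_idempotent[OF sp] C_def)
 also have "... = C * ?m" using KK_trace_1[OF th al] by (simp add: sum_distrib_left[symmetric])
 finally have "(SUM M:XX. SUM N:XX. f M N M N) = of_nat (card ?\<Gamma>) * C * C" using k0 mm by simp
 then have "?m * cnj ?m * of_nat (card ?\<Gamma>) = (of_nat (card ?\<Gamma>))\<^sup>2 * of_nat (card ?\<Gamma>)"
  unfolding A C_def using d0 by (simp add: field_simps power2_eq_square)
 then show ?thesis using P.card_pos by simp
qed

end

section \<open>Characters of S of true level below 2j - n\<close>

definition im :: "nat => 'a::field mat => 'a vec set" where
 "im j M = (%y. M *v y) ` Vec j"

text \<open>The last n - j coordinates, which cut out the image of \<open>std_inj n j\<close>. In
  this way a subspace of dimension j is recorded by n - j functionals.\<close>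

definition std_proj :: "nat => nat => 'a::field mat" where
 "std_proj n j = mat (n - j) n (%(a,b). if b = a + j then 1 else 0)"

lemma std_proj_kernel:
 fixes x :: "'a::field vec"
 assumes jn: "j <= n" and x: "x : Vec n"
 shows "std_proj n j *v x = zv (n - j) <-> x : im j (std_inj n j)"
proof -
 have Dc: "(std_proj n j :: 'a mat) : Mat (n - j) n" by (simp add: std_proj_def)
 have Ic: "(std_inj n j :: 'a mat) : Mat n j" by (simp add: std_inj_def)
 have D: "(std_proj n j *v x) $ a = x $ (a + j)" if a: "a < n - j" for a
 proof -
  have "(std_proj n j *v x) $ a = (\<Sum>k<n. if k = a + j then x $ k else 0)"
   unfolding mult_mat_vec_index[OF Dc x a] using a by (intro sum.cong refl) (simp add: std_proj_def)
  then show ?thesis using a by simp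
 qed
 have I: "(std_inj n j *v y) $ i = (if i < j then y $ i else 0)" if y: "y : Vec j" and i: "i < n" for y :: "'a vec" and i
 proof -
  have "(std_inj n j *v y) $ i = (\<Sum>k<j. if k = i then y $ k else 0)"
   unfolding mult_mat_vec_index[OF Ic y i] using i by (intro sum.cong refl) (auto simp: std_inj_def)
  then show ?thesis by simp
 qed
 show ?thesis
 proof
  assume 0: "std_proj n j *v x = zv (n - j)"
  have z: "x $ i = 0" if "j <= i" "i < n" for i
   using D[of "i - j"] 0 that by simp
  have "x = std_inj n j *v vec j (%i. x $ i)"
  proof (rule eq_vecI)
   fix i assume "i < dim_vec (std_inj n j *v vec j (%i. x $ i))"
   then have "i < n" using Ic by simp
   then show "x $ i = (std_inj n j *v vec j (%i. x $ i)) $ i" using I[of "vec j (%i. x $ i)" i] z[of i] by simp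
  qed (use x Ic in simp)
  then show "x : im j (std_inj n j)" unfolding im_def by (metis imageI vec_carrier)
 next
  assume "x : im j (std_inj n j)"
  then obtain y where y: "y : Vec j" "x = std_inj n j *v y" by (auto simp: im_def)
  show "std_proj n j *v x = zv (n - j)"
  proof (rule eq_vecI)
   fix a assume "a < dim_vec (zv (n - j) :: 'a vec)"
   then have a: "a < n - j" by simp
   then show "(std_proj n j *v x) $ a = zv (n - j) $ a" using D[OF a] I[OF y(1), of "a + j"] y(2) by simp
  qed (use Dc in simp)
 qed
qed

lemma std_proj_carrier: "std_proj n j : Mat (n - j) n"
 by (simp add: std_proj_def)

lemma im_mult:
 fixes g :: "'a::field mat"
 assumes g: "g : GLm n" and M: "M : Mat n j" and x: "x : Vec n"
 shows "x : im j (g * M) <-> minv n g *v x : im j M"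
proof
 assume "x : im j (g * M)"
 then obtain y where y: "y : Vec j" "x = g *v (M *v y)" using assoc_mult_mat_vec[OF GLm_carrier[OF g] M] by (auto simp: im_def)
 have "M *v y : Vec n" using M y by auto
 then have "minv n g *v x = M *v y" using GLm_cancel_vec(1)[OF g] y(2) by simp
 then show "minv n g *v x : im j M" using y by (auto simp: im_def)
next
 assume "minv n g *v x : im j M"
 then obtain y where y: "y : Vec j" "minv n g *v x = M *v y" by (auto simp: im_def)
 have "x = g *v (M *v y)" using GLm_cancel_vec(2)[OF g x] y(2) by simp
 then have "x = (g * M) *v y" using assoc_mult_mat_vec[OF GLm_carrier[OF g] M y(1)] by simp
 then show "x : im j (g * M)" using y(1) by (auto simp: im_def)
qed

lemma im_mult_transpose:
 fixes M :: "'a::field mat"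
 assumes M: "M : Mat n j" and s: "s : GLm j"
 shows "im j (M * trm s) = im j M"
proof -
 have st: "trm s : GLm j" by (rule transpose_GLm[OF s])
 note sc = GLm_carrier[OF st]
 have a: "(M * trm s) *v y = M *v (trm s *v y)" if "y : Vec j" for y
  by (rule assoc_mult_mat_vec[OF M sc that])
 show ?thesis
 proof
  show "im j (M * trm s) \<subseteq> im j M" using a sc by (auto simp: im_def)
  show "im j M \<subseteq> im j (M * trm s)"
  proof
   fix x assume "x : im j M"
   then obtain y where y: "y : Vec j" "x = M *v y" by (auto simp: im_def)
   have y': "minv j (trm s) *v y : Vec j" using minv_carrier[OF st] y by auto
   have "x = (M * trm s) *v (minv j (trm s) *v y)" using a[OF y'] GLm_cancel_vec(2)[OF st y(1)] y(2) by simp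
   then show "x : im j (M * trm s)" using y' by (auto simp: im_def)
  qed
 qed
qed

context gl_pair
begin

text \<open>The stabilizer of L in S acts on injective matrices with quotient the set of pairs (im M, M L).\<close>

lemma pair_kernel_vanishes:
 assumes new: "new_char n j th" and i: "i + n < 2 * j"
  and D: "D : Mat (n - j) n" "D' : Mat (n - j) n" and E: "E : Mat n i" "E' : Mat n i"
 shows "(SUM g:GG. if D * minv n g = D' & g * E = E' then cnj (th g) else 0) = 0"
proof -
 let ?Y = "(Mat (n - j) n :: 'a mat set) \<times> (Mat n i :: 'a mat set)"
 interpret Y: group_action_on GG "(*)" "idm n" "minv n" ?Y "%g p. (fst p * minv n g, g * snd p)"
 proof unfold_locales
  fix g h :: "'a mat" and p assume *: "g : GG" "h : GG" "p : ?Y"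
  have "fst p * (minv n h * minv n g) = fst p * minv n h * minv n g"
   by (rule assoc_mult_mat[OF _ minv_carrier[OF *(2)] minv_carrier[OF *(1)], symmetric]) (use * in auto)
  moreover have "g * h * snd p = g * (h * snd p)" by (rule assoc_mult_mat[OF GLm_carrier[OF *(1)] GLm_carrier[OF *(2)]]) (use * in auto)
  ultimately show "(fst p * minv n (g * h), g * h * snd p) = (fst (fst p * minv n h, h * snd p) * minv n g, g * snd (fst p * minv n h, h * snd p))"
   using G.iv_mul[OF *(1,2)] by simp
  show "(fst p * minv n g, g * snd p) : ?Y" using * minv_carrier[OF *(1)] GLm_carrier[OF *(1)] by (auto intro!: mult_carrier_mat)
 qed auto
 have eqv: "N * minv n g = N <-> N * g = N" if g: "g : GG" and N: "N : Mat (n - j) n" for g N :: "'a mat"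
 proof -
  have "N * minv n g * g = N" "N * g * minv n g = N"
   using N minv[OF g] minv_carrier[OF g] GLm_carrier[OF g] assoc_mult_mat[OF N minv_carrier[OF g] GLm_carrier[OF g]] assoc_mult_mat[OF N GLm_carrier[OF g] minv_carrier[OF g]] by simp_all
  then show ?thesis by metis
 qed
 have fx: "Y.fixc g = tau_m n g ^ (n - j + i)" if g: "g : GG" for g
 proof -
  have "{p : ?Y. (fst p * minv n g, g * snd p) = p} = {N : Mat (n - j) n. N * g = N} \<times> {N : Mat n i. g * N = N}"
   using eqv[OF g] by auto
  then have "Y.fixc g = of_nat (card {N : Mat n (n - j). g * N = N}) * of_nat (card {N : Mat n i. g * N = N})"
   unfolding Y.fixc_def using fixed_rows[OF GLm_carrier[OF g], of "n - j"] by (simp add: card_cartesian_product)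
  then show ?thesis using tau_pow[OF g] by (simp add: power_add)
 qed
 \<comment> \<open>Here 2j - n enters: n - j functionals and i vectors together number less than j,
   and a character of true level at least j does not occur in the functions on them.\<close>
 have "n - j + i < j" using i jn by simp
 then have "(SUM g:GG. Y.fixc g * cnj (th g)) = 0" using new by (simp add: new_char_def fx cong: sum.cong)
 from Y.kr_eq_0[OF G.irr_spherical[OF new_irr[OF new]] this, of "(D',E')" "(D,E)"] D E
 have "Y.kr th (D',E') (D,E) = 0" by simp
 then show ?thesis by (simp add: Y.kr_def)
qed

text \<open>For injective M and N, some s with L s = L satisfies g N = M s^T exactly if g N and M
  have the same image and g maps N L^T to M L^T. Equality of images is spelled out as a sum over all
  D' with kernel im M, and each summand vanishes by \<open>pair_kernel_vanishes\<close>.\<close>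

lemma stabilizer_sum_0:
 assumes new: "new_char n j th" and i: "i + n < 2 * j"
  and L: "L : Mat i j" and M: "M : XX" "injm j M" and N: "N : XX" "injm j N"
 shows "(SUM s:SS. if L * s = L then Gkr n th (M *t s) N else 0) = 0"
proof -
 let ?Lt = "trm L"
 have Lt: "?Lt : Mat j i" using L by simp
 obtain h where h: "h : GG" "h * M0 = N" using GL_transitive[OF M0 N] by blast
 define D0 where "D0 = std_proj n j * minv n h"
 have D0: "D0 : Mat (n - j) n" unfolding D0_def by (rule mult_carrier_mat[OF std_proj_carrier minv_carrier[OF h(1)]])
 have D0k: "D0 *v x = zv (n - j) <-> x : im j N" if x: "x : Vec n" for x
 proof -
  have hx: "minv n h *v x : Vec n" using minv_carrier[OF h(1)] x by auto
  have "D0 *v x = std_proj n j *v (minv n h *v x)" unfolding D0_def by (rule assoc_mult_mat_vec[OF std_proj_carrier minv_carrier[OF h(1)] x])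
  then show ?thesis using std_proj_kernel[OF jn hx] im_mult[OF h(1) M0(1) x] h(2) by simp
 qed
 define Q where "Q = {D : Mat (n - j) n. ALL x:Vec n. D *v x = zv (n - j) <-> x : im j M}"
 have finQ: "finite Q" by (rule finite_subset[of _ "Mat (n - j) n"]) (auto simp: Q_def)
 define cd where "cd g <-> im j (g * N) = im j M & g * (N * ?Lt) = M * ?Lt" for g
 have imc: "im j A \<subseteq> Vec n" if "A : XX" for A using that by (auto simp: im_def)
 have Q: "D0 * minv n g : Q <-> im j (g * N) = im j M" if g: "g : GG" for g
 proof -
  have gi: "minv n g : Mat n n" by (rule minv_carrier[OF g])
  have k: "(D0 * minv n g) *v x = zv (n - j) <-> x : im j (g * N)" if x: "x : Vec n" for x
  proof -
   have "minv n g *v x : Vec n" using gi x by auto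
   then show ?thesis using assoc_mult_mat_vec[OF D0 gi x] D0k im_mult[OF g N(1) x] by simp
  qed
  have "D0 * minv n g : Q <-> (ALL x:Vec n. x : im j (g * N) <-> x : im j M)"
   using k mult_carrier_mat[OF D0 gi] by (auto simp: Q_def)
  also have "... <-> im j (g * N) = im j M" using imc[OF gc[OF g N(1)]] imc[OF M(1)] by blast
  finally show ?thesis .
 qed
 have NL: "N * ?Lt : Mat n i" "M * ?Lt : Mat n i" using N M Lt by auto
 have "(SUM D':Q. SUM g:GG. if D0 * minv n g = D' & g * (N * ?Lt) = M * ?Lt then cnj (th g) else 0) = 0"
  by (rule sum.neutral, rule ballI, rule pair_kernel_vanishes[OF new i D0 _ NL]) (simp add: Q_def)
 then have "(SUM g:GG. SUM D':Q. if D0 * minv n g = D' & g * (N * ?Lt) = M * ?Lt then cnj (th g) else 0) = 0"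
  by (subst sum.swap)
 moreover have "(SUM D':Q. if D0 * minv n g = D' & g * (N * ?Lt) = M * ?Lt then cnj (th g) else 0) = (if cd g then cnj (th g) else 0)"
  if g: "g : GG" for g
 proof (cases "g * (N * ?Lt) = M * ?Lt")
  case True
  then have "(SUM D':Q. if D0 * minv n g = D' & g * (N * ?Lt) = M * ?Lt then cnj (th g) else 0) = (SUM D':Q. if D0 * minv n g = D' then cnj (th g) else 0)"
   by simp
  also have "... = (if D0 * minv n g : Q then cnj (th g) else 0)" using finQ by simp
  finally show ?thesis using Q[OF g] True by (simp add: cd_def)
 qed (simp add: cd_def)
 ultimately have Z: "(SUM g:GG. if cd g then cnj (th g) else 0) = 0" by (simp cong: sum.cong)
 \<comment> \<open>s is unique because M is injective, so summing over s counts the condition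
   \<open>cd\<close> once.\<close>
 have one: "(SUM s:SS. if L * s = L then (if g * N = M *t s then c else 0) else 0) = (if cd g then c else 0)" if g: "g : GG" for g and c :: complex
 proof -
  have gN: "g * N : XX" by (rule gc[OF g N(1)])
  have to_cd: "cd g" if s: "s : SS" "L * s = L" "g * N = M *t s" for s
  proof -
   have sc: "s : Mat j j" by (rule GLm_carrier[OF s(1)])
   have "g * (N * ?Lt) = M *t s * ?Lt" using assoc_mult_mat[OF GLm_carrier[OF g] N(1) Lt] s(3) by simp
   also have "... = M * (trm s * ?Lt)" by (rule assoc_mult_mat[OF M(1) _ Lt]) (use sc in simp)
   also have "trm s * ?Lt = ?Lt" using transpose_mult[OF L sc] s(2) by simp
   finally show ?thesis using s(3) im_mult_transpose[OF M(1) s(1)] by (simp add: cd_def)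
  qed
  show ?thesis
  proof (cases "cd g")
   case False
   then have "\<not> (L * s = L & g * N = M *t s)" if "s : SS" for s using to_cd that by blast
   then show ?thesis using False by (intro trans[OF sum.neutral]) auto
  next
   case True
   have "(g * N) *v y : (%z. M *v z) ` Vec j" if "y : Vec j" for y
    using True that unfolding cd_def im_def by blast
   then obtain D where D: "D : Mat j j" "g * N = M * D" using factor_through[OF M(1) gN] by blast
   have gNi: "injm j (g * N)" using injm_mult_left[OF g N(1)] N(2) by simp
   have "D : GLm j"
   proof (rule GLm_if_injective[OF D(1)])
    fix v :: "'a vec" assume v: "v : Vec j" "D *v v = zv j"
    have "(g * N) *v v = M *v zv j" unfolding D(2) using assoc_mult_mat_vec[OF M(1) D(1) v(1)] v(2) by simp
    also have "... = zv n" using M(1) by (intro eq_vecI) auto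
    finally show "v = zv j" using gNi v(1) gN by (auto simp: injm_def)
   qed
   then have s0: "trm D : SS" by (rule transpose_GLm)
   have "M * (D * ?Lt) = M * ?Lt" using True D assoc_mult_mat[OF M(1) D(1) Lt] assoc_mult_mat[OF GLm_carrier[OF g] N(1) Lt] by (simp add: cd_def)
   then have "D * ?Lt = ?Lt" by (rule injm_cancel_mat[OF M mult_carrier_mat[OF D(1) Lt] Lt])
   then have "trm (D * ?Lt) = L" by simp
   then have Ls: "L * trm D = L" using transpose_mult[OF D(1) Lt] by simp
   have un: "s = trm D" if s: "s : SS" "g * N = M *t s" for s
   proof -
    have eq: "M * D = M * trm s" using s(2) D(2) by simp
    have "D = trm s" by (rule injm_cancel_mat[OF M D(1) _ eq]) (use GLm_carrier[OF s(1)] in simp)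
    then show ?thesis by simp
   qed
   have "(SUM s:SS. (if L * s = L then (if g * N = M *t s then c else 0) else 0)) = (SUM s:SS. (if s = trm D then c else 0))"
   proof (rule sumc)
    fix s assume s: "s : SS"
    show "(if L * s = L then (if g * N = M *t s then c else 0) else 0) = (if s = trm D then c else 0)"
    proof (cases "s = trm D")
     case t: True
     have "g * N = M *t s" unfolding t D(2) by simp
     then show ?thesis using Ls t by simp
    next
     case False
     then have "g * N ~= M *t s" using un[OF s] by blast
     then show ?thesis using False by simp
    qed
   qed
   also have "... = (if trm D : SS then c else 0)" by (rule sum.delta) simp
   finally show ?thesis unfolding if_P[OF s0] if_P[OF True] .
  qed
 qed
 have "(SUM s:SS. if L * s = L then Gkr n th (M *t s) N else 0) = (SUM s:SS. SUM g:GG. if L * s = L then (if g * N = M *t s then cnj (th g) else 0) else 0)"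
  by (intro sum.cong refl) simp
 also have "... = (SUM g:GG. SUM s:SS. if L * s = L then (if g * N = M *t s then cnj (th g) else 0) else 0)" by (rule sum.swap)
 also have "... = (SUM g:GG. if cd g then cnj (th g) else 0)" by (intro sum.cong refl one)
 finally show ?thesis using Z by simp
qed

text \<open>The averages of the kernel over the stabilizers of i x j matrices L vanish. Summed over
  L, the weight of s becomes the i-th power of tau, and the total is a nonzero multiple of the
  multiplicity of al in that power times the multiplicity of the pair.\<close>

lemma low_alpha_old:
 assumes new: "new_char n j th" and al: "al : S.irr" and i: "i + n < 2 * j" and nz: "(SUM s:SS. tau_m j s ^ i * cnj (al s)) ~= 0"
 shows "mm th al = 0"
proof -
 note th = new_irr[OF new]
 let ?d = "tp th al (idm n, idm j)"
 have KZ: "(SUM s:SS. if L * s = L then KK th al (M *t s) N else 0) = 0" if L: "L : Mat i j" and M: "M : XX" and N: "N : XX" for L M N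
 proof (cases "injm j M & injm j N")
  case True
  have "(SUM s:SS. if L * s = L then KK th al (M *t s) N else 0)
   = (SUM s:SS. SUM t:SS. cnj (al t) * (if L * s = L then Gkr n th (M *t s) (N *t t) else 0))"
   by (intro sum.cong refl) (simp add: KK_expand[OF N])
  also have "... = (SUM t:SS. cnj (al t) * (SUM s:SS. if L * s = L then Gkr n th (M *t s) (N *t t) else 0))"
   by (subst sum.swap) (simp only: sum_distrib_left)
  also have "... = 0"
   using stabilizer_sum_0[OF new i L M _ rc[OF N] injm_mult_transpose[OF N]] True by (intro sum.neutral ballI) auto
  finally show ?thesis .
 next
  case False
  have "KK th al (M *t s) N = 0" if s: "s : SS" for s
  proof (cases "injm j N")
   case True
   have "\<not> injm j (M *t s)"
   proof
    assume "injm j (M *t s)"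
    from injm_mult_transpose[OF rc[OF M s] this S.iv_in[OF s]] have "injm j M" using ra[OF M s S.iv_in[OF s]] M s by simp
    with False True show False by simp
   qed
   then show ?thesis by (rule KK_0[OF new rc[OF M s] N])
  next
   case F2: False
   have "KK th al (M *t s) N = cnj (KK th al N (M *t s))" by (rule P.kr_hermitian[OF tp_spherical[OF th al] N rc[OF M s]])
   then show ?thesis using KK_0[OF new N rc[OF M s] F2] by simp
  qed
  then show ?thesis by (intro sum.neutral) simp
 qed
 have tr: "(SUM M:XX. KK th al (M *t s) M) = cnj (mm th al / ?d * th (idm n)) * cnj (al s)" if s: "s : SS" for s
  using KK_trace_swap[OF th al, of "(idm n, s)"] s by (simp add: act_def one_GLm tp_def cong: sum.cong)
 have "0 = (SUM L:Mat i j. SUM M:XX. SUM s:SS. if L * s = L then KK th al (M *t s) M else 0)" using KZ by simp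
 also have "... = (SUM s:SS. SUM L:Mat i j. SUM M:XX. if L * s = L then KK th al (M *t s) M else 0)"
  by (simp only: sum.swap[of _ XX SS] sum.swap[of _ "Mat i j" SS])
 also have "... = (SUM s:SS. tau_m j s ^ i * (SUM M:XX. KK th al (M *t s) M))"
 proof (rule sumc)
  fix s assume s: "s : SS"
  have "(SUM L:Mat i j. SUM M:XX. if L * s = L then KK th al (M *t s) M else 0)
   = (SUM L:Mat i j. if L * s = L then (SUM M:XX. KK th al (M *t s) M) else 0)" by (intro sum.cong refl) simp
  also have "... = of_nat (card {L : Mat i j. L * s = L}) * (SUM M:XX. KK th al (M *t s) M)"
   by (simp add: sum.If_cases Int_def)
  finally show "(SUM L:Mat i j. SUM M:XX. if L * s = L then KK th al (M *t s) M else 0) = tau_m j s ^ i * (SUM M:XX. KK th al (M *t s) M)"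
   using fixed_rows[OF GLm_carrier[OF s], of i] tau_pow[OF s, of i] by simp
 qed
 also have "... = cnj (mm th al / ?d * th (idm n)) * (SUM s:SS. tau_m j s ^ i * cnj (al s))"
 proof -
  have "(SUM s:SS. tau_m j s ^ i * (SUM M:XX. KK th al (M *t s) M)) = (SUM s:SS. cnj (mm th al / ?d * th (idm n)) * (tau_m j s ^ i * cnj (al s)))"
   by (rule sumc) (simp only: tr mult_ac)
  then show ?thesis by (simp only: sum_distrib_left)
 qed
 finally have "cnj (mm th al / ?d * th (idm n)) = 0" using nz by (metis mult_eq_0_iff)
 then show ?thesis using P.sphericalD(1)[OF tp_spherical[OF th al]] by (auto simp: tp_def)
qed

end

section \<open>The weighted cuspidal function attached to \<alpha>\<close>

lemma card_subsp_functional: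
 fixes V :: "'a::{finite,field} vec set"
 assumes V: "subsp j V" and et: "et : Vec j" and v: "v : V" "et *. v ~= 0"
 shows "card V = CARD('a) * card {p\<in>V. et *. p = 0}"
proof -
 have Vc: "V \<subseteq> Vec j" using V by (simp add: subsp_def)
 define A where "A = mat 1 j (%(_,b). et $ b)"
 have A: "A : Mat 1 j" by (simp add: A_def)
 have Ap: "A *v p = vec 1 (%_. et *. p)" if p: "p : Vec j" for p
 proof (rule eq_vecI)
  fix i assume "i < dim_vec (vec 1 (%_. et *. p))"
  then have i: "i < 1" by simp
  have "(A *v p) $ i = (\<Sum>k<j. et $ k * p $ k)" unfolding mult_mat_vec_index[OF A p i] using i by (intro sum.cong refl) (simp add: A_def)
  then show "(A *v p) $ i = vec 1 (%_. et *. p) $ i" using i p by (simp add: scalar_prod_def atLeast0LessThan)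
 qed (use A in simp)
 have "(%x. A *v x) ` V = Vec 1"
 proof
  show "Vec 1 \<subseteq> (%x. A *v x) ` V"
  proof
   fix c :: "'a vec" assume c: "c : Vec 1"
   have vc: "v : Vec j" using v Vc by auto
   have "(c $ 0 / (et *. v)) *s v : V" using V v by (simp add: subsp_def)
   moreover have "A *v ((c $ 0 / (et *. v)) *s v) = c" using c v(2) vc et by (subst Ap) (auto intro!: eq_vecI)
   ultimately show "c : (%x. A *v x) ` V" by (metis imageI)
  qed
 qed (use A Vc in auto)
 moreover have "{p\<in>V. A *v p = zv 1} = {p\<in>V. et *. p = 0}"
 proof -
  have "A *v p = zv 1 <-> et *. p = 0" if "p : V" for p
  proof -
   have "p : Vec j" using that Vc by auto
   moreover have "vec 1 (%_. c) = (zv 1 :: 'a vec) <-> c = 0" for c :: 'a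
   proof
    assume "vec 1 (%_. c) = (zv 1 :: 'a vec)"
    then have "vec 1 (%_. c) $ 0 = (zv 1 :: 'a vec) $ 0" by simp
    then show "c = 0" by simp
   qed (auto intro!: eq_vecI)
   ultimately show ?thesis using Ap by simp
  qed
  then show ?thesis by blast
 qed
 ultimately show ?thesis using card_image_kernel[OF A V] by (simp add: card_carrier_vec')
qed

text \<open>The recursion is the cancellation condition (q^n - q^(j+d)) om(d+1) + q^d om(d) = 0 for
  sums over a rank one direction, where the argument is the codimension of H. For d = n - j the
  denominator is 0 and the division returns 0; there the cancellation comes from the level of
  al.\<close>

primrec om :: "nat => nat => nat => nat => complex" where
 "om q n j 0 = 1"
| "om q n j (Suc d) = - om q n j d * of_nat q ^ d / (of_nat q ^ n - of_nat q ^ (j + d))"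

definition ldim :: "'a::{finite,field} vec set => nat" where
 "ldim V = (THE d. card V = CARD('a) ^ d)"

lemma ldim_eq:
 assumes "card (V :: 'a::{finite,field} vec set) = CARD('a) ^ d"
 shows "ldim V = d"
proof -
 have "CARD('a) > 1" using card_UNIV_field[where 'a='a] by simp
 then show ?thesis unfolding ldim_def assms by (intro the_equality) (auto dest: power_inject_exp)
qed

lemma vec_arith:
 fixes a b u :: "'a::field vec"
 assumes "a : Vec n" "b : Vec n" "u : Vec n"
 shows "a + (b - a) = b" "a + u - a = u" "a + b + u = a + u + b" "a - b = a + u - (b + u)" "u = b - a <-> b = a + u"
proof -
 show 1: "a + (b - a) = b" and 2: "a + u - a = u" and "a + b + u = a + u + b" and "a - b = a + u - (b + u)"
  using assms by (auto intro!: eq_vecI)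
 show "u = b - a <-> b = a + u" using 1 2 by metis
qed

lemma preim_im: "preim j r M N = {y : Vec j. N *v y : im r M}"
 by (simp add: preim_def im_def)

lemma subsp_im: "M : Mat n r ==> subsp n (im r M)"
 unfolding im_def by (rule subsp_image)

context gl_pair
begin

definition compat :: "'a mat => 'a vec set => 'a mat => bool" where
 "compat N H s <-> (ALL y:H. (M0 *t s) *v y = N *v y)"

definition csum :: "('a mat => complex) => 'a mat => 'a vec set => complex" where
 "csum al N H = (SUM s:SS. if compat N H s then cnj (al s) else 0)"

abbreviation HH :: "'a mat => 'a vec set" where
 "HH N \<equiv> preim j j M0 N"

text \<open>At M0 t^T this is the conjugate of al t. At other N the conjugates of al are summed over
  all s for which M0 s^T agrees with N on H, the part of N that M0 s^T can match.\<close>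

definition ww :: "('a mat => complex) => 'a mat => complex" where
 "ww al N = om (CARD('a)) n j (j - ldim (HH N)) * csum al N (HH N)"

text \<open>In a basis C of H the condition on s reads C^T s = D^T, so the sum is a kernel of al on
  d x j matrices, and d < 2j - n is covered by the hypothesis on the level.\<close>

lemma csum_0:
 assumes al: "al : S.irr" and lv: "!!i. i + n < 2 * j ==> (SUM s:SS. tau_m j s ^ i * cnj (al s)) = 0"
  and H: "subsp j H" "card H = CARD('a) ^ d" "n + d < 2 * j" and N: "N : XX" and im: "!!y. y : H ==> N *v y : im j M0"
 shows "csum al N H = 0"
proof -
 obtain r C C' where C: "C : Mat j r" "H = {C *v c | c. c : Vec r}" "card H = CARD('a) ^ r"
  using subsp_basis[OF H(1)] by blast
 have "CARD('a) > 1" using card_UNIV_field[where 'a='a] by simp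
 then have r: "r = d" using H(2) C(3) by (metis power_inject_exp)
 have NC: "N * C : Mat n r" using N C(1) by simp
 have "(N * C) *v c : (%z. M0 *v z) ` Vec j" if c: "c : Vec r" for c
 proof -
  have "N *v (C *v c) : im j M0" by (rule im) (use C(2) c in blast)
  then show ?thesis using assoc_mult_mat_vec[OF N C(1) c] by (simp add: im_def)
 qed
 then obtain D where D: "D : Mat j r" "N * C = M0 * D" using factor_through[OF M0(1) NC] by blast
 have Ct: "trm C : Mat r j" using C(1) by simp
 have "compat N H s <-> trm C * s = trm D" if s: "s : SS" for s
 proof -
  have sc: "s : Mat j j" by (rule GLm_carrier[OF s])
  have st: "trm s : Mat j j" using sc by simp
  have Ms: "M0 *t s : XX" using M0 st by simp
  have MsC: "(M0 *t s) * C : Mat n r" using Ms C(1) by simp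
  have "compat N H s <-> (ALL c:Vec r. ((M0 *t s) * C) *v c = (N * C) *v c)"
   using assoc_mult_mat_vec[OF Ms C(1)] assoc_mult_mat_vec[OF N C(1)] unfolding compat_def C(2) by auto
  also have "... <-> (M0 *t s) * C = N * C" using mat_eq_by_vec[OF MsC NC] by auto
  also have "(M0 *t s) * C = M0 * (trm s * C)" by (rule assoc_mult_mat[OF M0(1) st C(1)])
  also have "M0 * (trm s * C) = N * C <-> trm s * C = D"
   using injm_cancel_mat[OF M0 mult_carrier_mat[OF st C(1)] D(1)] D(2) by auto
  also have "... <-> trm (trm s * C) = trm D" by (metis transpose_transpose)
  finally show ?thesis using transpose_mult[OF st C(1)] by simp
 qed
 then have "csum al N H = (SUM s:SS. if trm C * s = trm D then cnj (al s) else 0)"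
  unfolding csum_def by (intro sum.cong refl) simp
 also have "... = 0" by (rule kernel_vanishes_right[OF al lv Ct]) (use H(3) r D in auto)
 finally show ?thesis .
qed

text \<open>A kernel vector of N lies in H, but every M0 s^T is injective, so no s is
  compatible.\<close>

lemma ww_not_inj:
 assumes "N : XX" "\<not> injm j N"
 shows "ww al N = 0"
proof -
 obtain v where v: "v : Vec j" "N *v v = zv n" "v ~= zv j" using assms by (auto simp: injm_def)
 have "M0 *v zv j = zv n" using M0(1) by (intro eq_vecI) auto
 then have "zv n : im j M0" unfolding im_def by (metis image_eqI zero_carrier_vec)
 then have vH: "v : HH N" using v by (simp add: preim_im)
 have "\<not> compat N (HH N) s" if s: "s : SS" for s
 proof
  assume "compat N (HH N) s"
  then have "(M0 *t s) *v v = zv n" using vH v(2) by (auto simp: compat_def)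
  moreover have "injm j (M0 *t s)" "M0 *t s : XX" using injm_mult_transpose[OF M0 s] rc[OF M0(1) s] by auto
  ultimately show False using v by (auto simp: injm_def)
 qed
 then show ?thesis by (simp add: ww_def csum_def)
qed

text \<open>Along N + u eta^T the space H is either H0, the part where eta vanishes, or one
  dimension larger. Let H0 have codimension d + 1. The larger space occurs for q^(j+d) vectors u,
  whose sums total q^d A, and each remaining u contributes the same sum A. The recursion of
  \<open>om\<close> lets the two kinds cancel.\<close>

lemma ww_outer_sum:
 assumes al: "al : S.irr" and lv: "!!i. i + n < 2 * j ==> (SUM s:SS. tau_m j s ^ i * cnj (al s)) = 0"
  and N: "N : XX" and et: "et : Vec j" "et ~= zv j"
 shows "(SUM u:Vec n. ww al (N + outer n j u et)) = 0"
proof -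
 let ?q = "CARD('a)"
 have q1: "?q > 1" using card_UNIV_field[where 'a='a] by simp
 obtain y1 where y1: "y1 : Vec j" "et *. y1 = 1" using exists_dual_vec[OF et] by blast
 define K where "K = {p\<in>Vec j. et *. p = 0}"
 define P where "P = {p\<in>Vec j. et *. p = 1}"
 define U where "U u = N + outer n j u et" for u
 have Uc: "U u : XX" for u using N by (simp add: U_def)
 have Uv: "U u *v y = N *v y + (et *. y) *s u" if "u : Vec n" "y : Vec j" for u y
  unfolding U_def by (rule add_outer_mult_vec[OF N that])
 have Nc: "N *v y : Vec n" if "y : Vec j" for y using N that by auto
 have UK: "U u *v y = N *v y" if "u : Vec n" "y : Vec j" "et *. y = 0" for u y
  using Uv[OF that(1,2)] that(3) vec_add_smult_0[OF Nc[OF that(2)] that(1)] by simp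
 have UP: "U u *v y = N *v y + u" if "u : Vec n" "y : Vec j" "et *. y = 1" for u y
  using Uv[OF that(1,2)] that by simp
 define I where "I = im j M0"
 have I: "subsp n I" unfolding I_def by (rule subsp_im[OF M0(1)])
 note Ic = I[unfolded subsp_def, THEN conjunct1]
 have Iadd: "x + y : I" if "x : I" "y : I" for x y using I that by (simp add: subsp_def)
 have Ism: "c *s x : I" if "x : I" for c x using I that by (simp add: subsp_def)
 define H0 where "H0 = {p\<in>Vec j. et *. p = 0 & N *v p : I}"
 have HHu: "y : HH (U u) <-> y : Vec j & U u *v y : I" for y u by (simp add: preim_im I_def)
 have H0s: "subsp j H0"
 proof -
  have "subsp j (preim j j M0 N)" by (rule subsp_preim'[OF N M0(1)])
  then show ?thesis unfolding H0_def preim_im I_def using et scalar_prod_add_distrib[OF et(1)] by (auto simp: subsp_def)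
 qed
 have finH0: "finite H0" by (rule finite_subset[of _ "Vec j"]) (auto simp: H0_def)
 obtain d0 where d0: "card H0 = ?q ^ d0" using subsp_basis[OF H0s] by blast
 have cK: "?q ^ j = ?q * card K"
  using card_subsp_functional[OF subsp_carrier et(1) y1(1)] y1(2) by (simp add: card_carrier_vec' K_def)
 then have cK': "card K = ?q ^ (j - 1)" using j1 q1 by (cases j) auto
 have H0K: "H0 \<subseteq> K" "finite K" by (auto simp: H0_def K_def)
 have d0j: "d0 < j"
 proof -
  have "?q ^ d0 <= ?q ^ (j - 1)" using card_mono[OF H0K(2,1)] d0 cK' by simp
  then show ?thesis using q1 j1 by (simp add: power_increasing_iff)
 qed
 have sp_add: "et *. (x + y) = et *. x + et *. y" if "x : Vec j" "y : Vec j" for x y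
  by (rule scalar_prod_add_distrib[OF et(1) that])
 have sp_minus: "et *. (x - y) = et *. x - et *. y" if "x : Vec j" "y : Vec j" for x y
  by (rule scalar_prod_minus_distrib[OF et(1) that])
 have Im: "x - y : I" if "x : I" "y : I" for x y
 proof -
  have "x - y = x + (-1) *s y" using that Ic by (intro eq_vecI) auto
  then show ?thesis using Iadd[OF that(1) Ism[OF that(2)]] by simp
 qed
 have cP: "card P = card K"
 proof (rule bij_betw_same_card[of "%y. y - y1"], rule bij_betwI[of _ _ _ "%y. y + y1"])
  show "(%y. y - y1) : P \<rightarrow> K" using y1 sp_minus by (auto simp: P_def K_def)
  show "(%y. y + y1) : K \<rightarrow> P" using y1 sp_add by (auto simp: P_def K_def)
 qed (use y1 in \<open>auto simp: P_def K_def intro!: eq_vecI\<close>)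
 have finP: "finite P" by (rule finite_subset[of _ "Vec j"]) (auto simp: P_def)
 \<comment> \<open>Y u consists of the new points of H on the affine hyperplane of eta-value 1. It
   is empty or a coset of H0, so a sum over the u with larger H becomes a sum over pairs (y, u),
   divided by the size of H0.\<close>
 define Y where "Y u = {y\<in>P. N *v y + u : I}" for u
 have Ysub: "y - y' : H0" if u: "u : Vec n" and y: "y : Y u" "y' : Y u" for u y y'
 proof -
  have c: "y : Vec j" "y' : Vec j" using y by (auto simp: Y_def P_def)
  have "N *v (y - y') = (N *v y + u) - (N *v y' + u)"
   unfolding mult_minus_distrib_mat_vec[OF N c] by (rule vec_arith(4)[OF Nc[OF c(1)] Nc[OF c(2)] u])
  then have "N *v (y - y') : I" using Im y by (simp add: Y_def)
  then show ?thesis using c y sp_minus by (simp add: H0_def Y_def P_def)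
 qed
 have Yadd: "y + h : Y u" if u: "u : Vec n" and y: "y : Y u" and h: "h : H0" for u y h
 proof -
  have c: "y : Vec j" "h : Vec j" using y h by (auto simp: Y_def P_def H0_def)
  have "N *v (y + h) + u = (N *v y + u) + N *v h"
   unfolding mult_add_distrib_mat_vec[OF N c] by (rule vec_arith(3)[OF Nc[OF c(1)] Nc[OF c(2)] u])
  then have "N *v (y + h) + u : I" using Iadd y h by (simp add: Y_def H0_def)
  then show ?thesis using c y h sp_add by (simp add: H0_def Y_def P_def)
 qed
 have cY: "card (Y u) = card H0" if u: "u : Vec n" and ne: "Y u ~= {}" for u
 proof -
  obtain y0 where y0: "y0 : Y u" using ne by blast
  have c: "y0 : Vec j" using y0 by (simp add: Y_def P_def)
  have Yc: "Y u \<subseteq> Vec j" "H0 \<subseteq> Vec j" by (auto simp: Y_def P_def H0_def)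
  show ?thesis
  proof (rule bij_betw_same_card[of "%y. y - y0"], rule bij_betwI[of _ _ _ "%h. y0 + h"])
   show "(%y. y - y0) : Y u \<rightarrow> H0" using Ysub[OF u _ y0] by simp
   show "(%h. y0 + h) : H0 \<rightarrow> Y u" using Yadd[OF u y0] by simp
   fix y assume "y : Y u" then have "y : Vec j" using Yc by blast
   then show "y0 + (y - y0) = y" using c by (intro eq_vecI) auto
  next
   fix y assume "y : H0" then have "y : Vec j" using Yc by blast
   then show "y0 + y - y0 = y" using c by (intro eq_vecI) auto
  qed
 qed
 have outH: "HH (U u) = H0" if u: "u : Vec n" and e: "Y u = {}" for u
 proof
  show "H0 \<subseteq> HH (U u)" using UK[OF u] by (auto simp: H0_def HHu)
  show "HH (U u) \<subseteq> H0"
  proof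
   fix y assume y: "y : HH (U u)"
   then have yc: "y : Vec j" "U u *v y : I" by (auto simp: HHu)
   have "et *. y = 0"
   proof (rule ccontr)
    assume nz: "et *. y ~= 0"
    let ?y = "(1 / (et *. y)) *s y"
    have c: "?y : Vec j" using yc by simp
    have e1: "et *. ?y = 1" using nz et yc by simp
    have "N *v ?y + u = (1 / (et *. y)) *s (U u *v y)"
     using UP[OF u c e1] mult_mat_vec[OF Uc yc(1)] by simp
    then have "?y : Y u" using Ism[OF yc(2)] c e1 by (simp add: Y_def P_def)
    then show False using e by blast
   qed
   then show "y : H0" using yc UK[OF u yc(1)] by (simp add: H0_def)
  qed
 qed
 have inH: "card (HH (U u)) = ?q ^ Suc d0" if u: "u : Vec n" and y: "y : Y u" for u y
 proof -
  have yc: "y : Vec j" "et *. y = 1" "N *v y + u : I" using y by (auto simp: Y_def P_def)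
  have yH: "y : HH (U u)" using yc UP[OF u yc(1,2)] by (simp add: HHu)
  have "{p\<in>HH (U u). et *. p = 0} = H0" using UK[OF u] by (auto simp: HHu H0_def)
  then show ?thesis using card_subsp_functional[OF subsp_preim'[OF Uc M0(1)] et(1) yH] yc(2) d0 by simp
 qed
 define A where "A = csum al N H0"
 have outc: "csum al (U u) H0 = A" if u: "u : Vec n" for u
 proof -
  have "compat (U u) H0 s <-> compat N H0 s" for s using UK[OF u] by (auto simp: compat_def H0_def)
  then show ?thesis by (simp add: A_def csum_def)
 qed
 \<comment> \<open>For given y and s exactly one u makes N + u eta^T agree with M0 s^T at y; this
   collapses the double sum over u and s.\<close>
 have inc: "compat (U u) (HH (U u)) s <-> compat N H0 s & u = (M0 *t s) *v y - N *v y"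
  if u: "u : Vec n" and y: "y : Y u" and s: "s : SS" for u y s
 proof -
  have yc: "y : Vec j" "et *. y = 1" "N *v y + u : I" using y by (auto simp: Y_def P_def)
  have Ms: "M0 *t s : XX" by (rule rc[OF M0(1) s])
  have Mc: "(M0 *t s) *v x : Vec n" if "x : Vec j" for x using Ms that by auto
  have ueq: "u = (M0 *t s) *v y - N *v y <-> (M0 *t s) *v y = N *v y + u"
   by (rule vec_arith(5)[OF Nc[OF yc(1)] Mc[OF yc(1)] u])
  show ?thesis unfolding ueq
  proof
   assume c: "compat (U u) (HH (U u)) s"
   have "compat N H0 s" unfolding compat_def
   proof
    fix x assume x: "x : H0"
    then have xc: "x : Vec j" "et *. x = 0" "N *v x : I" by (auto simp: H0_def)
    then have "x : HH (U u)" using UK[OF u xc(1,2)] by (simp add: HHu)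
    then show "(M0 *t s) *v x = N *v x" using c UK[OF u xc(1,2)] by (simp add: compat_def)
   qed
   moreover have "y : HH (U u)" using yc UP[OF u yc(1,2)] by (simp add: HHu)
   ultimately show "compat N H0 s & (M0 *t s) *v y = N *v y + u" using c UP[OF u yc(1,2)] by (simp add: compat_def)
  next
   assume c: "compat N H0 s & (M0 *t s) *v y = N *v y + u"
   show "compat (U u) (HH (U u)) s" unfolding compat_def
   proof
    fix z assume z: "z : HH (U u)"
    then have zc: "z : Vec j" "U u *v z : I" by (auto simp: HHu)
    let ?c = "et *. z"
    let ?x = "z - ?c *s y"
    have cy: "?c *s y : Vec j" using yc by simp
    have xc: "?x : Vec j" using zc cy by simp
    have x0: "et *. ?x = 0" using sp_minus[OF zc(1) cy] et yc by simp
    have lin: "A *v z = A *v ?x + ?c *s (A *v y)" if A: "A : XX" for A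
    proof -
     have "z = ?x + ?c *s y" using zc cy by (intro eq_vecI) auto
     then have "A *v z = A *v (?x + ?c *s y)" by metis
     then show ?thesis using mult_add_distrib_mat_vec[OF A xc cy] mult_mat_vec[OF A yc(1)] by simp
    qed
    have "N *v ?x = U u *v ?x" using UK[OF u xc x0] by simp
    also have "... = U u *v z - U u *v (?c *s y)" by (rule mult_minus_distrib_mat_vec[OF Uc zc(1) cy])
    also have "U u *v (?c *s y) = ?c *s (N *v y + u)" using mult_mat_vec[OF Uc yc(1)] UP[OF u yc(1,2)] by simp
    finally have "N *v ?x : I" using Im[OF zc(2) Ism[OF yc(3)]] by simp
    then have "?x : H0" using xc x0 by (simp add: H0_def)
    then have "(M0 *t s) *v ?x = U u *v ?x" using c UK[OF u xc x0] by (simp add: compat_def)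
    then show "(M0 *t s) *v z = U u *v z" using lin[OF Ms] lin[OF Uc] c UP[OF u yc(1,2)] by simp
   qed
  qed
 qed
 define In where "In = {u\<in>Vec n. Y u ~= {}}"
 have finIn: "finite In" by (rule finite_subset[of _ "Vec n"]) (auto simp: In_def)
 have ysum: "of_nat (card H0) * (SUM u:In. f u) = (SUM y:P. SUM u:Vec n. if y : Y u then f u else 0)" for f :: "'a vec => complex"
 proof -
  have "(SUM y:P. SUM u:Vec n. if y : Y u then f u else 0) = (SUM u:Vec n. SUM y:P. if y : Y u then f u else 0)" by (rule sum.swap)
  also have "... = (SUM u:Vec n. if u : In then of_nat (card H0) * f u else 0)"
  proof (rule sumc)
   fix u :: "'a vec" assume u: "u : Vec n"
   have "P \<inter> Y u = Y u" by (auto simp: Y_def)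
   then have "(SUM y:P. if y : Y u then f u else 0) = of_nat (card (Y u)) * f u" using finP by (simp add: sum.inter_restrict[symmetric])
   then show "(SUM y:P. if y : Y u then f u else 0) = (if u : In then of_nat (card H0) * f u else 0)"
    using cY[OF u] u by (auto simp: In_def)
  qed
  also have "... = (SUM u:In. of_nat (card H0) * f u)"
   by (subst sum.inter_restrict[symmetric]) (auto simp: In_def intro!: sum.cong)
  finally show ?thesis by (simp add: sum_distrib_left)
 qed
 have S1: "of_nat (card H0) * (SUM u:In. csum al (U u) (HH (U u))) = of_nat (card P) * A"
 proof -
  have "(SUM u:Vec n. if y : Y u then csum al (U u) (HH (U u)) else 0) = A" if y: "y : P" for y
  proof -
   have yc: "y : Vec j" "et *. y = 1" using y by (auto simp: P_def)
   let ?u = "%s. (M0 *t s) *v y - N *v y"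
   have "(SUM u:Vec n. if y : Y u then csum al (U u) (HH (U u)) else 0)
    = (SUM u:Vec n. SUM s:SS. if y : Y u & compat (U u) (HH (U u)) s then cnj (al s) else 0)"
    unfolding csum_def by (rule sumc) (simp cong: sum.cong)
   also have "... = (SUM u:Vec n. SUM s:SS. if u = ?u s then (if compat N H0 s then cnj (al s) else 0) else 0)"
   proof (rule sumc, rule sumc)
    fix u :: "'a vec" and s assume u: "u : Vec n" and s: "s : SS"
    have Ms: "M0 *t s : XX" by (rule rc[OF M0(1) s])
    have "y : Y u" if "u = ?u s"
    proof -
     have Mc: "(M0 *t s) *v y : Vec n" using Ms yc by auto
     have "N *v y + u = (M0 *t s) *v y" unfolding that by (rule vec_arith(1)[OF Nc[OF yc(1)] Mc Mc])
     also have "... = M0 *v (trm s *v y)"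
      by (rule assoc_mult_mat_vec[OF M0(1) _ yc(1)]) (use GLm_carrier[OF s] in simp)
     finally have "N *v y + u = M0 *v (trm s *v y)" .
     moreover have "trm s *v y : Vec j" using GLm_carrier[OF s] yc by auto
     ultimately have "N *v y + u : I" by (auto simp: I_def im_def)
     then show ?thesis using y by (simp add: Y_def)
    qed
    then show "(if y : Y u & compat (U u) (HH (U u)) s then cnj (al s) else 0) = (if u = ?u s then (if compat N H0 s then cnj (al s) else 0) else 0)"
     using inc[OF u _ s, of y] by auto
   qed
   also have "... = (SUM s:SS. SUM u:Vec n. if u = ?u s then (if compat N H0 s then cnj (al s) else 0) else 0)" by (rule sum.swap)
   also have "... = (SUM s:SS. if compat N H0 s then cnj (al s) else 0)"
   proof (rule sumc)
    fix s assume s: "s : SS"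
    have "?u s : Vec n" using rc[OF M0(1) s] yc Nc by auto
    then show "(SUM u:Vec n. if u = ?u s then (if compat N H0 s then cnj (al s) else 0) else 0) = (if compat N H0 s then cnj (al s) else 0)"
     by (subst sum.delta) auto
   qed
   finally show ?thesis by (simp add: A_def csum_def)
  qed
  then show ?thesis unfolding ysum by simp
 qed
 have S2: "of_nat (card H0) * of_nat (card In) = (of_nat (card P) * of_nat ?q ^ j :: complex)"
 proof -
  have cI: "card I = ?q ^ j"
  proof -
   have "inj_on (%y. M0 *v y) (Vec j)" using injmD[OF M0(2,1)] by (auto simp: inj_on_def)
   then show ?thesis by (simp add: I_def im_def card_image card_carrier_vec')
  qed
  have "(SUM u:Vec n. if y : Y u then 1 else 0 :: complex) = of_nat ?q ^ j" if y: "y : P" for y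
  proof -
   have yc: "y : Vec j" using y by (simp add: P_def)
   have "card {u\<in>Vec n. N *v y + u : I} = card I"
   proof (rule bij_betw_same_card[of "%u. N *v y + u"], rule bij_betwI[of _ _ _ "%z. z - N *v y"])
    show "(%z. z - N *v y) : I \<rightarrow> {u\<in>Vec n. N *v y + u : I}"
    proof
     fix z assume z: "z : I"
     then have zc: "z : Vec n" using Ic by blast
     have "N *v y + (z - N *v y) = z" by (rule vec_arith(1)[OF Nc[OF yc] zc zc])
     then show "z - N *v y : {u\<in>Vec n. N *v y + u : I}" using z zc Nc[OF yc] by simp
    qed
    fix z assume z: "z : I"
    then have zc: "z : Vec n" using Ic by blast
    show "N *v y + (z - N *v y) = z" by (rule vec_arith(1)[OF Nc[OF yc] zc zc])
   next
    fix u assume "u : {u\<in>Vec n. N *v y + u : I}"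
    then show "N *v y + u - N *v y = u" using vec_arith(2)[OF Nc[OF yc] Nc[OF yc]] by simp
   qed simp
   moreover have "Vec n \<inter> {u. y : Y u} = {u\<in>Vec n. N *v y + u : I}" using y by (auto simp: Y_def)
   ultimately show ?thesis using cI by (simp add: sum.If_cases)
  qed
  then show ?thesis using ysum[of "%_. 1"] by simp
 qed
 let ?om = "om ?q n j"
 \<comment> \<open>d is the codimension of the enlarged space, and d + 1 that of H0.\<close>
 define d where "d = j - d0 - 1"
 have dj: "j - d0 = Suc d" "j - Suc d0 = d" "d0 + d = j - 1" using d0j by (auto simp: d_def)
 have wo: "ww al (U u) = ?om (Suc d) * A" if "u : Vec n - In" for u
 proof -
  have u: "u : Vec n" "Y u = {}" using that by (auto simp: In_def)
  show ?thesis using outH[OF u] outc[OF u(1)] ldim_eq[OF d0] dj by (simp add: ww_def del: om.simps)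
 qed
 have wi: "ww al (U u) = ?om d * csum al (U u) (HH (U u))" if "u : In" for u
 proof -
  obtain y where u: "u : Vec n" "y : Y u" using \<open>u : In\<close> by (auto simp: In_def)
  show ?thesis using ldim_eq[OF inH[OF u]] dj by (simp add: ww_def)
 qed
 have "(SUM u:Vec n. ww al (U u)) = (SUM u:Vec n - In. ww al (U u)) + (SUM u:In. ww al (U u))"
  by (rule sum.subset_diff) (auto simp: In_def)
 also have "(SUM u:Vec n - In. ww al (U u)) = of_nat (card (Vec n - In)) * (?om (Suc d) * A)" using wo by simp
 also have "(SUM u:In. ww al (U u)) = ?om d * (SUM u:In. csum al (U u) (HH (U u)))" using wi by (simp add: sum_distrib_left)
 finally have tot: "(SUM u:Vec n. ww al (U u)) = of_nat (card (Vec n - In)) * (?om (Suc d) * A) + ?om d * (SUM u:In. csum al (U u) (HH (U u)))" .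
 have cdiff: "(of_nat (card (Vec n - In)) :: complex) = of_nat ?q ^ n - of_nat (card In)"
 proof -
  have "In \<subseteq> Vec n" by (auto simp: In_def)
  then have "card (Vec n - In) + card In = ?q ^ n" using card_Diff_subset[OF finIn, of "Vec n"] card_mono[of "Vec n" In] by (simp add: card_carrier_vec')
  then show ?thesis by (metis add_diff_cancel_right' of_nat_add of_nat_power)
 qed
 let ?Q = "of_nat ?q :: complex"
 have Q0: "?Q ~= 0" using q1 by simp
 have pj: "?Q ^ (j - 1) = ?Q ^ d0 * ?Q ^ d" using dj(3) by (metis power_add)
 have cd: "?Q ^ d0 * of_nat (card (Vec n - In)) = ?Q ^ d0 * (?Q ^ n - ?Q ^ (j + d))"
 proof -
  have "?Q ^ d0 * of_nat (card In) = ?Q ^ (j - 1) * ?Q ^ j" using S2 d0 cP cK' by simp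
  then show ?thesis unfolding cdiff pj by (simp add: right_diff_distrib power_add mult_ac)
 qed
 have "?Q ^ d0 * (SUM u:Vec n. ww al (U u)) = ?Q ^ d0 * of_nat (card (Vec n - In)) * (?om (Suc d) * A) + ?om d * (?Q ^ d0 * (SUM u:In. csum al (U u) (HH (U u))))"
  unfolding tot by (simp only: distrib_left mult_ac)
 also have "... = ?Q ^ d0 * ((?Q ^ n - ?Q ^ (j + d)) * ?om (Suc d) + ?om d * ?Q ^ d) * A"
  unfolding cd using S1 unfolding d0 cP cK' by (simp add: pj[simplified] algebra_simps del: om.simps)
 also have "... = 0"
 \<comment> \<open>The exceptional denominator: now H0 has dimension 2j - n - 1, so A itself
   vanishes by the hypothesis on the level.\<close>
 proof (cases "n = j + d")
  case True
  have "A = 0" unfolding A_def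
   by (rule csum_0[OF al lv H0s d0 _ N]) (use True dj j1 in \<open>auto simp: H0_def I_def\<close>)
  then show ?thesis by simp
 next
  case False
  have "?Q ^ n ~= ?Q ^ (j + d)" using False q1 by (metis of_nat_eq_iff of_nat_power power_inject_exp)
  then show ?thesis by (simp add: field_simps)
 qed
 finally show ?thesis using Q0 by (simp add: U_def)
qed

lemma ww_cuspidal:
 assumes al: "al : S.irr" and lv: "!!i. i + n < 2 * j ==> (SUM s:SS. tau_m j s ^ i * cnj (al s)) = 0"
 shows "cuspidal n j (ww al)"
 using ww_not_inj ww_outer_sum[OF assms] by (simp add: cuspidal_def)

lemma ww_M0: "al : S.irr ==> ww al M0 ~= 0"
proof -
 assume al: "al : S.irr"
 have H: "HH M0 = Vec j" by (auto simp: preim_def)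
 have "compat M0 (Vec j) s <-> s = idm j" if s: "s : SS" for s
 proof -
  have st: "trm s : Mat j j" using GLm_carrier[OF s] by simp
  have "compat M0 (Vec j) s <-> M0 *t s = M0" using mat_eq_by_vec[OF rc[OF M0(1) s] M0(1)] by (auto simp: compat_def)
  also have "... <-> trm s = idm j" using injm_cancel_mat[OF M0 st, of "idm j"] M0(1) by auto
  also have "... <-> s = idm j" by (metis transpose_one transpose_transpose)
  finally show ?thesis .
 qed
 then have "csum al M0 (HH M0) = (SUM s:SS. if s = idm j then cnj (al s) else 0)" unfolding H csum_def by (intro sum.cong refl) simp
 also have "... = cnj (al (idm j))" by (simp add: one_GLm)
 finally have "ww al M0 = cnj (al (idm j))" using ldim_eq[of "Vec j :: 'a vec set" j] by (simp add: ww_def H card_carrier_vec')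
 then show ?thesis using S.irr_degree[OF al] by auto
qed

lemma ww_shift:
 assumes N: "N : XX" and t: "t : SS"
 shows "ww al (N *t t) = om (CARD('a)) n j (j - ldim (HH N)) * (SUM s:SS. if compat N (HH N) s then cnj (al (t * s)) else 0)"
proof -
 let ?T = "trm t"
 have T: "?T : GLm j" by (rule transpose_GLm[OF t])
 have Tc: "?T : Mat j j" "minv j ?T : Mat j j" using GLm_carrier[OF T] minv_carrier[OF T] by auto
 have Nt: "(N *t t) *v y = N *v (?T *v y)" if "y : Vec j" for y by (rule assoc_mult_mat_vec[OF N Tc(1) that])
 have H: "y : HH (N *t t) <-> y : Vec j & ?T *v y : HH N" for y
  using Nt Tc by (auto simp: preim_def)
 have "card (HH (N *t t)) = card (HH N)"
 proof (rule bij_betw_same_card[of "%y. ?T *v y"], rule bij_betwI[of _ _ _ "%y. minv j ?T *v y"])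
  show "(%y. minv j ?T *v y) : HH N \<rightarrow> HH (N *t t)"
  proof
   fix y assume y: "y : HH N"
   then have yc: "y : Vec j" by (simp add: preim_def)
   then have c: "minv j ?T *v y : Vec j" using Tc by auto
   then show "minv j ?T *v y : HH (N *t t)" unfolding H using GLm_cancel_vec(2)[OF T yc] y by simp
  qed
  show "(%y. ?T *v y) : HH (N *t t) \<rightarrow> HH N" using H by auto
 next
  fix y assume "y : HH (N *t t)"
  then show "minv j ?T *v (?T *v y) = y" using GLm_cancel_vec(1)[OF T] H by simp
 next
  fix y assume "y : HH N"
  then show "?T *v (minv j ?T *v y) = y" using GLm_cancel_vec(2)[OF T] by (simp add: preim_def)
 qed
 then have ld: "ldim (HH (N *t t)) = ldim (HH N)" by (simp add: ldim_def)
 have cm: "compat (N *t t) (HH (N *t t)) (t * s) <-> compat N (HH N) s" if s: "s : SS" for s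
 proof -
  have M: "(M0 *t (t * s)) *v y = (M0 *t s) *v (?T *v y)" if "y : Vec j" for y
   using assoc_mult_mat_vec[OF rc[OF M0(1) s] Tc(1) that] ra[OF M0(1) s t] by simp
  have "compat (N *t t) (HH (N *t t)) (t * s) <-> (ALL y:HH (N *t t). (M0 *t s) *v (?T *v y) = N *v (?T *v y))"
   unfolding compat_def using M Nt H by auto
  also have "... <-> compat N (HH N) s"
  proof
   assume a: "ALL y:HH (N *t t). (M0 *t s) *v (?T *v y) = N *v (?T *v y)"
   show "compat N (HH N) s" unfolding compat_def
   proof
    fix y assume y: "y : HH N"
    then have yc: "y : Vec j" by (simp add: preim_def)
    then have c: "minv j ?T *v y : Vec j" using Tc by auto
    have e: "?T *v (minv j ?T *v y) = y" by (rule GLm_cancel_vec(2)[OF T yc])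
    then have "minv j ?T *v y : HH (N *t t)" using H c y by simp
    from a[rule_format, OF this] show "(M0 *t s) *v y = N *v y" unfolding e .
   qed
  qed (use H in \<open>auto simp: compat_def\<close>)
  finally show ?thesis .
 qed
 have "csum al (N *t t) (HH (N *t t)) = (SUM s:SS. if compat (N *t t) (HH (N *t t)) (t * s) then cnj (al (t * s)) else 0)"
  unfolding csum_def by (rule S.sum_left[OF t, of "%s. if compat (N *t t) (HH (N *t t)) s then cnj (al s) else 0", symmetric])
 also have "... = (SUM s:SS. if compat N (HH N) s then cnj (al (t * s)) else 0)" using cm by (intro sum.cong refl) simp
 finally show ?thesis by (simp add: ww_def ld)
qed

text \<open>The projection to the type of al leaves ww alone, up to a nonzero scalar; conjugates
  appear because ww is built from the conjugate of al.\<close>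

lemma ww_right:
 assumes al: "al : S.irr" and N: "N : XX"
 shows "(SUM t:SS. cnj (al t) * ww al (N *t minv j t)) = of_nat (card SS) / al (idm j) * ww al N"
proof -
 let ?o = "om (CARD('a)) n j (j - ldim (HH N))"
 have al1: "cnj (al (idm j)) = al (idm j)" using S.irr_degree[OF al] by auto
 have "(SUM t:SS. cnj (al t) * ww al (N *t minv j t)) = (SUM t:SS. SUM s:SS. ?o * (if compat N (HH N) s then cnj (al t) * cnj (al (minv j t * s)) else 0))"
 proof (rule sumc)
  fix t assume t: "t : SS"
  show "cnj (al t) * ww al (N *t minv j t) = (SUM s:SS. ?o * (if compat N (HH N) s then cnj (al t) * cnj (al (minv j t * s)) else 0))"
   unfolding ww_shift[OF N S.iv_in[OF t]] sum_distrib_left by (intro sum.cong refl) simp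
 qed
 also have "... = (SUM s:SS. SUM t:SS. ?o * (if compat N (HH N) s then cnj (al t) * cnj (al (minv j t * s)) else 0))" by (rule sum.swap)
 also have "... = (SUM s:SS. ?o * (if compat N (HH N) s then of_nat (card SS) / al (idm j) * cnj (al s) else 0))"
 proof (rule sumc)
  fix s assume s: "s : SS"
  have "(SUM t:SS. cnj (al t) * cnj (al (minv j t * s))) = cnj (SUM t:SS. al t * al (minv j t * s))" by simp
  also have "... = of_nat (card SS) / al (idm j) * cnj (al s)"
   unfolding S.spherical_convolution[OF S.irr_spherical[OF al] s] by (simp add: al1)
  finally have "(SUM t:SS. cnj (al t) * cnj (al (minv j t * s))) = of_nat (card SS) / al (idm j) * cnj (al s)" .
  then show "(SUM t:SS. ?o * (if compat N (HH N) s then cnj (al t) * cnj (al (minv j t * s)) else 0)) = ?o * (if compat N (HH N) s then of_nat (card SS) / al (idm j) * cnj (al s) else 0)"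
   by (simp add: sum_distrib_left[symmetric])
 qed
 also have "... = of_nat (card SS) / al (idm j) * ww al N"
  unfolding ww_def csum_def sum_distrib_left by (rule sumc) simp
 finally show ?thesis .
qed

text \<open>Otherwise every th annihilates ww: an old one because ww is cuspidal, a new one because
  its kernel with al is 0 and ww has the type of al. Summed over all th by completeness, this gives
  \<open>ww al M0\<close> = 0.\<close>

lemma exists_new:
 assumes al: "al : S.irr" and lv: "!!i. i + n < 2 * j ==> (SUM s:SS. tau_m j s ^ i * cnj (al s)) = 0"
 shows "EX th. new_char n j th & mm th al ~= 0"
proof (rule ccontr)
 assume "\<not> ?thesis"
 then have no: "mm th al = 0" if "new_char n j th" for th using that by blast
 have al1: "al (idm j) ~= 0" using S.irr_degree[OF al] by auto
 have z: "(SUM g:GG. cnj (th g) * ww al (minv n g * M)) = 0" if th: "th : G.irr" and M: "M : XX" for th M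
 proof (cases "new_char n j th")
  case False
  show ?thesis by (rule old_annihilates_cuspidal[OF th False ww_cuspidal[OF al lv] M])
 next
  case True
  have "0 = (SUM N:XX. KK th al M N * ww al N)" using KK_eq_0[OF th al no[OF True] M] by simp
  also have "... = (SUM p:GG \<times> SS. cnj (tp th al p) * ww al (act (piv p) M))"
  proof -
   have "(SUM N:XX. KK th al M N * ww al N) = (SUM N:XX. SUM p:GG \<times> SS. if N = act (piv p) M then cnj (tp th al p) * ww al N else 0)"
    unfolding P.kr_def sum_distrib_right by (rule sumc, rule sumc) (use P.act_eq_iff M in auto)
   also have "... = (SUM p:GG \<times> SS. SUM N:XX. if N = act (piv p) M then cnj (tp th al p) * ww al N else 0)" by (rule sum.swap)
   also have "... = (SUM p:GG \<times> SS. cnj (tp th al p) * ww al (act (piv p) M))"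
    by (rule sumc, subst sum.delta) (use P.act_in[OF P.iv_in M] in auto)
   finally show ?thesis .
  qed
  also have "... = (SUM g:GG. SUM s:SS. cnj (th g) * (cnj (al s) * ww al (minv n g * M *t minv j s)))"
   unfolding sum.cartesian_product by (rule sumc) (auto simp: tp_def act_def piv_def)
  also have "... = (SUM g:GG. cnj (th g) * (of_nat (card SS) / al (idm j) * ww al (minv n g * M)))"
   by (rule sumc) (simp only: sum_distrib_left[symmetric] ww_right[OF al gc[OF G.iv_in M]])
  also have "... = of_nat (card SS) / al (idm j) * (SUM g:GG. cnj (th g) * ww al (minv n g * M))"
   unfolding sum_distrib_left by (rule sumc) (simp only: mult_ac)
  finally show ?thesis using al1 S.card_pos by simp
 qed
 have "0 = (SUM th:G.irr. cnj (th (idm n)) * (SUM g:GG. cnj (th g) * ww al (minv n g * M0)))" using z[OF _ M0(1)] by simp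
 also have "... = (SUM g:GG. SUM th:G.irr. cnj (th (idm n) * th g) * ww al (minv n g * M0))"
  unfolding sum_distrib_left by (subst sum.swap) (simp add: mult_ac)
 also have "... = (SUM g:GG. cnj (SUM th:G.irr. th (idm n) * th g) * ww al (minv n g * M0))"
  by (simp only: sum_distrib_right[symmetric] cnj_sum)
 also have "... = (SUM g:GG. if g = idm n then of_nat (card GG) * ww al (minv n g * M0) else 0)"
  by (rule sumc) (simp add: G.irr_completeness)
 also have "... = of_nat (card GG) * ww al M0" using M0(1) one_GLm by (simp add: G.iv_e)
 finally show False using ww_M0[OF al] G.card_pos by simp
qed

end

section \<open>Comparison with the definitions of the statement\<close>

lemma is_char_vchar:
 fixes Gp :: "'a::field mat set"
 assumes gp: "finite_group_on Gp (*) (idm m) (minv m)"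
 shows "is_char m Gp ch <-> ch : finite_group_on.vchar Gp (*) (idm m) & ch ~= (%g. 0)"
proof -
 interpret finite_group_on Gp "(*)" "idm m" "minv m" by (rule gp)
 show ?thesis
 proof
  assume "is_char m Gp ch"
  then obtain d rh where rh: "is_rep m Gp d rh" and ch: "ch = (%g. if g : Gp then mat_trace (rh g) else 0)" by (auto simp: is_char_def)
  have c: "rh g : Mat d d" if "g : Gp" for g using rh that by (simp add: is_rep_def)
  let ?R = "%g i k. rh g $$ (i,k)"
  have "rep {..<d} ?R" unfolding rep_def
  proof (intro conjI ballI)
   fix g h assume gh: "g : Gp" "h : Gp"
   show "eq_on {..<d} {..<d} (mmul {..<d} (?R g) (?R h)) (?R (g * h))"
   proof (rule eq_onI)
    fix i k assume "i : {..<d}" "k : {..<d}"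
    then show "mmul {..<d} (?R g) (?R h) i k = ?R (g * h) i k"
     using rh gh mult_mat_index[OF c[OF gh(1)] c[OF gh(2)], of i k] by (simp add: mmul_def is_rep_def)
   qed
  next
   show "eq_on {..<d} {..<d} (?R (idm m)) kdelta" using rh by (auto simp: is_rep_def eq_on_def kdelta_def)
  qed simp
  from decompose[OF this] trace_e[OF this] have "(%g. if g : Gp then ktrace {..<d} (?R g) else 0) : vchar" and t: "ktrace {..<d} (?R (idm m)) = of_nat d" by simp_all
  moreover have e: "ch = (%g. if g : Gp then ktrace {..<d} (?R g) else 0)"
   unfolding ch by (rule ext) (use c in \<open>auto simp: mat_trace_def ktrace_def\<close>)
  \<comment> \<open>Positive degree excludes the zero function, the one sum of irreducible
    characters that is not a character.\<close>
  moreover have "ch (idm m) ~= 0" using e t e_in rh by (simp add: is_rep_def)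
  then have "ch ~= (%g. 0)" by metis
  ultimately show "ch : vchar & ch ~= (%g. 0)" by simp
 next
  assume a: "ch : vchar & ch ~= (%g. 0)"
  then obtain cs where cs: "set cs \<subseteq> irr" "ch = (%g. \<Sum>c\<leftarrow>cs. c g)" by (auto simp: vchar_def)
  then have "cs ~= []" using a by auto
  from vchar_rep[OF cs(1) this] obtain d :: nat and R where R: "d > 0" "rep {..<d} R" "!!g. g : Gp ==> (\<Sum>c\<leftarrow>cs. c g) = ktrace {..<d} (R g)" by blast
  define rh where "rh g = mat d d (%(i,k). R g i k)" for g
  have rhc: "rh g : Mat d d" for g by (simp add: rh_def)
  have "rh (g * h) = rh g * rh h" if "g : Gp" "h : Gp" for g h
  proof (rule eq_matI)
   fix i k assume "i < dim_row (rh g * rh h)" "k < dim_col (rh g * rh h)"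
   then have ik: "i < d" "k < d" by (simp_all add: rh_def)
   show "rh (g * h) $$ (i,k) = (rh g * rh h) $$ (i,k)"
    unfolding mult_mat_index[OF rhc rhc ik] using ik rep_mul[OF R(2) that, of i k] by (simp add: rh_def)
  qed (simp_all add: rh_def)
  moreover have "rh (idm m) = idm d" using rep_e[OF R(2)] by (intro eq_matI) (auto simp: rh_def kdelta_def)
  ultimately have "is_rep m Gp d rh" using R(1) by (simp add: is_rep_def rh_def)
  moreover have "ch = (%g. if g : Gp then mat_trace (rh g) else 0)"
  proof
   fix g
   show "ch g = (if g : Gp then mat_trace (rh g) else 0)"
   proof (cases "g : Gp")
    case True
    then show ?thesis using R(3) cs(2) by (simp add: mat_trace_def ktrace_def rh_def)
   next
    case False
    have "(\<Sum>c\<leftarrow>cs. c g) = 0" using cs(1) irr_out[OF _ False] by (induction cs) auto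
    then show ?thesis using cs(2) False by simp
   qed
  qed
  ultimately show "is_char m Gp ch" unfolding is_char_def by blast
 qed
qed

lemma Irr_eq:
 fixes Gp :: "'a::field mat set"
 assumes gp: "finite_group_on Gp (*) (idm m) (minv m)"
 shows "Irr m Gp = finite_group_on.irr Gp (*) (idm m)"
proof -
 interpret finite_group_on Gp "(*)" "idm m" "minv m" by (rule gp)
 have i: "inner_G Gp ph psi = ip ph psi" for ph psi by (simp add: inner_G_def ip_def)
 show ?thesis
 proof
  show "Irr m Gp \<subseteq> irr" using vchar_norm_one by (auto simp: Irr_def is_char_vchar[OF gp] i)
  show "irr \<subseteq> Irr m Gp"
  proof
   fix ch assume ch: "ch : irr"
   have "ch ~= (%g. 0)" using irr_degree[OF ch] by auto
   then show "ch : Irr m Gp" using ch irr_vchar[OF ch] irr_orthogonal[OF ch ch] by (simp add: Irr_def is_char_vchar[OF gp] i)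
  qed
 qed
qed

lemma inner_ip:
 assumes "finite_group_on Gp (*) (idm m) (minv m)"
 shows "inner_G Gp ph psi = finite_group_on.ip Gp ph psi"
 by (simp add: inner_G_def finite_group_on.ip_def[OF assms])

lemmas GL_Irr = Irr_eq[OF GL_group] and SL_Irr = Irr_eq[OF SL_group]

lemma constituent_tau:
 fixes th :: "'a::{finite,field} mat => complex"
 assumes th: "th : gl_irr n"
 shows "constituent n (GLm n) th (%g. tau_m n g ^ k) <-> (SUM g:GLm n. tau_m n g ^ k * cnj (th g)) ~= 0"
proof -
 interpret finite_group_on "GLm n :: 'a mat set" "(*)" "idm n" "minv n" by (rule GL_group)
 show ?thesis using th card_pos by (simp add: constituent_def GL_Irr inner_G_def)
qed

text \<open>Every th occurs in the n-th power of tau: only the identity fixes the identity matrix,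
  so the kernel there is the degree of th. Hence the least k exists and \<open>LEAST\<close> has its
  intended meaning.\<close>

lemma true_level:
 fixes th :: "'a::{finite,field} mat => complex"
 assumes th: "th : gl_irr n"
 shows "(SUM g:GLm n. tau_m n g ^ true_level n th * cnj (th g)) ~= 0" and "new_char n j th <-> j <= true_level n th"
proof -
 interpret finite_group_on "GLm n :: 'a mat set" "(*)" "idm n" "minv n" by (rule GL_group)
 have "(SUM g:GLm n. tau_m n g ^ n * cnj (th g)) ~= 0"
 proof
  assume "(SUM g:GLm n. tau_m n g ^ n * cnj (th g)) = 0"
  from kernel_vanishes[OF th this, of "idm n" "idm n"] have "Gkr n th (idm n) (idm n) = 0" by simp
  moreover have "Gkr n th (idm n) (idm n) = (SUM g:GLm n. if g = idm n then cnj (th g) else 0)"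
   by (rule sumc) (simp add: GLm_carrier)
  ultimately show False using irr_degree[OF th] one_GLm by auto
 qed
 then have "EX k. constituent n (GLm n) th (%g. tau_m n g ^ k)" unfolding constituent_tau[OF th] by blast
 from LeastI_ex[OF this] show 1: "(SUM g:GLm n. tau_m n g ^ true_level n th * cnj (th g)) ~= 0"
  by (fold true_level_def) (simp add: constituent_tau[OF th])
 have 2: "(SUM g:GLm n. tau_m n g ^ k * cnj (th g)) = 0" if "k < true_level n th" for k
  using not_less_Least[OF that[unfolded true_level_def]] unfolding constituent_tau[OF th] by simp
 show "new_char n j th <-> j <= true_level n th"
 proof
  assume "new_char n j th"
  then show "j <= true_level n th" using 1 by (metis new_char_def not_le)
 next
  assume "j <= true_level n th"
  then show "new_char n j th" using 2 th by (simp add: new_char_def)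
 qed
qed

lemma true_level_le:
 assumes "th : gl_irr n" "(SUM g:GLm n. tau_m n g ^ k * cnj (th g)) ~= 0"
 shows "true_level n th <= k"
 using assms unfolding true_level_def constituent_tau[OF assms(1), symmetric] by (intro Least_le)

section \<open>The coefficients \<open>D_coef\<close> and the correspondence of characters\<close>

context gl_pair
begin

lemma fixc_tau_V: "g : GG ==> s : SS ==> tau_V n j g s = P.fixc (g, s)"
 using tau_V_card[OF GLm_carrier GLm_carrier, of g n s j] j1 by (simp add: P.fixc_def act_def)

lemma D_coef_eq: "g : GG ==> D_coef n j al g = (SUM s:SS. P.fixc (g, s) * cnj (al s)) / of_nat (card SS)"
 by (simp add: D_coef_def inner_G_def fixc_tau_V cong: sum.cong)

text \<open>This is the character of G on the S-invariants in the functions on n x j matrices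
  tensored with the conjugate of a representation for al. Pr averages over S, and the trace of R g
  Pr is the inner product that defines the coefficient.\<close>

lemma D_coef_vchar:
 assumes al: "al : S.irr"
 shows "D_coef n j al : G.vchar"
proof -
 obtain a :: nat and rh where rh: "S.simple {..<a} rh" and ale: "al = (%s. if s : SS then ktrace {..<a} (rh s) else 0)"
  using al by (auto simp: S.irr_def)
 have r: "S.rep {..<a} rh" using rh by (simp add: S.simple_def)
 define I where "I = XX \<times> {..<a}"
 have finI: "finite I" by (simp add: I_def)
 define R :: "'a mat => 'a mat \<times> nat => 'a mat \<times> nat => complex" where "R g p r = (if g * fst r = fst p & snd r = snd p then 1 else 0)" for g p r
 define Q where "Q s p r = (if fst r *t s = fst p then cnj (rh s (snd p) (snd r)) else 0)" for s p and r :: "'a mat \<times> nat"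
 define Pr where "Pr p r = (SUM s:SS. Q s p r) / of_nat (card SS)" for p r
 have RX: "mmul I (R g) T p r' = T (minv n g * fst p, snd p) r'" if "g : GG" "p : I" for g T p and r' :: "'a mat \<times> nat"
 proof -
  have px: "fst p : XX" using that by (auto simp: I_def)
  have "mmul I (R g) T p r' = (SUM l:I. if l = (minv n g * fst p, snd p) then T l r' else 0)"
   unfolding mmul_def
  proof (rule sumc)
   fix l assume l: "l : I"
   then have "fst l : XX" by (auto simp: I_def)
   then have "g * fst l = fst p <-> fst l = minv n g * fst p"
    using GLm_cancel_mat[OF that(1)] px by metis
   then show "R g p l * T l r' = (if l = (minv n g * fst p, snd p) then T l r' else 0)" by (auto simp: R_def prod_eq_iff)
  qed
  also have "... = T (minv n g * fst p, snd p) r'"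
   using that gc[OF G.iv_in[OF that(1)] px] finI by (subst sum.delta) (auto simp: I_def)
  finally show ?thesis .
 qed
 have XR: "mmul I T (R g) p r' = T p (g * fst r', snd r')" if "g : GG" "r' : I" for g T r' and p :: "'a mat \<times> nat"
 proof -
  have rx: "fst r' : XX" using that by (auto simp: I_def)
  have "mmul I T (R g) p r' = (SUM l:I. if l = (g * fst r', snd r') then T p l else 0)"
   unfolding mmul_def by (rule sumc) (auto simp: R_def prod_eq_iff)
  then show ?thesis using that gc[OF that(1) rx] finI by (auto simp: I_def)
 qed
 have repR: "G.rep I R" unfolding G.rep_def
 proof (intro conjI ballI finI eq_onI)
  fix g h p r' assume *: "g : GG" "h : GG" "p : I" "r' : I"
  then have "fst r' : XX" by (auto simp: I_def)
  then show "mmul I (R g) (R h) p r' = R (g * h) p r'" unfolding XR[OF *(2,4)] using ga[OF *(1,2)] by (simp add: R_def)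
 next
  fix p r' assume "p : I" "r' : I"
  then show "R (idm n) p r' = kdelta p r'" by (auto simp: R_def kdelta_def I_def)
 qed
 have QQ: "mmul I (Q s) (Q t) p r' = Q (s * t) p r'" if "s : SS" "t : SS" "p : I" "r' : I" for s t p r'
 proof -
  have rx: "fst r' : XX" "snd r' < a" and px: "snd p < a" using that by (auto simp: I_def)
  have "mmul I (Q s) (Q t) p r' = (SUM x:XX. \<Sum>i<a. Q s p (x,i) * Q t (x,i) r')"
   unfolding mmul_def I_def by (simp add: sum.cartesian_product)
  also have "... = (SUM x:XX. if x = fst r' *t t then (\<Sum>i<a. if x *t s = fst p then cnj (rh s (snd p) i * rh t i (snd r')) else 0) else 0)"
  proof (rule sumc)
   fix x
   show "(\<Sum>i<a. Q s p (x,i) * Q t (x,i) r') = (if x = fst r' *t t then (\<Sum>i<a. if x *t s = fst p then cnj (rh s (snd p) i * rh t i (snd r')) else 0) else 0)"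
    by (cases "x = fst r' *t t"; cases "x *t s = fst p") (simp_all add: Q_def)
  qed
  also have "... = (\<Sum>i<a. if fst r' *t t *t s = fst p then cnj (rh s (snd p) i * rh t i (snd r')) else 0)"
   using rc[OF rx(1) that(2)] by simp
  also have "... = (if fst r' *t t *t s = fst p then cnj (\<Sum>i<a. rh s (snd p) i * rh t i (snd r')) else 0)" by simp
  also have "... = Q (s * t) p r'" using S.rep_mul[OF r that(1,2), of "snd p" "snd r'"] rx px ra[OF rx(1) that(2,1)] by (simp add: Q_def)
  finally show ?thesis .
 qed
 have nz: "of_nat (card SS) ~= (0::complex)" using S.card_pos by simp
 have idem: "eq_on I I (mmul I Pr Pr) Pr"
 proof (rule eq_onI)
  fix p r' assume pr: "p : I" "r' : I"
  have "mmul I Pr Pr p r' = (SUM l:I. SUM s:SS. SUM t:SS. Q s p l * Q t l r') / (of_nat (card SS) * of_nat (card SS))"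
   unfolding mmul_def Pr_def by (simp add: sum_product sum_divide_distrib)
  also have "(SUM l:I. SUM s:SS. SUM t:SS. Q s p l * Q t l r') = (SUM s:SS. SUM t:SS. mmul I (Q s) (Q t) p r')"
   unfolding mmul_def by (subst sum.swap) (rule sumc, rule sum.swap)
  also have "... = (SUM s:SS. SUM t:SS. Q (s * t) p r')" using QQ pr by simp
  also have "... = (SUM s:SS. SUM t:SS. Q t p r')"
   by (rule sumc) (rule S.sum_left[of _ "%t. Q t p r'"])
  also have "(SUM s:SS. SUM t:SS. Q t p r') / (of_nat (card SS) * of_nat (card SS)) = Pr p r'" using nz by (simp add: Pr_def)
  finally show "mmul I Pr Pr p r' = Pr p r'" .
 qed
 have com: "G.commutes I R Pr" unfolding G.commutes_def
 proof (intro ballI eq_onI)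
  fix g p r' assume *: "g : GG" "p : I" "r' : I"
  have rx: "fst r' : XX" "fst p : XX" using * by (auto simp: I_def)
  have "Q s p (g * fst r', snd r') = Q s (minv n g * fst p, snd p) r'" if s: "s : SS" for s
  proof -
   have "g * fst r' *t s = g * (fst r' *t s)" by (rule la[OF rx(1) s *(1)])
   moreover have "g * (fst r' *t s) = fst p <-> fst r' *t s = minv n g * fst p"
    using GLm_cancel_mat[OF *(1)] rx(2) rc[OF rx(1) s] by metis
   ultimately show ?thesis by (simp add: Q_def)
  qed
  then show "mmul I Pr (R g) p r' = mmul I (R g) Pr p r'"
   unfolding XR[OF *(1,3)] RX[OF *(1,2)] by (simp add: Pr_def)
 qed
 have tr: "ktrace I (mmul I (R g) Pr) = (SUM s:SS. P.fixc (g, s) * cnj (al s)) / of_nat (card SS)" if g: "g : GG" for g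
 proof -
  have "ktrace I (mmul I (R g) Pr) = ktrace I (mmul I Pr (R g))" by (rule ktrace_mmul)
  also have "... = (SUM p:I. Pr p (g * fst p, snd p))" unfolding ktrace_def using XR[OF g] by simp
  also have "... = (SUM s:SS. SUM p:I. Q s p (g * fst p, snd p)) / of_nat (card SS)"
   unfolding Pr_def sum_divide_distrib[symmetric] by (subst sum.swap) simp
  also have "(SUM s:SS. SUM p:I. Q s p (g * fst p, snd p)) = (SUM s:SS. P.fixc (g, s) * cnj (al s))"
  proof (rule sumc)
   fix s assume s: "s : SS"
   have "(SUM p:I. Q s p (g * fst p, snd p)) = (SUM M:XX. \<Sum>i<a. if act (g,s) M = M then cnj (rh s i i) else 0)"
    unfolding I_def sum.cartesian_product by (rule sumc) (auto simp: Q_def act_def)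
   also have "... = (SUM M:XX. (if act (g,s) M = M then 1 else 0) * cnj (al s))"
    by (rule sumc) (simp add: ale s ktrace_def)
   finally show "(SUM p:I. Q s p (g * fst p, snd p)) = P.fixc (g, s) * cnj (al s)" by (simp add: P.fixc_sum sum_distrib_right)
  qed
  finally show ?thesis .
 qed
 have "D_coef n j al = (%g. if g : GG then ktrace I (mmul I (R g) Pr) else 0)"
  using tr D_coef_eq by (auto simp: D_coef_def)
 then show ?thesis using G.compress_vchar[OF repR idem com] by simp
qed

lemma ip_D_coef: "G.ip (D_coef n j al) th = mm th al / (of_nat (card GG) * of_nat (card SS))"
proof -
 have "(SUM g:GG. D_coef n j al g * cnj (th g)) = (SUM g:GG. SUM s:SS. P.fixc (g, s) * cnj (tp th al (g, s))) / of_nat (card SS)"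
  unfolding sum_divide_distrib by (rule sumc) (simp add: D_coef_eq sum_distrib_left sum_divide_distrib tp_def mult_ac)
 then show ?thesis by (simp add: G.ip_def mm_def sum.cartesian_product mult.commute)
qed

lemma mm_level:
 assumes th: "th : G.irr" and al: "al : S.irr" and mm: "mm th al ~= 0"
 shows "true_level n th <= j"
proof (rule true_level_le[OF th], rule notI)
 assume 0: "(SUM g:GG. tau_m n g ^ j * cnj (th g)) = 0"
 have "KK th al x x = 0" if x: "x : XX" for x
  unfolding KK_expand[OF x] by (rule sum.neutral) (use kernel_vanishes[OF th 0 x rc[OF x]] in auto)
 then show False using KK_trace_1[OF th al] mm by simp
qed

text \<open>Completeness for S restricts the sum to s = 1, where the permutation character is the
  j-th power of tau. So a th that occurs in this power meets some al.\<close>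

lemma tau_pow_mm:
 "(SUM al:S.irr. cnj (al (idm j)) * mm th al) = (SUM g:GG. tau_m n g ^ j * cnj (th g)) * of_nat (card SS)"
proof -
 have "(SUM al:S.irr. cnj (al (idm j)) * mm th al) = (SUM p:GG \<times> SS. SUM al:S.irr. cnj (al (idm j)) * (P.fixc p * cnj (tp th al p)))"
  unfolding mm_def sum_distrib_left by (rule sum.swap)
 also have "... = (SUM p:GG \<times> SS. P.fixc p * cnj (th (fst p)) * cnj (SUM al:S.irr. al (idm j) * al (snd p)))"
  unfolding cnj_sum sum_distrib_left by (rule sumc, rule sumc) (simp add: tp_def mult_ac)
 also have "... = (SUM g:GG. SUM s:SS. if s = idm j then P.fixc (g, s) * cnj (th g) * of_nat (card SS) else 0)"
  unfolding sum.cartesian_product by (rule sumc) (auto simp: S.irr_completeness)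
 also have "... = (SUM g:GG. tau_m n g ^ j * cnj (th g)) * of_nat (card SS)"
  unfolding sum_distrib_right
 proof (rule sumc)
  fix g assume g: "g : GG"
  have "act (g, idm j) x = g * x" if "x : XX" for x using r1[OF gc[OF g that]] by (simp only: act_def fst_conv snd_conv)
  then have "{x : XX. act (g, idm j) x = x} = {x : XX. g * x = x}" by (rule_tac Collect_cong) metis
  then have "P.fixc (g, idm j) = tau_m n g ^ j" using tau_pow[OF g, of j] by (simp add: P.fixc_def)
  then show "(SUM s:SS. if s = idm j then P.fixc (g, s) * cnj (th g) * of_nat (card SS) else 0) = tau_m n g ^ j * cnj (th g) * of_nat (card SS)"
   by (simp add: one_GLm)
 qed
 finally show ?thesis .
qed

lemma exists_alpha:
 assumes lv: "(SUM g:GG. tau_m n g ^ j * cnj (th g)) ~= 0"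
 shows "EX al:S.irr. mm th al ~= 0"
proof (rule ccontr)
 assume "\<not> ?thesis"
 then have "(SUM al:S.irr. cnj (al (idm j)) * mm th al) = 0" by simp
 then show False using lv S.card_pos by (simp add: tau_pow_mm)
qed

text \<open>The multiplicity is a natural number whose square is 1 by
  \<open>new_multiplicity\<close>.\<close>

lemma ip_D_new:
 assumes new: "new_char n j th" and al: "al : S.irr" and mm: "mm th al ~= 0"
 shows "G.ip (D_coef n j al) th = 1"
proof -
 obtain k where k: "G.ip (D_coef n j al) th = of_nat k" using G.ip_vchar_nat[OF D_coef_vchar[OF al] new_irr[OF new]] by blast
 let ?c = "of_nat (card GG) * of_nat (card SS) :: complex"
 have c: "?c ~= 0" using G.card_pos S.card_pos by simp
 have m: "mm th al = of_nat k * ?c" using k c unfolding ip_D_coef by (simp add: field_simps)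
 have "of_nat (k * k) * (?c * ?c) = ?c * ?c" using new_multiplicity[OF assms] unfolding m by (simp add: card_cartesian_product power2_eq_square mult_ac)
 then have "of_nat (k * k) = (1::complex)" using c by simp
 then have "k * k = 1" by (metis of_nat_eq_1_iff)
 then show ?thesis using k by simp
qed

lemma new_level: "new_char n j th ==> al : S.irr ==> mm th al ~= 0 ==> true_level n th = j"
 using mm_level[OF new_irr] true_level(2)[OF new_irr] by (metis le_antisym)

lemma level_mm:
 assumes th: "th : G.irr" and al: "al : S.irr" and mm: "mm th al ~= 0"
 shows "true_level n th < j \<or> new_char n j th"
 using true_level(2)[OF th] by auto

lemma ip_minus: "G.ip (%g. f g - h g) psi = G.ip f psi - G.ip h psi"
 by (simp add: G.ip_def sum_subtractf left_diff_distrib diff_divide_distrib)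

lemma D_circ_prop_new:
 assumes new: "new_char n j th" and al: "al : S.irr" and mm: "mm th al ~= 0"
 shows "D_circ_prop n j al th" and "D_circ_prop n j al th' ==> th' = th"
proof -
 note th = new_irr[OF new]
 let ?D = "%g. D_coef n j al g - th g"
 have v: "?D : G.vchar" by (rule G.vchar_remove[OF D_coef_vchar[OF al] th]) (simp add: ip_D_new[OF assms])
 have lv: "true_level n psi < j" if psi: "psi : G.irr" and nz: "G.ip ?D psi ~= 0" for psi
 proof -
  have ne: "psi ~= th" using nz ip_D_new[OF assms] G.irr_orthogonal[OF th th] by (auto simp: ip_minus)
  then have m: "mm psi al ~= 0" using nz G.irr_orthogonal[OF th psi] by (auto simp: ip_minus ip_D_coef)
  from level_mm[OF psi al m] show ?thesis using new_unique[OF _ new al m mm] ne by blast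
 qed
 show "D_circ_prop n j al th" unfolding D_circ_prop_def
  using v lv new_level[OF assms] th by (auto simp: GL_Irr is_char_vchar[OF GL_group] constituent_def inner_ip[OF GL_group])
 assume c: "D_circ_prop n j al th'"
 show "th' = th"
 \<comment> \<open>If another th' were admissible, th would remain a constituent of the difference
   although its true level is j.\<close>
 proof (rule ccontr)
  assume ne: "th' ~= th"
  let ?E = "%g. D_coef n j al g - th' g"
  have th': "th' : G.irr" using c by (simp add: D_circ_prop_def GL_Irr)
  have one: "G.ip ?E th = 1" using ip_D_new[OF assms] G.irr_orthogonal[OF th' th] ne by (simp add: ip_minus)
  have "?E ~= (%g. 0)"
  proof
   assume "?E = (%g. 0)"
   then have "G.ip ?E th = G.ip (%g. 0) th" by simp
   then show False using one by (simp add: G.ip_def)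
  qed
  then have "true_level n th < j" using c one th by (auto simp: D_circ_prop_def constituent_def GL_Irr inner_ip[OF GL_group])
  then show False using new_level[OF assms] by simp
 qed
qed

lemma D_circ_eq: "new_char n j th ==> al : S.irr ==> mm th al ~= 0 ==> D_circ n j al = th"
 unfolding D_circ_def using D_circ_prop_new by (intro the_equality)

lemma high_level_new:
 assumes al: "al : S.irr" and lv: "int (true_level j al) >= 2 * int j - int n"
 shows "EX th. new_char n j th & mm th al ~= 0"
proof (rule exists_new[OF al])
 fix i assume "i + n < 2 * j"
 then have "i < true_level j al" using lv by linarith
 then show "(SUM s:SS. tau_m j s ^ i * cnj (al s)) = 0" using true_level_le[OF al, of i] by (metis not_le)
qed

lemma mm_high_level:
 assumes new: "new_char n j th" and al: "al : S.irr" and mm: "mm th al ~= 0"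
 shows "int (true_level j al) >= 2 * int j - int n"
proof (rule ccontr)
 assume "\<not> ?thesis"
 then have "true_level j al + n < 2 * j" by linarith
 from low_alpha_old[OF new al this true_level(1)[OF al]] mm show False by simp
qed

theorem levels_of_coefficients:
 shows "(ALL al : Irr j SS. int (true_level j al) < 2 * int j - int n & D_coef n j al ~= (%g. 0) -->
    (ALL th. constituent n (GLm n) th (D_coef n j al) --> true_level n th < j))"
  and "(ALL al : Irr j SS. int (true_level j al) >= 2 * int j - int n --> (\<exists>!th. D_circ_prop n j al th))"
  and "bij_betw (D_circ n j) {al : Irr j SS. int (true_level j al) >= 2 * int j - int n} {th : Irr n GG. true_level n th = j}"
proof -
 show "(ALL al : Irr j SS. int (true_level j al) < 2 * int j - int n & D_coef n j al ~= (%g. 0) -->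
    (ALL th. constituent n (GLm n) th (D_coef n j al) --> true_level n th < j))"
 proof (intro ballI impI allI)
  fix al th assume a: "al : Irr j SS" and l: "int (true_level j al) < 2 * int j - int n & D_coef n j al ~= (%g. 0)"
   and c: "constituent n (GLm n) th (D_coef n j al)"
  have al: "al : S.irr" and th: "th : G.irr" using a c by (simp_all add: GL_Irr constituent_def)
  have m: "mm th al ~= 0" using c by (auto simp: constituent_def inner_ip[OF GL_group] ip_D_coef)
  show "true_level n th < j" using level_mm[OF th al m] mm_high_level[OF _ al m] l by fastforce
 qed
 show "(ALL al : Irr j SS. int (true_level j al) >= 2 * int j - int n --> (\<exists>!th. D_circ_prop n j al th))"
 proof (intro ballI impI)
  fix al assume "al : Irr j SS" "int (true_level j al) >= 2 * int j - int n"
  then have al: "al : S.irr" and "EX th. new_char n j th & mm th al ~= 0" using high_level_new by (auto simp: GL_Irr)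
  then obtain th where th: "new_char n j th" "mm th al ~= 0" by blast
  show "\<exists>!th. D_circ_prop n j al th" using D_circ_prop_new[OF th(1) al th(2)] by blast
 qed
 show "bij_betw (D_circ n j) {al : Irr j SS. int (true_level j al) >= 2 * int j - int n} {th : Irr n GG. true_level n th = j}" (is "bij_betw _ ?A ?B")
 proof -
  have ob: "EX th. new_char n j th & mm th al ~= 0 & D_circ n j al = th & al : S.irr" if "al : ?A" for al
   using that high_level_new[of al] D_circ_eq by (fastforce simp: GL_Irr)
  show ?thesis unfolding bij_betw_def
  proof
   show "inj_on (D_circ n j) ?A"
   proof (rule inj_onI)
    fix al be assume a: "al : ?A" and b: "be : ?A" and eq: "D_circ n j al = D_circ n j be"
    obtain th where t: "new_char n j th" "mm th al ~= 0" "D_circ n j al = th" "al : S.irr" using ob[OF a] by blast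
    obtain th' where t': "new_char n j th'" "mm th' be ~= 0" "D_circ n j be = th'" "be : S.irr" using ob[OF b] by blast
    have "mm th be ~= 0" using t' t eq by metis
    from new_one_alpha[OF t(1,4) t'(4) t(2) this] show "al = be" .
   qed
   show "D_circ n j ` ?A = ?B"
   proof
    show "D_circ n j ` ?A \<subseteq> ?B"
    proof
     fix th assume "th : D_circ n j ` ?A"
     then obtain al where a: "al : ?A" "th = D_circ n j al" by blast
     obtain th' where t: "new_char n j th'" "mm th' al ~= 0" "D_circ n j al = th'" "al : S.irr" using ob[OF a(1)] by blast
     show "th : ?B" using new_level[OF t(1,4,2)] new_irr[OF t(1)] t(3) a(2) by (simp add: GL_Irr)
    qed
    show "?B \<subseteq> D_circ n j ` ?A"
    proof
     fix th assume "th : ?B"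
     then have th: "th : G.irr" "true_level n th = j" by (auto simp: GL_Irr)
     have new: "new_char n j th" using true_level(2)[OF th(1)] th(2) by simp
     obtain al where al: "al : S.irr" "mm th al ~= 0" using exists_alpha[of th] true_level(1)[OF th(1)] th(2) by auto
     have "al : ?A" using al(1) mm_high_level[OF new al] by (simp add: GL_Irr)
     then show "th : D_circ n j ` ?A" using D_circ_eq[OF new al] by blast
    qed
   qed
  qed
 qed
qed

end

subsection \<open>Eigenspaces\<close>

lemma kernel_dim_echelon:
 fixes A :: "'a::field mat"
 assumes A: "A : Mat n k" and P: "P : Mat n n" "Q : Mat n n" "Q * P = idm n" and ref: "row_echelon_form (P * A)"
 shows "kernel_dim A = k - card {i. i < n & row (P * A) i ~= zv k}"
proof -
 have B: "P * A : Mat n k" using A P by simp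
 show ?thesis using find_base_vectors(6)[OF ref B] mat_kernel_mult_eq[OF A P] A by (simp add: kernel_dim_def)
qed

text \<open>The reduced echelon form over the base field is still one over the algebraic closure,
  with the same nonzero rows. This allows eigenspaces over the base field to be compared with
  \<open>delta\<close>.\<close>

lemma kernel_dim_to_ac:
 fixes A :: "'a::field mat"
 assumes A: "A : Mat n k"
 shows "kernel_dim (map_mat to_ac A) = kernel_dim A"
proof -
 interpret h: semiring_hom "to_ac :: 'a => 'a alg_closure" by unfold_locales auto
 let ?h = "map_mat (to_ac :: 'a => 'a alg_closure)"
 obtain P Q where PQ: "gauss_jordan_single A = P * A" "P : Mat n n" "Q : Mat n n" "Q * P = idm n"
  using gauss_jordan_single(4)[OF A refl] by blast
 define B0 where "B0 = P * A"
 let ?B = B0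
 have B: "?B : Mat n k" unfolding B0_def using PQ(2) A by simp
 have ref: "row_echelon_form ?B" using gauss_jordan_single(3)[OF A refl] PQ(1) B0_def by simp
 then obtain f where f: "pivot_fun ?B f k" using B by (auto simp: row_echelon_form_def)
 have hB: "?h P * ?h A = ?h ?B" using h.mat_hom_mult[OF PQ(2) A] by (simp add: B0_def)
 have dimB: "dim_row ?B = n" "dim_col ?B = k" using B by auto
 have ent: "?h ?B $$ (i,l) = to_ac (?B $$ (i,l))" if "i < n" "l < k" for i l using that B by simp
 have "pivot_fun (?h ?B) f k"
 proof (rule pivot_funI[where nr = n])
  note pf = f[unfolded pivot_fun_def Let_def dimB]
  fix i assume i: "i < n"
  show fk: "f i <= k" using pf i by blast
  show "?h ?B $$ (i,l) = 0" if "l < f i" for l using pf i that fk ent[of i l] by fastforce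
  show "f (Suc i) > f i \<or> f (Suc i) = k" if "Suc i < n" using pf i that by blast
  show "?h ?B $$ (i, f i) = 1" if "f i < k" using pf i that ent[of i "f i"] by fastforce
  fix i' assume "f i < k" "i' < n" "i' ~= i"
  then show "?h ?B $$ (i', f i) = 0" using pf i ent[of i' "f i"] by fastforce
 qed (use B in simp)
 then have ref': "row_echelon_form (?h P * ?h A)" unfolding hB using B by (auto simp: row_echelon_form_def)
 have "?h Q * ?h P = idm n" using h.mat_hom_mult[OF PQ(3,2)] PQ(4) h.mat_hom_one[of n] by simp
 from kernel_dim_echelon[OF _ _ _ this ref', of k] A PQ
 have "kernel_dim (?h A) = k - card {i. i < n & row (?h ?B) i ~= zv k}" unfolding hB by simp
 moreover have "row (?h ?B) i ~= zv k <-> row ?B i ~= zv k" if i: "i < n" for i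
 proof -
  have "row (?h ?B) i = zv k <-> (\<forall>l<k. ?h ?B $$ (i,l) = 0)" "row ?B i = zv k <-> (\<forall>l<k. ?B $$ (i,l) = 0)"
   using i dimB by (simp_all only: vec_eq_iff index_row index_map_mat dim_vec index_zero_vec dim_row_mat row_def) auto
  then show ?thesis using ent[OF i] by simp
 qed
 then have "{i. i < n & row (?h ?B) i ~= zv k} = {i. i < n & row ?B i ~= zv k}" by blast
 ultimately show ?thesis using kernel_dim_echelon[OF A PQ(2,3,4) ref[unfolded B0_def]] by (simp add: B0_def)
qed

definition eig :: "nat => 'a::field mat => 'a => nat" where
 "eig n g c = kernel_dim (g - c \<cdot>\<^sub>m idm n)"

lemma finite_delta_range: "finite ((%\<mu>. kernel_dim (map_mat to_ac g - \<mu> \<cdot>\<^sub>m idm n)) ` UNIV)"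
 by (rule finite_subset[of _ "{..n}"]) (auto simp: kernel_dim_code)

lemma eig_le_delta:
 fixes g :: "'a::field mat"
 assumes g: "g : Mat n n"
 shows "eig n g c <= delta n g"
proof -
 have "map_mat to_ac (g - c \<cdot>\<^sub>m idm n) = map_mat to_ac g - to_ac c \<cdot>\<^sub>m idm n" using g by (intro eq_matI) auto
 moreover have "g - c \<cdot>\<^sub>m idm n : Mat n n" using g by (intro minus_carrier_mat) simp
 ultimately have "eig n g c = kernel_dim (map_mat to_ac g - to_ac c \<cdot>\<^sub>m idm n)" using kernel_dim_to_ac[of "g - c \<cdot>\<^sub>m idm n" n n] by (simp add: eig_def)
 then show ?thesis unfolding delta_def by (intro Max_ge finite_delta_range) auto
qed

lemma delta_le: "delta n g <= n"
 unfolding delta_def by (intro Max.boundedI finite_delta_range) (auto simp: kernel_dim_code)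

lemma card_eigenspace:
 fixes g :: "'a::{finite,field} mat"
 assumes g: "g : Mat n n"
 shows "card {x : Vec n. g *v x = c *s x} = CARD('a) ^ eig n g c"
proof -
 have A: "g - c \<cdot>\<^sub>m idm n : Mat n n" using g by (intro minus_carrier_mat) simp
 have "(g - c \<cdot>\<^sub>m idm n) *v x = g *v x - c *s x" if x: "x : Vec n" for x
 proof -
  have "(g - c \<cdot>\<^sub>m idm n) *v x = g *v x - (c \<cdot>\<^sub>m idm n) *v x" by (rule minus_mult_distrib_mat_vec[OF g _ x]) simp
  also have "(c \<cdot>\<^sub>m idm n) *v x = c *s x" using x by (intro eq_vecI) auto
  finally show ?thesis .
 qed
 moreover have "g *v x - c *s x = zv n <-> g *v x = c *s x" if x: "x : Vec n" for x
  using vec_eq_if_diff_0[of "g *v x" n "c *s x"] g x by auto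
 ultimately have "{x : Vec n. g *v x = c *s x} = {x : Vec n. (g - c \<cdot>\<^sub>m idm n) *v x = zv n}" by auto
 then show ?thesis using card_mat_kernel[OF A] by (simp add: eig_def)
qed

text \<open>A is the product of the g - c over c in C. It acts on every further eigenspace by a
  nonzero scalar, so each new factor enlarges the kernel by at least the whole new
  eigenspace.\<close>

lemma eigenspaces_independent:
 fixes g :: "'a::{finite,field} mat"
 assumes g: "g : Mat n n" and C: "finite C"
 shows "EX A:Mat n n. (ALL c. c \<notin> C --> (EX k. k ~= 0 & (ALL x:Vec n. g *v x = c *s x --> A *v x = k *s x))) &
  CARD('a) ^ (SUM c:C. eig n g c) <= card {x\<in>Vec n. A *v x = zv n}"
 using C
proof (induction C rule: finite_induct)
 case empty
 have "{x\<in>Vec n. (idm n :: 'a mat) *v x = zv n} = {zv n}" by auto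
 then show ?case by (intro bexI[of _ "idm n"]) (auto intro!: exI[of _ 1])
next
 case (insert c1 C)
 then obtain A where A: "A : Mat n n"
  and sc: "!!c. c \<notin> C ==> EX k. k ~= 0 & (ALL x:Vec n. g *v x = c *s x --> A *v x = k *s x)"
  and ca: "CARD('a) ^ (SUM c:C. eig n g c) <= card {x\<in>Vec n. A *v x = zv n}" by auto
 let ?B = "g - c1 \<cdot>\<^sub>m idm n"
 have B: "?B : Mat n n" using g by (intro minus_carrier_mat) simp
 have Bx: "?B *v x = g *v x - c1 *s x" if x: "x : Vec n" for x
 proof -
  have "?B *v x = g *v x - (c1 \<cdot>\<^sub>m idm n) *v x" by (rule minus_mult_distrib_mat_vec[OF g _ x]) simp
  also have "(c1 \<cdot>\<^sub>m idm n) *v x = c1 *s x" using x by (intro eq_vecI) auto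
  finally show ?thesis .
 qed
 have BA: "?B * A : Mat n n" using A B by simp
 have BAx: "(?B * A) *v x = ?B *v (A *v x)" if "x : Vec n" for x by (rule assoc_mult_mat_vec[OF B A that])
 let ?V = "{x\<in>Vec n. (?B * A) *v x = zv n}"
 have kerA: "{x\<in>?V. A *v x = zv n} = {x\<in>Vec n. A *v x = zv n}"
 proof -
  have "?B *v zv n = zv n" using B by (intro eq_vecI) auto
  then show ?thesis using BAx by auto
 qed
 obtain k1 where k1: "k1 ~= 0" "!!x. x : Vec n ==> g *v x = c1 *s x ==> A *v x = k1 *s x" using sc[OF insert(2)] by blast
 let ?E = "{x : Vec n. g *v x = c1 *s x}"
 have sub: "?E \<subseteq> (%x. A *v x) ` ?V"
 proof
  fix x assume x: "x : ?E"
  let ?y = "(1 / k1) *s x"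
  have y: "?y : Vec n" "g *v ?y = c1 *s ?y" using x mult_mat_vec[OF g, of x "1 / k1"] by (auto simp: smult_smult_assoc mult.commute)
  have Ay: "A *v ?y = x" using k1(2)[OF y] k1(1) x by (simp add: smult_smult_assoc)
  have "?B *v x = zv n" using Bx[of x] x by simp
  then have "?y : ?V" using BAx[OF y(1)] Ay y by simp
  then show "x : (%x. A *v x) ` ?V" using Ay by (metis (no_types, lifting) image_eqI)
 qed
 have "card ?E <= card ((%x. A *v x) ` ?V)" by (rule card_mono[OF _ sub]) simp
 then have ge: "card {x\<in>Vec n. A *v x = zv n} * card ?E <= card ?V"
  using card_image_kernel[OF A subsp_kernel[OF BA]] unfolding kerA by simp
 have "CARD('a) ^ (SUM c:insert c1 C. eig n g c) = CARD('a) ^ (SUM c:C. eig n g c) * card ?E"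
  using insert(1,2) card_eigenspace[OF g, of c1] by (simp add: power_add)
 also have "... <= card ?V" using ge mult_right_mono[OF ca, of "card ?E"] by linarith
 finally have c: "CARD('a) ^ (SUM c:insert c1 C. eig n g c) <= card ?V" .
 have s: "EX k. k ~= 0 & (ALL x:Vec n. g *v x = c *s x --> (?B * A) *v x = k *s x)" if cn: "c \<notin> insert c1 C" for c
 proof -
  obtain k where k: "k ~= 0" "!!x. x : Vec n ==> g *v x = c *s x ==> A *v x = k *s x" using sc[of c] cn by blast
  show ?thesis
  proof (intro exI[of _ "(c - c1) * k"] conjI ballI impI)
   show "(c - c1) * k ~= 0" using k cn by simp
   fix x assume x: "x : Vec n" "g *v x = c *s x"
   have "(?B * A) *v x = k *s (g *v x - c1 *s x)" using BAx[OF x(1)] k(2)[OF x] mult_mat_vec[OF B x(1)] Bx[OF x(1)] by simp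
   also have "... = ((c - c1) * k) *s x" unfolding x(2) using x(1) by (intro eq_vecI) (auto simp: algebra_simps)
   finally show "(?B * A) *v x = ((c - c1) * k) *s x" .
  qed
 qed
 show ?case using BA c s by blast
qed

lemma sum_eig_le:
 fixes g :: "'a::{finite,field} mat"
 assumes g: "g : Mat n n"
 shows "(SUM c:C. eig n g c) <= n"
proof -
 have C: "finite C" by simp
 obtain A :: "'a mat" where A: "A : Mat n n" "CARD('a) ^ (SUM c:C. eig n g c) <= card {x\<in>Vec n. A *v x = zv n}"
  using eigenspaces_independent[OF g C] by blast
 have "card {x\<in>Vec n. A *v x = zv n} <= CARD('a) ^ n"
  using card_mono[of "Vec n :: 'a vec set" "{x\<in>Vec n. A *v x = zv n}"] by (auto simp: card_carrier_vec')
 then have "CARD('a) ^ (SUM c:C. eig n g c) <= CARD('a) ^ n" using A(2) by simp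
 then show ?thesis using card_UNIV_field[where 'a='a] by (simp add: power_increasing_iff)
qed

lemma eig_full:
 fixes g :: "'a::{finite,field} mat"
 assumes g: "g : Mat n n" and "eig n g c = n"
 shows "g = c \<cdot>\<^sub>m idm n"
proof (rule mat_eq_by_vec[OF g])
 have "card {x : Vec n. g *v x = c *s x} = card (Vec n :: 'a vec set)"
  using card_eigenspace[OF g, of c] assms(2) by (simp add: card_carrier_vec')
 then have "{x : Vec n. g *v x = c *s x} = Vec n" by (intro card_subset_eq) auto
 moreover fix x :: "'a vec" assume x: "x : Vec n"
 ultimately have "g *v x = c *s x" by blast
 also have "... = (c \<cdot>\<^sub>m idm n) *v x" using x by (intro eq_vecI) auto
 finally show "g *v x = (c \<cdot>\<^sub>m idm n) *v x" .
qed simp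

lemma eig_le: "eig n g c <= n"
 by (simp add: eig_def kernel_dim_code)

lemma scalar_in_center:
 fixes G :: "'a::field mat set"
 assumes "G \<subseteq> Mat n n" "c \<cdot>\<^sub>m idm n : G"
 shows "c \<cdot>\<^sub>m idm n : grp_center G"
proof -
 have "c \<cdot>\<^sub>m idm n * g = g * (c \<cdot>\<^sub>m idm n)" if "g : Mat n n" for g :: "'a mat"
  using that mult_smult_distrib[OF that, of "idm n" n c] mult_smult_assoc_mat[of "idm n" n n g n c] by simp
 then show ?thesis using assms by (auto simp: grp_center_def)
qed

section \<open>Elementary bounds for irreducible characters\<close>

context finite_group_on
begin

text \<open>In the functional equation take x where |ch| has its maximum m, and y = x^-1: one side
  has absolute value |G| m^2, the other at most |G| m times the degree.\<close>

lemma irr_bound: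
 assumes ch: "ch : irr" and g: "g : G"
 shows "cmod (ch g) <= Re (ch e)"
proof -
 obtain d :: nat where d: "d > 0" "ch e = of_nat d" using irr_degree[OF ch] by blast
 define m where "m = Max ((%g. cmod (ch g)) ` G)"
 have fm: "finite ((%g. cmod (ch g)) ` G)" by simp
 have le: "cmod (ch h) <= m" if "h : G" for h unfolding m_def using that by (intro Max_ge fm) auto
 obtain x where x: "x : G" "m = cmod (ch x)" using Max_in[OF fm] nonempty unfolding m_def by (auto simp del: Max_in)
 note s = sphericalD[OF irr_spherical[OF ch]]
 have "(SUM h:G. ch (h ** x ** iv h ** iv x)) * of_nat d = of_nat (card G) * ch x * cnj (ch x)"
  using s(5)[OF x(1) iv_in[OF x(1)]] s(2)[OF x(1)] d by simp
 then have "cmod (SUM h:G. ch (h ** x ** iv h ** iv x)) * real d = real (card G) * (m * m)"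
  using x(2) by (metis (no_types, lifting) norm_mult norm_of_nat complex_mod_cnj mult.assoc)
 moreover have "cmod (SUM h:G. ch (h ** x ** iv h ** iv x)) <= real (card G) * m"
  by (rule sum_norm_bound) (use le x in simp)
 ultimately have "real (card G) * (m * m) <= real (card G) * m * real d" by (metis mult_right_mono of_nat_0_le_iff)
 then have mm: "m * m <= m * real d" using card_pos by simp
 have "m <= real d"
 proof (cases "m > 0")
  case False
  then show ?thesis using d by simp
 qed (use mm in simp)
 then show ?thesis using le[OF g] d by simp
qed

lemma vchar_bound:
 assumes f: "f : vchar" and g: "g : G"
 shows "cmod (f g) <= Re (f e)"
proof -
 obtain cs where cs: "set cs \<subseteq> irr" "f = (%g. \<Sum>c\<leftarrow>cs. c g)" using f by (auto simp: vchar_def)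
 have "cmod (\<Sum>c\<leftarrow>cs. c g) <= Re (\<Sum>c\<leftarrow>cs. c e)" using cs(1)
 proof (induction cs)
  case (Cons c cs)
  then have "cmod (c g) <= Re (c e)" "cmod (\<Sum>c\<leftarrow>cs. c g) <= Re (\<Sum>c\<leftarrow>cs. c e)" using irr_bound[OF _ g] by auto
  then show ?case using norm_triangle_ineq[of "c g" "\<Sum>c\<leftarrow>cs. c g"] by simp
 qed simp
 then show ?thesis using cs(2) by simp
qed

text \<open>The squares of |ch g| sum to |G|; the first bound follows from 2 t <= 1 + t^2.\<close>

lemma irr_abs_sum:
 assumes ch: "ch : irr"
 shows "(SUM g:G. cmod (ch g)) <= real (card G)" and "(Re (ch e))\<^sup>2 <= real (card G)"
proof -
 have "(SUM g:G. ch g * cnj (ch g)) = complex_of_real (SUM g:G. (cmod (ch g))\<^sup>2)"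
  by (simp only: complex_norm_square of_real_sum)
 then have "complex_of_real (SUM g:G. (cmod (ch g))\<^sup>2) = complex_of_real (real (card G))"
  using sphericalD(3)[OF irr_spherical[OF ch]] by simp
 then have sq: "(SUM g:G. (cmod (ch g))\<^sup>2) = real (card G)" by (simp only: of_real_eq_iff)
 have "(SUM g:G. 2 * cmod (ch g)) <= (SUM g:G. 1 + (cmod (ch g))\<^sup>2)"
 proof (rule sum_mono)
  fix g
  have "0 <= (1 - cmod (ch g))\<^sup>2" by simp
  then show "2 * cmod (ch g) <= 1 + (cmod (ch g))\<^sup>2" by (simp add: power2_diff)
 qed
 then show "(SUM g:G. cmod (ch g)) <= real (card G)" using sq by (simp add: sum.distrib sum_distrib_left[symmetric])
 have "(cmod (ch e))\<^sup>2 <= (SUM g:G. (cmod (ch g))\<^sup>2)" by (rule member_le_sum) auto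
 moreover have "(Re (ch e))\<^sup>2 <= (cmod (ch e))\<^sup>2" by (simp add: cmod_power2)
 ultimately show "(Re (ch e))\<^sup>2 <= real (card G)" using sq by simp
qed

end

subsection \<open>Bounds for character values\<close>

context gl_pair
begin

lemma card_ge_2: "CARD('a) >= 2" by (rule card_UNIV_field)

text \<open>With eta of value 1 at v, every matrix is M + u eta^T for a unique u and a unique M that
  kills v.\<close>

lemma card_killed:
 assumes v: "v : Vec j" "v ~= zv j"
 shows "card {M\<in>XX. M *v v = zv n} = CARD('a) ^ (n * (j - 1))"
proof -
 obtain et where et: "et : Vec j" "et *. v = 1"
  using exists_dual_vec[OF v] comm_scalar_prod[OF v(1)] by metis
 have ov: "(M + outer n j u et) *v v = M *v v + u" if "M : XX" "u : Vec n" for M u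
  using add_outer_mult_vec[OF that(1,2) v(1), of et] et(2) by simp
 have oo: "M + outer n j u et + outer n j w et = M + outer n j (u + w) et" if "M : XX" "u : Vec n" "w : Vec n" for M u w
  using that by (intro eq_matI) (auto simp: outer_def algebra_simps)
 have o0: "M + outer n j (zv n) et = M" if "M : XX" for M using that by (intro eq_matI) (auto simp: outer_def)
 have "bij_betw (%(M,u). M + outer n j u et) ({M\<in>XX. M *v v = zv n} \<times> Vec n) XX"
 proof (rule bij_betwI[of _ _ _ "%N. (N + outer n j (- (N *v v)) et, N *v v)"])
  show "(%(M,u). M + outer n j u et) : {M\<in>XX. M *v v = zv n} \<times> Vec n \<rightarrow> XX" by auto
  show "(%N. (N + outer n j (- (N *v v)) et, N *v v)) : XX \<rightarrow> {M\<in>XX. M *v v = zv n} \<times> Vec n"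
  proof
   fix N :: "'a mat" assume N: "N : XX"
   have c: "N *v v : Vec n" using N v by auto
   then show "(N + outer n j (- (N *v v)) et, N *v v) : {M\<in>XX. M *v v = zv n} \<times> Vec n" using N ov[OF N, of "- (N *v v)"] by simp
  qed
 next
  fix p :: "'a mat \<times> 'a vec" assume p: "p : {M\<in>XX. M *v v = zv n} \<times> Vec n"
  then obtain M u where Mu: "p = (M,u)" "M : XX" "M *v v = zv n" "u : Vec n" by auto
  have "(M + outer n j u et) *v v = u" using ov[OF Mu(2,4)] Mu by simp
  moreover have "M + outer n j u et + outer n j (- u) et = M" using oo[OF Mu(2,4), of "-u"] o0[OF Mu(2)] Mu(4) by simp
  ultimately show "(%N. (N + outer n j (- (N *v v)) et, N *v v)) (case p of (M,u) => M + outer n j u et) = p"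
   unfolding Mu(1) by simp
 next
  fix N :: "'a mat" assume N: "N : XX"
  have c: "N *v v : Vec n" using N v by auto
  have "- (N *v v) + N *v v = zv n" using c by simp
  then show "(case (N + outer n j (- (N *v v)) et, N *v v) of (M,u) => M + outer n j u et) = N"
   using oo[OF N _ c, of "- (N *v v)"] o0[OF N] c by simp
 qed
 from bij_betw_same_card[OF this] have e: "card {M\<in>XX. M *v v = zv n} * CARD('a) ^ n = CARD('a) ^ (n * j)"
  by (simp add: card_cartesian_product card_carrier_vec' card_carrier_mat)
 have "n * j = n * (j - 1) + n" using j1 by (cases j) auto
 then show ?thesis using e card_ge_2 by (simp add: power_add)
qed

text \<open>A fixed N kills the image of s^T - 1, which contains a nonzero vector.\<close>

lemma card_fixed_right:
 assumes s: "s : SS" "s ~= idm j"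
 shows "card {N\<in>XX. N *t s = N} <= CARD('a) ^ (n * (j - 1))"
proof -
 let ?t = "trm s"
 have t: "?t : Mat j j" using GLm_carrier[OF s(1)] by simp
 have "?t ~= idm j" using s(2) by (metis transpose_one transpose_transpose)
 then obtain v where v: "v : Vec j" "?t *v v ~= v" using mat_eq_by_vec[OF t, of "idm j"] by force
 let ?w = "?t *v v - v"
 have tv: "?t *v v : Vec j" using t v by auto
 have w: "?w : Vec j" "?w ~= zv j" using vec_eq_if_diff_0[OF tv v(1)] v tv by auto
 have "{N\<in>XX. N *t s = N} \<subseteq> {M\<in>XX. M *v ?w = zv n}"
 proof (rule subsetI, clarify)
  fix N assume N: "N : XX" "N *t s = N"
  have "N *v ?w = (N *t s) *v v - N *v v"
   unfolding mult_minus_distrib_mat_vec[OF N(1) tv v(1)] assoc_mult_mat_vec[OF N(1) t v(1)] ..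
  moreover have "N *v v : Vec n" using N(1) v(1) by auto
  ultimately show "N *v ?w = zv n" using N(2) by simp
 qed
 then have "card {N\<in>XX. N *t s = N} <= card {M\<in>XX. M *v ?w = zv n}" by (intro card_mono) auto
 then show ?thesis using card_killed[OF w] by simp
qed

lemma scalar_if_all_eigenvectors:
 fixes t :: "'a mat"
 assumes t: "t : Mat j j" and ev: "!!v. v : Vec j ==> EX c. t *v v = c *s v"
 shows "EX c. t = c \<cdot>\<^sub>m idm j"
proof -
 have ent: "t $$ (i,k) = (t *v unit_vec j k) $ i" if "i < j" "k < j" for i k using that t by simp
 obtain c where c: "!!k. k < j ==> t *v unit_vec j k = c k *s unit_vec j k" using ev[OF unit_vec_carrier] by metis
 have off: "t $$ (i,k) = (if i = k then c k else 0)" if "i < j" "k < j" for i k using ent[OF that] c[OF that(2)] that by simp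
 have eq: "c i = c k" if ik: "i < j" "k < j" for i k
 proof (cases "i = k")
  case False
  let ?v = "unit_vec j i + unit_vec j k"
  obtain d where d: "t *v ?v = d *s ?v" using ev[of ?v] by auto
  have "t *v ?v = c i *s unit_vec j i + c k *s unit_vec j k"
   using mult_add_distrib_mat_vec[OF t, of "unit_vec j i" "unit_vec j k"] c ik by simp
  then have e: "d *s ?v = c i *s unit_vec j i + c k *s unit_vec j k" using d by simp
  have "(d *s ?v) $ i = c i" "(d *s ?v) $ k = c k" unfolding e using ik False by simp_all
  then show ?thesis using ik False by simp
 qed simp
 have "t = c 0 \<cdot>\<^sub>m idm j"
 proof (rule eq_matI)
  fix i k assume "i < dim_row (c 0 \<cdot>\<^sub>m idm j)" "k < dim_col (c 0 \<cdot>\<^sub>m idm j)"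
  then have ik: "i < j" "k < j" by simp_all
  have "c k = c 0" by (rule eq) (use ik j1 in auto)
  then show "t $$ (i,k) = (c 0 \<cdot>\<^sub>m idm j) $$ (i,k)" using off[OF ik] ik by simp
 qed (use t in auto)
 then show ?thesis by blast
qed

text \<open>Choose v such that w = s^T v is no multiple of v. A fixed N satisfies g N w = N v, so N
  w is determined by N v. Subtracting N w along a functional with value 0 at v and 1 at w thus maps
  the fixed matrices injectively to matrices that kill w.\<close>

lemma card_fixed_nonscalar:
 assumes s: "s : SS" "!!c. s ~= c \<cdot>\<^sub>m idm j" and g: "g : GG"
 shows "card {N\<in>XX. act (g,s) N = N} <= CARD('a) ^ (n * (j - 1))"
proof -
 let ?t = "trm s"
 have t: "?t : Mat j j" using GLm_carrier[OF s(1)] by simp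
 have "\<not> (EX c. ?t = c \<cdot>\<^sub>m idm j)"
 proof
  assume "EX c. ?t = c \<cdot>\<^sub>m idm j"
  then obtain c where "?t = c \<cdot>\<^sub>m idm j" by blast
  then have "trm ?t = c \<cdot>\<^sub>m idm j" by (intro eq_matI) auto
  then show False using s(2)[of c] by simp
 qed
 then obtain v where v: "v : Vec j" "!!c. ?t *v v ~= c *s v" using scalar_if_all_eigenvectors[OF t] by blast
 let ?w = "?t *v v"
 have w: "?w : Vec j" using t v by auto
 let ?W = "range (%c. c *s v)"
 have W: "subsp j ?W" unfolding subsp_def
 proof (intro conjI ballI allI)
  show "zv j : ?W" using v(1) by (intro image_eqI[of _ _ 0]) auto
  fix x y assume "x : ?W" "y : ?W"
  then obtain a b where "x = a *s v" "y = b *s v" by blast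
  then have "x + y = (a + b) *s v" using v(1) by (simp add: add_smult_distrib_vec)
  then show "x + y : ?W" by blast
 next
  fix a x assume "x : ?W"
  then obtain b where "x = b *s v" by blast
  then have "a *s x = (a * b) *s v" by (simp add: smult_smult_assoc)
  then show "a *s x : ?W" by blast
 qed (use v in auto)
 have "?w \<notin> ?W" using v(2) by blast
 then obtain l where l: "l : Vec j" "ALL w:?W. l *. w = 0" "l *. ?w ~= 0" using separating_functional[OF W w] by blast
 define et where "et = (1 / (l *. ?w)) *s l"
 have "l *. (1 *s v) = 0" using l(2) by blast
 then have et: "et : Vec j" "et *. v = 0" "et *. ?w = 1" using l w v by (simp_all add: et_def)
 have w0: "?w ~= zv j" using v(2)[of 0] v(1) by auto
 let ?f = "%N. N + outer n j (- (N *v ?w)) et"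
 have fv: "?f N *v v = N *v v" and fw: "?f N *v ?w = zv n" if N: "N : XX" for N
 proof -
  have c: "- (N *v ?w) : Vec n" "N *v v : Vec n" "N *v ?w : Vec n" using N w v by auto
  show "?f N *v v = N *v v" using add_outer_mult_vec[OF N c(1) v(1), of et] et(2) vec_add_smult_0[OF c(2,1)] by simp
  show "?f N *v ?w = zv n" using add_outer_mult_vec[OF N c(1) w, of et] et(3) c(3) by simp
 qed
 have "inj_on ?f {N\<in>XX. act (g,s) N = N}"
 proof (rule inj_onI, clarify)
  fix N N' assume N: "N : XX" "act (g,s) N = N" and N': "N' : XX" "act (g,s) N' = N'" and eq: "?f N = ?f N'"
  have vv: "N *v v = N' *v v" using fv[OF N(1)] fv[OF N'(1)] eq by simp
  have gw: "g *v (L *v ?w) = L *v v" if L: "L : XX" "act (g,s) L = L" for L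
  proof -
   have "L *v v = (g * L * ?t) *v v" using L(2) by (simp add: act_def)
   also have "... = (g * L) *v ?w" by (rule assoc_mult_mat_vec[OF gc[OF g L(1)] t v(1)])
   also have "... = g *v (L *v ?w)" by (rule assoc_mult_mat_vec[OF GLm_carrier[OF g] L(1) w])
   finally show ?thesis by simp
  qed
  have "N *v ?w : Vec n" "N' *v ?w : Vec n" using N N' w by auto
  then have ww: "N *v ?w = N' *v ?w" using gw[OF N] gw[OF N'] vv GLm_cancel_vec(1)[OF g] by metis
  have "N $$ (i,k) = N' $$ (i,k)" if ik: "i < n" "k < j" for i k
  proof -
   have "?f N $$ (i,k) = ?f N' $$ (i,k)" using eq by simp
   then show ?thesis using ik N(1) N'(1) unfolding ww by (simp add: outer_def)
  qed
  then show "N = N'" using N(1) N'(1) by (intro eq_matI) auto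
 qed
 then have "card {N\<in>XX. act (g,s) N = N} = card (?f ` {N\<in>XX. act (g,s) N = N})" by (simp add: card_image)
 also have "... <= card {M\<in>XX. M *v ?w = zv n}" by (rule card_mono) (use fw in auto)
 finally show ?thesis using card_killed[OF w w0] by simp
qed

lemma card_fixed_scalar:
 assumes c: "c ~= 0" and g: "g : GG"
 shows "card {N\<in>XX. act (g, c \<cdot>\<^sub>m idm j) N = N} = CARD('a) ^ (j * eig n g (1 / c))"
proof -
 let ?W = "{x : Vec n. g *v x = (1 / c) *s x}"
 have "act (g, c \<cdot>\<^sub>m idm j) N = N <-> (\<forall>k<j. col N k : ?W)" if N: "N : XX" for N
 proof -
  have gN: "g * N : XX" by (rule gc[OF g N])
  have "trm (c \<cdot>\<^sub>m idm j) = c \<cdot>\<^sub>m (idm j :: 'a mat)" by (intro eq_matI) auto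
  then have a: "act (g, c \<cdot>\<^sub>m idm j) N = c \<cdot>\<^sub>m (g * N)" using right_mult_one_mat[OF gN] mult_smult_distrib[OF gN, of "idm j" j c] by (simp add: act_def)
  have ck: "col N k : Vec n" if "k < j" for k using N that by auto
  have "c \<cdot>\<^sub>m (g * N) = N <-> (\<forall>k<j. c *s (g *v col N k) = col N k)"
  proof
   assume e: "c \<cdot>\<^sub>m (g * N) = N"
   show "\<forall>k<j. c *s (g *v col N k) = col N k"
   proof (intro allI impI)
    fix k assume k: "k < j"
    have "col (c \<cdot>\<^sub>m (g * N)) k = c *s (g *v col N k)" using k N GLm_carrier[OF g] by (intro eq_vecI) auto
    then show "c *s (g *v col N k) = col N k" using e by simp
   qed
  next
   assume a: "\<forall>k<j. c *s (g *v col N k) = col N k"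
   show "c \<cdot>\<^sub>m (g * N) = N"
   proof (rule eq_matI)
    fix i k assume "i < dim_row N" "k < dim_col N"
    then have ik: "i < n" "k < j" using N by auto
    have "(c *s (g *v col N k)) $ i = col N k $ i" using a ik by simp
    then show "(c \<cdot>\<^sub>m (g * N)) $$ (i,k) = N $$ (i,k)" using ik N GLm_carrier[OF g] by simp
   qed (use N GLm_carrier[OF g] in auto)
  qed
  also have "... <-> (\<forall>k<j. g *v col N k = (1 / c) *s col N k)"
  proof -
   have "c *s x = y <-> x = (1 / c) *s y" if "x : Vec n" "y : Vec n" for x y
    using c that by (auto simp: smult_smult_assoc)
   moreover have "g *v col N k : Vec n" if "k < j" for k by (rule mult_mat_vec_carrier[OF GLm_carrier[OF g] ck[OF that]])
   ultimately show ?thesis using ck by blast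
  qed
  finally show ?thesis unfolding a using ck by auto
 qed
 then have "{N\<in>XX. act (g, c \<cdot>\<^sub>m idm j) N = N} = {N\<in>XX. \<forall>k<j. col N k : ?W}" by auto
 also have "card ... = card ?W ^ j" by (rule card_columns_in(2)) auto
 finally show ?thesis using card_eigenspace[OF GLm_carrier[OF g], of "1 / c"] by (simp add: power_mult[symmetric] mult.commute)
qed

lemma scalar_SS: "c \<cdot>\<^sub>m idm j : SS <-> c ~= (0 :: 'a)"
 using j1 by (simp add: GLm_def)

lemma scalar_inj: "inj (%c :: 'a. c \<cdot>\<^sub>m idm j)"
proof (rule injI)
 fix c d :: 'a assume "c \<cdot>\<^sub>m idm j = d \<cdot>\<^sub>m idm j"
 then have "(c \<cdot>\<^sub>m idm j) $$ (0,0) = (d \<cdot>\<^sub>m idm j) $$ (0,0)" by simp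
 then show "c = d" using j1 by simp
qed

text \<open>The term s = 1 is the main one: every other s fixes at most q^(n (j-1)) matrices, and
  |al| has average at most 1.\<close>

lemma degree_lower:
 assumes al: "al : S.irr"
 shows "Re (D_coef n j al (idm n)) >= Re (al (idm j)) / real (card SS) * real CARD('a) ^ (n * j) - real CARD('a) ^ (n * (j - 1))"
proof -
 let ?e = "real CARD('a) ^ (n * (j - 1))"
 let ?F = "%s. P.fixc (idm n, s) * cnj (al s)"
 have f1: "P.fixc (idm n, idm j) = of_nat (CARD('a) ^ (n * j))"
  using P.act_e by (simp add: P.fixc_def card_carrier_mat cong: conj_cong)
 have b: "cmod (?F s) <= ?e * cmod (al s)" if s: "s : SS - {idm j}" for s
 proof -
  have "{N\<in>XX. act (idm n, s) N = N} = {N\<in>XX. N *t s = N}" by (auto simp: act_def)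
  then have "card {N\<in>XX. act (idm n, s) N = N} <= CARD('a) ^ (n * (j - 1))" using card_fixed_right[of s] s by simp
  from of_nat_mono[OF this, where 'a = real] have "real (card {N\<in>XX. act (idm n, s) N = N}) <= ?e" by simp
  then show ?thesis by (simp add: P.fixc_def norm_mult mult_right_mono)
 qed
 have "cmod (SUM s:SS - {idm j}. ?F s) <= (SUM s:SS - {idm j}. ?e * cmod (al s))"
  by (rule sum_norm_le) (use b in blast)
 also have "... <= (SUM s:SS. ?e * cmod (al s))" by (rule sum_mono2) auto
 also have "... <= ?e * real (card SS)" unfolding sum_distrib_left[symmetric] using S.irr_abs_sum(1)[OF al] by (intro mult_left_mono) auto
 finally have B: "cmod (SUM s:SS - {idm j}. ?F s) <= ?e * real (card SS)" .
 have "(SUM s:SS. ?F s) = ?F (idm j) + (SUM s:SS - {idm j}. ?F s)" by (rule sum.remove) (auto simp: one_GLm)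
 then have "Re (SUM s:SS. ?F s) = real CARD('a) ^ (n * j) * Re (al (idm j)) + Re (SUM s:SS - {idm j}. ?F s)"
  unfolding f1 by (simp flip: of_nat_power)
 then have "Re (SUM s:SS. ?F s) >= real CARD('a) ^ (n * j) * Re (al (idm j)) - ?e * real (card SS)"
  using B abs_Re_le_cmod[of "SUM s:SS - {idm j}. ?F s"] by linarith
 then have "Re (SUM s:SS. ?F s) / real (card SS) >= (real CARD('a) ^ (n * j) * Re (al (idm j)) - ?e * real (card SS)) / real (card SS)"
  by (rule divide_right_mono) simp
 then show ?thesis using S.card_pos by (simp add: D_coef_eq[OF one_GLm] diff_divide_distrib mult.commute)
qed

text \<open>Only scalar s can fix many matrices, namely those with all columns in one eigenspace of
  g; every non-scalar s is treated as an error term.\<close>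

lemma D_coef_upper:
 assumes al: "al : S.irr" and g: "g : GG"
 shows "cmod (D_coef n j al g) <= Re (al (idm j)) / real (card SS) * (SUM c:UNIV - {0}. real CARD('a) ^ (j * eig n g c)) + real CARD('a) ^ (n * (j - 1))"
proof -
 let ?e = "real CARD('a) ^ (n * (j - 1))"
 let ?F = "%s. P.fixc (g, s) * cnj (al s)"
 let ?a = "Re (al (idm j))"
 define C where "C = (%c :: 'a. c \<cdot>\<^sub>m idm j) ` (UNIV - {0})"
 have CS: "C \<subseteq> SS" using scalar_SS by (auto simp: C_def)
 have b1: "cmod (?F s) <= ?e * cmod (al s)" if s: "s : SS - C" for s
 proof -
  have "s ~= c \<cdot>\<^sub>m idm j" for c using s scalar_SS[of c] by (auto simp: C_def)
  then have "card {N\<in>XX. act (g, s) N = N} <= CARD('a) ^ (n * (j - 1))" using card_fixed_nonscalar[of s g] s g by blast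
  from of_nat_mono[OF this, where 'a = real] have "real (card {N\<in>XX. act (g, s) N = N}) <= ?e" by simp
  then show ?thesis by (simp add: P.fixc_def norm_mult mult_right_mono)
 qed
 have "cmod (SUM s:SS - C. ?F s) <= (SUM s:SS - C. ?e * cmod (al s))" by (rule sum_norm_le) (use b1 in blast)
 also have "... <= (SUM s:SS. ?e * cmod (al s))" by (rule sum_mono2) auto
 also have "... <= ?e * real (card SS)" unfolding sum_distrib_left[symmetric] using S.irr_abs_sum(1)[OF al] by (intro mult_left_mono) auto
 finally have B1: "cmod (SUM s:SS - C. ?F s) <= ?e * real (card SS)" .
 have "cmod (SUM s:C. ?F s) <= (SUM s:C. cmod (?F s))" by (rule norm_sum)
 also have "... = (SUM c:UNIV - {0}. cmod (?F (c \<cdot>\<^sub>m idm j)))"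
  unfolding C_def by (subst sum.reindex) (auto intro: inj_on_subset[OF scalar_inj])
 also have "... <= (SUM c:UNIV - {0 :: 'a}. real CARD('a) ^ (j * eig n g (1 / c)) * ?a)"
 proof (rule sum_mono)
  fix c :: 'a assume c: "c : UNIV - {0}"
  then have "c \<cdot>\<^sub>m idm j : SS" using scalar_SS by simp
  then show "cmod (?F (c \<cdot>\<^sub>m idm j)) <= real CARD('a) ^ (j * eig n g (1 / c)) * ?a"
   using card_fixed_scalar[of c g] c g S.irr_bound[OF al] by (simp add: P.fixc_def norm_mult norm_power mult_left_mono)
 qed
 \<comment> \<open>The scalar c belongs to the eigenvalue 1/c, so the sum is reindexed by
   inversion.\<close>
 also have "... = (SUM c:UNIV - {0 :: 'a}. real CARD('a) ^ (j * eig n g c) * ?a)"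
  by (rule sum.reindex_bij_witness[of _ "%c. 1 / c" "%c. 1 / c"]) auto
 finally have B2: "cmod (SUM s:C. ?F s) <= (SUM c:UNIV - {0}. real CARD('a) ^ (j * eig n g c)) * ?a" by (simp add: sum_distrib_right)
 have "(SUM s:SS. ?F s) = (SUM s:SS - C. ?F s) + (SUM s:C. ?F s)" by (rule sum.subset_diff[OF CS]) simp
 then have "cmod (SUM s:SS. ?F s) <= (SUM c:UNIV - {0}. real CARD('a) ^ (j * eig n g c)) * ?a + ?e * real (card SS)"
  using norm_triangle_ineq[of "SUM s:SS - C. ?F s" "SUM s:C. ?F s"] B1 B2 by simp
 then have "cmod (SUM s:SS. ?F s) / real (card SS) <= ((SUM c:UNIV - {0}. real CARD('a) ^ (j * eig n g c)) * ?a + ?e * real (card SS)) / real (card SS)"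
  by (rule divide_right_mono) simp
 then show ?thesis using S.card_pos by (simp add: D_coef_eq[OF g] norm_divide add_divide_distrib mult.commute)
qed

section \<open>Degree of the part of true level below j\<close>

definition olds :: "('a mat => complex) set" where
 "olds = {psi : G.irr. \<not> new_char n j psi}"

text \<open>The factor psi(1) / |G| makes each kernel idempotent, so this is the projection of the
  functions on n x j matrices to all components of true level below j.\<close>

definition Plow :: "'a mat => 'a mat => complex" where
 "Plow x y = (SUM psi:olds. psi (idm n) / of_nat (card GG) * Gkr n psi x y)"

sublocale A: group_action_on GG "(*)" "idm n" "minv n" XX "(*)"
 by (rule GL_action)

lemma A_kr: "A.kr psi x y = Gkr n psi x y"
 by (simp add: A.kr_def)

lemma finite_olds [simp]: "finite olds"
 by (simp add: olds_def)

lemma Plow_idem: "eq_on XX XX (mmul XX Plow Plow) Plow"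
proof (rule eq_onI)
 fix x z :: "'a mat" assume x: "x : XX" and z: "z : XX"
 let ?c = "of_nat (card GG) :: complex"
 have c0: "?c ~= 0" using G.card_pos by simp
 have k: "(SUM y:XX. Gkr n psi x y * Gkr n ph y z) = (if ph = psi then ?c / psi (idm n) * Gkr n psi x z else 0)" if "psi : olds" "ph : olds" for psi ph
  using A.kr_idempotent[OF G.irr_spherical x z] A.kr_convolution_0[OF _ _ _ x z] that unfolding A_kr olds_def by auto
 have pull: "(SUM y:Y. (a * f y) * (b * h y)) = a * b * (SUM y:Y. f y * h y)" for Y :: "'a mat set" and a b and f h :: "'a mat => complex"
  unfolding sum_distrib_left by (rule sumc) (simp only: mult_ac)
 have "mmul XX Plow Plow x z = (SUM y:XX. SUM psi:olds. SUM ph:olds. (psi (idm n) / ?c * Gkr n psi x y) * (ph (idm n) / ?c * Gkr n ph y z))"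
  unfolding mmul_def Plow_def by (simp only: sum_product)
 also have "... = (SUM psi:olds. SUM ph:olds. SUM y:XX. (psi (idm n) / ?c * Gkr n psi x y) * (ph (idm n) / ?c * Gkr n ph y z))"
  by (subst sum.swap) (rule sumc, rule sum.swap)
 also have "... = (SUM psi:olds. SUM ph:olds. if ph = psi then psi (idm n) / ?c * Gkr n psi x z else 0)"
 proof (rule sumc, rule sumc)
  fix psi ph assume *: "psi : olds" "ph : olds"
  have p1: "psi (idm n) ~= 0" using G.irr_degree[of psi] * by (auto simp: olds_def)
  have "(SUM y:XX. (psi (idm n) / ?c * Gkr n psi x y) * (ph (idm n) / ?c * Gkr n ph y z)) = psi (idm n) / ?c * (ph (idm n) / ?c) * (SUM y:XX. Gkr n psi x y * Gkr n ph y z)"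
   by (rule pull)
  then show "(SUM y:XX. (psi (idm n) / ?c * Gkr n psi x y) * (ph (idm n) / ?c * Gkr n ph y z)) = (if ph = psi then psi (idm n) / ?c * Gkr n psi x z else 0)"
   unfolding k[OF *] using c0 p1 by simp
 qed
 also have "... = Plow x z" by (simp add: Plow_def)
 finally show "mmul XX Plow Plow x z = Plow x z" .
qed

lemma Plow_cuspidal:
 assumes f: "cuspidal n j f" and x: "x : XX"
 shows "(SUM y:XX. Plow x y * f y) = 0"
proof -
 have "(SUM y:XX. Gkr n psi x y * f y) = 0" if psi: "psi : olds" for psi
 proof -
  have "(SUM y:XX. Gkr n psi x y * f y) = (SUM y:XX. SUM g:GG. if y = minv n g * x then cnj (psi g) * f y else 0)"
   unfolding sum_distrib_right
  proof (rule sumc, rule sumc)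
   fix y g assume "y : XX" "g : GG"
   then have "g * y = x <-> y = minv n g * x" using A.act_eq_iff[of g x y] x by blast
   then show "(if g * y = x then cnj (psi g) else 0) * f y = (if y = minv n g * x then cnj (psi g) * f y else 0)" by simp
  qed
  also have "... = (SUM g:GG. SUM y:XX. if y = minv n g * x then cnj (psi g) * f y else 0)" by (rule sum.swap)
  also have "... = (SUM g:GG. cnj (psi g) * f (minv n g * x))"
   by (rule sumc, subst sum.delta) (use gc[OF G.iv_in x] in auto)
  also have "... = 0" by (rule old_annihilates_cuspidal[OF _ _ f x]) (use psi in \<open>auto simp: olds_def\<close>)
  finally show ?thesis .
 qed
 then have "(SUM psi:olds. psi (idm n) / of_nat (card GG) * (SUM y:XX. Gkr n psi x y * f y)) = 0" by simp
 moreover have "(SUM y:XX. Plow x y * f y) = (SUM psi:olds. psi (idm n) / of_nat (card GG) * (SUM y:XX. Gkr n psi x y * f y))"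
  unfolding Plow_def sum_distrib_right sum_distrib_left mult.assoc by (rule sum.swap)
 ultimately show ?thesis by simp
qed

text \<open>A cuspidal function in the image of Plow is 0, so the conditions that define cuspidality
  separate the image, and their number bounds the trace. There is one for each nonzero v and each M
  that kills v, and one for each nonzero eta and each coset of the matrices u eta^T.\<close>

lemma Plow_trace: "EX r<= 2 * (CARD('a) ^ j - 1) * CARD('a) ^ (n * (j - 1)). ktrace XX Plow = of_nat r"
proof -
 define V where "V = Vec j - {zv j :: 'a vec}"
 have "EX y. y : Vec j & et *. y = 1" if "et : V" for et using exists_dual_vec[of et j] that by (auto simp: V_def)
 \<comment> \<open>In every coset of the direction eta exactly one matrix kills
   \<open>dv et\<close>, so cosets are counted like matrices with a given kernel vector.\<close>
 then obtain dv where dv: "!!et. et : V ==> dv et : Vec j & et *. dv et = 1" by metis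
 define K where "K v = {M\<in>XX. M *v v = zv n}" for v :: "'a vec"
 define Z where "Z = Inl ` (SIGMA v:V. K v) \<union> Inr ` (SIGMA et:V. K (dv et))"
 define F where "F z x = (case z of Inl p => if x = snd p then 1 else 0 | Inr p => (if EX u:Vec n. x = snd p + outer n j u (fst p) then 1 else (0::complex)))" for z :: "'a vec \<times> 'a mat + 'a vec \<times> 'a mat" and x
 have finK: "finite (K v)" for v by (rule finite_subset[of _ XX]) (auto simp: K_def)
 have finV: "finite V" by (simp add: V_def)
 have cV: "card V = CARD('a) ^ j - 1" by (simp add: V_def card_Diff_subset card_carrier_vec')
 have ck: "card (K v) = CARD('a) ^ (n * (j - 1))" if "v : V" for v using card_killed[of v] that by (simp add: K_def V_def)
 have ck': "card (K (dv et)) = CARD('a) ^ (n * (j - 1))" if "et : V" for et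
 proof -
  have "dv et ~= zv j" using dv[OF that] that by (auto simp: V_def)
  then show ?thesis using ck[of "dv et"] dv[OF that] by (simp add: V_def)
 qed
 have cZ: "card Z = 2 * (CARD('a) ^ j - 1) * CARD('a) ^ (n * (j - 1))"
 proof -
  have "card Z = card (SIGMA v:V. K v) + card (SIGMA et:V. K (dv et))"
   unfolding Z_def by (subst card_Un_disjoint) (auto simp: card_image finV finK)
  also have "... = 2 * (CARD('a) ^ j - 1) * CARD('a) ^ (n * (j - 1))" using ck ck' finV finK by (simp add: cV)
  finally show ?thesis .
 qed
 have finZ: "finite Z" using finV finK by (simp add: Z_def)
 have "EX r <= card Z. ktrace XX Plow = of_nat r"
 proof (rule idempotent_trace_le_card[OF _ finZ Plow_idem, of F])
  fix f :: "'a mat => complex" and x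
  assume im: "!!x. x : XX ==> f x = (SUM y:XX. Plow x y * f y)"
   and kill: "!!z. z : Z ==> (SUM x:XX. F z x * f x) = 0" and x: "x : XX"
  have "cuspidal n j f" unfolding cuspidal_def
  proof (intro conjI ballI impI)
   fix M :: "'a mat" assume M: "M : XX" "\<not> injm j M"
   then obtain v where v: "v : Vec j" "M *v v = zv n" "v ~= zv j" by (auto simp: injm_def)
   then have "Inl (v, M) : Z" using M by (auto simp: Z_def V_def K_def)
   from kill[OF this] have "(SUM x:XX. if x = M then f x else 0) = 0" by (simp add: F_def if_distrib[of "%c. c * _"] cong: if_cong)
   then show "f M = 0" using M by simp
  next
   fix M :: "'a mat" and et :: "'a vec" assume M: "M : XX" and et: "et : Vec j" "et ~= zv j"
   then have eV: "et : V" by (simp add: V_def)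
   note y = dv[OF eV]
   have Mc: "M *v dv et : Vec n" using M y by auto
   let ?m = "- (M *v dv et)"
   have mc: "?m : Vec n" using Mc by simp
   let ?M = "M + outer n j ?m et"
   have ov: "(L + outer n j u et) *v dv et = L *v dv et + u" if "L : XX" "u : Vec n" for L u
    using add_outer_mult_vec[OF that, of "dv et" et] y by simp
   have M': "?M : XX" using M by simp
   have "?M *v dv et = zv n" using ov[OF M mc] Mc by simp
   then have zin: "Inr (et, ?M) : Z" using M' eV by (auto simp: Z_def K_def)
   have oo: "L + outer n j u et + outer n j w et = L + outer n j (u + w) et" if "L : XX" "u : Vec n" "w : Vec n" for L u w
    using that by (intro eq_matI) (auto simp: outer_def algebra_simps)
   have mM: "?m + M *v dv et = zv n" using Mc by simp
   have set: "{x\<in>XX. EX u:Vec n. x = ?M + outer n j u et} = (%u. M + outer n j u et) ` Vec n"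
   proof (intro subset_antisym subsetI)
    fix z assume "z : {x\<in>XX. EX u:Vec n. x = ?M + outer n j u et}"
    then obtain u where u: "u : Vec n" "z = ?M + outer n j u et" by blast
    then have "z = M + outer n j (?m + u) et" using oo[OF M mc u(1)] by simp
    then show "z : (%u. M + outer n j u et) ` Vec n" using u(1) mc by (intro image_eqI[of _ _ "?m + u"]) auto
   next
    fix z assume "z : (%u. M + outer n j u et) ` Vec n"
    then obtain u where u: "u : Vec n" "z = M + outer n j u et" by blast
    have "?M + outer n j (M *v dv et + u) et = M + outer n j (?m + (M *v dv et + u)) et" by (rule oo[OF M mc]) (use Mc u in simp)
    also have "?m + (M *v dv et + u) = u" using assoc_add_vec[OF mc Mc u(1)] mM u(1) by simp
    finally have "z = ?M + outer n j (M *v dv et + u) et" using u(2) by simp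
    moreover have "M *v dv et + u : Vec n" using Mc u by simp
    ultimately show "z : {x\<in>XX. EX u:Vec n. x = ?M + outer n j u et}" using u M by auto
   qed
   have inj: "inj_on (%u. M + outer n j u et) (Vec n)"
   proof (rule inj_onI)
    fix u w :: "'a vec" assume c: "u : Vec n" "w : Vec n" and e: "M + outer n j u et = M + outer n j w et"
    have "M *v dv et + u = M *v dv et + w" using ov[OF M c(1)] ov[OF M c(2)] e by simp
    then show "u = w" using vec_arith(2)[OF Mc Mc c(1)] vec_arith(2)[OF Mc Mc c(2)] by metis
   qed
   have "0 = (SUM x:XX. F (Inr (et, ?M)) x * f x)" using kill[OF zin] by simp
   also have "... = (SUM x:XX. if x : {x\<in>XX. EX u:Vec n. x = ?M + outer n j u et} then f x else 0)"
    by (rule sumc) (simp add: F_def)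
   also have "... = sum f {x\<in>XX. EX u:Vec n. x = ?M + outer n j u et}"
    by (subst sum.inter_restrict[symmetric]) (auto intro!: arg_cong[of _ _ "sum f"])
   also have "... = (SUM u:Vec n. f (M + outer n j u et))" unfolding set using inj by (simp add: sum.reindex)
   finally show "(SUM u:Vec n. f (M + outer n j u et)) = 0" by simp
  qed
  from Plow_cuspidal[OF this x] im[OF x] show "f x = 0" by simp
 qed simp
 then show ?thesis unfolding cZ .
qed

end

context gl_pair
begin

text \<open>psi occurs in the coefficient of al at most as often as in the j-th power of tau, where
  the coefficient of each be enters with the degree of be, which is at least 1.\<close>

lemma trace_old_part:
 assumes al: "al : S.irr" and psi: "psi : G.irr"
 shows "Re (G.ip (D_coef n j al) psi * psi (idm n)) <= Re (psi (idm n) / of_nat (card GG) * (SUM x:XX. Gkr n psi x x))"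
proof -
 let ?G = "of_nat (card GG) :: complex" and ?S = "of_nat (card SS) :: complex"
 have nz: "?G ~= 0" "?S ~= 0" using G.card_pos S.card_pos by simp_all
 obtain p :: nat where p: "p > 0" "psi (idm n) = of_nat p" using G.irr_degree[OF psi] by blast
 have "EX k. G.ip (D_coef n j be) psi = of_nat k" if "be : S.irr" for be using G.ip_vchar_nat[OF D_coef_vchar[OF that] psi] by blast
 then obtain k where k: "!!be. be : S.irr ==> G.ip (D_coef n j be) psi = of_nat (k be)" by metis
 have "\<exists>d::nat. d > 0 & be (idm j) = of_nat d" if "be : S.irr" for be using S.irr_degree[OF that] by blast
 then obtain d :: "('a mat => complex) => nat" where d: "!!be. be : S.irr ==> d be > 0 & be (idm j) = of_nat (d be)" by metis
 have mmk: "mm psi be = of_nat (k be) * (?G * ?S)" if "be : S.irr" for be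
  using k[OF that] nz unfolding ip_D_coef by (simp add: field_simps)
 have "(SUM g:GG. tau_m n g ^ j * cnj (psi g)) * ?S = (SUM be:S.irr. cnj (be (idm j)) * mm psi be)" by (rule tau_pow_mm[symmetric])
 also have "... = (SUM be:S.irr. of_nat (d be * k be) * (?G * ?S))"
 proof (rule sumc)
  fix be assume b: "be : S.irr"
  have "be (idm j) = of_nat (d be)" using d[OF b] by blast
  then show "cnj (be (idm j)) * mm psi be = of_nat (d be * k be) * (?G * ?S)" using mmk[OF b] by simp
 qed
 also have "... = of_nat (SUM be:S.irr. d be * k be) * ?G * ?S" by (simp only: sum_distrib_right of_nat_sum mult.assoc)
 finally have t: "(SUM g:GG. tau_m n g ^ j * cnj (psi g)) = of_nat (SUM be:S.irr. d be * k be) * ?G" using nz by simp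
 have "(SUM x:XX. Gkr n psi x x) = (SUM g:GG. A.fixc g * cnj (psi g))"
  using A.kr_trace[OF G.irr_spherical[OF psi] one_GLm] p by (simp add: A_kr cong: sum.cong)
 also have "... = (SUM g:GG. tau_m n g ^ j * cnj (psi g))"
  by (rule sumc) (simp add: A.fixc_def tau_pow)
 finally have "psi (idm n) / ?G * (SUM x:XX. Gkr n psi x x) = of_nat (p * (SUM be:S.irr. d be * k be))" unfolding t p(2) using nz by simp
 moreover have "k al <= (SUM be:S.irr. d be * k be)"
 proof -
  have "k al <= d al * k al" using d[OF al] by simp
  also have "... <= (SUM be:S.irr. d be * k be)" by (rule member_le_sum) (use al in auto)
  finally show ?thesis .
 qed
 then have "k al * p <= p * (SUM be:S.irr. d be * k be)" by simp
 from of_nat_mono[OF this, where 'a = real] have "real (k al * p) <= real (p * (SUM be:S.irr. d be * k be))" .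
 moreover have "G.ip (D_coef n j al) psi * psi (idm n) = of_nat (k al * p)" using k[OF al] p by simp
 ultimately show ?thesis by (simp only: complex_Re_of_nat)
qed

text \<open>th is the only new partner of al and occurs once, so all constituents of the difference
  are old and its degree is at most the trace of Plow.\<close>

lemma low_part_degree:
 assumes new: "new_char n j th" and al: "al : S.irr" and mm: "mm th al ~= 0"
 shows "(%g. D_coef n j al g - th g) : G.vchar" (is "?E : _")
  and "Re (D_coef n j al (idm n)) - Re (th (idm n)) <= 2 * (real CARD('a) ^ j - 1) * real CARD('a) ^ (n * (j - 1))"
proof -
 note th = new_irr[OF new]
 show E: "?E : G.vchar" by (rule G.vchar_remove[OF D_coef_vchar[OF al] th]) (simp add: ip_D_new[OF assms])
 have z: "G.ip ?E psi = 0" if psi: "psi : G.irr" "new_char n j psi" for psi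
 proof (cases "psi = th")
  case True
  then show ?thesis using ip_D_new[OF assms] G.irr_orthogonal[OF th th] by (simp add: ip_minus)
 next
  case False
  then have "mm psi al = 0" using new_unique[OF psi(2) new al _ mm] by blast
  then show ?thesis using G.irr_orthogonal[OF th psi(1)] False by (auto simp: ip_minus ip_D_coef)
 qed
 have o: "G.ip ?E psi = G.ip (D_coef n j al) psi" if psi: "psi : olds" for psi
  using G.irr_orthogonal[OF th, of psi] psi new by (auto simp: olds_def ip_minus)
 have "?E (idm n) = (SUM psi:G.irr. G.ip ?E psi * psi (idm n))" by (rule G.vchar_expand[OF E])
 also have "... = (SUM psi:olds. G.ip ?E psi * psi (idm n))" by (rule sum.mono_neutral_right) (use z in \<open>auto simp: olds_def\<close>)
 also have "... = (SUM psi:olds. G.ip (D_coef n j al) psi * psi (idm n))" by (rule sumc) (simp add: o)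
 finally have "Re (?E (idm n)) = (SUM psi:olds. Re (G.ip (D_coef n j al) psi * psi (idm n)))" by (simp only: Re_sum)
 also have "... <= (SUM psi:olds. Re (psi (idm n) / of_nat (card GG) * (SUM x:XX. Gkr n psi x x)))"
  by (rule sum_mono) (use trace_old_part[OF al] in \<open>auto simp: olds_def\<close>)
 also have "... = Re (ktrace XX Plow)"
 proof -
  have "ktrace XX Plow = (SUM psi:olds. SUM x:XX. psi (idm n) / of_nat (card GG) * Gkr n psi x x)" unfolding ktrace_def Plow_def by (rule sum.swap)
  also have "... = (SUM psi:olds. psi (idm n) / of_nat (card GG) * (SUM x:XX. Gkr n psi x x))"
   by (rule sumc, rule sum_distrib_left[symmetric])
  finally show ?thesis by (simp only: Re_sum)
 qed
 also have "... <= real (2 * (CARD('a) ^ j - 1) * CARD('a) ^ (n * (j - 1)))"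
  using Plow_trace by (metis complex_Re_of_nat of_nat_mono)
 also have "real (2 * (CARD('a) ^ j - 1) * CARD('a) ^ (n * (j - 1))) = 2 * (real CARD('a) ^ j - 1) * real CARD('a) ^ (n * (j - 1))"
 proof -
  have "CARD('a) ^ j >= 1" using card_ge_2 by simp
  then have "real (CARD('a) ^ j - 1) = real CARD('a) ^ j - 1" by (simp add: of_nat_diff)
  then show ?thesis by simp
 qed
 finally show "Re (D_coef n j al (idm n)) - Re (th (idm n)) <= 2 * (real CARD('a) ^ j - 1) * real CARD('a) ^ (n * (j - 1))" by simp
qed

text \<open>From al(1)^2 <= |S| <= q^(j^2). For q >= 3 the scalars give |S| >= 2, so that 2 al(1) <=
  |S| holds for degree 1 as well as for larger degrees.\<close>

lemma degree_ratio:
 assumes al: "al : S.irr"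
 defines "T \<equiv> Re (al (idm j)) / real (card SS)"
 shows "1 / real CARD('a) ^ (j * j) <= T" "T <= 1" "CARD('a) >= 3 ==> T <= 1 / 2"
proof -
 obtain a :: nat where a: "a > 0" "al (idm j) = of_nat a" using S.irr_degree[OF al] by blast
 have T: "T = real a / real (card SS)" by (simp add: T_def a)
 have s0: "card SS > 0" by (rule S.card_pos)
 have sq: "a * a <= card SS"
 proof -
  have "real (a * a) <= real (card SS)" using S.irr_abs_sum(2)[OF al] a by (simp add: power2_eq_square)
  then show ?thesis by (simp only: of_nat_le_iff)
 qed
 have "card SS <= card (Mat j j :: 'a mat set)" by (rule card_mono) (auto simp: GLm_def)
 then have "real (card SS) <= real CARD('a) ^ (j * j)" by (simp add: card_carrier_mat flip: of_nat_power)
 then have "1 / real CARD('a) ^ (j * j) <= 1 / real (card SS)" using s0 by (intro divide_left_mono) auto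
 also have "... <= T" unfolding T using a(1) s0 by (intro divide_right_mono) auto
 finally show "1 / real CARD('a) ^ (j * j) <= T" .
 have "a <= a * a" using a(1) by simp
 then have "a <= card SS" using sq by linarith
 then show "T <= 1" unfolding T using s0 by simp
 assume q3: "CARD('a) >= 3"
 have "card (UNIV - {0 :: 'a}) = CARD('a) - 1" by simp
 moreover have "card ((%c :: 'a. c \<cdot>\<^sub>m idm j) ` (UNIV - {0})) = card (UNIV - {0 :: 'a})"
  by (rule card_image) (rule inj_on_subset[OF scalar_inj], simp)
 moreover have "card ((%c :: 'a. c \<cdot>\<^sub>m idm j) ` (UNIV - {0})) <= card SS" by (rule card_mono) (use scalar_SS in auto)
 ultimately have s2: "card SS >= 2" using q3 by linarith
 have "2 * a <= card SS"
 proof (cases "a >= 2")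
  case True
  then have "2 * a <= a * a" by simp
  then show ?thesis using sq by linarith
 next
  case False
  then show ?thesis using s2 by simp
 qed
 then have "real (2 * a) <= real (card SS)" by (rule of_nat_mono)
 then show "T <= 1 / 2" unfolding T using s0 by (simp add: field_simps)
qed

lemma character_estimates:
 assumes th: "th : gl_irr n" and lv: "true_level n th = j"
 shows "EX T. 1 / real CARD('a) ^ (j * j) <= T & T <= 1 & (CARD('a) >= 3 --> T <= 1 / 2) &
  T * real CARD('a) ^ (n * j) - (2 * real CARD('a) ^ j - 1) * real CARD('a) ^ (n * (j - 1)) <= Re (th (idm n)) &
  (ALL g:GG. cmod (th g) <= T * (SUM c:UNIV - {0}. real CARD('a) ^ (j * eig n g c)) + (2 * real CARD('a) ^ j - 1) * real CARD('a) ^ (n * (j - 1)))"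
proof -
 have new: "new_char n j th" using true_level(2)[OF th] lv by simp
 obtain al where al: "al : S.irr" and mm: "mm th al ~= 0" using exists_alpha[of th] true_level(1)[OF th] lv by auto
 define T where "T = Re (al (idm j)) / real (card SS)"
 let ?Q = "real CARD('a)"
 let ?L = "2 * (?Q ^ j - 1) * ?Q ^ (n * (j - 1))"
 \<comment> \<open>The old part contributes 2 (q^j - 1) and the terms s outside the main part
   contribute 1, each times q^(n (j-1)).\<close>
 have sum: "?L + ?Q ^ (n * (j - 1)) = (2 * ?Q ^ j - 1) * ?Q ^ (n * (j - 1))" by (simp add: algebra_simps)
 have d: "T * ?Q ^ (n * j) - (2 * ?Q ^ j - 1) * ?Q ^ (n * (j - 1)) <= Re (th (idm n))"
  using degree_lower[OF al] low_part_degree(2)[OF new al mm] sum unfolding T_def by linarith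
 have u: "cmod (th g) <= T * (SUM c:UNIV - {0}. ?Q ^ (j * eig n g c)) + (2 * ?Q ^ j - 1) * ?Q ^ (n * (j - 1))" if g: "g : GG" for g
 proof -
  have "cmod (D_coef n j al g - th g) <= ?L" using G.vchar_bound[OF low_part_degree(1)[OF new al mm] g] low_part_degree(2)[OF new al mm] by simp
  moreover have "cmod (th g) <= cmod (D_coef n j al g) + cmod (D_coef n j al g - th g)"
   using norm_triangle_ineq4[of "D_coef n j al g" "D_coef n j al g - th g"] by simp
  ultimately show ?thesis using D_coef_upper[OF al g] sum unfolding T_def by linarith
 qed
 show ?thesis using degree_ratio[OF al] d u unfolding T_def[symmetric] by blast
qed

end

subsection \<open>Twists by linear characters\<close>

lemma mat_trace_one: "mat_trace (idm d) = of_nat d"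
 by (simp add: mat_trace_def)

lemma trivial_char:
 "linear_char n (GLm n :: 'a::field mat set) (%g. if g : GLm n then 1 else 0)"
proof -
 have "is_rep n (GLm n :: 'a mat set) 1 (%g. idm 1)" by (simp add: is_rep_def)
 moreover have "(%g :: 'a mat. if g : GLm n then 1 else 0) = (%g. if g : GLm n then mat_trace (idm 1) else 0)"
  using mat_trace_one[of 1] by (auto simp: fun_eq_iff)
 ultimately have "is_char n (GLm n :: 'a mat set) (%g. if g : GLm n then 1 else 0)" unfolding is_char_def by blast
 then show ?thesis by (simp add: linear_char_def one_GLm)
qed

lemma linear_char_mult:
 fixes lam :: "'a::{finite,field} mat => complex"
 assumes l: "linear_char n (GLm n) lam" and g: "g : GLm n" and h: "h : GLm n"
 shows "lam (g * h) = lam g * lam h"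
proof -
 obtain d rh where rh: "is_rep n (GLm n) d rh" and lam: "lam = (%g. if g : GLm n then mat_trace (rh g) else 0)"
  using l by (auto simp: linear_char_def is_char_def)
 have "lam (idm n) = of_nat d" unfolding lam using rh one_GLm by (simp add: is_rep_def mat_trace_one)
 then have d: "d = 1" using l by (simp add: linear_char_def)
 have c: "rh g : Mat (1::nat) 1" if "g : GLm n" for g using rh that d by (simp add: is_rep_def)
 have t: "lam g = rh g $$ (0,0)" if "g : GLm n" for g using c[OF that] that by (simp add: lam mat_trace_def)
 have z: "(0::nat) < 1" by simp
 have "rh (g * h) = rh g * rh h" using rh g h by (simp add: is_rep_def)
 then have "lam (g * h) = (rh g * rh h) $$ (0,0)" using t[OF GLm_mult[OF g h]] by simp
 also have "... = lam g * lam h" unfolding mult_mat_index[OF c[OF g] c[OF h] z z] using t[OF g] t[OF h] by simp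
 finally show ?thesis .
qed

lemma linear_char_norm:
 fixes lam :: "'a::{finite,field} mat => complex"
 assumes l: "linear_char n (GLm n) lam" and g: "g : GLm n"
 shows "cmod (lam g) = 1"
proof -
 interpret finite_group_on "GLm n :: 'a mat set" "(*)" "idm n" "minv n" by (rule GL_group)
 have v: "lam : vchar" and 1: "lam (idm n) = 1" using l by (simp_all add: linear_char_def is_char_vchar[OF GL_group])
 have b: "cmod (lam h) <= 1" if "h : GLm n" for h using vchar_bound[OF v that] 1 by simp
 have "lam g * lam (minv n g) = 1" using linear_char_mult[OF l g iv_in[OF g]] 1 g by simp
 then have m: "cmod (lam g) * cmod (lam (minv n g)) = 1" by (metis norm_mult norm_one)
 have "cmod (lam g) * cmod (lam (minv n g)) <= cmod (lam g) * 1" by (rule mult_left_mono) (use b[OF iv_in[OF g]] in auto)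
 then show ?thesis using m b[OF g] by linarith
qed

text \<open>By minimality, a linear character that attains the level yields a twist whose true level
  is exactly the level. Bounds on absolute values may then be proved for the twist.\<close>

lemma exists_twist:
 fixes ch :: "'a::{finite,field} mat => complex"
 assumes ch: "ch : Irr n (GLm n)"
 shows "EX lam. linear_char n (GLm n) lam & (%g. lam g * ch g) : gl_irr n & true_level n (%g. lam g * ch g) = level n ch"
proof -
 interpret finite_group_on "GLm n :: 'a mat set" "(*)" "idm n" "minv n" by (rule GL_group)
 let ?P = "%k. EX lam. linear_char n (GLm n) lam & constituent n (GLm n) (%g. lam g * ch g) (%g. tau_m n g ^ k)"
 define tr :: "'a mat => complex" where "tr = (%g. if g : GLm n then 1 else 0)"
 have trl: "linear_char n (GLm n) tr" unfolding tr_def by (rule trivial_char)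
 have chi: "ch : gl_irr n" using ch by (simp add: GL_Irr)
 have "(%g. tr g * ch g) = ch" using irr_out[OF chi] by (auto simp: tr_def)
 then have "?P (true_level n ch)" using trl constituent_tau[OF chi] true_level(1)[OF chi] by metis
 then have "?P (level n ch)" unfolding level_def by (rule LeastI)
 then obtain lam where lam: "linear_char n (GLm n) lam" "constituent n (GLm n) (%g. lam g * ch g) (%g. tau_m n g ^ level n ch)" by blast
 let ?t = "%g. lam g * ch g"
 have t: "?t : gl_irr n" using lam(2) by (simp add: constituent_def GL_Irr)
 have "true_level n ?t <= level n ch" using true_level_le[OF t] lam(2) constituent_tau[OF t] by blast
 moreover have "level n ch <= true_level n ?t" unfolding level_def
  by (rule Least_le) (use lam(1) constituent_tau[OF t] true_level(1)[OF t] in blast)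
 ultimately show ?thesis using lam(1) t by (metis le_antisym)
qed

text \<open>The zeroth power of tau is the trivial character, which has no other
  constituent.\<close>

lemma true_level_0:
 fixes th :: "'a::{finite,field} mat => complex"
 assumes th: "th : gl_irr n" and 0: "true_level n th = 0" and g: "g : GLm n"
 shows "th g = 1"
proof -
 interpret finite_group_on "GLm n :: 'a mat set" "(*)" "idm n" "minv n" by (rule GL_group)
 define tr :: "'a mat => complex" where "tr = (%g. if g : GLm n then 1 else 0)"
 have "is_char n (GLm n) tr" using trivial_char by (auto simp: tr_def linear_char_def)
 moreover have "ip tr tr = 1" using card_pos by (simp add: ip_def tr_def)
 ultimately have tr: "tr : irr" using vchar_norm_one by (simp add: is_char_vchar[OF GL_group])
 have "(SUM g:GLm n. cnj (th g)) ~= 0" using true_level(1)[OF th] 0 by simp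
 then have "ip tr th ~= 0" using card_pos by (simp add: ip_def tr_def)
 then have "tr = th" using irr_orthogonal[OF tr th] by metis
 then show ?thesis using g by (auto simp: tr_def)
qed

subsection \<open>Numerical estimates\<close>

text \<open>T Y is the main term of the degree d, e the error, and kp the fraction of T Y that d
  retains. The sum over eigenspaces costs \<mu> and the error 1/4, both relative to (T Y)^x, while
  d^x >= kp (T Y)^x because kp and x are at most 1.\<close>

lemma final_estimate:
 fixes T :: real
 assumes T: "0 < T" and Y: "0 < Y" and x: "0 <= x" "x <= 1" and kp: "0 < kp" "kp <= 1"
  and d: "T * Y - e <= d" and e: "e <= (1 - kp) * (T * Y)" and v: "v <= T * S + e"
  and B: "T * S <= \<mu> * (T * Y) powr x" "4 * e <= (T * Y) powr x" and \<mu>: "\<mu> + 1 / 4 < 1.76 * kp"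
 shows "v < 1.76 * d powr x"
proof -
 let ?B = "(T * Y) powr x"
 have TY: "0 < T * Y" using T Y by simp
 then have B0: "0 < ?B" using T Y by simp
 have d': "kp * (T * Y) <= d" using d e by (simp add: algebra_simps)
 have "kp = kp powr 1" using kp by simp
 also have "... <= kp powr x" by (rule powr_mono') (use x kp in auto)
 finally have "kp * ?B <= kp powr x * ?B" using B0 by (intro mult_right_mono) auto
 also have "... = (kp * (T * Y)) powr x" using kp TY by (simp add: powr_mult)
 also have "... <= d powr x" by (rule powr_mono2) (use d' kp TY x in auto)
 finally have k: "kp * ?B <= d powr x" .
 have "v <= (\<mu> + 1 / 4) * ?B" using v B by (simp add: algebra_simps)
 also have "... < 1.76 * kp * ?B" using \<mu> B0 by (intro mult_strict_right_mono) auto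
 also have "... <= 1.76 * d powr x" using k by simp
 finally show ?thesis .
qed

lemma power_ge_two:
 fixes Q :: real
 assumes "2 <= Q" "k <= m"
 shows "2 ^ k <= Q ^ m"
proof -
 have "(2::real) ^ k <= 2 ^ m" using assms by (intro power_increasing) auto
 also have "... <= Q ^ m" using assms by (intro power_mono) auto
 finally show ?thesis .
qed

lemma error_small:
 fixes Q T :: real
 assumes Q: "2 <= Q" and j: "1 <= j" and T: "1 / Q ^ (j * j) <= T" and n: "j * j + j + r <= n"
 shows "2 ^ r * ((2 * Q ^ j - 1) * Q ^ (n * (j - 1))) <= 2 * (T * Q ^ (n * j))"
proof -
 have Q0: "0 < Q" using Q by simp
 have nj: "n * j = j * j + (j + (n * (j - 1) + (n - j * j - j)))" using n j by (cases j) auto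
 have "2 ^ r * ((2 * Q ^ j - 1) * Q ^ (n * (j - 1))) <= 2 ^ r * ((2 * Q ^ j) * Q ^ (n * (j - 1)))"
  using Q0 by (intro mult_left_mono mult_right_mono) auto
 also have "... <= Q ^ (n - j * j - j) * ((2 * Q ^ j) * Q ^ (n * (j - 1)))"
  using Q0 power_ge_two[OF Q, of r "n - j * j - j"] n by (intro mult_right_mono) auto
 also have "... = 2 * (1 / Q ^ (j * j) * Q ^ (n * j))" unfolding nj power_add using Q0 by simp
 also have "... <= 2 * (T * Q ^ (n * j))" using T Q0 by (intro mult_left_mono mult_right_mono) auto
 finally show ?thesis .
qed

text \<open>Merging two exponents can only help, as R^a + R^b <= 1 + R^(a+b); iterated, the sum
  concentrates in one exponent.\<close>

lemma sum_power_le: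
 fixes R :: real
 assumes "finite C" "1 <= R"
 shows "(SUM c:C. R ^ f c) + 1 <= real (card C) + R ^ (SUM c:C. f c)"
 using assms(1)
proof (induction C rule: finite_induct)
 case (insert c C)
 have "0 <= (R ^ f c - 1) * (R ^ (SUM c:C. f c) - 1)" using assms(2) by (intro mult_nonneg_nonneg) auto
 then show ?case using insert by (simp add: power_add algebra_simps)
qed simp

text \<open>The hypothesis grants each eigenspace a share of H proportional to its dimension, with N
  as the unit, so all shares together are n/N. The extra card C covers the eigenvalues with
  eigenspace 0, where h is 1.\<close>

lemma sum_weighted_le:
 fixes h :: "nat => real"
 assumes C: "finite C" and N: "0 < N" and f: "(SUM c:C. f c) <= n" and H: "0 <= H"
  and h: "!!c. c : C ==> f c > 0 ==> N * h (f c) <= real (f c) * H" and h0: "h 0 = 1"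
 shows "(SUM c:C. h (f c)) <= real (card C) + real n / N * H"
proof -
 have "N * h (f c) <= N + real (f c) * H" if "c : C" for c
  using h[OF that] h0 N by (cases "f c = 0") (auto intro: order_trans)
 then have "(SUM c:C. N * h (f c)) <= (SUM c:C. N + real (f c) * H)" by (rule sum_mono)
 also have "... = real (card C) * N + real (SUM c:C. f c) * H" by (simp add: sum.distrib sum_distrib_right)
 also have "... <= real (card C) * N + real n * H"
  using of_nat_mono[OF f, where 'a = real] H by (intro add_left_mono mult_right_mono) auto
 finally have "N * (SUM c:C. h (f c)) <= N * (real (card C) + real n / N * H)"
  using N by (simp add: sum_distrib_left algebra_simps)
 then show ?thesis using N by simp
qed

text \<open>The exponent 1 - 1/n turns q^(n j) into ?H = q^(j (n-1)), the contribution of an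
  eigenspace of codimension one, the largest one allowed here. The whole sum is at most 101/80 = 6/5
  + 1/16 times ?H: n/(n-1) <= 6/5 because n >= 6, and the number of eigenvalues is at most
  ?H/16.\<close>

lemma estimate_noncentral:
 fixes Q T :: real and f :: "'c => nat"
 assumes Q: "2 <= Q" and j: "1 <= j" and nb: "3 * j * j + 3 * j + 5 <= 2 * n"
  and T: "1 / Q ^ (j * j) <= T" "T <= 1" and d: "T * Q ^ (n * j) - (2 * Q ^ j - 1) * Q ^ (n * (j - 1)) <= d"
  and C: "finite C" "real (card C) <= Q" and f: "(SUM c:C. f c) <= n" "!!c. c : C ==> f c < n"
  and v: "v <= T * (SUM c:C. Q ^ (j * f c)) + (2 * Q ^ j - 1) * Q ^ (n * (j - 1))"
 shows "v < 1.76 * d powr (1 - 1 / real n)"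
proof -
 have Q0: "0 < Q" using Q by simp
 have "0 < 1 / Q ^ (j * j)" using Q0 by simp
 then have T0: "0 < T" using T(1) by linarith
 have jj: "1 <= j * j" using j by (metis mult_le_mono nat_mult_1)
 have nb': "3 * (j * j) + 3 * j + 5 <= 2 * n" using nb by (simp add: mult.assoc)
 have n0: "6 <= n" using nb' jj j by linarith
 let ?e = "(2 * Q ^ j - 1) * Q ^ (n * (j - 1))"
 let ?H = "Q ^ (j * (n - 1))"
 have Y: "(Q ^ (n * j)) powr (1 - 1 / real n) = ?H"
 proof -
  have "(Q ^ (n * j)) powr (1 - 1 / real n) = Q powr (real (n * j) * (1 - 1 / real n))" using Q0 by (simp add: powr_realpow[symmetric] powr_powr)
  also have "real (n * j) * (1 - 1 / real n) = real (j * (n - 1))" using n0 by (simp add: field_simps of_nat_diff)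
  finally show ?thesis using Q0 by (simp add: powr_realpow del: of_nat_mult)
 qed
 have B: "T * ?H <= (T * Q ^ (n * j)) powr (1 - 1 / real n)"
 proof -
  have "T powr 1 <= T powr (1 - 1 / real n)" by (rule powr_mono') (use T T0 in auto)
  then have "T * ?H <= T powr (1 - 1 / real n) * ?H" using Q0 T0 by (intro mult_right_mono) auto
  then show ?thesis using T0 Q0 by (simp add: powr_mult Y)
 qed
 \<comment> \<open>The factor 16 keeps the error below 1/8 of the main term, whence the 7/8 at the
   end.\<close>
 have e1: "16 * ?e <= 2 * (T * Q ^ (n * j))"
 proof -
  have "w + j + 4 <= n" if "3 * w + 3 * j + 5 <= 2 * n" "1 <= w" for w using that j by presburger
  from this[OF nb' jj] have "j * j + j + 4 <= n" .
  from error_small[OF Q j T(1) this] show ?thesis by simp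
 qed
 have e2: "4 * ?e <= T * ?H"
 proof -
  have "w + j + (j + 3) <= n" if "3 * w + 3 * j + 5 <= 2 * n" "j <= w" for w using that by presburger
  from this[OF nb'] have 3: "j * j + j + (j + 3) <= n" using j by simp
  have nj: "n * j = j * j + (j + (n * (j - 1) + (n - j * j - j)))" using 3 j by (cases j) auto
  have nj': "n * j = j + j * (n - 1)" using n0 by (cases n) auto
  have k: "n - j * j - j = j + (n - j * j - j - j)" using 3 by simp
  have "8 <= Q ^ (n - j * j - j - j)" using power_ge_two[OF Q, of 3 "n - j * j - j - j"] 3 by simp
  then have "8 * (Q ^ j * Q ^ j * Q ^ (n * (j - 1))) <= Q ^ (n - j * j - j - j) * (Q ^ j * Q ^ j * Q ^ (n * (j - 1)))"
   using Q0 by (intro mult_right_mono) auto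
  also have "... = Q ^ (n * j) / Q ^ (j * j)" unfolding nj power_add using Q0 by (subst k) (simp add: power_add)
  also have "... <= T * Q ^ (n * j)" using mult_right_mono[OF T(1), of "Q ^ (n * j)"] Q0 by simp
  also have "... = Q ^ j * (T * ?H)" unfolding nj' power_add by simp
  finally have "Q ^ j * (8 * (Q ^ j * Q ^ (n * (j - 1)))) <= Q ^ j * (T * ?H)" by (simp add: mult_ac)
  then have "8 * (Q ^ j * Q ^ (n * (j - 1))) <= T * ?H" using Q0 by simp
  moreover have "4 * ?e <= 8 * (Q ^ j * Q ^ (n * (j - 1)))" using Q0 by (simp add: algebra_simps)
  ultimately show ?thesis by linarith
 qed
 have S: "(SUM c:C. Q ^ (j * f c)) <= 101 / 80 * ?H"
 proof -
  have "(SUM c:C. (%m. Q ^ (j * m)) (f c)) <= real (card C) + real n / real (n - 1) * ?H"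
  proof (rule sum_weighted_le[OF C(1) _ f(1)])
   fix c assume c: "c : C" "f c > 0"
   define m where "m = n - 1 - f c"
   have m: "n - 1 = f c + m" using f(2)[OF c(1)] by (simp add: m_def)
   \<comment> \<open>n - 1 = f c + m is at most f c (m + 1), and m + 1 <= 2^m is absorbed by the
     missing power q^(j m).\<close>
   have "n - 1 <= f c * (m + 1)" unfolding m using c(2) by (cases "f c") auto
   then have "real (n - 1) <= real (f c) * real (m + 1)" by (metis of_nat_le_iff of_nat_mult)
   also have "... <= real (f c) * Q ^ (j * m)"
   proof (rule mult_left_mono)
    have "real (m + 1) <= 2 ^ m" by (metis Suc_eq_plus1 Suc_leI less_exp of_nat_le_iff of_nat_numeral of_nat_power)
    also have "... <= Q ^ (j * m)" using j by (intro power_ge_two[OF Q]) auto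
    finally show "real (m + 1) <= Q ^ (j * m)" .
   qed simp
   finally have "real (n - 1) * Q ^ (j * f c) <= real (f c) * Q ^ (j * m) * Q ^ (j * f c)" using Q0 by (intro mult_right_mono) auto
   also have "... = real (f c) * ?H" unfolding m by (simp add: algebra_simps power_add)
   finally show "real (n - 1) * Q ^ (j * f c) <= real (f c) * ?H" .
  qed (use n0 Q0 in auto)
  moreover have "real n / real (n - 1) <= 6 / 5" using n0 by (simp add: field_simps of_nat_diff)
  then have "real n / real (n - 1) * ?H <= 6 / 5 * ?H" using Q0 by (intro mult_right_mono) auto
  moreover have "real (card C) <= 1 / 16 * ?H"
  proof -
   have "(16::real) = 2 ^ 4" by simp
   also have "... <= Q ^ (j * (n - 1) - 1)"
   proof (rule power_ge_two[OF Q])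
    have "1 * (n - 1) <= j * (n - 1)" using j by (rule mult_right_mono) simp
    then show "4 <= j * (n - 1) - 1" using n0 by linarith
   qed
   finally have "16 * Q <= Q ^ (j * (n - 1) - 1) * Q" using Q0 by (intro mult_right_mono) auto
   also have "... = ?H" using j n0 by (subst power_minus_mult) auto
   finally show ?thesis using C(2) by simp
  qed
  ultimately show ?thesis by simp
 qed
 show ?thesis
 proof (rule final_estimate[OF T0 _ _ _ _ _ d _ v, of _ "7 / 8" "101 / 80"])
  have "T * (SUM c:C. Q ^ (j * f c)) <= T * (101 / 80 * ?H)" using S T0 by (intro mult_left_mono) auto
  then show "T * (SUM c:C. Q ^ (j * f c)) <= 101 / 80 * (T * Q ^ (n * j)) powr (1 - 1 / real n)" using B by linarith
  show "4 * ?e <= (T * Q ^ (n * j)) powr (1 - 1 / real n)" using e2 B by linarith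
  have "16 * u <= 2 * w ==> u <= (1 - 7 / 8) * w" for u w :: real by simp
  from this[OF e1] show "?e <= (1 - 7 / 8) * (T * Q ^ (n * j))" .
 qed (use Q0 n0 in auto)
qed

text \<open>Supplies the linear bound for \<open>sum_weighted_le\<close> with N = n/2 and H =
  q^(n/2), where n = 2 r + k. It rests on 1 + k/2 <= 1.7^k, with 1.7 a rational lower bound for the
  square root of 3 and hence of q.\<close>

lemma sqrt_power_ge:
 fixes Q :: real
 assumes Q: "3 <= Q" and r: "1 <= r" and H: "0 <= H" "H * H = Q ^ (2 * r + k)"
 shows "real (2 * r + k) / 2 * Q ^ r <= real r * H"
proof -
 have "1 + real k * (7 / 10) <= (1 + 7 / 10) ^ k" by (rule Bernoulli_inequality) simp
 then have "1 + real k / 2 <= (17 / 10) ^ k" by simp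
 then have "(1 + real k / 2)\<^sup>2 <= ((17 / 10) ^ k)\<^sup>2" by (intro power_mono) auto
 also have "... = (289 / 100) ^ k" by (simp add: power2_eq_square flip: power_mult_distrib)
 also have "... <= Q ^ k" using Q by (intro power_mono) auto
 finally have "(Q ^ r)\<^sup>2 * (1 + real k / 2)\<^sup>2 <= (Q ^ r)\<^sup>2 * Q ^ k" by (intro mult_left_mono) auto
 also have "... = H\<^sup>2" using H(2) by (simp add: power2_eq_square power_add mult_2)
 finally have "(Q ^ r * (1 + real k / 2))\<^sup>2 <= H\<^sup>2" by (simp add: power_mult_distrib)
 then have h: "Q ^ r * (1 + real k / 2) <= H" using H(1) by (rule power2_le_imp_le)
 have "real (2 * r + k) / 2 <= real r * (1 + real k / 2)"
 proof -
  have "real k <= real r * real k" using r by (simp add: mult_le_cancel_right1)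
  then show ?thesis by (simp add: algebra_simps)
 qed
 then have "real (2 * r + k) / 2 * Q ^ r <= real r * (1 + real k / 2) * Q ^ r" using Q by (intro mult_right_mono) auto
 also have "... <= real r * H" using mult_left_mono[OF h, of "real r"] by (simp add: mult_ac)
 finally show ?thesis .
qed

text \<open>The two lower bounds for the exponent match two shapes of the sum: a/n matches one
  dominant eigenspace of dimension a, and t = 1 - 1/(2 j) matches H^(2 j - 1) with H = q^(n/2). If q
  = 2, there is a single nonzero eigenvalue. Otherwise either the largest eigenspace exceeds n/2 and
  dominates, or all are at most n/2 and the sum is about 2 H^j at most.\<close>

lemma estimate_general:
 fixes Q T :: real and f :: "'c => nat"
 assumes Q: "2 <= Q" and Q3: "Q = 2 \<or> 3 <= Q & T <= 1 / 2" and j: "1 <= j" and nb: "3 * j * j + j + 5 <= n"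
  and T: "1 / Q ^ (j * j) <= T" "T <= 1" and d: "T * Q ^ (n * j) - (2 * Q ^ j - 1) * Q ^ (n * (j - 1)) <= d"
  and C: "finite C" "real (card C) = Q - 1" and f: "(SUM c:C. f c) <= n" "!!c. c : C ==> f c <= a" and a: "c0 : C" "f c0 = a" "a < n"
  and x: "1 - 1 / (2 * real j) <= x" "real a / real n <= x" "x <= 1"
  and v: "v <= T * (SUM c:C. Q ^ (j * f c)) + (2 * Q ^ j - 1) * Q ^ (n * (j - 1))"
 shows "v < 1.76 * d powr x"
proof -
 have Q0: "0 < Q" using Q by simp
 have "0 < 1 / Q ^ (j * j)" using Q0 by simp
 then have T0: "0 < T" using T(1) by linarith
 have jj: "1 <= j * j" using j by (metis mult_le_mono nat_mult_1)
 have n0: "9 <= n" using nb jj j by linarith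
 let ?e = "(2 * Q ^ j - 1) * Q ^ (n * (j - 1))"
 let ?Y = "Q ^ (n * j)"
 let ?B = "(T * ?Y) powr x"
 have Th: "1 <= T * ?Y"
 proof -
  have "j * j <= n * j" using nb j by (intro mult_right_mono) auto
  then have "Q ^ (j * j) <= ?Y" using Q by (intro power_increasing) auto
  then have "1 <= 1 / Q ^ (j * j) * ?Y" using Q0 by simp
  also have "... <= T * ?Y" using T Q0 by (intro mult_right_mono) auto
  finally show ?thesis .
 qed
 define t where "t = 1 - 1 / (2 * real j)"
 have t: "1 / 2 <= t" "t <= 1" using j by (simp_all add: t_def field_simps)
 have x0: "0 <= x" using x(1) t by (simp add: t_def)
 define H where "H = sqrt (Q ^ n)"
 have H: "0 < H" "H * H = Q ^ n" using Q0 by (simp_all add: H_def)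
 have Hp: "H = Q powr (real n / 2)" using Q0 by (simp add: H_def powr_half_sqrt[symmetric] powr_realpow[symmetric] powr_powr)
 have "T powr 1 <= T powr (real a / real n)" using a(3) T T0 by (intro powr_mono') auto
 then have "T * Q ^ (j * a) <= T powr (real a / real n) * Q ^ (j * a)" using Q0 T0 by (intro mult_right_mono) auto
 also have "... = (T * ?Y) powr (real a / real n)"
 proof -
  have "?Y powr (real a / real n) = Q powr (real (n * j) * (real a / real n))" using Q0 by (simp add: powr_realpow[symmetric] powr_powr)
  also have "real (n * j) * (real a / real n) = real (j * a)" using n0 by simp
  finally have "?Y powr (real a / real n) = Q ^ (j * a)" using Q0 by (simp add: powr_realpow del: of_nat_mult)
  then show ?thesis using T0 Q0 by (simp add: powr_mult)
 qed
 also have "... <= ?B" by (rule powr_mono) (use x Th in auto)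
 finally have B1: "T * Q ^ (j * a) <= ?B" .
 have "T powr t * Q powr (real (n * j) - real n / 2) = (T * ?Y) powr t"
 proof -
  have "?Y powr t = Q powr (real (n * j) * t)" using Q0 by (simp add: powr_realpow[symmetric] powr_powr)
  also have "real (n * j) * t = real (n * j) - real n / 2" using j by (simp add: t_def field_simps)
  finally show ?thesis using T0 Q0 by (simp add: powr_mult)
 qed
 also have "... <= ?B" by (rule powr_mono) (use x Th in \<open>auto simp: t_def\<close>)
 finally have B2: "T powr t * Q powr (real (n * j) - real n / 2) <= ?B" .
 have nbr: "3 * real (j * j) + real j + 5 <= real n" using of_nat_mono[OF nb, where 'a = real] by simp
 have jr: "1 <= real j" "1 <= real (j * j)" using j jj by (metis of_nat_1 of_nat_le_iff)+
 have e2: "4 * ?e <= ?B"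
 proof -
  have "8 <= Q powr 3" using power_ge_two[OF Q, of 3 3] Q0 by (simp add: powr_realpow[of Q 3, simplified])
  also have "... <= Q powr (real n / 2 - real (j * j) - real j / 2)" using nbr jr Q by (intro powr_mono) auto
  finally have "8 * Q powr (real j + real (n * (j - 1))) <= Q powr (real n / 2 - real (j * j) - real j / 2) * Q powr (real j + real (n * (j - 1)))"
   by (intro mult_right_mono) auto
  also have "... = Q powr (- (real (j * j) * t)) * Q powr (real (n * j) - real n / 2)"
  proof -
   have "n * j = n * (j - 1) + n" using j by (cases j) auto
   then have nj: "real (n * j) = real (n * (j - 1)) + real n" by (metis of_nat_add)
   have "real (j * j) * t = real (j * j) - real j / 2" using j by (simp add: t_def field_simps)
   then have "real n / 2 - real (j * j) - real j / 2 + (real j + real (n * (j - 1))) = - (real (j * j) * t) + (real (n * j) - real n / 2)"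
    unfolding nj by linarith
   then show ?thesis unfolding powr_add[symmetric] by (rule arg_cong)
  qed
  also have "... <= T powr t * Q powr (real (n * j) - real n / 2)"
  proof (rule mult_right_mono)
   have "Q powr (- (real (j * j) * t)) = (1 / Q ^ (j * j)) powr t"
    using Q0 by (simp add: powr_minus powr_divide powr_realpow[symmetric] powr_powr inverse_eq_divide)
   also have "... <= T powr t" by (rule powr_mono2) (use t T Q0 in auto)
   finally show "Q powr (- (real (j * j) * t)) <= T powr t" .
  qed simp
  finally have "8 * Q powr (real j + real (n * (j - 1))) <= ?B" using B2 by linarith
  moreover have "Q powr (real j + real (n * (j - 1))) = Q ^ j * Q ^ (n * (j - 1))"
   using Q0 by (simp add: powr_add powr_realpow del: of_nat_mult)
  moreover have "4 * ?e <= 8 * (Q ^ j * Q ^ (n * (j - 1)))" using Q0 by (simp add: algebra_simps)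
  ultimately show ?thesis by linarith
 qed
 have S: "T * (SUM c:C. Q ^ (j * f c)) <= 29 / 20 * ?B"
 proof (cases "Q = 2")
  case True
  then have "card C = 1" using C(2) by simp
  then have "C = {c0}" using a(1) by (metis card_1_singletonE singletonD)
  then have "T * (SUM c:C. Q ^ (j * f c)) = T * Q ^ (j * a)" using a(2) by simp
  moreover have "0 <= ?B" by simp
  ultimately show ?thesis using B1 by linarith
 next
  case False
  then have Q3: "3 <= Q" "T <= 1 / 2" using Q3 by auto
  show ?thesis
  proof (cases "n < 2 * a")
   case True
   let ?R = "Q ^ j"
   have Qj: "?R ^ m = Q ^ (j * m)" for m by (simp add: power_mult)
   have R1: "1 <= ?R" using Q by simp
   have sp: "(SUM c:C. f c) = a + (SUM c:C - {c0}. f c)" using sum.remove[OF C(1) a(1), of f] a(2) by simp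
   \<comment> \<open>The other eigenspaces are merged into one of dimension at most n - a < a. The
     sum is then at most (1 + 1/81 + 1/3) q^(j a), which is below 29/20 q^(j a).\<close>
   have "(SUM c:C - {c0}. ?R ^ f c) + 1 <= real (card (C - {c0})) + ?R ^ (SUM c:C - {c0}. f c)" using C(1) R1 by (intro sum_power_le) auto
   moreover have "real (card (C - {c0})) <= Q - 1" using C(2) card_mono[OF C(1), of "C - {c0}"] by (metis Diff_subset of_nat_le_iff)
   moreover have "?R ^ (SUM c:C - {c0}. f c) <= ?R ^ (n - a)" using R1 sp f(1) by (intro power_increasing) auto
   moreover have "(SUM c:C. ?R ^ f c) = ?R ^ a + (SUM c:C - {c0}. ?R ^ f c)" using sum.remove[OF C(1) a(1), of "%c. ?R ^ f c"] a(2) by simp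
   ultimately have s: "(SUM c:C. Q ^ (j * f c)) <= Q ^ (j * a) + Q + Q ^ (j * (n - a))" unfolding Qj by linarith
   have aa: "5 <= a" using True n0 by linarith
   have ja: "a <= j * a" using j by simp
   have "81 * Q <= Q ^ (j * a)"
   proof -
    have "(81::real) = 3 ^ 4" by simp
    also have "... <= Q ^ 4" using Q3 by (intro power_mono) auto
    finally have "81 * Q <= Q ^ 4 * Q" using Q0 by (intro mult_right_mono) auto
    also have "... = Q ^ 5" by (simp add: eval_nat_numeral)
    also have "... <= Q ^ (j * a)" using order_trans[OF aa ja] Q by (intro power_increasing) auto
    finally show ?thesis .
   qed
   moreover have "3 * Q ^ (j * (n - a)) <= Q ^ (j * a)"
   proof -
    have "j * (n - a + 1) <= j * a" using True by (intro mult_left_mono) auto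
    then have "j * (n - a) + 1 <= j * a" using j by (simp add: algebra_simps)
    then have "Q ^ (j * (n - a) + 1) <= Q ^ (j * a)" using Q by (intro power_increasing) auto
    moreover have "3 * Q ^ (j * (n - a)) <= Q * Q ^ (j * (n - a))" using Q3 by (intro mult_right_mono) auto
    ultimately show ?thesis by simp
   qed
   ultimately have "(SUM c:C. Q ^ (j * f c)) <= 29 / 20 * Q ^ (j * a)" using s Q0 zero_less_power[OF Q0, of "j * a"] by simp
   then have "T * (SUM c:C. Q ^ (j * f c)) <= T * (29 / 20 * Q ^ (j * a))" using T0 by (intro mult_left_mono) auto
   then show ?thesis using B1 by linarith
  next
   case False
   have hh: "real n / 2 * Q ^ (j * r) <= real r * H ^ j" if r: "0 < r" "2 * r <= n" for r
   proof -
    obtain k where k: "n = 2 * r + k" using r(2) by (metis le_Suc_ex)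
    have "real n / 2 * Q ^ r <= real r * H" using sqrt_power_ge[OF Q3(1), of r H k] r H k by simp
    moreover have "Q ^ r <= H"
    proof (rule power2_le_imp_le)
     have "Q ^ (r + r) <= Q ^ n" using r Q by (intro power_increasing) auto
     then show "(Q ^ r)\<^sup>2 <= H\<^sup>2" using H(2) by (simp add: power2_eq_square power_add)
    qed (use H in simp)
    then have "(Q ^ r) ^ (j - 1) <= H ^ (j - 1)" using Q0 by (intro power_mono) auto
    ultimately have "(real n / 2 * Q ^ r) * (Q ^ r) ^ (j - 1) <= (real r * H) * H ^ (j - 1)" by (rule mult_mono) (use Q0 H in auto)
    moreover have "Q ^ (j * r) = Q ^ r * (Q ^ r) ^ (j - 1)" using j by (cases j) (simp_all add: power_mult[symmetric] power_add mult.commute)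
    moreover have "H ^ j = H * H ^ (j - 1)" using j by (cases j) auto
    ultimately show ?thesis by (simp add: mult_ac)
   qed
   have "(SUM c:C. (%r. Q ^ (j * r)) (f c)) <= real (card C) + real n / (real n / 2) * H ^ j"
   proof (rule sum_weighted_le[OF C(1) _ f(1)])
    fix c assume c: "c : C" "0 < f c"
    have "2 * f c <= n" using f(2)[OF c(1)] False by linarith
    then show "real n / 2 * Q ^ (j * f c) <= real (f c) * H ^ j" by (rule hh[OF c(2)])
   qed (use n0 H in auto)
   then have s: "(SUM c:C. Q ^ (j * f c)) <= Q + 2 * H ^ j" using n0 C(2) by simp
   \<comment> \<open>H^2 = q^n with n >= 9, and 3^7 = 2187 exceeds 45^2 = 2025; thus the q - 1 terms
     for empty eigenspaces are negligible against H.\<close>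
   have HQ: "45 * Q <= H"
   proof (rule power2_le_imp_le)
    have "(3::real) ^ 7 <= Q ^ 7" using Q3 by (intro power_mono) auto
    then have "2025 * (Q * Q) <= Q ^ 7 * (Q * Q)" using Q0 by (intro mult_right_mono) auto
    also have "... = Q ^ 9" by (simp add: eval_nat_numeral)
    also have "... <= Q ^ n" using n0 Q by (intro power_increasing) auto
    finally show "(45 * Q)\<^sup>2 <= H\<^sup>2" using H(2) by (simp add: power2_eq_square)
   qed (use H in simp)
   have HB: "T powr t * H ^ (2 * j - 1) <= ?B"
   proof -
    have "H ^ (2 * j - 1) = Q powr (real n / 2 * real (2 * j - 1))" using Hp H Q0 by (simp add: powr_powr powr_realpow[symmetric])
    also have "real n / 2 * real (2 * j - 1) = real (n * j) - real n / 2" using j by (simp add: of_nat_diff field_simps)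
    finally show ?thesis using B2 by simp
   qed
   show ?thesis
   \<comment> \<open>For j = 1 the sum, at most (2 + 1/45) H, has the order of the bound, and the
     constant is saved by T <= 1/2: it gives T <= 0.7072 sqrt T, and 0.7072 times 2.0223 is below
     29/20. For j >= 2 at least one power of H is left over.\<close>
   proof (cases "j = 1")
    case True
    have tt: "T powr t = sqrt T" using True T0 by (simp add: t_def powr_half_sqrt)
    have "sqrt T <= 7072 / 10000"
     by (rule real_le_lsqrt) (use Q3(2) in \<open>simp_all add: power2_eq_square\<close>)
    then have "sqrt T * sqrt T <= sqrt T * (7072 / 10000)" using T0 by (intro mult_left_mono) auto
    then have T7: "T <= 7072 / 10000 * sqrt T" using T0 by simp
    have "H ^ j = H" using True by simp
    then have "(SUM c:C. Q ^ (j * f c)) <= 20223 / 10000 * H" using s HQ H(1) by linarith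
    then have "T * (SUM c:C. Q ^ (j * f c)) <= T * (20223 / 10000 * H)" using T0 by (intro mult_left_mono) auto
    also have "... <= 7072 / 10000 * sqrt T * (20223 / 10000 * H)" using T7 H by (intro mult_right_mono) auto
    also have "... <= 29 / 20 * (sqrt T * H)" using H T0 mult_nonneg_nonneg[of "sqrt T" H] by (simp add: algebra_simps)
    also have "... <= 29 / 20 * ?B" using HB True tt by (simp add: mult.commute)
    finally show ?thesis .
   next
    case False
    then have j2: "2 <= j" using j by simp
    have H1: "135 <= H" using HQ Q3 by linarith
    have "H ^ j >= H" using H1 j by (intro self_le_power) auto
    then have "Q + 2 * H ^ j <= 3 * H ^ j" using HQ Q0 by linarith
    also have "... <= H * H ^ j" using H1 H by (intro mult_right_mono) auto
    also have "... = H ^ (j + 1)" by simp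
    also have "... <= H ^ (2 * j - 1)" using H1 j2 by (intro power_increasing) auto
    finally have "T * (SUM c:C. Q ^ (j * f c)) <= T * H ^ (2 * j - 1)" using s T0 by (intro mult_left_mono) auto
    also have "... <= T powr t * H ^ (2 * j - 1)"
    proof (rule mult_right_mono)
     have "T powr 1 <= T powr t" by (rule powr_mono') (use t T T0 in auto)
     then show "T <= T powr t" using T0 by simp
    qed (use H in simp)
    finally have "T * (SUM c:C. Q ^ (j * f c)) <= ?B" using HB by linarith
    moreover have "0 <= ?B" by simp
    ultimately show ?thesis by linarith
   qed
  qed
 qed
 show ?thesis
 \<comment> \<open>With the factor 2^7 the error is at most 1/64 of the main term, and 29/20 + 1/4 <
   1.76 times 63/64.\<close>
 proof (rule final_estimate[OF T0 _ _ _ _ _ d _ v S e2, of "63 / 64"])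
  have "j * j + j + 7 <= n" using nb jj by linarith
  note e1 = error_small[OF Q j T(1) this]
  have "2 ^ 7 * u <= 2 * w ==> u <= (1 - 63 / 64) * w" for u w :: real by simp
  from this[OF e1] show "?e <= (1 - 63 / 64) * (T * Q ^ (n * j))" .
 qed (use Q0 x0 x in auto)
qed

subsection \<open>Restriction to the special linear group\<close>

text \<open>As q^n > q^(2j), two functionals agree on all columns of x and y; their difference l
  kills both images. In coordinates whose first one is l, the matrix diag(c, 1, ..., 1) fixes the
  kernel of l pointwise.\<close>

lemma exists_fixing_with_det:
 fixes x y :: "'a::{finite,field} mat"
 assumes x: "x : Mat n j" and y: "y : Mat n j" and jn: "2 * j < n" and c: "c ~= 0"
 shows "EX u:GLm n. det u = c & u * x = x & u * y = y"
proof -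
 let ?xt = "trm x" and ?yt = "trm y"
 have xt: "?xt : Mat j n" "?yt : Mat j n" using x y by auto
 let ?m = "%l. (?xt *v l, ?yt *v l)"
 have "\<not> inj_on ?m (Vec n)"
 proof
  assume "inj_on ?m (Vec n)"
  then have "card (Vec n :: 'a vec set) <= card (Vec j \<times> Vec j :: ('a vec \<times> 'a vec) set)"
   by (rule card_inj_on_le) (use xt in auto)
  then have "CARD('a) ^ n <= CARD('a) ^ (j + j)" by (simp add: card_carrier_vec' card_cartesian_product power_add)
  then show False using jn card_UNIV_field[where 'a='a] by (simp add: power_increasing_iff)
 qed
 then obtain l1 l2 where l12: "l1 : Vec n" "l2 : Vec n" "?xt *v l1 = ?xt *v l2" "?yt *v l1 = ?yt *v l2" "l1 ~= l2"
  by (auto simp: inj_on_def)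
 define l where "l = l1 - l2"
 have l: "l : Vec n" "l ~= zv n" using l12 vec_eq_if_diff_0[OF l12(1,2)] by (auto simp: l_def)
 have k0: "A *v l = zv j" if "A : Mat j n" "A *v l1 = A *v l2" for A
  unfolding l_def mult_minus_distrib_mat_vec[OF that(1) l12(1,2)] using that l12(2) by auto
 have W: "subsp n {zv n :: 'a vec}" by (auto simp: subsp_def)
 have n0: "0 < n" using jn by simp
 have e0: "unit_vec n 0 : Vec n" "unit_vec n 0 ~= (zv n :: 'a vec)"
 proof -
  have "unit_vec n 0 $ 0 ~= (zv n :: 'a vec) $ 0" using n0 by simp
  then show "unit_vec n 0 ~= (zv n :: 'a vec)" by metis
 qed simp
 obtain h where h: "h : GLm n" "h *v l = unit_vec n 0" using mover[OF W l(1) _ e0(1)] l(2) e0(2) by auto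
 let ?k = "trm h"
 have k: "?k : GLm n" by (rule transpose_GLm[OF h(1)])
 note kc = GLm_carrier[OF k] minv_carrier[OF k]
 define D where "D = mat n n (%(i,k). if i = k then if i = 0 then c else 1 else 0)"
 have D: "D : Mat n n" by (simp add: D_def)
 have "det D = prod_list (diag_mat D)" by (rule det_upper_triangular[OF _ D]) (auto simp: D_def)
 also have "... = (\<Prod>i\<leftarrow>[0..<n]. if i = 0 then c else 1)" unfolding diag_mat_def by (rule arg_cong[of _ _ prod_list]) (auto simp: D_def)
 also have "... = (\<Prod>i\<in>{0..<n}. if i = 0 then c else 1)" by (simp add: prod.distinct_set_conv_list[symmetric])
 also have "... = c" using n0 by simp
 finally have dD: "det D = c" .
 define u where "u = ?k * D * minv n ?k"
 have uc: "u : Mat n n" using kc D by (simp add: u_def)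
 have "det u = det ?k * det D * det (minv n ?k)" unfolding u_def using det_mult[OF mult_carrier_mat[OF kc(1) D] kc(2)] det_mult[OF kc(1) D] by simp
 also have "... = det (?k * minv n ?k) * c" using det_mult[OF kc] dD by simp
 also have "... = c" unfolding minv(3)[OF k] by simp
 finally have du: "det u = c" .
 have fixw: "u *v w = w" if w: "w : Vec n" "l *. w = 0" for w
 proof -
  let ?v = "minv n ?k *v w"
  have v: "?v : Vec n" using kc w by auto
  have kv: "?k *v ?v = w" by (rule GLm_cancel_vec(2)[OF k w(1)])
  have "l *. w = (trm ?k *v l) *. ?v" using transpose_vec_mult_scalar[OF kc(1) v l(1)] kv by simp
  then have "unit_vec n 0 *. ?v = 0" using w(2) h(2) by simp
  then have v0: "?v $ 0 = 0" using scalar_prod_left_unit[OF v n0] by simp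
  have "D *v ?v = ?v"
  proof (rule eq_vecI)
   fix i assume "i < dim_vec ?v"
   then have i: "i < n" unfolding carrier_vecD[OF v] .
   have "(D *v ?v) $ i = (\<Sum>m<n. if m = i then (if i = 0 then c else 1) * ?v $ m else 0)"
    unfolding mult_mat_vec_index[OF D v i] using i by (intro sum.cong refl) (simp add: D_def)
   also have "... = (if i = 0 then c else 1) * ?v $ i" using i by simp
   also have "... = ?v $ i" using v0 by (cases "i = 0") simp_all
   finally show "(D *v ?v) $ i = ?v $ i" .
  next
   show "dim_vec (D *v ?v) = dim_vec ?v" unfolding carrier_vecD[OF v] using D by simp
  qed
  then have "?k *v (D *v ?v) = w" using kv by simp
  then show ?thesis unfolding u_def
   using assoc_mult_mat_vec[OF mult_carrier_mat[OF kc(1) D] kc(2) w(1)] assoc_mult_mat_vec[OF kc(1) D v] by simp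
 qed
 have fixm: "u * z = z" if z: "z : Mat n j" "trm z *v l = zv j" for z
 proof (rule mat_eq_by_vec[of _ n j])
  fix v :: "'a vec" assume v: "v : Vec j"
  have "l *. (z *v v) = 0" using transpose_vec_mult_scalar[OF z(1) v l(1)] z(2) v by simp
  moreover have "z *v v : Vec n" using z v by auto
  ultimately show "(u * z) *v v = z *v v" using fixw assoc_mult_mat_vec[OF uc z(1) v] by simp
 qed (use uc z in auto)
 have "u : GLm n" using uc du c by (simp add: GLm_def)
 then show ?thesis using du fixm[OF x k0[OF xt(1) l12(3)]] fixm[OF y k0[OF xt(2) l12(4)]] by blast
qed

lemma det_minv:
 assumes "g : GLm n"
 shows "det (minv n g) = 1 / det g"
proof -
 have "det g * det (minv n g) = 1" using det_mult[OF GLm_carrier[OF assms] minv_carrier[OF assms]] minv(3)[OF assms] by simp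
 then show ?thesis using assms by (simp add: GLm_def field_simps)
qed

lemma det_mult_GLm: "g : GLm n ==> h : GLm n ==> det (g * h) = det g * det h"
 by (rule det_mult[OF GLm_carrier GLm_carrier])

lemma GLm_det: "g : GLm n ==> det g ~= 0"
 by (simp add: GLm_def)

text \<open>Split the norm of th on GL_n by determinant into the sums C c; it suffices that they are
  all equal. If det k = d, convolution at k shows C 1 th(k) = C d th(k), so an element k with th(k)
  nonzero is wanted for every determinant. It is found in the stabilizer of a matrix x at which the
  kernel of th is nonzero: the partial sums B d of th over this stabilizer do not depend on
  d.\<close>

lemma norm_on_SL:
 fixes th :: "'a::{finite,field} mat => complex"
 assumes th: "th : gl_irr n" and lv: "true_level n th = j" and jn: "2 * j < n"
 shows "(SUM g:SLm n. th g * cnj (th g)) = of_nat (card (SLm n :: 'a mat set))"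
proof -
 let ?GG = "GLm n :: 'a mat set" and ?X = "Mat n j :: 'a mat set"
 interpret A: group_action_on ?GG "(*)" "idm n" "minv n" ?X "(*)" by (rule GL_action)
 have sp: "A.spherical th" by (rule A.irr_spherical[OF th])
 note s = A.sphericalD[OF sp]
 have assoc: "a * b * c = a * (b * c)" if "a : ?GG" "b : ?GG" "c : ?GG" for a b c by (rule A.assoc[OF that])
 have "(SUM g:?GG. A.fixc g * cnj (th g)) = (SUM g:?GG. tau_m n g ^ j * cnj (th g))"
  by (rule sumc) (simp add: A.fixc_def tau_pow)
 then have "(SUM x:?X. A.kr th x x) ~= 0" using A.kr_trace[OF sp one_GLm] true_level(1)[OF th] lv s(1) by (simp cong: sum.cong)
 then obtain x where x: "x : ?X" "A.kr th x x ~= 0" by (meson sum.neutral)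
 define B where "B d = (SUM p:?GG. if p * x = x & det p = d then th p else 0)" for d
 define Bt where "Bt = (SUM p:?GG. if p * x = x then th p else 0)"
 have "Bt = cnj (A.kr th x x)" by (auto simp: Bt_def A.kr_def intro!: sum.cong)
 then have Bt: "Bt ~= 0" using x by simp
 define Sh where "Sh h d = (SUM p:?GG. SUM p':?GG. if p * x = x & p' * x = x & det p' = d then th (h * p * minv n h * p') else 0)" for h d
 \<comment> \<open>u has determinant c and fixes both x and h x. Inserting it next to p' multiplies
   the determinant by c, and carried through h it becomes k = h^-1 u h, which fixes x and is
   absorbed by p.\<close>
 have Sinv: "Sh h d = Sh h (c * d)" if h: "h : ?GG" and c: "c ~= 0" for h c d
 proof -
  have hx: "h * x : ?X" by (rule A.act_in[OF h x(1)])
  obtain u where u: "u : ?GG" "det u = c" "u * x = x" "u * (h * x) = h * x" using exists_fixing_with_det[OF x(1) hx jn c] by blast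
  define k where "k = minv n h * u * h"
  have k: "k : ?GG" using A.closed A.iv_in h u by (simp add: k_def)
  have hi: "minv n h : ?GG" by (rule A.iv_in[OF h])
  have kx: "k * x = x"
   unfolding k_def using A.act_mul[OF A.closed[OF hi u(1)] h x(1)] A.act_mul[OF hi u(1) hx] u(4) GLm_cancel_mat(1)[OF h x(1)] by simp
  have "Sh h (c * d) = (SUM p:?GG. SUM p':?GG. if p * x = x & p' * x = x & det p' = c * d then th (h * p * minv n h * p') else 0)" by (simp add: Sh_def)
  also have "... = (SUM p:?GG. SUM p':?GG. if p * x = x & u * p' * x = x & det (u * p') = c * d then th (h * p * minv n h * (u * p')) else 0)"
   by (rule sumc, rule A.sum_left[OF u(1), of "%p'. if _ & p' * x = x & det p' = c * d then th (_ * p') else 0", symmetric])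
  also have "... = (SUM p:?GG. SUM p':?GG. if p * k * x = x & p' * x = x & det p' = d then th (h * (p * k) * minv n h * p') else 0)"
  proof (rule sumc, rule sumc)
   fix p p' assume p: "p : ?GG" "p' : ?GG"
   have 1: "u * p' * x = x <-> p' * x = x"
    using A.act_mul[OF u(1) p(2) x(1)] GLm_cancel_mat(1)[OF u(1), of x j] GLm_cancel_mat(1)[OF u(1) A.act_in[OF p(2) x(1)]] u(3) x(1) by metis
   have 2: "det (u * p') = c * d <-> det p' = d" using det_mult_GLm[OF u(1) p(2)] u(2) c by simp
   have 3: "p * k * x = p * x" using A.act_mul[OF p(1) k x(1)] kx by simp
   have "h * (p * k) * minv n h * p' = h * p * (k * minv n h) * p'" using h p k hi assoc A.closed by simp
   also have "k * minv n h = minv n h * u" unfolding k_def using assoc[OF A.closed[OF hi u(1)] h hi] A.iv_right[OF h] A.closed[OF hi u(1)] by simp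
   also have "h * p * (minv n h * u) * p' = h * p * minv n h * (u * p')" using h p u hi assoc A.closed by simp
   finally show "(if p * x = x & u * p' * x = x & det (u * p') = c * d then th (h * p * minv n h * (u * p')) else 0)
    = (if p * k * x = x & p' * x = x & det p' = d then th (h * (p * k) * minv n h * p') else 0)" unfolding 1 2 3 by simp
  qed
  also have "... = Sh h d" unfolding Sh_def
   by (rule A.sum_right[OF k, of "%p. SUM p':?GG. if p * x = x & p' * x = x & det p' = d then th (h * p * minv n h * p') else 0"])
  finally show ?thesis by simp
 qed
 \<comment> \<open>Summing over h, the functional equation separates the two stabilizer sums; since
   Bt is nonzero, invariance of Sh passes to B.\<close>
 have SB: "(SUM h:?GG. Sh h d) * th (idm n) = of_nat (card ?GG) * Bt * B d" for d
 proof -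
  have "(SUM h:?GG. Sh h d) = (SUM p:?GG. SUM p':?GG. SUM h:?GG. if p * x = x & p' * x = x & det p' = d then th (h * p * minv n h * p') else 0)"
   unfolding Sh_def by (subst sum.swap) (rule sumc, rule sum.swap)
  then have "(SUM h:?GG. Sh h d) * th (idm n) = (SUM p:?GG. SUM p':?GG. (SUM h:?GG. if p * x = x & p' * x = x & det p' = d then th (h * p * minv n h * p') else 0) * th (idm n))"
   by (simp only: sum_distrib_right)
  also have "... = (SUM p:?GG. SUM p':?GG. of_nat (card ?GG) * ((if p * x = x then th p else 0) * (if p' * x = x & det p' = d then th p' else 0)))"
  proof (rule sumc, rule sumc)
   fix p p' assume p: "p : ?GG" "p' : ?GG"
   show "(SUM h:?GG. if p * x = x & p' * x = x & det p' = d then th (h * p * minv n h * p') else 0) * th (idm n)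
    = of_nat (card ?GG) * ((if p * x = x then th p else 0) * (if p' * x = x & det p' = d then th p' else 0))"
    using s(5)[OF p] by (cases "p * x = x & p' * x = x & det p' = d") auto
  qed
  also have "... = of_nat (card ?GG) * (Bt * B d)"
  proof -
   have e: "Bt * B d = (SUM p:?GG. SUM p':?GG. (if p * x = x then th p else 0) * (if p' * x = x & det p' = d then th p' else 0))"
    unfolding Bt_def B_def by (rule sum_product)
   show ?thesis unfolding e by (simp only: sum_distrib_left)
  qed
  finally show ?thesis by simp
 qed
 have BB: "B d = B 1" if "d ~= 0" for d
 proof -
  have "of_nat (card ?GG) * Bt * B d = of_nat (card ?GG) * Bt * B 1"
   unfolding SB[symmetric] using Sinv[OF _ that, of _ 1] by (simp cong: sum.cong)
  then show ?thesis using Bt A.card_pos by simp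
 qed
 have "Bt = (SUM d:UNIV - {0}. B d)"
 proof -
  have "(SUM d:UNIV - {0}. B d) = (SUM p:?GG. SUM d:UNIV - {0}. if p * x = x & det p = d then th p else 0)" unfolding B_def by (rule sum.swap)
  also have "... = Bt" unfolding Bt_def
  proof (rule sumc)
   fix p assume "p : ?GG"
   then have "(SUM d:UNIV - {0}. if det p = d then (if p * x = x then th p else 0) else 0) = (if p * x = x then th p else 0)"
    using GLm_det by (subst sum.delta') auto
   then show "(SUM d:UNIV - {0}. if p * x = x & det p = d then th p else 0) = (if p * x = x then th p else 0)"
    by (cases "p * x = x") auto
  qed
  finally show ?thesis by simp
 qed
 also have "... = (SUM d:UNIV - {0 :: 'a}. B 1)" by (rule sumc, rule BB) simp
 finally have "B 1 ~= 0" using Bt by auto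
 then have Bd: "B d ~= 0" if "d ~= 0" for d using BB[OF that] by simp
 define C where "C c = (SUM g:?GG. if det g = c then th g * th (minv n g) else 0)" for c
 have C1: "C d = C 1" if d: "d ~= 0" for d
 proof -
  have "EX k:?GG. det k = d & th k ~= 0"
  proof (rule ccontr)
   assume "\<not> ?thesis"
   then have "B d = 0" unfolding B_def by (intro sum.neutral) auto
   then show False using Bd[OF d] by simp
  qed
  then obtain k where k: "k : ?GG" "det k = d" "th k ~= 0" by blast
  have conv: "(SUM g:?GG. (if det g = c then th g else 0) * th (minv n g * k)) * th (idm n) = C c * th k" for c
  proof -
   have "det (h * g * minv n h) = det g" if "g : ?GG" "h : ?GG" for g h
    using that det_mult_GLm[OF A.closed[OF that(2,1)] A.iv_in[OF that(2)]] det_mult_GLm[OF that(2,1)] det_minv[OF that(2)] GLm_det[OF that(2)] by simp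
   then have "(SUM g:?GG. (if det g = c then th g else 0) * th (minv n g * k)) * th (idm n) = (SUM g:?GG. (if det g = c then th g else 0) * th (minv n g)) * th k"
    by (intro A.class_convolution[where f = "%g. if det g = c then th g else 0", OF sp _ k(1)]) (simp add: s(4))
   also have "(SUM g:?GG. (if det g = c then th g else 0) * th (minv n g)) = C c" unfolding C_def by (rule sumc) simp
   finally show ?thesis .
  qed
  \<comment> \<open>The substitution g -> k g^-1 exchanges the two factors and determinant 1 with
    determinant d.\<close>
  have "(SUM g:?GG. (if det g = 1 then th g else 0) * th (minv n g * k)) = (SUM g:?GG. (if det (k * g) = 1 then th (k * g) else 0) * th (minv n (k * g) * k))"
   by (rule A.sum_left[OF k(1), of "%g. (if det g = 1 then th g else 0) * th (minv n g * k)", symmetric])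
  also have "... = (SUM g:?GG. (if det (k * minv n g) = 1 then th (k * minv n g) else 0) * th (minv n (k * minv n g) * k))"
   by (rule A.sum_iv[of "%g. (if det (k * g) = 1 then th (k * g) else 0) * th (minv n (k * g) * k)", symmetric])
  also have "... = (SUM g:?GG. (if det g = d then th g else 0) * th (minv n g * k))"
  proof (rule sumc)
   fix g assume g: "g : ?GG"
   note gi = A.iv_in[OF g]
   have 1: "det (k * minv n g) = 1 <-> det g = d" using det_mult_GLm[OF k(1) gi] det_minv[OF g] k(2) GLm_det[OF g] by (auto simp: field_simps)
   have "minv n (k * minv n g) * k = g * minv n k * k" using A.iv_mul[OF k(1) gi] A.iv_iv[OF g] by simp
   also have "... = g" using A.iv_cancel(4)[OF k(1) g] .
   finally have 2: "minv n (k * minv n g) * k = g" .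
   have 3: "th (k * minv n g) = th (minv n g * k)" by (rule A.spherical_comm[OF sp k(1) gi])
   show "(if det (k * minv n g) = 1 then th (k * minv n g) else 0) * th (minv n (k * minv n g) * k) = (if det g = d then th g else 0) * th (minv n g * k)"
    unfolding 1 2 3 by simp
  qed
  finally have "C 1 * th k = C d * th k" unfolding conv[symmetric] by simp
  then show ?thesis using k(3) by simp
 qed
 have "(SUM d:UNIV - {0}. C d) = (SUM g:?GG. SUM d:UNIV - {0}. if det g = d then th g * th (minv n g) else 0)" unfolding C_def by (rule sum.swap)
 also have "... = (SUM g:?GG. th g * cnj (th g))"
 proof (rule sumc)
  fix g assume g: "g : ?GG"
  show "(SUM d:UNIV - {0}. if det g = d then th g * th (minv n g) else 0) = th g * cnj (th g)"
   using GLm_det[OF g] s(2)[OF g] by (subst sum.delta') auto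
 qed
 also have "... = of_nat (card ?GG)" by (rule s(3))
 finally have "(SUM d:UNIV - {0}. C d) = of_nat (card ?GG)" .
 moreover have "(SUM d:UNIV - {0}. C d) = (SUM d:UNIV - {0 :: 'a}. C 1)" by (rule sumc, rule C1) simp
 ultimately have "of_nat (card (UNIV - {0 :: 'a})) * C 1 = of_nat (card ?GG)" by (simp del: card_Diff_insert)
 \<comment> \<open>The cosets of SL_n are the fibers of the determinant, and every nonzero
   determinant occurs by \<open>exists_fixing_with_det\<close>.\<close>
 moreover have "card ?GG = card (UNIV - {0 :: 'a}) * card (SLm n :: 'a mat set)"
 proof -
  have "card {g\<in>?GG. det g = d} = card (SLm n :: 'a mat set)" if d: "d : det ` ?GG" for d
  proof -
   obtain v where v: "v : ?GG" "det v = d" using d by blast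
   show ?thesis
   proof (rule bij_betw_same_card[of "%g. minv n v * g"], rule bij_betwI[of _ _ _ "%g. v * g"])
    show "(%g. minv n v * g) : {g\<in>?GG. det g = d} \<rightarrow> SLm n"
    proof
     fix g assume "g : {g\<in>?GG. det g = d}"
     then have g: "g : ?GG" "det g = d" by auto
     show "minv n v * g : SLm n" using GLm_carrier[OF A.closed[OF A.iv_in[OF v(1)] g(1)]] det_mult_GLm[OF A.iv_in[OF v(1)] g(1)] det_minv[OF v(1)] v(2) g GLm_det[OF v(1)]
      by (simp add: SLm_def)
    qed
    show "(%g. v * g) : SLm n \<rightarrow> {g\<in>?GG. det g = d}"
    proof
     fix g assume "g : (SLm n :: 'a mat set)"
     then have g: "g : ?GG" "det g = 1" using SLm_GLm by (auto simp: SLm_def)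
     show "v * g : {g\<in>?GG. det g = d}" using A.closed[OF v(1) g(1)] det_mult_GLm[OF v(1) g(1)] v g by simp
    qed
   next
    fix g assume "g : {g\<in>?GG. det g = d}"
    then show "v * (minv n v * g) = g" using A.iv_cancel(2)[OF v(1)] by blast
   next
    fix g assume "g : (SLm n :: 'a mat set)"
    then show "minv n v * (v * g) = g" using A.iv_cancel(1)[OF v(1)] SLm_GLm by blast
   qed
  qed
  then have "card ?GG = card (SLm n :: 'a mat set) * card (det ` ?GG)" by (intro card_fibers) auto
  moreover have "det ` ?GG = UNIV - {0}"
  proof (rule subset_antisym)
   show "UNIV - {0} \<subseteq> det ` ?GG" using exists_fixing_with_det[OF x(1) x(1) jn] by fastforce
  qed (use GLm_det in auto)
  ultimately show ?thesis by simp
 qed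
 moreover have "card (UNIV - {0 :: 'a}) ~= 0" using card_UNIV_field[where 'a = 'a] by simp
 ultimately have "C 1 = of_nat (card (SLm n :: 'a mat set))" by simp
 moreover have "C 1 = (SUM g:SLm n. th g * cnj (th g))"
 proof -
  have "C 1 = (SUM g:?GG \<inter> {g. det g = 1}. th g * th (minv n g))" unfolding C_def by (simp add: sum.inter_restrict)
  also have "?GG \<inter> {g. det g = 1} = SLm n" by (auto simp: GLm_def SLm_def)
  also have "(SUM g:SLm n. th g * th (minv n g)) = (SUM g:SLm n. th g * cnj (th g))"
   by (rule sumc) (use s(2) SLm_GLm in auto)
  finally show ?thesis .
 qed
 ultimately show ?thesis by simp
qed

text \<open>A linear character has absolute value 1, so the norm on SL_n is that of a twist whose
  true level is the level of ch, and \<open>norm_on_SL\<close> applies to the twist.\<close>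

lemma restriction_irreducible:
 fixes ch :: "'a::{finite,field} mat => complex"
 assumes ch: "ch : Irr n (GLm n)" and lv: "2 * level n ch < n"
 shows "(%g. if g : SLm n then ch g else 0) : Irr n (SLm n)"
proof -
 interpret S: finite_group_on "SLm n :: 'a mat set" "(*)" "idm n" "minv n" by (rule SL_group)
 obtain lam where lam: "linear_char n (GLm n) lam" "(%g. lam g * ch g) : gl_irr n" "true_level n (%g. lam g * ch g) = level n ch"
  using exists_twist[OF ch] by blast
 obtain d rh where rh: "is_rep n (GLm n) d rh" "ch = (%g. if g : GLm n then mat_trace (rh g) else 0)"
  using ch by (auto simp: Irr_def is_char_def)
 have "is_rep n (SLm n) d rh" using rh(1) SLm_GLm by (auto simp: is_rep_def subset_iff)
 moreover have "(%g. if g : SLm n then ch g else 0) = (%g. if g : SLm n then mat_trace (rh g) else 0)"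
  by (rule ext) (use SLm_GLm[where 'a = 'a, of n] in \<open>auto simp: rh(2)\<close>)
 ultimately have "is_char n (SLm n) (%g. if g : SLm n then ch g else 0)" unfolding is_char_def by blast
 moreover have "inner_G (SLm n) (%g. if g : SLm n then ch g else 0) (%g. if g : SLm n then ch g else 0) = 1"
 proof -
  have "(SUM g:SLm n. ch g * cnj (ch g)) = (SUM g:SLm n. (lam g * ch g) * cnj (lam g * ch g))"
  proof (rule sumc)
   fix g assume "g : (SLm n :: 'a mat set)"
   then have "cmod (lam g) = 1" using linear_char_norm[OF lam(1)] SLm_GLm by blast
   then have "lam g * cnj (lam g) = 1" by (simp add: complex_norm_square[symmetric])
   moreover have "(lam g * ch g) * cnj (lam g * ch g) = (lam g * cnj (lam g)) * (ch g * cnj (ch g))" by (simp add: mult_ac)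
   ultimately show "ch g * cnj (ch g) = (lam g * ch g) * cnj (lam g * ch g)" by simp
  qed
  also have "... = of_nat (card (SLm n :: 'a mat set))" by (rule norm_on_SL[OF lam(2,3) lv])
  finally show ?thesis using S.card_pos by (simp add: inner_G_def)
 qed
 ultimately show ?thesis by (simp add: Irr_def)
qed

text \<open>If psi were orthogonal to all restrictions, completeness for GL_n would give psi(1) = 0.
  This makes the choice inside \<open>level_SL\<close> meaningful.\<close>

lemma exists_character_above:
 fixes psi :: "'a::{finite,field} mat => complex"
 assumes psi: "psi : Irr n (SLm n)"
 shows "EX ch. ch : Irr n (GLm n) & inner_G (SLm n) ch psi ~= 0"
proof (rule ccontr)
 interpret G: finite_group_on "GLm n :: 'a mat set" "(*)" "idm n" "minv n" by (rule GL_group)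
 interpret S: finite_group_on "SLm n :: 'a mat set" "(*)" "idm n" "minv n" by (rule SL_group)
 have psii: "psi : S.irr" using psi by (simp add: SL_Irr)
 assume "\<not> ?thesis"
 then have "(SUM g:SLm n. ch g * cnj (psi g)) = 0" if "ch : G.irr" for ch using that S.card_pos by (auto simp: GL_Irr inner_G_def)
 then have "0 = (SUM ch:G.irr. ch (idm n) * (SUM g:SLm n. ch g * cnj (psi g)))" by simp
 also have "... = (SUM g:SLm n. SUM ch:G.irr. ch (idm n) * ch g * cnj (psi g))" unfolding sum_distrib_left mult.assoc by (rule sum.swap)
 also have "... = (SUM g:SLm n. if g = idm n then of_nat (card (GLm n :: 'a mat set)) * cnj (psi g) else 0)"
  unfolding sum_distrib_right[symmetric] G.irr_completeness by (rule sumc) simp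
 also have "... = of_nat (card (GLm n :: 'a mat set)) * cnj (psi (idm n))" by simp
 finally show False using S.irr_degree[OF psii] G.card_pos by auto
qed

text \<open>Adding 1/2 and squaring turns the bound into (l + 1/2)^2 <= (8 n - 17)/12, which clears
  to an inequality between integers. The condition on n keeps the radicand nonnegative, so that
  squaring removes the root.\<close>

lemma level_bound_noncentral:
 fixes l n :: nat
 assumes "17 <= 8 * n" and "real l <= sqrt ((8 * real n - 17) / 12) - 1 / 2"
 shows "3 * l * l + 3 * l + 5 <= 2 * n"
proof -
 have y: "0 <= (8 * real n - 17) / 12" using of_nat_mono[OF assms(1), where 'a = real] by simp
 have "(real l + 1 / 2)\<^sup>2 <= (sqrt ((8 * real n - 17) / 12))\<^sup>2" using assms(2) by (intro power_mono) auto
 then have "(real l + 1 / 2)\<^sup>2 <= (8 * real n - 17) / 12" using y by simp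
 moreover have "(real l + 1 / 2)\<^sup>2 = real l * real l + real l + 1 / 4" by (simp add: power2_eq_square algebra_simps)
 ultimately have e: "real l * real l + real l + 1 / 4 <= (8 * real n - 17) / 12" by (simp only:)
 have "w + v + 1 / 4 <= (8 * u - 17) / 12 ==> 3 * w + 3 * v + 5 <= 2 * u" for u v w :: real
  using mult_left_mono[of "w + v + 1 / 4" "(8 * u - 17) / 12" 12] by (simp add: distrib_left)
 from this[OF e] have "3 * (real l * real l) + 3 * real l + 5 <= 2 * real n" .
 then have "real (3 * l * l + 3 * l + 5) <= real (2 * n)" by (simp add: mult.assoc)
 then show ?thesis by (simp only: of_nat_le_iff)
qed

text \<open>The same computation with (6 l + 1)^2 <= 12 n - 59, divided by 12.\<close>

lemma level_bound_general:
 fixes l n :: nat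
 assumes "59 <= 12 * n" and "real l <= (sqrt (12 * real n - 59) - 1) / 6"
 shows "3 * l * l + l + 5 <= n"
proof -
 have y: "0 <= 12 * real n - 59" using of_nat_mono[OF assms(1), where 'a = real] by simp
 have "(6 * real l + 1)\<^sup>2 <= (sqrt (12 * real n - 59))\<^sup>2" using assms(2) by (intro power_mono) auto
 then have "(6 * real l + 1)\<^sup>2 <= 12 * real n - 59" using y by simp
 moreover have "(6 * real l + 1)\<^sup>2 = 36 * (real l * real l) + 12 * real l + 1" by (simp add: power2_eq_square algebra_simps)
 ultimately have e: "36 * (real l * real l) + 12 * real l + 1 <= 12 * real n - 59" by (simp only:)
 have "36 * w + 12 * v + 1 <= 12 * u - 59 ==> 3 * w + v + 5 <= u" for u v w :: real by linarith
 from this[OF e] have "3 * (real l * real l) + real l + 5 <= real n" .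
 then have "real (3 * l * l + l + 5) <= real n" by (simp add: mult.assoc)
 then show ?thesis by (simp only: of_nat_le_iff)
qed

section \<open>The bounds for GL_n and SL_n\<close>

lemma twist_data:
 fixes ch :: "'a::{finite,field} mat => complex"
 assumes ch: "ch : Irr n (GLm n)"
 obtains th where "th : gl_irr n" "true_level n th = level n ch" "!!g. g : GLm n ==> cmod (ch g) = cmod (th g)"
  "cmod (ch (idm n)) = Re (th (idm n))" "0 < Re (th (idm n))" "!!g. g : GLm n ==> cmod (th g) <= Re (th (idm n))"
proof -
 interpret G: finite_group_on "GLm n :: 'a mat set" "(*)" "idm n" "minv n" by (rule GL_group)
 obtain lam where lam: "linear_char n (GLm n) lam" "(%g. lam g * ch g) : gl_irr n" "true_level n (%g. lam g * ch g) = level n ch"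
  using exists_twist[OF ch] by blast
 let ?th = "%g. lam g * ch g"
 have n: "cmod (ch g) = cmod (?th g)" if "g : GLm n" for g using linear_char_norm[OF lam(1) that] by (simp add: norm_mult)
 obtain d :: nat where d: "d > 0" "?th (idm n) = of_nat d" using G.irr_degree[OF lam(2)] by blast
 have "cmod (ch (idm n)) = Re (?th (idm n))" "0 < Re (?th (idm n))" using n[OF one_GLm] d by simp_all
 then show ?thesis using that[of ?th] lam n G.irr_bound[OF lam(2)] by blast
qed

lemma card_nonzero: "real (card (UNIV - {0 :: 'a::{finite,field}})) = real CARD('a) - 1"
 using card_UNIV_field[where 'a = 'a] by (simp add: of_nat_diff)

text \<open>A non-scalar g has no eigenspace of dimension n, which is what
  \<open>estimate_noncentral\<close> asks of it. For level 0 the twist is trivial and all absolute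
  values are 1.\<close>

lemma noncentral_bound:
 fixes ch :: "'a::{finite,field} mat => complex"
 assumes ch: "ch : Irr n (GLm n)" and nb: "3 * level n ch * level n ch + 3 * level n ch + 5 <= 2 * n"
  and g: "g : GLm n" "!!c. g ~= c \<cdot>\<^sub>m idm n"
 shows "cmod (ch g) < 1.76 * cmod (ch (idm n)) powr (1 - 1 / real n)"
proof -
 obtain th where th: "th : gl_irr n" "true_level n th = level n ch" "!!g. g : GLm n ==> cmod (ch g) = cmod (th g)"
  "cmod (ch (idm n)) = Re (th (idm n))" using twist_data[OF ch] by metis
 show ?thesis
 proof (cases "level n ch = 0")
  case True
  then have "th g = 1" "th (idm n) = 1" using true_level_0[OF th(1)] th(2) g(1) one_GLm by auto
  then show ?thesis using th(3)[OF g(1)] th(4) by simp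
 next
  case False
  define j where "j = level n ch"
  have j: "1 <= j" using False by (simp add: j_def)
  note nb = nb[folded j_def]
  have "j * j >= j" using j by simp
  then have "j <= n" using nb by (simp add: mult.assoc)
  then interpret gl_pair n j "TYPE('a)" using j by unfold_locales
  obtain T where T: "1 / real CARD('a) ^ (j * j) <= T" "T <= 1"
   and d: "T * real CARD('a) ^ (n * j) - (2 * real CARD('a) ^ j - 1) * real CARD('a) ^ (n * (j - 1)) <= Re (th (idm n))"
   and v: "!!g. g : GG ==> cmod (th g) <= T * (SUM c:UNIV - {0}. real CARD('a) ^ (j * eig n g c)) + (2 * real CARD('a) ^ j - 1) * real CARD('a) ^ (n * (j - 1))"
   using character_estimates[OF th(1)] th(2) unfolding j_def by blast
  have "eig n g c < n" for c using eig_le[of n g c] eig_full[OF GLm_carrier[OF g(1)], of c] g(2)[of c] by (metis le_neq_implies_less)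
  then show ?thesis unfolding th(3)[OF g(1)] th(4)
   using estimate_noncentral[OF _ j nb T d _ _ sum_eig_le[OF GLm_carrier[OF g(1)]] _ v[OF g(1)]] card_ge_2 card_nonzero[where 'a = 'a] by simp
 qed
qed

text \<open>Level 0 is treated apart: division by 0 returns 0, so the general formula would give
  exponent at least 1 there.\<close>

definition exponent :: "nat => nat => 'a::field mat => real" where
 "exponent n l g = (if l = 0 then real (delta n g) / real n else max (1 - 1 / (2 * real l)) (real (delta n g) / real n))"

lemma general_bound:
 fixes ch :: "'a::{finite,field} mat => complex"
 assumes ch: "ch : Irr n (GLm n)" and nb: "3 * level n ch * level n ch + level n ch + 5 <= n" and g: "g : GLm n"
 shows "cmod (ch g) < 1.76 * cmod (ch (idm n)) powr exponent n (level n ch) g"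
proof -
 obtain th where th: "th : gl_irr n" "true_level n th = level n ch" "!!g. g : GLm n ==> cmod (ch g) = cmod (th g)"
  "cmod (ch (idm n)) = Re (th (idm n))" "0 < Re (th (idm n))" "!!g. g : GLm n ==> cmod (th g) <= Re (th (idm n))" using twist_data[OF ch] by metis
 show ?thesis
 proof (cases "level n ch = 0")
  case True
  then have "th g = 1" "th (idm n) = 1" using true_level_0[OF th(1)] th(2) g one_GLm by auto
  then show ?thesis using th(3)[OF g] th(4) by simp
 next
  case False
  define j where "j = level n ch"
  have j: "1 <= j" using False by (simp add: j_def)
  note nb = nb[folded j_def]
  have jn: "j <= n" using nb by simp
  then interpret gl_pair n j "TYPE('a)" using j by unfold_locales
  have n0: "0 < n" using j jn by simp
  define x where "x = exponent n j g"
  have x: "1 - 1 / (2 * real j) <= x" "real (delta n g) / real n <= x" "x <= 1"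
   using delta_le[of n g] n0 j by (simp_all add: x_def exponent_def)
  let ?C = "UNIV - {0 :: 'a}"
  have ne: "eig n g ` ?C ~= {}" by (auto intro: exI[of _ 1])
  \<comment> \<open>a is the largest eigenspace dimension for nonzero eigenvalues in the base field.
    \<open>delta\<close> also sees the algebraic closure, so a <= \<open>delta n g\<close>, and the
    exponent is at least a/n.\<close>
  define a where "a = Max (eig n g ` ?C)"
  have "a : eig n g ` ?C" unfolding a_def by (rule Max_in) (use ne in auto)
  then obtain c0 where c0: "c0 : ?C" "eig n g c0 = a" by blast
  have le: "eig n g c <= a" if "c : ?C" for c unfolding a_def using that by (intro Max_ge) auto
  have ad: "a <= delta n g" using eig_le_delta[OF GLm_carrier[OF g], of c0] c0 by simp
  then have ax: "real a / real n <= x" using x(2) n0 by (meson divide_right_mono of_nat_0_le_iff of_nat_mono order_trans)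
  have "cmod (th g) < 1.76 * Re (th (idm n)) powr x"
  \<comment> \<open>For a = n the exponent is 1, and the bound of |th g| by the degree
    suffices.\<close>
  proof (cases "a = n")
   case True
   then have "x = 1" using ax x(3) n0 by simp
   then show ?thesis using th(5) th(6)[OF g] by simp
  next
   case False
   then have an: "a < n" using eig_le[of n g c0] c0 by simp
   obtain T where T: "1 / real CARD('a) ^ (j * j) <= T" "T <= 1" "CARD('a) >= 3 --> T <= 1 / 2"
    and d: "T * real CARD('a) ^ (n * j) - (2 * real CARD('a) ^ j - 1) * real CARD('a) ^ (n * (j - 1)) <= Re (th (idm n))"
    and v: "!!g. g : GG ==> cmod (th g) <= T * (SUM c:UNIV - {0}. real CARD('a) ^ (j * eig n g c)) + (2 * real CARD('a) ^ j - 1) * real CARD('a) ^ (n * (j - 1))"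
    using character_estimates[OF th(1)] th(2) unfolding j_def by blast
   have Q2: "2 <= real CARD('a)" using card_ge_2 by simp
   have Q3: "real CARD('a) = 2 \<or> 3 <= real CARD('a) & T <= 1 / 2"
   proof (cases "CARD('a) = 2")
    case False
    then have "CARD('a) >= 3" using card_ge_2 by linarith
    then show ?thesis using T(3) by simp
   qed simp
   show ?thesis
    by (rule estimate_general[OF Q2 Q3 j nb T(1,2) d _ card_nonzero sum_eig_le[OF GLm_carrier[OF g]] le c0 an x(1) ax x(3) v[OF g]]) simp
  qed
  then show ?thesis unfolding th(3)[OF g] th(4) x_def j_def .
 qed
qed

text \<open>The character chosen in \<open>level_SL\<close> restricts irreducibly to SL_n, so lying
  over psi means restricting to psi, and bounds for GL_n carry over.\<close>

lemma SL_character: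
 fixes psi :: "'a::{finite,field} mat => complex"
 assumes psi: "psi : Irr n (SLm n)" and lv: "2 * level_SL n psi < n"
 shows "EX ch:Irr n (GLm n). level n ch = level_SL n psi & (ALL g:SLm n. psi g = ch g)"
proof -
 interpret S: finite_group_on "SLm n :: 'a mat set" "(*)" "idm n" "minv n" by (rule SL_group)
 define ch where "ch = (SOME ch. ch : Irr n (GLm n) & inner_G (SLm n) ch psi ~= 0)"
 have ch: "ch : Irr n (GLm n)" "inner_G (SLm n) ch psi ~= 0" using someI_ex[OF exists_character_above[OF psi]] by (simp_all add: ch_def)
 have l: "level n ch = level_SL n psi" by (simp add: level_SL_def ch_def)
 let ?r = "%g. if g : SLm n then ch g else 0"
 have r: "?r : S.irr" using restriction_irreducible[OF ch(1)] lv l by (simp add: SL_Irr)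
 have "S.ip ?r psi = inner_G (SLm n) ch psi" by (simp add: S.ip_def inner_G_def)
 then have "?r = psi" using S.irr_orthogonal[OF r, of psi] psi ch(2) by (auto simp: SL_Irr split: if_splits)
 then have "psi g = ch g" if "g : SLm n" for g using fun_cong[of ?r psi g] that by simp
 then show ?thesis using ch(1) l by blast
qed

lemma one_SLm: "idm n : SLm n"
 by (simp add: SLm_def)

lemma GL_bounds:
 fixes ch :: "'a::{finite,field} mat => complex"
 assumes ch: "ch : Irr n (GLm n)"
 shows "17 <= 8 * n & real (level n ch) <= sqrt ((8 * real n - 17) / 12) - 1 / 2 ==> g : GLm n - grp_center (GLm n) ==>
   cmod (ch g) < 1.76 * cmod (ch (idm n)) powr (1 - 1 / real n)"
  and "59 <= 12 * n & real (level n ch) <= (sqrt (12 * real n - 59) - 1) / 6 ==> g : GLm n ==>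
   cmod (ch g) < 1.76 * cmod (ch (idm n)) powr exponent n (level n ch) g"
proof -
 assume a: "17 <= 8 * n & real (level n ch) <= sqrt ((8 * real n - 17) / 12) - 1 / 2" and g: "g : GLm n - grp_center (GLm n)"
 have "GLm n \<subseteq> (Mat n n :: 'a mat set)" by (auto simp: GLm_def)
 then have "g ~= c \<cdot>\<^sub>m idm n" for c using g scalar_in_center by blast
 then show "cmod (ch g) < 1.76 * cmod (ch (idm n)) powr (1 - 1 / real n)"
  using noncentral_bound[OF ch level_bound_noncentral] a g by blast
next
 assume a: "59 <= 12 * n & real (level n ch) <= (sqrt (12 * real n - 59) - 1) / 6" and g: "g : GLm n"
 show "cmod (ch g) < 1.76 * cmod (ch (idm n)) powr exponent n (level n ch) g"
  using general_bound[OF ch level_bound_general g] a by blast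
qed

lemma SL_bounds:
 fixes psi :: "'a::{finite,field} mat => complex"
 assumes psi: "psi : Irr n (SLm n)"
 shows "17 <= 8 * n & real (level_SL n psi) <= sqrt ((8 * real n - 17) / 12) - 1 / 2 ==> g : SLm n - grp_center (SLm n) ==>
   cmod (psi g) < 1.76 * cmod (psi (idm n)) powr (1 - 1 / real n)"
  and "59 <= 12 * n & real (level_SL n psi) <= (sqrt (12 * real n - 59) - 1) / 6 ==> g : SLm n ==>
   cmod (psi g) < 1.76 * cmod (psi (idm n)) powr exponent n (level_SL n psi) g"
proof -
 have sq: "l <= l * l" for l :: nat by simp
 assume a: "17 <= 8 * n & real (level_SL n psi) <= sqrt ((8 * real n - 17) / 12) - 1 / 2" and g: "g : SLm n - grp_center (SLm n)"
 then have nb: "3 * level_SL n psi * level_SL n psi + 3 * level_SL n psi + 5 <= 2 * n" using level_bound_noncentral by blast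
 \<comment> \<open>With w = l^2 >= l the bound on the level yields 2 l < n, as the restriction
   argument requires.\<close>
 have "3 * w + 3 * l + 5 <= 2 * n ==> l <= w ==> 2 * l < n" for l w by linarith
 from this[OF nb[unfolded mult.assoc] sq] have "2 * level_SL n psi < n" .
 then obtain ch where ch: "ch : Irr n (GLm n)" "level n ch = level_SL n psi" "!!g. g : SLm n ==> psi g = ch g" using SL_character[OF psi] by blast
 have "SLm n \<subseteq> (Mat n n :: 'a mat set)" by (auto simp: SLm_def)
 then have ns: "g ~= c \<cdot>\<^sub>m idm n" for c using g scalar_in_center by blast
 have gG: "g : GLm n" "g : SLm n" using g SLm_GLm by auto
 show "cmod (psi g) < 1.76 * cmod (psi (idm n)) powr (1 - 1 / real n)"
  unfolding ch(3)[OF gG(2)] ch(3)[OF one_SLm] by (rule noncentral_bound[OF ch(1) nb[folded ch(2)] gG(1) ns])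
next
 assume a: "59 <= 12 * n & real (level_SL n psi) <= (sqrt (12 * real n - 59) - 1) / 6" and g: "g : SLm n"
 then have nb: "3 * level_SL n psi * level_SL n psi + level_SL n psi + 5 <= n" using level_bound_general by blast
 have sq: "l <= l * l" for l :: nat by simp
 have "3 * w + l + 5 <= n ==> l <= w ==> 2 * l < n" for l w by linarith
 from this[OF nb[unfolded mult.assoc] sq] have "2 * level_SL n psi < n" .
 then obtain ch where ch: "ch : Irr n (GLm n)" "level n ch = level_SL n psi" "!!g. g : SLm n ==> psi g = ch g" using SL_character[OF psi] by blast
 have gG: "g : GLm n" using g SLm_GLm by auto
 show "cmod (psi g) < 1.76 * cmod (psi (idm n)) powr exponent n (level_SL n psi) g"
  unfolding ch(3)[OF g] ch(3)[OF one_SLm] using general_bound[OF ch(1) nb[folded ch(2)] gG] unfolding ch(2) .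
qed

theorem theorem1p5:
  fixes n j :: nat
  assumes "1 \<le> j" and "j \<le> n"
  shows
   "(\<forall>\<alpha> \<in> Irr j (GLm j :: 'a::{finite,field} mat set).
        int (true_level j \<alpha>) < 2 * int j - int n \<and> D_coef n j \<alpha> \<noteq> (\<lambda>g. 0) \<longrightarrow>
        (\<forall>\<theta>. constituent n (GLm n) \<theta> (D_coef n j \<alpha>) \<longrightarrow> true_level n \<theta> < j))
  \<and> (\<forall>\<alpha> \<in> Irr j (GLm j :: 'a mat set).
        int (true_level j \<alpha>) \<ge> 2 * int j - int n \<longrightarrow> (\<exists>!\<theta>. D_circ_prop n j \<alpha> \<theta>))
  \<and> bij_betw (D_circ n j)
        {\<alpha> \<in> Irr j (GLm j :: 'a mat set). int (true_level j \<alpha>) \<ge> 2 * int j - int n}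
        {\<theta> \<in> Irr n (GLm n :: 'a mat set). true_level n \<theta> = j}
  \<and> (\<forall>\<chi> \<in> Irr n (GLm n :: 'a mat set).
        (17 \<le> 8 * n \<and> real (level n \<chi>) \<le> sqrt ((8 * real n - 17) / 12) - 1 / 2 \<longrightarrow>
          (\<forall>g \<in> GLm n - grp_center (GLm n).
             cmod (\<chi> g) < 1.76 * cmod (\<chi> (1\<^sub>m n)) powr (1 - 1 / real n)))
      \<and> (59 \<le> 12 * n \<and> real (level n \<chi>) \<le> (sqrt (12 * real n - 59) - 1) / 6 \<longrightarrow>
          (\<forall>g \<in> GLm n.
             cmod (\<chi> g) < 1.76 * cmod (\<chi> (1\<^sub>m n)) powr
               (if level n \<chi> = 0 then real (delta n g) / real n
                else max (1 - 1 / (2 * real (level n \<chi>))) (real (delta n g) / real n)))))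
  \<and> (\<forall>\<chi> \<in> Irr n (SLm n :: 'a mat set).
        (17 \<le> 8 * n \<and> real (level_SL n \<chi>) \<le> sqrt ((8 * real n - 17) / 12) - 1 / 2 \<longrightarrow>
          (\<forall>g \<in> SLm n - grp_center (SLm n).
             cmod (\<chi> g) < 1.76 * cmod (\<chi> (1\<^sub>m n)) powr (1 - 1 / real n)))
      \<and> (59 \<le> 12 * n \<and> real (level_SL n \<chi>) \<le> (sqrt (12 * real n - 59) - 1) / 6 \<longrightarrow>
          (\<forall>g \<in> SLm n.
             cmod (\<chi> g) < 1.76 * cmod (\<chi> (1\<^sub>m n)) powr
               (if level_SL n \<chi> = 0 then real (delta n g) / real n
                else max (1 - 1 / (2 * real (level_SL n \<chi>))) (real (delta n g) / real n)))))"
  proof -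
  interpret gl_pair n j "TYPE('a)" using assms by unfold_locales
  show ?thesis
  proof (intro conjI levels_of_coefficients; intro ballI conjI impI)
    fix \<chi> :: "'a mat \<Rightarrow> complex" and g
    assume \<chi>: "\<chi> \<in> Irr n (GLm n)"
    show "cmod (\<chi> g) < 1.76 * cmod (\<chi> (1\<^sub>m n)) powr (1 - 1 / real n)"
      if "17 \<le> 8 * n \<and> real (level n \<chi>) \<le> sqrt ((8 * real n - 17) / 12) - 1 / 2" "g \<in> GLm n - grp_center (GLm n)"
      using GL_bounds(1)[OF \<chi> that] .
    show "cmod (\<chi> g) < 1.76 * cmod (\<chi> (1\<^sub>m n)) powr (if level n \<chi> = 0 then real (delta n g) / real n
        else max (1 - 1 / (2 * real (level n \<chi>))) (real (delta n g) / real n))"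
      if "59 \<le> 12 * n \<and> real (level n \<chi>) \<le> (sqrt (12 * real n - 59) - 1) / 6" "g \<in> GLm n"
      using GL_bounds(2)[OF \<chi> that] unfolding exponent_def .
  next
    fix \<chi> :: "'a mat \<Rightarrow> complex" and g
    assume \<chi>: "\<chi> \<in> Irr n (SLm n)"
    show "cmod (\<chi> g) < 1.76 * cmod (\<chi> (1\<^sub>m n)) powr (1 - 1 / real n)"
      if "17 \<le> 8 * n \<and> real (level_SL n \<chi>) \<le> sqrt ((8 * real n - 17) / 12) - 1 / 2" "g \<in> SLm n - grp_center (SLm n)"
      using SL_bounds(1)[OF \<chi> that] .
    show "cmod (\<chi> g) < 1.76 * cmod (\<chi> (1\<^sub>m n)) powr (if level_SL n \<chi> = 0 then real (delta n g) / real n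
        else max (1 - 1 / (2 * real (level_SL n \<chi>))) (real (delta n g) / real n))"
      if "59 \<le> 12 * n \<and> real (level_SL n \<chi>) \<le> (sqrt (12 * real n - 59) - 1) / 6" "g \<in> SLm n"
      using SL_bounds(2)[OF \<chi> that] unfolding exponent_def .
  qed
qed

end
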